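(* Let $X=\mathbb{C}^2$ with a real structure $\sigma_X$, and let $\{Q,\overline Q\}$ be a pair of nonreal conjugate branches at $0$ (with $\overline Q=\sigma_X(Q)$) having distinct tangent lines. Put $m=\operatorname{mt}(Q,0)$, choose the adapted linear coordinates $(p,q)$ and the adapted primitive parametrizations $$\gamma_Q(u)=(u^m,\varphi(u)),\qquad \gamma_{\overline Q}(v)=(\overline\varphi(v),v^m),\qquad \varphi(u)=\sum_{n>m}a_nu^n,\quad \overline\varphi(v)=\sum_{n>m}\overline{a_n}v^n,$$ as described in the context, and for small $r>0$ let $$\alpha_r:\mathbb{R}/2\pi\mathbb{Z}\to X_{\mathbb{R}},\qquad \alpha_r(\theta)=\gamma_Q(re^{i\theta})+\gamma_{\overline Q}(re^{-i\theta}),\qquad \Gamma_r=\alpha_r(\mathbb{R}/2\pi\mathbb{Z}).$$ Let $\mathbb{B}\subset X$ be a $\sigma_X$-invariant Milnor ball centered at $0$ and $\mathbb{B}_{\mathbb{R}}=\mathbb{B}\cap X_{\mathbb{R}}$. Then the expression for $\alpha_r(\theta)$ depends real analytically on $(r,\theta)$. Also, there are $r_0>0$ and a closed real disk $D\subset\mathbb{B}_{\mathbb{R}}$, with $0\in\operatorname{int}D$, such that for every $0<r<r_0$ the image $\Gamma_r$ is contained in $\operatorname{int}D$ and is a predivide in $D$ (parametrized by $\alpha_r$). Moreover, $$\operatorname{dbl}(\Gamma_r)=2\delta(Q,0)+(Q\cdot\overline Q)_0-1=\delta(Q\cup\overline Q,0)-1.$$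
   Context: **Real structure.** $\sigma_X$ is an antiholomorphic involution of $X=\mathbb{C}^2$ which is coordinatewise conjugation in suitable complex linear coordinates; $X_{\mathbb{R}}=\operatorname{Fix}(\sigma_X)$. A branch is an irreducible reduced complex plane curve germ; its multiplicity $\operatorname{mt}(Q,0)$ is the order of the lowest nonzero homogeneous part of a local equation. A primitive parametrization is a normalization map from a small disk (equivalently, one injective near the origin). **Adapted coordinates and parametrizations.** Let $L=T_0Q$; by assumption $T_0\overline Q=\sigma_X(L)\ne L$. Choose a complex linear form $q$ with kernel $L$ and define $p(z)=\overline{q(\sigma_X(z))}$, whose kernel is $\sigma_X(L)$. Then $(p,q)$ is a complex linear coordinate system in which $\sigma_X$ reads $(p,q)\mapsto(\overline q,\overline p)$ and the real plane $X_{\mathbb{R}}$ is $\{q=\overline p\}$. In these coordinates, after a change of primitive parameter, $Q$ has a primitive parametrization $\gamma_Q(u)=(u^m,\varphi(u))$ with $\varphi(u)=\sum_{n>m}a_nu^n$ convergent, and $\overline Q$ is given the conjugate parametrization $\gamma_{\overline Q}(v)=\sigma_X(\gamma_Q(\overline v))=(\overline\varphi(v),v^m)$. The sum defining $\alpha_r$ is vector addition in $X=\mathbb{C}^2$. **Milnor ball.** A Milnor ball is an open Euclidean ball centered at $0$ in which the curve germ under consideration has a representative that is smooth away from $0$ and whose closure is transverse to all spheres centered at $0$ of radius at most that of the ball. **Delta invariant and intersection multiplicity.** $\delta(C,0)=\dim_{\mathbb{C}}(\widetilde{\mathcal O}_C/\mathcal O_C)$ for a reduced germ $C$, with $\widetilde{\mathcal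 O}_C$ the normalization of the local ring $\mathcal O_C$; $(A\cdot B)_0=\dim_{\mathbb{C}}\mathcal O_{\mathbb{C}^2,0}/(f_A,f_B)$ for distinct branches with local equations $f_A,f_B$. **Predivide.** A predivide in a closed real disk $D$ is a smooth immersion $\alpha:J\to D$ from a compact one-dimensional manifold such that (1) $\alpha^{-1}(\partial D)=\partial J$ and $\alpha|_{\partial J}$ is injective; (2) $P=\alpha(J)$ is transverse to $\partial D$; (3) every multiple point is ordinary: if $p\in P$ has preimages $x_1,\dots,x_k$ with $k\ge2$, the lines $d\alpha(T_{x_i}J)\subset T_pD$ are pairwise distinct. The image is also called a predivide. **dbl.** For an immersion $\alpha:J\to S$ of a compact 1-manifold with only ordinary multiple points and $P=\alpha(J)$, $\operatorname{dbl}(P)=\#\{\{x,y\}\subset J: x\ne y,\ \alpha(x)=\alpha(y)\}$ (unordered pairs). *)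

theory Defs
  imports
    "HOL-Analysis.Analysis"
    "HOL-Algebra.QuotRing"
    "HOL-Algebra.Ring_Divisibility"
begin

type_synonym C2 = "complex \<times> complex"

definition cscale :: "complex \<Rightarrow> C2 \<Rightarrow> C2" where
  "cscale c z = (c * fst z, c * snd z)"

abbreviation clinear_map :: "(C2 \<Rightarrow> C2) \<Rightarrow> bool" where
  "clinear_map \<equiv> Vector_Spaces.linear cscale cscale"

abbreviation clinear_form :: "(C2 \<Rightarrow> complex) \<Rightarrow> bool" where
  "clinear_form \<equiv> Vector_Spaces.linear cscale (*)"

definition real_structure :: "(C2 \<Rightarrow> C2) \<Rightarrow> bool" where
  "real_structure \<sigma> \<longleftrightarrow>
     (\<exists>\<kappa>. clinear_map \<kappa> \<and> bij \<kappa> \<and>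
        (\<forall>z. \<kappa> (\<sigma> z) = (cnj (fst (\<kappa> z)), cnj (snd (\<kappa> z)))))"

definition real_plane :: "(C2 \<Rightarrow> C2) \<Rightarrow> C2 set" where
  "real_plane \<sigma> = {z. \<sigma> z = z}"


section \<open>The local ring of convergent power series\<close>

text \<open>An element of \<open>complex fps fps\<close> is read as a formal power series in \<open>x, y\<close>: the
  outer variable is \<open>y\<close>, the inner one is \<open>x\<close>.\<close>

definition coeff2 :: "complex fps fps \<Rightarrow> nat \<Rightarrow> nat \<Rightarrow> complex" where
  "coeff2 F i j = fps_nth (fps_nth F j) i"

definition const2 :: "complex \<Rightarrow> complex fps fps" where
  "const2 c = fps_const (fps_const c)"

definition convergent2 :: "complex fps fps \<Rightarrow> bool" where
  "convergent2 F \<longleftrightarrow>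
     (\<exists>\<rho>>0. (\<lambda>(i, j). norm (coeff2 F i j) * \<rho> ^ (i + j)) summable_on UNIV)"

text \<open>Only meaningful near the origin; outside the domain of convergence \<open>infsum\<close>
  returns \<open>0\<close>.\<close>

definition eval2 :: "complex fps fps \<Rightarrow> C2 \<Rightarrow> complex" where
  "eval2 F z = (\<Sum>\<^sub>\<infinity>(i, j)\<in>UNIV. coeff2 F i j * fst z ^ i * snd z ^ j)"

definition local_ring :: "complex fps fps ring" where
  "local_ring =
     \<lparr>carrier = {F. convergent2 F}, mult = (*), one = 1, zero = 0, add = (+)\<rparr>"


section \<open>Branches\<close>

text \<open>A plane curve germ is given by a local equation.  A local equation of the union of two
  distinct branches is the product of their local equations.\<close>

definition branch :: "complex fps fps \<Rightarrow> bool" where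
  "branch f \<longleftrightarrow> f \<in> carrier local_ring \<and> ring_irreducible\<^bsub>local_ring\<^esub> f"

definition same_zero_germ :: "complex fps fps \<Rightarrow> complex fps fps \<Rightarrow> bool" where
  "same_zero_germ f g \<longleftrightarrow> (\<forall>\<^sub>F z in nhds 0. eval2 f z = 0 \<longleftrightarrow> eval2 g z = 0)"

text \<open>The image under \<open>\<sigma>\<close> of the germ \<open>f = 0\<close> has the local equation
  \<open>cnj \<circ> f \<circ> \<sigma>\<close>, because \<open>\<sigma>\<close> is an involution.\<close>

definition conjugate_equation ::
  "(C2 \<Rightarrow> C2) \<Rightarrow> complex fps fps \<Rightarrow> complex fps fps \<Rightarrow> bool" where
  "conjugate_equation \<sigma> f g \<longleftrightarrow>
     g \<in> carrier local_ring \<and> (\<forall>\<^sub>F z in nhds 0. eval2 g z = cnj (eval2 f (\<sigma> z)))"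

definition mult2 :: "complex fps fps \<Rightarrow> nat" where
  "mult2 f = (LEAST d. \<exists>i j. i + j = d \<and> coeff2 f i j \<noteq> 0)"

definition initial_form :: "complex fps fps \<Rightarrow> C2 \<Rightarrow> complex" where
  "initial_form f z =
     (\<Sum>i\<le>mult2 f. coeff2 f i (mult2 f - i) * fst z ^ i * snd z ^ (mult2 f - i))"

text \<open>For a branch the initial form is a power of a linear form, so this is the tangent
  line.\<close>

definition tangent_cone :: "complex fps fps \<Rightarrow> C2 set" where
  "tangent_cone f = {z. initial_form f z = 0}"

definition primitive_parametrization :: "complex fps fps \<Rightarrow> (complex \<Rightarrow> C2) \<Rightarrow> bool" where
  "primitive_parametrization f \<gamma> \<longleftrightarrow>
     \<gamma> 0 = 0 \<and>
     (\<exists>\<epsilon>>0. \<exists>U. open U \<and> 0 \<in> U \<and>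
        (fst \<circ> \<gamma>) holomorphic_on ball 0 \<epsilon> \<and> (snd \<circ> \<gamma>) holomorphic_on ball 0 \<epsilon> \<and>
        inj_on \<gamma> (ball 0 \<epsilon>) \<and> \<gamma> ` ball 0 \<epsilon> = {z \<in> U. eval2 f z = 0})"

definition fps_cnj :: "complex fps \<Rightarrow> complex fps" where
  "fps_cnj \<phi> = Abs_fps (\<lambda>n. cnj (fps_nth \<phi> n))"


section \<open>Normalization, delta invariant, intersection multiplicity\<close>

definition nonzerodivisors :: "('a, 'b) ring_scheme \<Rightarrow> 'a set" where
  "nonzerodivisors R =
     {b \<in> carrier R. \<forall>a\<in>carrier R. a \<otimes>\<^bsub>R\<^esub> b = \<zero>\<^bsub>R\<^esub> \<longrightarrow> a = \<zero>\<^bsub>R\<^esub>}"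

definition fraction_rel :: "('a, 'b) ring_scheme \<Rightarrow> (('a \<times> 'a) \<times> ('a \<times> 'a)) set" where
  "fraction_rel R =
     {((a, b), (c, d)). a \<in> carrier R \<and> b \<in> nonzerodivisors R \<and>
        c \<in> carrier R \<and> d \<in> nonzerodivisors R \<and> a \<otimes>\<^bsub>R\<^esub> d = c \<otimes>\<^bsub>R\<^esub> b}"

definition fraction :: "('a, 'b) ring_scheme \<Rightarrow> 'a \<Rightarrow> 'a \<Rightarrow> ('a \<times> 'a) set" where
  "fraction R a b = fraction_rel R `` {(a, b)}"

definition total_fractions :: "('a, 'b) ring_scheme \<Rightarrow> ('a \<times> 'a) set ring" where
  "total_fractions R =
     \<lparr>carrier = (carrier R \<times> nonzerodivisors R) // fraction_rel R,
      mult = (\<lambda>X Y. \<Union>(a, b)\<in>X. \<Union>(c, d)\<in>Y. fraction R (a \<otimes>\<^bsub>R\<^esub> c) (b \<otimes>\<^bsub>R\<^esub> d)),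
      one = fraction R \<one>\<^bsub>R\<^esub> \<one>\<^bsub>R\<^esub>,
      zero = fraction R \<zero>\<^bsub>R\<^esub> \<one>\<^bsub>R\<^esub>,
      add = (\<lambda>X Y. \<Union>(a, b)\<in>X. \<Union>(c, d)\<in>Y.
               fraction R (a \<otimes>\<^bsub>R\<^esub> d \<oplus>\<^bsub>R\<^esub> c \<otimes>\<^bsub>R\<^esub> b) (b \<otimes>\<^bsub>R\<^esub> d))\<rparr>"

definition fraction_embed :: "('a, 'b) ring_scheme \<Rightarrow> 'a \<Rightarrow> ('a \<times> 'a) set" where
  "fraction_embed R a = fraction R a \<one>\<^bsub>R\<^esub>"

definition integral_closure :: "('a, 'b) ring_scheme \<Rightarrow> 'a set \<Rightarrow> 'a set" where
  "integral_closure K A =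
     {x \<in> carrier K. \<exists>(n::nat) c. (\<forall>i<n. c i \<in> A) \<and>
        x [^]\<^bsub>K\<^esub> n \<oplus>\<^bsub>K\<^esub> (\<Oplus>\<^bsub>K\<^esub>i\<in>{..<n}. c i \<otimes>\<^bsub>K\<^esub> x [^]\<^bsub>K\<^esub> i) = \<zero>\<^bsub>K\<^esub>}"

definition normalization :: "('a, 'b) ring_scheme \<Rightarrow> ('a \<times> 'a) set set" where
  "normalization R = integral_closure (total_fractions R) (fraction_embed R ` carrier R)"

text \<open>For a ring \<open>K\<close> made into a complex algebra by \<open>e\<close>, and subspaces \<open>W \<subseteq> V\<close> of \<open>K\<close>:
  \<open>B\<close> represents a (finite) basis of \<open>V / W\<close>.\<close>

definition quotient_basis ::
  "('a, 'b) ring_scheme \<Rightarrow> (complex \<Rightarrow> 'a) \<Rightarrow> 'a set \<Rightarrow> 'a set \<Rightarrow> 'a set \<Rightarrow> bool" where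
  "quotient_basis K e V W B \<longleftrightarrow>
     finite B \<and> B \<subseteq> V \<and>
     (\<forall>x\<in>V. \<exists>!c. c \<in> B \<rightarrow>\<^sub>E UNIV \<and> x \<ominus>\<^bsub>K\<^esub> (\<Oplus>\<^bsub>K\<^esub>b\<in>B. e (c b) \<otimes>\<^bsub>K\<^esub> b) \<in> W)"

text \<open>All bases have the same cardinality; the infimum is \<open>\<infinity>\<close> when there is no finite
  basis.\<close>

definition quotient_dim ::
  "('a, 'b) ring_scheme \<Rightarrow> (complex \<Rightarrow> 'a) \<Rightarrow> 'a set \<Rightarrow> 'a set \<Rightarrow> enat" where
  "quotient_dim K e V W = (INF B\<in>{B. quotient_basis K e V W B}. enat (card B))"

definition curve_ring :: "complex fps fps \<Rightarrow> complex fps fps set ring" where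
  "curve_ring f = local_ring Quot (PIdl\<^bsub>local_ring\<^esub> f)"

definition delta_invariant :: "complex fps fps \<Rightarrow> enat" where
  "delta_invariant f =
     quotient_dim (total_fractions (curve_ring f))
       (\<lambda>c. fraction_embed (curve_ring f) ((PIdl\<^bsub>local_ring\<^esub> f) +>\<^bsub>local_ring\<^esub> const2 c))
       (normalization (curve_ring f))
       (fraction_embed (curve_ring f) ` carrier (curve_ring f))"

definition intersection_mult :: "complex fps fps \<Rightarrow> complex fps fps \<Rightarrow> enat" where
  "intersection_mult f g =
     quotient_dim local_ring const2 (carrier local_ring) (Idl\<^bsub>local_ring\<^esub> {f, g})"


section \<open>Milnor balls\<close>

text \<open>Balls and spheres are Euclidean in the linear coordinates \<open>\<Psi>\<close> on \<open>C2\<close>.\<close>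

definition coord_ball :: "(C2 \<Rightarrow> C2) \<Rightarrow> real \<Rightarrow> C2 set" where
  "coord_ball \<Psi> R = {z. norm (\<Psi> z) < R}"

text \<open>\<open>C\<close> is a representative, closed in the ball, of the germ \<open>f = 0\<close>.  Near each point
  \<open>z \<noteq> 0\<close> of its closure, the closure is the part in the closed ball of a smooth complex curve
  \<open>F (w - z) = 0\<close> with nonzero differential at \<open>z\<close>, whose tangent line at \<open>z\<close> is not
  contained in the tangent space at \<open>z\<close> of the sphere through \<open>z\<close>.\<close>

definition milnor_ball :: "(C2 \<Rightarrow> C2) \<Rightarrow> real \<Rightarrow> complex fps fps \<Rightarrow> bool" where
  "milnor_ball \<Psi> R f \<longleftrightarrow>
     R > 0 \<and>
     (\<exists>C. closedin (top_of_set (coord_ball \<Psi> R)) C \<and>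
        (\<forall>\<^sub>F z in nhds 0. z \<in> C \<longleftrightarrow> eval2 f z = 0) \<and>
        (\<forall>z\<in>closure C - {0}. \<exists>F.
           convergent2 F \<and> coeff2 F 0 0 = 0 \<and> (coeff2 F 1 0, coeff2 F 0 1) \<noteq> (0, 0) \<and>
           (\<forall>\<^sub>F w in nhds z. w \<in> closure C \<longleftrightarrow> eval2 F (w - z) = 0 \<and> norm (\<Psi> w) \<le> R) \<and>
           (\<exists>v. coeff2 F 1 0 * fst v + coeff2 F 0 1 * snd v = 0 \<and>
                inner (\<Psi> v) (\<Psi> z) \<noteq> 0)))"


section \<open>Predivides\<close>

text \<open>A compact one-dimensional manifold is a finite disjoint union of circles \<open>\<real>/2\<pi>\<int>\<close> and
  segments \<open>[0,1]\<close>, encoded as a list; its points are pairs (component, parameter), with the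
  parameter in a fundamental domain in the case of a circle.  Maps on a circle are given by
  periodic functions of a real parameter.\<close>

datatype component = Circle | Segment

primrec param_dom :: "component \<Rightarrow> real set" where
  "param_dom Circle = UNIV"
| "param_dom Segment = {0..1}"

primrec param_points :: "component \<Rightarrow> real set" where
  "param_points Circle = {0..<2*pi}"
| "param_points Segment = {0..1}"

primrec param_bd :: "component \<Rightarrow> real set" where
  "param_bd Circle = {}"
| "param_bd Segment = {0, 1}"

definition points :: "component list \<Rightarrow> (nat \<times> real) set" where
  "points J = {(k, t). k < length J \<and> t \<in> param_points (J ! k)}"

definition bd_points :: "component list \<Rightarrow> (nat \<times> real) set" where
  "bd_points J = {(k, t). k < length J \<and> t \<in> param_bd (J ! k)}"

definition velocity ::
  "component list \<Rightarrow> (nat \<times> real \<Rightarrow> 'a::real_normed_vector) \<Rightarrow> nat \<times> real \<Rightarrow> 'a" where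
  "velocity J \<alpha> x =
     vector_derivative (\<lambda>t. \<alpha> (fst x, t)) (at (snd x) within param_dom (J ! fst x))"

definition smooth_on_dom :: "real set \<Rightarrow> (real \<Rightarrow> 'a::real_normed_vector) \<Rightarrow> bool" where
  "smooth_on_dom T \<beta> \<longleftrightarrow>
     (\<exists>d :: nat \<Rightarrow> real \<Rightarrow> 'a. (\<forall>t\<in>T. d 0 t = \<beta> t) \<and>
        (\<forall>n. \<forall>t\<in>T. (d n has_vector_derivative d (Suc n) t) (at t within T)))"

definition smooth_immersion ::
  "component list \<Rightarrow> (nat \<times> real \<Rightarrow> 'a::real_normed_vector) \<Rightarrow> bool" where
  "smooth_immersion J \<alpha> \<longleftrightarrow>
     (\<forall>k<length J.
        smooth_on_dom (param_dom (J ! k)) (\<lambda>t. \<alpha> (k, t)) \<and>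
        (J ! k = Circle \<longrightarrow> (\<forall>t. \<alpha> (k, t + 2*pi) = \<alpha> (k, t))) \<and>
        (\<forall>t\<in>param_dom (J ! k). velocity J \<alpha> (k, t) \<noteq> 0))"

text \<open>The disk is the round disk with centre \<open>c\<close> and radius \<open>s\<close> in a real plane \<open>E\<close> containing
  \<open>c\<close>; the tangent line to its boundary circle at \<open>p\<close> is the orthogonal complement of \<open>p - c\<close>
  in \<open>E\<close>.\<close>

definition predivide ::
  "'a::euclidean_space set \<Rightarrow> 'a \<Rightarrow> real \<Rightarrow> component list \<Rightarrow> (nat \<times> real \<Rightarrow> 'a) \<Rightarrow> bool" where
  "predivide E c s J \<alpha> \<longleftrightarrow>
     smooth_immersion J \<alpha> \<and>
     \<alpha> ` points J \<subseteq> E \<inter> cball c s \<and>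
     {x \<in> points J. \<alpha> x \<in> E \<inter> sphere c s} = bd_points J \<and>
     inj_on \<alpha> (bd_points J) \<and>
     (\<forall>x\<in>points J. \<alpha> x \<in> sphere c s \<longrightarrow> inner (velocity J \<alpha> x) (\<alpha> x - c) \<noteq> 0) \<and>
     (\<forall>x\<in>points J. \<forall>y\<in>points J. x \<noteq> y \<and> \<alpha> x = \<alpha> y \<longrightarrow>
        span {velocity J \<alpha> x} \<noteq> span {velocity J \<alpha> y})"

definition double_pairs :: "component list \<Rightarrow> (nat \<times> real \<Rightarrow> 'a) \<Rightarrow> (nat \<times> real) set set" where
  "double_pairs J \<alpha> =
     {{x, y} | x y. x \<in> points J \<and> y \<in> points J \<and> x \<noteq> y \<and> \<alpha> x = \<alpha> y}"

definition dbl :: "component list \<Rightarrow> (nat \<times> real \<Rightarrow> 'a) \<Rightarrow> nat" where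
  "dbl J \<alpha> = card (double_pairs J \<alpha>)"


section \<open>Real analyticity\<close>

definition real_analytic_at ::
  "(real \<times> real \<Rightarrow> 'a::real_normed_vector) \<Rightarrow> real \<times> real \<Rightarrow> bool" where
  "real_analytic_at h a \<longleftrightarrow>
     (\<exists>\<epsilon>>0. \<exists>c. \<forall>x\<in>ball a \<epsilon>.
        ((\<lambda>(i, j). ((fst x - fst a) ^ i * (snd x - snd a) ^ j) *\<^sub>R c i j) has_sum h x) UNIV)"


section \<open>Adapted coordinates and the curves \<open>\<alpha>\<^sub>r\<close>\<close>

text \<open>The pair \<open>(p, q)\<close> with \<open>p z = cnj (q (\<sigma> z))\<close>; in these coordinates \<open>\<sigma>\<close> is
  \<open>(p, q) \<mapsto> (cnj q, cnj p)\<close>.\<close>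

definition adapted_coords :: "(C2 \<Rightarrow> C2) \<Rightarrow> (C2 \<Rightarrow> complex) \<Rightarrow> C2 \<Rightarrow> C2" where
  "adapted_coords \<sigma> q z = (cnj (q (\<sigma> z)), q z)"

definition gamma_Q ::
  "(C2 \<Rightarrow> C2) \<Rightarrow> (C2 \<Rightarrow> complex) \<Rightarrow> nat \<Rightarrow> complex fps \<Rightarrow> complex \<Rightarrow> C2" where
  "gamma_Q \<sigma> q m \<phi> u = inv_into UNIV (adapted_coords \<sigma> q) (u ^ m, eval_fps \<phi> u)"

definition gamma_Qbar ::
  "(C2 \<Rightarrow> C2) \<Rightarrow> (C2 \<Rightarrow> complex) \<Rightarrow> nat \<Rightarrow> complex fps \<Rightarrow> complex \<Rightarrow> C2" where
  "gamma_Qbar \<sigma> q m \<phi> v = inv_into UNIV (adapted_coords \<sigma> q) (eval_fps (fps_cnj \<phi>) v, v ^ m)"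

definition alpha ::
  "(C2 \<Rightarrow> C2) \<Rightarrow> (C2 \<Rightarrow> complex) \<Rightarrow> nat \<Rightarrow> complex fps \<Rightarrow> real \<Rightarrow> real \<Rightarrow> C2" where
  "alpha \<sigma> q m \<phi> r \<theta> =
     gamma_Q \<sigma> q m \<phi> (of_real r * cis \<theta>) + gamma_Qbar \<sigma> q m \<phi> (of_real r * cis (- \<theta>))"

text \<open>The same curve, as a map on the one-component manifold \<open>[Circle]\<close>.\<close>

definition alpha_circle ::
  "(C2 \<Rightarrow> C2) \<Rightarrow> (C2 \<Rightarrow> complex) \<Rightarrow> nat \<Rightarrow> complex fps \<Rightarrow> real \<Rightarrow> nat \<times> real \<Rightarrow> C2" where
  "alpha_circle \<sigma> q m \<phi> r x = alpha \<sigma> q m \<phi> r (snd x)"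

end

theory Submission
  imports Defs "HOL-Computational_Algebra.Formal_Laurent_Series" "HOL-Complex_Analysis.Cauchy_Integral_Formula"
begin

text \<open>Let \<open>a k\<close> be the coefficients of \<open>\<phi>\<close>. In the adapted coordinates the real plane consists of the
  points \<open>(z, cnj z)\<close>, and the point of the curve at \<open>\<theta>\<close> has \<open>z = h \<theta> = u^m + cnj (\<phi> u)\<close> with
  \<open>u = r cis \<theta>\<close>. So the crossings are the pairs of parameters with the same value of \<open>h\<close>. For the
  parameters \<open>s - t\<close> and \<open>s + t\<close>, this condition becomes, after conjugation and division by \<open>r^m\<close>
  and a unit, that \<open>sin (m t)\<close> equals the sum over \<open>k > m\<close> of
  \<open>a k r^(k-m) cis ((k+m) s) sin (k t)\<close> (\<open>h_difference\<close>).

  For small \<open>r\<close> the solution \<open>t\<close> must be close to some \<open>\<pi> j / m\<close> with \<open>0 < j < m\<close>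
  (\<open>zero_localization\<close>). The first term of the sum that does not vanish there has the index \<open>n j\<close>, the
  order of \<open>\<phi>(u) - \<phi>(\<omega>^j u)\<close> for \<open>\<omega> = cis (2 \<pi> / m)\<close>. Rescaling \<open>t - \<pi> j / m\<close> by
  \<open>r^(n j - m)\<close> turns the equation into \<open>m x = c cis ((n j + m) s)\<close>, up to an error that is small
  together with its Lipschitz constant. The limiting equation has \<open>2 (n j + m)\<close> solutions with \<open>s\<close>
  modulo \<open>2 \<pi>\<close>, which persist because the limiting map is expanding near them (\<open>card_zeros\<close>). The
  expansion also makes the crossings transversal. As each crossing is counted twice, there are
  \<open>d + m (m - 1)\<close> of them, where \<open>d\<close> is the sum of the \<open>n j\<close> (\<open>small_curves\<close>).

  On the algebraic side, the functions on the branch \<open>Q\<close>, pulled back to its normalization, form the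
  ring of the polynomials in \<open>\<phi>\<close> whose coefficients are convergent series in \<open>u^m\<close>. Let \<open>D\<close> be the
  product of the differences \<open>\<phi>(u) - \<phi>(\<omega>^j u)\<close>, of order \<open>d\<close>. For the pairing of \<open>a\<close> and \<open>b\<close> by the residue
  of \<open>a b u^(m-1) du / D\<close>, this ring is its own orthogonal, while the radical consists of the series
  of order at least \<open>d + 1 - m\<close>. A self-orthogonal space has half the codimension of the radical, so
  \<open>2 \<delta>(Q) + m = d + 1\<close> (\<open>codim_branch_ring\<close>). As the two branches have distinct tangents, their
  intersection multiplicity is \<open>m^2\<close> (\<open>pullback_g\<close>), and \<open>\<delta>\<close> of the union is the sum of both
  deltas and this number (\<open>delta_union\<close>). Hence \<open>d + m (m - 1) + 1 = 2 \<delta>(Q) + m^2\<close>.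

  The invariants are defined by quotients of the total ring of fractions of an abstract ring. They
  are reduced to spaces of power series by sending a fraction to its Laurent expansions along the
  branches: the normalization is the set of fractions with expansions without poles
  (\<open>normalization_iff\<close>), because all regular functions of high order come from the ring.\<close>

section \<open>Quotients of vector spaces of finite dimension\<close>

lemma homogeneous_system_nontrivial_solution:
  fixes A :: "'j \<Rightarrow> 'i \<Rightarrow> 'k::field"
  assumes "finite J" "finite I" "card J < card I"
  shows "\<exists>c. (\<exists>i\<in>I. c i \<noteq> 0) \<and> (\<forall>j\<in>J. (\<Sum>i\<in>I. A j i * c i) = 0)"
  using assms
proof (induction J arbitrary: I A rule: finite_induct)
  case empty
  then obtain p where "p \<in> I" by (metis card.empty ex_in_conv less_irrefl)
  then show ?case by (intro exI[of _ "\<lambda>_. 1"]) auto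
next
  case (insert j J I A)
  show ?case
  proof (cases "\<forall>i\<in>I. A j i = 0")
    case True
    have "card J < card I" using insert by simp
    from insert.IH[OF insert.prems(1) this, of A] obtain c where
      "\<exists>i\<in>I. c i \<noteq> 0" "\<forall>j\<in>J. (\<Sum>i\<in>I. A j i * c i) = 0" by blast
    with True show ?thesis by (intro exI[of _ c]) auto
  next
    case False
    then obtain p where p: "p \<in> I" "A j p \<noteq> 0" by blast
    define I' where "I' = I - {p}"
    define A' where "A' = (\<lambda>k i. A k i - A k p * A j i / A j p)"
    have I': "finite I'" "card J < card I'" "p \<notin> I'" "I = insert p I'"
      using insert p by (auto simp: I'_def)
    from insert.IH[OF I'(1,2), of A'] obtain c where
      c: "\<exists>i\<in>I'. c i \<noteq> 0" "\<forall>k\<in>J. (\<Sum>i\<in>I'. A' k i * c i) = 0" by blast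
    define c' where "c' = c(p := - (\<Sum>i\<in>I'. A j i * c i) / A j p)"
    have cong: "(\<Sum>i\<in>I'. A k i * c' i) = (\<Sum>i\<in>I'. A k i * c i)" for k
      by (rule sum.cong) (use I'(3) in \<open>auto simp: c'_def\<close>)
    have sum: "(\<Sum>i\<in>I. A k i * c' i) = A k p * c' p + (\<Sum>i\<in>I'. A k i * c i)" for k
      using I' cong[of k] by simp
    have "(\<Sum>i\<in>I. A j i * c' i) = 0"
      by (simp only: sum) (use p in \<open>simp add: c'_def\<close>)
    moreover have "(\<Sum>i\<in>I. A k i * c' i) = 0" if "k \<in> J" for k
    proof -
      have "0 = (\<Sum>i\<in>I'. A k i * c i - A k p / A j p * (A j i * c i))"
        using c(2) that p(2) by (simp add: A'_def left_diff_distrib mult.assoc)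
      also have "\<dots> = (\<Sum>i\<in>I'. A k i * c i) - A k p / A j p * (\<Sum>i\<in>I'. A j i * c i)"
        by (simp add: sum_subtractf sum_distrib_left)
      also have "\<dots> = (\<Sum>i\<in>I. A k i * c' i)"
        unfolding sum by (simp add: c'_def)
      finally show ?thesis by simp
    qed
    moreover have "\<exists>i\<in>I. c' i \<noteq> 0"
      using c(1) I'(3,4) by (auto simp: c'_def)
    ultimately show ?thesis by blast
  qed
qed

text \<open>The classes of \<open>b 0, \<dots>, b (n - 1)\<close> form a basis of \<open>V / W\<close>. Stated by representatives, this also
  makes sense for a scalar multiplication that belongs to no type class.\<close>

definition qbasis ::
  "('k::field \<Rightarrow> 'v \<Rightarrow> 'v::ab_group_add) \<Rightarrow> 'v set \<Rightarrow> 'v set \<Rightarrow> nat \<Rightarrow> (nat \<Rightarrow> 'v) \<Rightarrow> bool" where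
  "qbasis sc V W n b \<longleftrightarrow>
     (\<forall>i<n. b i \<in> V) \<and>
     (\<forall>x\<in>V. \<exists>c. x - (\<Sum>i<n. sc (c i) (b i)) \<in> W) \<and>
     (\<forall>c. (\<Sum>i<n. sc (c i) (b i)) \<in> W \<longrightarrow> (\<forall>i<n. c i = 0))"

lemma qbasis_indepD:
  "qbasis sc V W n b \<Longrightarrow> (\<Sum>i<n. sc (c i) (b i)) \<in> W \<Longrightarrow> i < n \<Longrightarrow> c i = 0"
  unfolding qbasis_def by blast

lemma qbasis_memD: "qbasis sc V W n b \<Longrightarrow> i < n \<Longrightarrow> b i \<in> V"
  unfolding qbasis_def by simp

definition codim :: "('k::field \<Rightarrow> 'v \<Rightarrow> 'v::ab_group_add) \<Rightarrow> 'v set \<Rightarrow> 'v set \<Rightarrow> nat \<Rightarrow> bool" where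
  "codim sc V W n \<longleftrightarrow> (\<exists>b. qbasis sc V W n b)"

definition indep_mod ::
  "('k::field \<Rightarrow> 'v \<Rightarrow> 'v::ab_group_add) \<Rightarrow> 'v set \<Rightarrow> nat \<Rightarrow> (nat \<Rightarrow> 'v) \<Rightarrow> bool" where
  "indep_mod sc W n b \<longleftrightarrow> (\<forall>c. (\<Sum>i<n. sc (c i) (b i)) \<in> W \<longrightarrow> (\<forall>i<n. c i = 0))"

context vector_space
begin

text \<open>Otherwise the \<open>k\<close> vectors, expanded in the \<open>n\<close> representatives modulo \<open>U\<close>, would give a
  homogeneous system with more unknowns than equations.\<close>

lemma indep_mod_card_le:
  assumes V: "subspace U" and b: "qbasis scale V U n b"
    and v: "\<And>i. i < k \<Longrightarrow> v i \<in> V" "indep_mod scale U k v"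
  shows "k \<le> n"
proof (rule ccontr)
  assume "\<not> k \<le> n"
  hence nk: "card {..<n} < card {..<k}" by simp
  have "\<exists>c. v i - (\<Sum>j<n. scale (c j) (b j)) \<in> U" if "i < k" for i
    using b v(1)[OF that] unfolding qbasis_def by simp
  hence "\<forall>i\<in>{..<k}. \<exists>c. v i - (\<Sum>j<n. scale (c j) (b j)) \<in> U" by simp
  from bchoice[OF this] obtain A where
    A: "\<And>i. i < k \<Longrightarrow> v i - (\<Sum>j<n. scale (A i j) (b j)) \<in> U" by auto
  from homogeneous_system_nontrivial_solution[OF _ _ nk, of "\<lambda>j i. A i j"] obtain c where
    c: "\<exists>i<k. c i \<noteq> 0" "\<forall>j<n. (\<Sum>i<k. A i j * c i) = 0" by auto
  have "(\<Sum>i<k. scale (c i) (v i - (\<Sum>j<n. scale (A i j) (b j)))) \<in> U"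
    using A by (intro subspace_sum[OF V] subspace_scale[OF V]) auto
  also have "(\<Sum>i<k. scale (c i) (v i - (\<Sum>j<n. scale (A i j) (b j)))) =
      (\<Sum>i<k. scale (c i) (v i)) - (\<Sum>i<k. \<Sum>j<n. scale (A i j * c i) (b j))"
    by (simp add: scale_right_diff_distrib sum_subtractf scale_sum_right mult.commute)
  also have "(\<Sum>i<k. \<Sum>j<n. scale (A i j * c i) (b j)) = (\<Sum>j<n. scale (\<Sum>i<k. A i j * c i) (b j))"
    by (subst sum.swap) (simp add: scale_sum_left)
  also have "\<dots> = 0" using c(2) by simp
  finally have "(\<Sum>i<k. scale (c i) (v i)) \<in> U" by simp
  with v(2) c(1) show False unfolding indep_mod_def by blast
qed

lemma codim_unique:
  assumes "subspace W" "codim scale V W n" "codim scale V W k"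
  shows "n = k"
proof -
  have "n \<le> k" if "codim scale V W n" "codim scale V W k" for n k
  proof -
    from that obtain b v where b: "qbasis scale V W k b" and v: "qbasis scale V W n v"
      by (auto simp: codim_def)
    show ?thesis
      by (rule indep_mod_card_le[OF assms(1) b, of n v])
         (use v in \<open>auto simp: qbasis_def indep_mod_def\<close>)
  qed
  from this[OF assms(2,3)] this[OF assms(3,2)] show ?thesis by simp
qed

lemma sum_lessThan_append:
  fixes h :: "nat \<Rightarrow> 'b"
  shows "(\<Sum>i<n+k. h i) = (\<Sum>i<n. h i) + (\<Sum>i<k. h (n + i))"
  by (induction k) (auto simp: algebra_simps)

lemma codim_trans:
  assumes V: "subspace W" "W \<subseteq> V" and U: "U \<subseteq> W"
    and "codim scale V W n" "codim scale W U k"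
  shows "codim scale V U (n + k)"
proof -
  from assms obtain b v where b: "qbasis scale V W n b" and v: "qbasis scale W U k v"
    by (auto simp: codim_def)
  define w where "w = (\<lambda>i. if i < n then b i else v (i - n))"
  have split: "(\<Sum>i<n+k. scale (c i) (w i)) =
      (\<Sum>i<n. scale (c i) (b i)) + (\<Sum>i<k. scale (c (n + i)) (v i))" for c
    by (simp add: sum_lessThan_append w_def)
  have tail: "(\<Sum>i<k. scale (c i) (v i)) \<in> W" for c
    using v by (intro subspace_sum[OF V(1)] subspace_scale[OF V(1)]) (auto simp: qbasis_def)
  have "qbasis scale V U (n + k) w"
    unfolding qbasis_def
  proof (intro conjI allI ballI impI)
    fix i assume "i < n + k"
    then show "w i \<in> V" using b v V(2) by (auto simp: w_def qbasis_def)
  next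
    fix x assume "x \<in> V"
    then obtain c where c: "x - (\<Sum>i<n. scale (c i) (b i)) \<in> W"
      using b unfolding qbasis_def by blast
    then obtain c' where c': "x - (\<Sum>i<n. scale (c i) (b i)) - (\<Sum>i<k. scale (c' i) (v i)) \<in> U"
      using v unfolding qbasis_def by blast
    show "\<exists>c. x - (\<Sum>i<n+k. scale (c i) (w i)) \<in> U"
      by (rule exI[of _ "\<lambda>i. if i < n then c i else c' (i - n)"])
         (use c' in \<open>simp add: split diff_diff_eq\<close>)
  next
    fix c i assume U': "(\<Sum>i<n+k. scale (c i) (w i)) \<in> U" and i: "i < n + k"
    have "(\<Sum>i<n. scale (c i) (b i)) =
        (\<Sum>i<n+k. scale (c i) (w i)) - (\<Sum>i<k. scale (c (n + i)) (v i))"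
      by (simp add: split)
    also have "\<dots> \<in> W" using U' U by (intro subspace_diff[OF V(1)] tail) auto
    finally have z: "\<forall>i<n. c i = 0" using b unfolding qbasis_def by blast
    hence "(\<Sum>i<k. scale (c (n + i)) (v i)) \<in> U" using U' by (simp add: split)
    moreover from v have "(\<Sum>i<k. scale (c (n + i)) (v i)) \<in> U \<longrightarrow> (\<forall>i<k. c (n + i) = 0)"
      unfolding qbasis_def by (elim conjE) (erule spec)
    ultimately have "\<forall>i<k. c (n + i) = 0" by blast
    with z i show "c i = 0" by (metis add_diff_inverse_nat nat_add_left_cancel_less)
  qed
  thus ?thesis by (auto simp: codim_def)
qed

text \<open>A maximal family that is independent modulo \<open>W\<close> represents a basis.\<close>

lemma codim_exists_of_bounded:
  assumes W: "subspace W"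
    and bd: "\<And>k v. \<lbrakk>\<And>i. i < k \<Longrightarrow> v i \<in> V; indep_mod scale W k v\<rbrakk> \<Longrightarrow> k \<le> n"
  shows "\<exists>k. codim scale V W k"
proof -
  define P where "P = (\<lambda>k. \<exists>v. (\<forall>i<k. v i \<in> V) \<and> indep_mod scale W k v)"
  have "P 0" by (auto simp: P_def indep_mod_def)
  moreover have "\<forall>k. P k \<longrightarrow> k \<le> n" using bd by (auto simp: P_def)
  ultimately obtain k where k: "P k" and max: "\<And>j. P j \<Longrightarrow> j \<le> k"
    using GreatestI_nat[of P 0 n] Greatest_le_nat[of P _ n] by blast
  then obtain v where v: "\<forall>i<k. v i \<in> V" "indep_mod scale W k v" by (auto simp: P_def)
  have "\<exists>c. x - (\<Sum>i<k. scale (c i) (v i)) \<in> W" if x: "x \<in> V" for x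
  proof -
    define v' where "v' = v(k := x)"
    have eq: "(\<Sum>i<Suc k. scale (c i) (v' i)) = (\<Sum>i<k. scale (c i) (v i)) + scale (c k) x" for c
      by (auto simp: v'_def)
    have "\<not> P (Suc k)" using max[of "Suc k"] by auto
    moreover have "\<forall>i<Suc k. v' i \<in> V" using v x by (auto simp: v'_def less_Suc_eq)
    ultimately have "\<not> indep_mod scale W (Suc k) v'" by (auto simp: P_def)
    then obtain c i where c: "(\<Sum>i<k. scale (c i) (v i)) + scale (c k) x \<in> W" "i < Suc k" "c i \<noteq> 0"
      unfolding indep_mod_def eq by blast
    have ck: "c k \<noteq> 0"
    proof
      assume "c k = 0"
      with c(1) have "(\<Sum>i<k. scale (c i) (v i)) \<in> W" by simp
      with v(2) c \<open>c k = 0\<close> show False unfolding indep_mod_def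
        by (metis less_Suc_eq)
    qed
    have "scale (inverse (c k)) ((\<Sum>i<k. scale (c i) (v i)) + scale (c k) x) \<in> W"
      by (intro subspace_scale[OF W] c)
    also have "scale (inverse (c k)) ((\<Sum>i<k. scale (c i) (v i)) + scale (c k) x) =
       x - (\<Sum>i<k. scale (- (inverse (c k) * c i)) (v i))"
      using ck by (simp add: scale_right_distrib scale_sum_right sum_negf)
    finally show ?thesis by (rule exI[of _ "\<lambda>i. - (inverse (c k) * c i)"])
  qed
  with v have "qbasis scale V W k v" by (auto simp: qbasis_def indep_mod_def)
  thus ?thesis by (auto simp: codim_def)
qed

text \<open>Families in \<open>V\<close> independent modulo \<open>W\<close> and families in \<open>W\<close> independent modulo \<open>U\<close> are also
  independent in \<open>V\<close> modulo \<open>U\<close>, which bounds their sizes.\<close>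

lemma codim_intermediate:
  assumes W: "subspace W" "U \<subseteq> W" "W \<subseteq> V" and U: "subspace U"
    and c: "codim scale V U n"
  shows "\<exists>k l. codim scale V W k \<and> codim scale W U l \<and> k + l = n"
proof -
  from c obtain b where b: "qbasis scale V U n b" by (auto simp: codim_def)
  have "\<exists>k. codim scale V W k"
  proof (rule codim_exists_of_bounded[OF W(1)])
    fix k v assume "\<And>i. i < k \<Longrightarrow> v i \<in> V" "indep_mod scale W k v"
    then show "k \<le> n" using W(2)
      by (intro indep_mod_card_le[OF U b, of k v]) (auto simp: indep_mod_def)
  qed
  then obtain k where k: "codim scale V W k" ..
  have "\<exists>l. codim scale W U l"
  proof (rule codim_exists_of_bounded[OF U])
    fix k v assume "\<And>i. i < k \<Longrightarrow> v i \<in> W" "indep_mod scale U k v"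
    then show "k \<le> n" using W(3)
      by (intro indep_mod_card_le[OF U b, of k v]) (auto simp: indep_mod_def)
  qed
  then obtain l where l: "codim scale W U l" ..
  have "codim scale V U (k + l)" by (rule codim_trans[OF W(1,3,2) k l])
  from codim_unique[OF U this c] k l show ?thesis by blast
qed

text \<open>The matrix of the pairing between representatives of a basis of \<open>V / W\<close> and of a basis of
  \<open>W / U\<close> has trivial kernel on both sides, so it is square.\<close>

lemma codim_self_orthogonal:
  fixes \<beta> :: "'b \<Rightarrow> 'b \<Rightarrow> 'a"
  assumes V: "subspace V" and W: "subspace W" "W \<subseteq> V" and U: "U \<subseteq> W"
    and add: "\<And>x y z. \<beta> (x + y) z = \<beta> x z + \<beta> y z"
    and hom: "\<And>c x z. \<beta> (scale c x) z = c * \<beta> x z"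
    and sym: "\<And>x y. \<beta> x y = \<beta> y x"
    and radical: "\<And>x. x \<in> V \<Longrightarrow> x \<in> U \<longleftrightarrow> (\<forall>y\<in>V. \<beta> x y = 0)"
    and self: "\<And>x. x \<in> V \<Longrightarrow> x \<in> W \<longleftrightarrow> (\<forall>y\<in>W. \<beta> x y = 0)"
    and cV: "codim scale V W n" and cW: "codim scale W U k"
  shows "n = k"
proof -
  from cV cW obtain b a where b: "qbasis scale V W n b" and a: "qbasis scale W U k a"
    by (auto simp: codim_def)
  have bV: "b i \<in> V" if "i < n" for i using b that by (auto simp: qbasis_def)
  have aW: "a i \<in> W" if "i < k" for i using a that by (auto simp: qbasis_def)
  have zero: "\<beta> 0 z = 0" for z using hom[of 0 0 z] by simp
  have sum: "\<beta> (\<Sum>i\<in>I. scale (c i) (w i)) z = (\<Sum>i\<in>I. c i * \<beta> (w i) z)" for c z w and I :: "nat set"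
    by (induction I rule: infinite_finite_induct) (auto simp: add hom zero)
  have sum': "\<beta> z (\<Sum>i\<in>I. scale (c i) (w i)) = (\<Sum>i\<in>I. c i * \<beta> (w i) z)" for c z w and I :: "nat set"
    using sum[of c w I z] by (simp add: sym)
  have diff: "\<beta> x z = \<beta> (x - y) z + \<beta> y z" for x y z
    using add[of "x - y" y z] by simp
  have "n \<le> k"
  proof (rule ccontr)
    assume "\<not> n \<le> k"
    then obtain c where c: "\<exists>i<n. c i \<noteq> 0" "\<forall>j<k. (\<Sum>i<n. \<beta> (b i) (a j) * c i) = 0"
      using homogeneous_system_nontrivial_solution[of "{..<k}" "{..<n}" "\<lambda>j i. \<beta> (b i) (a j)"] by auto
    define x where "x = (\<Sum>i<n. scale (c i) (b i))"
    have xV: "x \<in> V" unfolding x_def by (intro subspace_sum[OF V] subspace_scale[OF V] bV) auto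
    have xa: "\<beta> (a j) x = 0" if "j < k" for j
      using c(2) that by (simp add: x_def sum' sum sym[of "a j"] mult.commute)
    have "\<beta> x y = 0" if y: "y \<in> W" for y
    proof -
      from a y obtain e where e: "y - (\<Sum>i<k. scale (e i) (a i)) \<in> U"
        unfolding qbasis_def by blast
      hence eV: "y - (\<Sum>i<k. scale (e i) (a i)) \<in> V" using U W by blast
      have "\<beta> y x = \<beta> (y - (\<Sum>i<k. scale (e i) (a i))) x + \<beta> (\<Sum>i<k. scale (e i) (a i)) x"
        by (rule diff)
      also have "\<beta> (y - (\<Sum>i<k. scale (e i) (a i))) x = 0" using radical[OF eV] e xV by blast
      also have "\<beta> (\<Sum>i<k. scale (e i) (a i)) x = 0" using xa by (simp add: sum)
      finally show ?thesis by (simp add: sym[of x y])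
    qed
    hence "x \<in> W" using self[OF xV] by blast
    with b c(1) show False unfolding qbasis_def x_def by blast
  qed
  moreover have "k \<le> n"
  proof (rule ccontr)
    assume "\<not> k \<le> n"
    then obtain c where c: "\<exists>i<k. c i \<noteq> 0" "\<forall>j<n. (\<Sum>i<k. \<beta> (a i) (b j) * c i) = 0"
      using homogeneous_system_nontrivial_solution[of "{..<n}" "{..<k}" "\<lambda>j i. \<beta> (a i) (b j)"] by auto
    define x where "x = (\<Sum>i<k. scale (c i) (a i))"
    have xW: "x \<in> W" unfolding x_def by (intro subspace_sum[OF W(1)] subspace_scale[OF W(1)] aW) auto
    hence xV: "x \<in> V" using W by blast
    have xb: "\<beta> (b j) x = 0" if "j < n" for j
      using c(2) that by (simp add: x_def sum' sum sym[of "b j"] mult.commute)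
    have "\<beta> x y = 0" if y: "y \<in> V" for y
    proof -
      from b y obtain e where e: "y - (\<Sum>i<n. scale (e i) (b i)) \<in> W"
        unfolding qbasis_def by blast
      have "\<beta> y x = \<beta> (y - (\<Sum>i<n. scale (e i) (b i))) x + \<beta> (\<Sum>i<n. scale (e i) (b i)) x"
        by (rule diff)
      also have "\<beta> (y - (\<Sum>i<n. scale (e i) (b i))) x = 0"
        using self[OF xV] xW e by (subst sym) blast
      also have "\<beta> (\<Sum>i<n. scale (e i) (b i)) x = 0" using xb by (simp add: sum)
      finally show ?thesis by (simp add: sym[of x y])
    qed
    hence "x \<in> U" using radical[OF xV] by blast
    with a c(1) show False unfolding qbasis_def x_def by blast
  qed
  ultimately show ?thesis by simp
qed

end

text \<open>Preimages under \<open>h\<close> of the representatives in \<open>V'\<close> represent a basis.\<close>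

lemma codim_vimage:
  fixes sa :: "'k::field \<Rightarrow> 'a \<Rightarrow> 'a::ab_group_add" and sb :: "'k \<Rightarrow> 'b \<Rightarrow> 'b::ab_group_add"
  assumes vs: "vector_space sa" "module.subspace sa V"
    and add: "\<And>x y. x \<in> V \<Longrightarrow> y \<in> V \<Longrightarrow> h (x + y) = h x + h y"
    and hom: "\<And>c x. x \<in> V \<Longrightarrow> h (sa c x) = sb c (h x)"
    and onto: "h ` V = V'" and W: "\<And>x. x \<in> V \<Longrightarrow> x \<in> W \<longleftrightarrow> h x \<in> W'" and WV: "W \<subseteq> V"
    and cod: "codim sb V' W' n"
  shows "codim sa V W n"
proof -
  interpret vector_space sa by fact
  note V = vs(2)
  from cod obtain b where b: "qbasis sb V' W' n b" by (auto simp: codim_def)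
  have "\<forall>i\<in>{..<n}. \<exists>x. x \<in> V \<and> h x = b i"
    using qbasis_memD[OF b] onto by force
  from bchoice[OF this] obtain x where x: "\<And>i. i < n \<Longrightarrow> x i \<in> V" "\<And>i. i < n \<Longrightarrow> h (x i) = b i" by auto
  have zero: "h 0 = 0" using add[of 0 0] subspace_0[OF V] by simp
  have diff: "h (y - z) = h y - h z" if "y \<in> V" "z \<in> V" for y z
    using add[of "y - z" z] subspace_diff[OF V that] that by simp
  have sum: "(\<Sum>i<k. sa (c i) (x i)) \<in> V \<and> h (\<Sum>i<k. sa (c i) (x i)) = (\<Sum>i<k. sb (c i) (b i))"
    if "k \<le> n" for k c
    using that
  proof (induction k)
    case (Suc k)
    have "sa (c k) (x k) \<in> V" "h (sa (c k) (x k)) = sb (c k) (b k)"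
      using Suc.prems x by (auto simp: hom intro: subspace_scale[OF V])
    thus ?case using Suc subspace_add[OF V] by (auto simp: add)
  qed (auto simp: zero subspace_0[OF V])
  have "qbasis sa V W n x"
    unfolding qbasis_def
  proof (intro conjI allI ballI impI)
    fix y assume y: "y \<in> V"
    hence "h y \<in> V'" using onto by blast
    then obtain c where "h y - (\<Sum>i<n. sb (c i) (b i)) \<in> W'" using b unfolding qbasis_def by blast
    hence "y - (\<Sum>i<n. sa (c i) (x i)) \<in> W"
      using sum[of n c] y subspace_diff[OF V] by (subst W) (auto simp: diff)
    thus "\<exists>c. y - (\<Sum>i<n. sa (c i) (x i)) \<in> W" by (rule exI[of _ c])
  next
    fix c i assume "(\<Sum>i<n. sa (c i) (x i)) \<in> W" "i < n"
    thus "c i = 0" using sum[of n c] W[of "\<Sum>i<n. sa (c i) (x i)"] qbasis_indepD[OF b, of c i] by auto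
  qed (use x in auto)
  thus ?thesis by (auto simp: codim_def)
qed

text \<open>A set \<open>B\<close> as in the definition of \<open>quotient_basis\<close>, transported to a vector space by an
  additive and homogeneous map, is the same as an enumerated basis of the quotient.\<close>

lemma quotient_dim_eq:
  fixes K :: "('a, 'c) ring_scheme" (structure) and scale :: "complex \<Rightarrow> 'v \<Rightarrow> 'v::ab_group_add"
    and \<Theta> :: "'a \<Rightarrow> 'v"
  assumes K: "ring K" and V: "V \<subseteq> carrier K" and e: "\<And>c. e c \<in> carrier K"
    and closed: "\<zero> \<in> V" "\<And>x y. x \<in> V \<Longrightarrow> y \<in> V \<Longrightarrow> x \<oplus> y \<in> V"
      "\<And>x. x \<in> V \<Longrightarrow> \<ominus> x \<in> V" "\<And>c x. x \<in> V \<Longrightarrow> e c \<otimes> x \<in> V"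
    and add: "\<And>x y. x \<in> V \<Longrightarrow> y \<in> V \<Longrightarrow> \<Theta> (x \<oplus> y) = \<Theta> x + \<Theta> y"
    and scal: "\<And>c x. x \<in> V \<Longrightarrow> \<Theta> (e c \<otimes> x) = scale c (\<Theta> x)"
    and inj: "inj_on \<Theta> V"
    and W: "\<And>x. x \<in> V \<Longrightarrow> x \<in> W \<longleftrightarrow> \<Theta> x \<in> W'"
    and vs: "vector_space scale" and subW: "module.subspace scale W'"
    and cod: "codim scale (\<Theta> ` V) W' n"
  shows "quotient_dim K e V W = enat n"
proof -
  interpret K: ring K by fact
  interpret vector_space scale by fact
  have zero: "\<Theta> \<zero> = 0"
    using add[OF closed(1) closed(1)] K.r_zero[OF K.zero_closed] by simp
  have minus: "\<Theta> (\<ominus> x) = - \<Theta> x" if "x \<in> V" for x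
  proof -
    have "\<Theta> (x \<oplus> (\<ominus> x)) = \<Theta> x + \<Theta> (\<ominus> x)"
      using that by (intro add closed)
    also have "x \<oplus> (\<ominus> x) = \<zero>" using that V by (intro K.r_neg) blast
    finally show ?thesis using zero by (simp add: minus_unique)
  qed
  have sum: "(\<Oplus>b\<in>B. e (c b) \<otimes> b) \<in> V \<and>
      \<Theta> (\<Oplus>b\<in>B. e (c b) \<otimes> b) = (\<Sum>b\<in>B. scale (c b) (\<Theta> b))"
    if "finite B" "B \<subseteq> V" for B c
    using that
  proof (induction B rule: finite_induct)
    case empty show ?case by (simp add: closed zero)
  next
    case (insert x B)
    have x: "x \<in> V" and B: "B \<subseteq> V" using insert by auto
    have "(\<Oplus>b\<in>insert x B. e (c b) \<otimes> b) =
       e (c x) \<otimes> x \<oplus> (\<Oplus>b\<in>B. e (c b) \<otimes> b)"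
      using insert.hyps x B V e by (intro K.finsum_insert) auto
    with insert.IH[OF B] insert.hyps x closed show ?case by (simp add: add scal)
  qed
  have char: "x \<ominus> (\<Oplus>b\<in>B. e (c b) \<otimes> b) \<in> W \<longleftrightarrow>
      \<Theta> x - (\<Sum>b\<in>B. scale (c b) (\<Theta> b)) \<in> W'" if "finite B" "B \<subseteq> V" "x \<in> V" for B c x
    using sum[OF that(1,2), of c] that(3) closed
    by (simp add: a_minus_def W add minus)
  have qb: "quotient_basis K e V W B \<longleftrightarrow> finite B \<and> B \<subseteq> V \<and>
     (\<forall>x\<in>V. \<exists>!c. c \<in> B \<rightarrow>\<^sub>E UNIV \<and> \<Theta> x - (\<Sum>b\<in>B. scale (c b) (\<Theta> b)) \<in> W')" for B
    unfolding quotient_basis_def using char by (intro conj_cong refl ball_cong) auto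
  have card: "card B = n" if B: "quotient_basis K e V W B" for B
  proof -
    from B have fin: "finite B" "B \<subseteq> V" and ex: "\<And>x. x \<in> V \<Longrightarrow>
        \<exists>!c. c \<in> B \<rightarrow>\<^sub>E UNIV \<and> \<Theta> x - (\<Sum>b\<in>B. scale (c b) (\<Theta> b)) \<in> W'" by (auto simp: qb)
    obtain h where h: "bij_betw h {..<card B} B"
      using ex_bij_betw_nat_finite[OF fin(1)] by (auto simp: atLeast0LessThan)
    have reindex: "(\<Sum>b\<in>B. scale (c b) (\<Theta> b)) = (\<Sum>i<card B. scale (c (h i)) (\<Theta> (h i)))" for c
      by (rule sum.reindex_bij_betw[OF h, symmetric])
    have "qbasis scale (\<Theta> ` V) W' (card B) (\<Theta> \<circ> h)"
      unfolding qbasis_def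
    proof (intro conjI allI ballI impI)
      fix i assume "i < card B"
      then show "(\<Theta> \<circ> h) i \<in> \<Theta> ` V" using h fin(2) by (auto simp: bij_betw_def)
    next
      fix x assume "x \<in> \<Theta> ` V"
      then obtain y where y: "y \<in> V" "x = \<Theta> y" by blast
      from ex[OF y(1)] obtain c where "\<Theta> y - (\<Sum>b\<in>B. scale (c b) (\<Theta> b)) \<in> W'" by blast
      then show "\<exists>c. x - (\<Sum>i<card B. scale (c i) ((\<Theta> \<circ> h) i)) \<in> W'"
        by (intro exI[of _ "c \<circ> h"]) (simp add: y reindex)
    next
      fix c i assume s: "(\<Sum>i<card B. scale (c i) ((\<Theta> \<circ> h) i)) \<in> W'" and i: "i < card B"
      define c' where "c' = restrict (c \<circ> inv_into {..<card B} h) B"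
      have c'h: "c' (h j) = c j" if "j < card B" for j
        using h that by (auto simp: c'_def bij_betw_def restrict_def)
      have 1: "c' \<in> B \<rightarrow>\<^sub>E UNIV \<and> \<Theta> \<zero> - (\<Sum>b\<in>B. scale (c' b) (\<Theta> b)) \<in> W'"
      proof
        have "(\<Sum>b\<in>B. scale (c' b) (\<Theta> b)) = (\<Sum>i<card B. scale (c i) ((\<Theta> \<circ> h) i))"
          unfolding reindex by (rule sum.cong) (auto simp: c'h)
        with s show "\<Theta> \<zero> - (\<Sum>b\<in>B. scale (c' b) (\<Theta> b)) \<in> W'"
          using subspace_neg[OF subW s] by (simp add: zero)
      qed (auto simp: c'_def)
      have 2: "restrict (\<lambda>_. 0) B \<in> B \<rightarrow>\<^sub>E UNIV \<and>
          \<Theta> \<zero> - (\<Sum>b\<in>B. scale (restrict (\<lambda>_. 0) B b) (\<Theta> b)) \<in> W'"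
        by (auto simp: zero subspace_0[OF subW])
      from ex[OF closed(1)] 1 2 have "c' = restrict (\<lambda>_. 0) B" by blast
      moreover have "h i \<in> B" using h i by (auto simp: bij_betw_def)
      ultimately show "c i = 0" using c'h[OF i] by simp
    qed
    hence "codim scale (\<Theta> ` V) W' (card B)" by (auto simp: codim_def)
    from codim_unique[OF subW this cod] show ?thesis .
  qed
  from cod obtain b where b: "qbasis scale (\<Theta> ` V) W' n b" by (auto simp: codim_def)
  define h where "h = (\<lambda>i. inv_into V \<Theta> (b i))"
  have h: "h i \<in> V" "\<Theta> (h i) = b i" if "i < n" for i
    using b that unfolding qbasis_def h_def by (auto intro: inv_into_into f_inv_into_f)
  have "inj_on h {..<n}"
  proof (rule inj_onI)
    fix i j assume ij: "i \<in> {..<n}" "j \<in> {..<n}" "h i = h j"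
    show "i = j"
    proof (rule ccontr)
      assume ne: "i \<noteq> j"
      define c :: "nat \<Rightarrow> complex" where "c = (\<lambda>k. if k = i then 1 else if k = j then - 1 else 0)"
      have "(\<Sum>k<n. scale (c k) (b k)) = (\<Sum>k\<in>{i,j}. scale (c k) (b k))"
        by (rule sum.mono_neutral_right) (use ij in \<open>auto simp: c_def\<close>)
      also have "\<dots> = b i - b j" using ne by (simp add: c_def)
      also have "\<dots> = 0" using h ij by (metis lessThan_iff right_minus_eq)
      finally have "(\<Sum>k<n. scale (c k) (b k)) \<in> W'" using subspace_0[OF subW] by simp
      with b have "\<forall>k<n. c k = 0" unfolding qbasis_def by blast
      then show False using ij by (auto simp: c_def split: if_splits)
    qed
  qed
  hence bij: "bij_betw h {..<n} (h ` {..<n})" by (simp add: bij_betw_def)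
  have reindex: "(\<Sum>x\<in>h ` {..<n}. scale (c x) (\<Theta> x)) = (\<Sum>i<n. scale (c (h i)) (b i))" for c
    by (subst sum.reindex_bij_betw[OF bij, symmetric]) (auto intro!: sum.cong simp: h)
  have "quotient_basis K e V W (h ` {..<n})"
    unfolding qb
  proof (intro conjI ballI)
    show "finite (h ` {..<n})" "h ` {..<n} \<subseteq> V" using h by auto
    fix x assume x: "x \<in> V"
    then obtain c where c: "\<Theta> x - (\<Sum>i<n. scale (c i) (b i)) \<in> W'"
      using b unfolding qbasis_def by blast
    show "\<exists>!c. c \<in> h ` {..<n} \<rightarrow>\<^sub>E UNIV \<and> \<Theta> x - (\<Sum>y\<in>h ` {..<n}. scale (c y) (\<Theta> y)) \<in> W'"
      unfolding reindex
    proof (rule ex_ex1I)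
      define c' where "c' = restrict (c \<circ> inv_into {..<n} h) (h ` {..<n})"
      have "c' (h j) = c j" if "j < n" for j
        using bij that by (auto simp: c'_def bij_betw_def)
      hence "(\<Sum>i<n. scale (c' (h i)) (b i)) = (\<Sum>i<n. scale (c i) (b i))" by simp
      with c show "\<exists>c. c \<in> h ` {..<n} \<rightarrow>\<^sub>E UNIV \<and> \<Theta> x - (\<Sum>i<n. scale (c (h i)) (b i)) \<in> W'"
        by (intro exI[of _ c']) (auto simp: c'_def)
    next
      fix c1 c2
      assume 1: "c1 \<in> h ` {..<n} \<rightarrow>\<^sub>E UNIV \<and> \<Theta> x - (\<Sum>i<n. scale (c1 (h i)) (b i)) \<in> W'"
        and 2: "c2 \<in> h ` {..<n} \<rightarrow>\<^sub>E UNIV \<and> \<Theta> x - (\<Sum>i<n. scale (c2 (h i)) (b i)) \<in> W'"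
      have "(\<Theta> x - (\<Sum>i<n. scale (c2 (h i)) (b i))) - (\<Theta> x - (\<Sum>i<n. scale (c1 (h i)) (b i))) \<in> W'"
        using 1 2 subspace_diff[OF subW] by blast
      also have "(\<Theta> x - (\<Sum>i<n. scale (c2 (h i)) (b i))) - (\<Theta> x - (\<Sum>i<n. scale (c1 (h i)) (b i))) =
         (\<Sum>i<n. scale (c1 (h i) - c2 (h i)) (b i))"
        by (simp add: scale_left_diff_distrib sum_subtractf)
      finally have "c1 (h i) = c2 (h i)" if "i < n" for i
        using qbasis_indepD[OF b, of "\<lambda>i. c1 (h i) - c2 (h i)"] that by simp
      then show "c1 = c2" using 1 2 by (intro PiE_ext[of c1 _ _ c2]) auto
    qed
  qed
  moreover have "card (h ` {..<n}) = n" using bij by (simp add: bij_betw_same_card[symmetric])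
  ultimately have "{B. quotient_basis K e V W B} \<noteq> {}" by blast
  thus ?thesis unfolding quotient_dim_def using card by (simp add: INF_eq_const)
qed

(* abs_summable_on stands for absolute summability in the sense of has_sum *)
no_notation Infinite_Set_Sum.abs_summable_on (infix \<open>abs'_summable'_on\<close> 50)
notation Infinite_Sum.abs_summable_on (infixr \<open>abs'_summable'_on\<close> 46)

section \<open>Convergent power series in two variables\<close>

lemma coeff2_add: "coeff2 (F + G) i j = coeff2 F i j + coeff2 G i j"
  by (simp add: coeff2_def)

lemma coeff2_uminus: "coeff2 (- F) i j = - coeff2 F i j"
  by (simp add: coeff2_def)

lemma coeff2_0: "coeff2 0 i j = 0"
  by (simp add: coeff2_def)

lemma coeff2_eqI: "(\<And>i j. coeff2 F i j = coeff2 G i j) \<Longrightarrow> F = G"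
  by (intro fps_ext) (auto simp: coeff2_def)

lemma coeff2_Abs: "coeff2 (Abs_fps (\<lambda>j. Abs_fps (\<lambda>i. c i j))) i j = c i j"
  by (simp add: coeff2_def)

lemma coeff2_mult:
  "coeff2 (F * G) a b = (\<Sum>j\<le>b. \<Sum>i\<le>a. coeff2 F i j * coeff2 G (a - i) (b - j))"
  by (simp add: coeff2_def fps_mult_nth fps_sum_nth atLeast0AtMost)

lemma has_sum_Cauchy_product2:
  fixes f g :: "nat \<times> nat \<Rightarrow> 'a :: {real_normed_field, banach, second_countable_topology}"
  assumes f: "f abs_summable_on UNIV" and g: "g abs_summable_on UNIV"
  shows "((\<lambda>(a, b). \<Sum>j\<le>b. \<Sum>i\<le>a. f (i, j) * g (a - i, b - j)) has_sum (infsum f UNIV * infsum g UNIV)) UNIV"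
proof -
  define h where "h = (\<lambda>(p, q). f p * g q)"
  have "h abs_summable_on UNIV \<times> UNIV"
    unfolding Infinite_Sum.abs_summable_on_Sigma_iff
  proof (intro conjI ballI)
    show "(\<lambda>q. h (p, q)) abs_summable_on UNIV" for p
      using summable_on_cmult_right[OF g, of "norm (f p)"] by (simp add: h_def norm_mult)
    show "(\<lambda>p. \<Sum>\<^sub>\<infinity>q. norm (h (p, q))) abs_summable_on UNIV"
      using summable_on_cmult_left[OF f, of "\<Sum>\<^sub>\<infinity>q. norm (g q)"]
      by (simp add: h_def norm_mult infsum_cmult_right' abs_mult infsum_nonneg)
  qed
  hence "(h has_sum (infsum f UNIV * infsum g UNIV)) (UNIV \<times> UNIV)"
    by (intro has_sum_SigmaI[where g = "\<lambda>p. f p * infsum g UNIV"])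
       (auto simp: h_def intro!: has_sum_cmult_right has_sum_cmult_left
          has_sum_infsum[OF abs_summable_summable[OF f]] has_sum_infsum[OF abs_summable_summable[OF g]]
          intro: abs_summable_summable)
  moreover have "bij_betw (\<lambda>((a, b), (j, i)). ((i, j), (a - i, b - j)))
      (SIGMA s:UNIV. SIGMA j:{..snd s}. {..fst s}) (UNIV \<times> UNIV :: ((nat \<times> nat) \<times> (nat \<times> nat)) set)"
    by (rule bij_betwI[where g = "\<lambda>((i, j), (k, l)). ((i + k, j + l), (j, i))"]) auto
  ultimately have *: "((\<lambda>x. h ((\<lambda>((a, b), (j, i)). ((i, j), (a - i, b - j))) x))
      has_sum (infsum f UNIV * infsum g UNIV)) (SIGMA s:UNIV. SIGMA j:{..snd s}. {..fst s})"
    by (subst has_sum_reindex_bij_betw) auto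
  have "((\<lambda>s. \<Sum>p\<in>(SIGMA j:{..snd s}. {..fst s}). h ((\<lambda>((a, b), (j, i)). ((i, j), (a - i, b - j))) (s, p)))
      has_sum (infsum f UNIV * infsum g UNIV)) UNIV"
    by (rule has_sum_SigmaD[OF *]) (rule has_sum_finite, auto)
  also have "(\<lambda>s. \<Sum>p\<in>(SIGMA j:{..snd s}. {..fst s}). h ((\<lambda>((a, b), (j, i)). ((i, j), (a - i, b - j))) (s, p)))
     = (\<lambda>(a, b). \<Sum>j\<le>b. \<Sum>i\<le>a. f (i, j) * g (a - i, b - j))"
    by (auto simp: fun_eq_iff sum.Sigma h_def case_prod_unfold)
  finally show ?thesis .
qed

definition abs_conv2 :: "real \<Rightarrow> complex fps fps \<Rightarrow> bool" where
  "abs_conv2 \<rho> F \<longleftrightarrow> (\<lambda>(i, j). norm (coeff2 F i j) * \<rho> ^ (i + j)) summable_on UNIV"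

text \<open>The sum of the absolute values of the terms on the polydisc of radius \<open>\<rho>\<close>: a submultiplicative
  bound for the values there.\<close>

definition majorant2 :: "real \<Rightarrow> complex fps fps \<Rightarrow> real" where
  "majorant2 \<rho> F = (\<Sum>\<^sub>\<infinity>(i, j). norm (coeff2 F i j) * \<rho> ^ (i + j))"

lemma convergent2_iff: "convergent2 F \<longleftrightarrow> (\<exists>\<rho>>0. abs_conv2 \<rho> F)"
  by (simp add: convergent2_def abs_conv2_def)

lemma majorant2_nonneg: "\<rho> \<ge> 0 \<Longrightarrow> majorant2 \<rho> F \<ge> 0"
  unfolding majorant2_def by (rule infsum_nonneg) auto

lemma abs_conv2_mono:
  assumes "abs_conv2 \<rho> F" "0 \<le> r" "r \<le> \<rho>"
  shows "abs_conv2 r F"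
  unfolding abs_conv2_def
  by (rule summable_on_comparison_test[OF assms(1)[unfolded abs_conv2_def]])
     (use assms in \<open>auto intro!: mult_left_mono power_mono\<close>)

text \<open>Without constant term, each summand contains at least one factor \<open>r \<le> \<rho>\<close>.\<close>

lemma majorant2_shrink:
  assumes "abs_conv2 \<rho> F" "0 < \<rho>" "coeff2 F 0 0 = 0" "0 \<le> r" "r \<le> \<rho>"
  shows "majorant2 r F \<le> r / \<rho> * majorant2 \<rho> F"
proof -
  have "majorant2 r F \<le> (\<Sum>\<^sub>\<infinity>p. r / \<rho> * (case p of (i, j) \<Rightarrow> norm (coeff2 F i j) * \<rho> ^ (i + j)))"
    unfolding majorant2_def
  proof (rule infsum_mono)
    show "(\<lambda>(i, j). norm (coeff2 F i j) * r ^ (i + j)) summable_on UNIV"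
      using abs_conv2_mono[OF assms(1,4,5)] by (simp add: abs_conv2_def)
    show "(\<lambda>p. r / \<rho> * (case p of (i, j) \<Rightarrow> norm (coeff2 F i j) * \<rho> ^ (i + j))) summable_on UNIV"
      using assms(1) by (intro summable_on_cmult_right) (simp add: abs_conv2_def)
    fix p :: "nat \<times> nat"
    obtain i j where p: "p = (i, j)" by (cases p)
    show "(case p of (i, j) \<Rightarrow> norm (coeff2 F i j) * r ^ (i + j)) \<le>
        r / \<rho> * (case p of (i, j) \<Rightarrow> norm (coeff2 F i j) * \<rho> ^ (i + j))"
    proof (cases "i + j")
      case 0 thus ?thesis using assms by (simp add: p)
    next
      case (Suc k)
      have "r ^ k \<le> \<rho> ^ k" using assms by (intro power_mono) auto
      hence "norm (coeff2 F i j) * (r * r ^ k) \<le> norm (coeff2 F i j) * (r * \<rho> ^ k)"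
        using assms by (intro mult_left_mono) auto
      thus ?thesis using Suc assms by (simp add: p field_simps)
    qed
  qed
  also have "\<dots> = r / \<rho> * majorant2 \<rho> F"
    unfolding majorant2_def by (rule infsum_cmult_right')
  finally show ?thesis .
qed

lemma
  assumes "abs_conv2 \<rho> F" "norm (fst z) \<le> \<rho>" "norm (snd z) \<le> \<rho>"
  shows abs_summable_eval2: "(\<lambda>(i, j). coeff2 F i j * fst z ^ i * snd z ^ j) abs_summable_on UNIV"
    and has_sum_eval2: "((\<lambda>(i, j). coeff2 F i j * fst z ^ i * snd z ^ j) has_sum eval2 F z) UNIV"
    and norm_eval2_le: "norm (eval2 F z) \<le> majorant2 \<rho> F"
proof -
  have bound: "norm (case p of (i, j) \<Rightarrow> coeff2 F i j * fst z ^ i * snd z ^ j) \<le>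
     (case p of (i, j) \<Rightarrow> norm (coeff2 F i j) * \<rho> ^ (i + j))" for p
  proof -
    obtain i j where p: "p = (i, j)" by (cases p)
    have "\<rho> \<ge> 0" using assms(2) norm_ge_zero order_trans by blast
    hence "norm (fst z) ^ i * norm (snd z) ^ j \<le> \<rho> ^ i * \<rho> ^ j"
      using assms by (intro mult_mono power_mono) auto
    thus ?thesis
      by (simp add: p norm_mult norm_power power_add mult.assoc mult_left_mono)
  qed
  show 1: "(\<lambda>(i, j). coeff2 F i j * fst z ^ i * snd z ^ j) abs_summable_on UNIV"
    by (rule summable_on_comparison_test[OF assms(1)[unfolded abs_conv2_def]]) (use bound in auto)
  show "((\<lambda>(i, j). coeff2 F i j * fst z ^ i * snd z ^ j) has_sum eval2 F z) UNIV"
    unfolding eval2_def by (rule has_sum_infsum[OF abs_summable_summable[OF 1]])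
  show "norm (eval2 F z) \<le> majorant2 \<rho> F"
    unfolding eval2_def majorant2_def
    by (rule norm_infsum_le[OF has_sum_infsum[OF abs_summable_summable[OF 1]]
          has_sum_infsum[OF assms(1)[unfolded abs_conv2_def]] bound])
qed

lemma abs_conv2_add:
  assumes "abs_conv2 \<rho> F" "abs_conv2 \<rho> G" "\<rho> \<ge> 0"
  shows "abs_conv2 \<rho> (F + G)"
proof -
  have "(\<lambda>p. (case p of (i, j) \<Rightarrow> norm (coeff2 F i j) * \<rho> ^ (i + j)) +
      (case p of (i, j) \<Rightarrow> norm (coeff2 G i j) * \<rho> ^ (i + j))) summable_on UNIV"
    using assms by (intro summable_on_add) (auto simp: abs_conv2_def)
  thus ?thesis unfolding abs_conv2_def
    by (rule summable_on_comparison_test)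
       (use assms in \<open>auto simp: coeff2_add ring_distribs[symmetric] intro!: mult_right_mono norm_triangle_ineq\<close>)
qed

lemma eval2_add:
  assumes "abs_conv2 \<rho> F" "abs_conv2 \<rho> G" "norm (fst z) \<le> \<rho>" "norm (snd z) \<le> \<rho>"
  shows "eval2 (F + G) z = eval2 F z + eval2 G z"
proof -
  have "((\<lambda>p. (case p of (i, j) \<Rightarrow> coeff2 F i j * fst z ^ i * snd z ^ j) +
      (case p of (i, j) \<Rightarrow> coeff2 G i j * fst z ^ i * snd z ^ j)) has_sum (eval2 F z + eval2 G z)) UNIV"
    by (intro has_sum_add has_sum_eval2[OF _ assms(3,4)] assms)
  thus ?thesis unfolding eval2_def[of "F + G"]
    by (intro infsumI) (simp add: coeff2_add case_prod_unfold ring_distribs)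
qed

lemma abs_conv2_mult:
  assumes F: "abs_conv2 \<rho> F" and G: "abs_conv2 \<rho> G" and \<rho>: "\<rho> \<ge> 0"
  shows "abs_conv2 \<rho> (F * G)" "majorant2 \<rho> (F * G) \<le> majorant2 \<rho> F * majorant2 \<rho> G"
proof -
  let ?f = "\<lambda>(i, j). norm (coeff2 F i j) * \<rho> ^ (i + j)"
  let ?g = "\<lambda>(i, j). norm (coeff2 G i j) * \<rho> ^ (i + j)"
  let ?h = "\<lambda>(a, b). \<Sum>j\<le>b. \<Sum>i\<le>a. ?f (i, j) * ?g (a - i, b - j)"
  have "?f abs_summable_on UNIV" "?g abs_summable_on UNIV"
    using F G \<rho> by (auto simp: abs_conv2_def case_prod_unfold abs_mult)
  from has_sum_Cauchy_product2[OF this]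
  have *: "(?h has_sum majorant2 \<rho> F * majorant2 \<rho> G) UNIV"
    by (simp add: majorant2_def)
  have bound: "(case p of (a, b) \<Rightarrow> norm (coeff2 (F * G) a b) * \<rho> ^ (a + b)) \<le> ?h p" for p
  proof -
    obtain a b where p: "p = (a, b)" by (cases p)
    have "norm (coeff2 (F * G) a b) \<le> (\<Sum>j\<le>b. \<Sum>i\<le>a. norm (coeff2 F i j) * norm (coeff2 G (a - i) (b - j)))"
      unfolding coeff2_mult by (intro order_trans[OF norm_sum] sum_mono) (auto simp: norm_mult intro!: order_trans[OF norm_sum])
    hence "norm (coeff2 (F * G) a b) * \<rho> ^ (a + b) \<le>
       (\<Sum>j\<le>b. \<Sum>i\<le>a. norm (coeff2 F i j) * norm (coeff2 G (a - i) (b - j))) * \<rho> ^ (a + b)"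
      using \<rho> by (intro mult_right_mono) auto
    also have "\<dots> = ?h p"
      unfolding p sum_distrib_right prod.case
    proof (intro sum.cong refl)
      fix i j assume "j \<in> {..b}" "i \<in> {..a}"
      hence "\<rho> ^ (a + b) = \<rho> ^ (i + j) * \<rho> ^ (a - i + (b - j))"
        by (simp flip: power_add)
      thus "norm (coeff2 F i j) * norm (coeff2 G (a - i) (b - j)) * \<rho> ^ (a + b) =
         norm (coeff2 F i j) * \<rho> ^ (i + j) * (norm (coeff2 G (a - i) (b - j)) * \<rho> ^ (a - i + (b - j)))"
        by simp
    qed
    finally show ?thesis by (simp add: p)
  qed
  show 1: "abs_conv2 \<rho> (F * G)"
    unfolding abs_conv2_def
    by (rule summable_on_comparison_test[OF has_sum_imp_summable[OF *]])
       (use bound \<rho> in \<open>auto simp: case_prod_unfold\<close>)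
  show "majorant2 \<rho> (F * G) \<le> majorant2 \<rho> F * majorant2 \<rho> G"
    using has_sum_mono[OF has_sum_infsum[OF 1[unfolded abs_conv2_def]] * bound]
    by (simp add: majorant2_def)
qed

lemma eval2_mult:
  assumes "abs_conv2 \<rho> F" "abs_conv2 \<rho> G" "norm (fst z) \<le> \<rho>" "norm (snd z) \<le> \<rho>"
  shows "eval2 (F * G) z = eval2 F z * eval2 G z"
proof -
  let ?f = "\<lambda>F (i, j). coeff2 F i j * fst z ^ i * snd z ^ j"
  have "((\<lambda>(a, b). \<Sum>j\<le>b. \<Sum>i\<le>a. ?f F (i, j) * ?f G (a - i, b - j)) has_sum
      infsum (?f F) UNIV * infsum (?f G) UNIV) UNIV"
    by (intro has_sum_Cauchy_product2 abs_summable_eval2[OF _ assms(3,4)] assms)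
  also have "(\<lambda>(a, b). \<Sum>j\<le>b. \<Sum>i\<le>a. ?f F (i, j) * ?f G (a - i, b - j)) = ?f (F * G)"
  proof (clarsimp simp: fun_eq_iff coeff2_mult sum_distrib_right)
    fix a b
    show "(\<Sum>j\<le>b. \<Sum>i\<le>a. coeff2 F i j * fst z ^ i * snd z ^ j *
           (coeff2 G (a - i) (b - j) * fst z ^ (a - i) * snd z ^ (b - j))) =
        (\<Sum>j\<le>b. \<Sum>i\<le>a. coeff2 F i j * coeff2 G (a - i) (b - j) * fst z ^ a * snd z ^ b)"
    proof (intro sum.cong refl)
      fix i j assume "j \<in> {..b}" "i \<in> {..a}"
      hence "fst z ^ a = fst z ^ i * fst z ^ (a - i)" "snd z ^ b = snd z ^ j * snd z ^ (b - j)"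
        by (simp_all flip: power_add)
      thus "coeff2 F i j * fst z ^ i * snd z ^ j *
           (coeff2 G (a - i) (b - j) * fst z ^ (a - i) * snd z ^ (b - j)) =
         coeff2 F i j * coeff2 G (a - i) (b - j) * fst z ^ a * snd z ^ b"
        by simp
    qed
  qed
  finally show ?thesis unfolding eval2_def by (intro infsumI)
qed

lemma abs_conv2_const2 [simp]: "abs_conv2 \<rho> (const2 c)"
proof -
  have "(\<lambda>(i, j). norm (coeff2 (const2 c) i j) * \<rho> ^ (i + j)) summable_on {(0,0)}" by simp
  also have "?this \<longleftrightarrow> ?thesis" unfolding abs_conv2_def
    by (rule summable_on_cong_neutral) (auto simp: coeff2_def const2_def split: if_splits)
  finally show ?thesis .
qed

lemma eval2_const2 [simp]: "eval2 (const2 c) z = c"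
proof -
  have "eval2 (const2 c) z = (\<Sum>\<^sub>\<infinity>(i, j)\<in>{(0,0)}. coeff2 (const2 c) i j * fst z ^ i * snd z ^ j)"
    unfolding eval2_def
    by (rule infsum_cong_neutral) (auto simp: coeff2_def const2_def split: if_splits)
  thus ?thesis by (simp add: coeff2_def const2_def)
qed

lemma const2_1: "const2 1 = 1" and const2_0: "const2 0 = 0"
  by (simp_all add: const2_def)

lemma abs_conv2_power:
  assumes "abs_conv2 \<rho> F" "\<rho> \<ge> 0"
  shows "abs_conv2 \<rho> (F ^ n) \<and> majorant2 \<rho> (F ^ n) \<le> majorant2 \<rho> F ^ n"
proof (induction n)
  case 0
  have "majorant2 \<rho> (const2 1) = (\<Sum>\<^sub>\<infinity>(i, j)\<in>{(0,0)}. norm (coeff2 (const2 1) i j) * \<rho> ^ (i + j))"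
    unfolding majorant2_def
    by (rule infsum_cong_neutral) (auto simp: coeff2_def const2_def split: if_splits)
  also have "\<dots> = 1" by (simp add: coeff2_def const2_def)
  finally show ?case using abs_conv2_const2[of \<rho> 1] by (simp add: const2_1)
next
  case (Suc n)
  with abs_conv2_mult[OF assms(1) _ assms(2), of "F ^ n"] majorant2_nonneg[OF assms(2), of F]
  show ?case by (auto intro: order_trans mult_left_mono)
qed

lemma eval2_power:
  assumes "abs_conv2 \<rho> F" "norm (fst z) \<le> \<rho>" "norm (snd z) \<le> \<rho>"
  shows "eval2 (F ^ n) z = eval2 F z ^ n"
proof (induction n)
  case 0 show ?case using eval2_const2[of 1 z] by (simp add: const2_1)
next
  case (Suc n)
  have "\<rho> \<ge> 0" using assms norm_ge_zero order_trans by blast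
  thus ?case using Suc abs_conv2_power[OF assms(1)] by (simp add: eval2_mult[OF assms(1) _ assms(2,3)])
qed

subsection \<open>Germs with a convergent expansion\<close>

definition expansion2 :: "(C2 \<Rightarrow> complex) \<Rightarrow> complex fps fps \<Rightarrow> bool" where
  "expansion2 h F \<longleftrightarrow> convergent2 F \<and> (\<forall>\<^sub>F z in nhds 0. h z = eval2 F z)"

lemma eventually_polydisc:
  assumes "\<rho> > 0"
  shows "\<forall>\<^sub>F z in nhds (0::C2). norm (fst z) \<le> \<rho> \<and> norm (snd z) \<le> \<rho>"
proof -
  have "\<forall>\<^sub>F z in nhds (0::C2). z \<in> ball 0 \<rho>"
    using assms by (intro eventually_nhds_in_open) auto
  thus ?thesis
  proof eventually_elim
    case (elim z)
    thus ?case using norm_fst_le[of "fst z" "snd z"] norm_snd_le[of "snd z" "fst z"]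
      by (auto simp: dist_norm)
  qed
qed

lemma expansion2E:
  assumes "expansion2 h F"
  obtains \<rho> where "\<rho> > 0" "abs_conv2 \<rho> F"
  using assms by (auto simp: expansion2_def convergent2_iff)

lemma abs_conv2_common:
  assumes "convergent2 F" "convergent2 G"
  obtains \<rho> where "\<rho> > 0" "abs_conv2 \<rho> F" "abs_conv2 \<rho> G"
proof -
  from assms obtain r s where "r > 0" "abs_conv2 r F" "s > 0" "abs_conv2 s G"
    by (auto simp: convergent2_iff)
  thus ?thesis
    by (intro that[of "min r s"]) (auto intro: abs_conv2_mono)
qed

lemma convergent2_add: "convergent2 F \<Longrightarrow> convergent2 G \<Longrightarrow> convergent2 (F + G)"
  by (erule (1) abs_conv2_common) (auto simp: convergent2_iff intro: abs_conv2_add less_imp_le)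

lemma convergent2_mult: "convergent2 F \<Longrightarrow> convergent2 G \<Longrightarrow> convergent2 (F * G)"
  by (erule (1) abs_conv2_common) (auto simp: convergent2_iff intro: abs_conv2_mult less_imp_le)

lemma convergent2_const2 [simp]: "convergent2 (const2 c)"
  by (auto simp: convergent2_iff intro: exI[of _ 1])

lemma convergent2_uminus: "convergent2 F \<Longrightarrow> convergent2 (- F)"
  by (simp add: convergent2_def coeff2_uminus)

lemma expansion2_add:
  assumes "expansion2 f F" "expansion2 g G"
  shows "expansion2 (\<lambda>z. f z + g z) (F + G)"
proof -
  from assms have c: "convergent2 F" "convergent2 G"
    and e: "\<forall>\<^sub>F z in nhds 0. f z = eval2 F z" "\<forall>\<^sub>F z in nhds 0. g z = eval2 G z"
    by (auto simp: expansion2_def)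
  from c obtain \<rho> where \<rho>: "\<rho> > 0" "abs_conv2 \<rho> F" "abs_conv2 \<rho> G" by (rule abs_conv2_common)
  have "\<forall>\<^sub>F z in nhds 0. f z + g z = eval2 (F + G) z"
    using e eventually_polydisc[OF \<rho>(1)]
    by eventually_elim (simp add: eval2_add[OF \<rho>(2,3)])
  with c show ?thesis by (simp add: expansion2_def convergent2_add)
qed

lemma expansion2_mult:
  assumes "expansion2 f F" "expansion2 g G"
  shows "expansion2 (\<lambda>z. f z * g z) (F * G)"
proof -
  from assms have c: "convergent2 F" "convergent2 G"
    and e: "\<forall>\<^sub>F z in nhds 0. f z = eval2 F z" "\<forall>\<^sub>F z in nhds 0. g z = eval2 G z"
    by (auto simp: expansion2_def)
  from c obtain \<rho> where \<rho>: "\<rho> > 0" "abs_conv2 \<rho> F" "abs_conv2 \<rho> G" by (rule abs_conv2_common)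
  have "\<forall>\<^sub>F z in nhds 0. f z * g z = eval2 (F * G) z"
    using e eventually_polydisc[OF \<rho>(1)]
    by eventually_elim (simp add: eval2_mult[OF \<rho>(2,3)])
  with c show ?thesis by (simp add: expansion2_def convergent2_mult)
qed

lemma expansion2_const: "expansion2 (\<lambda>_. c) (const2 c)"
  by (simp add: expansion2_def)

lemma expansion2_eval2: "convergent2 F \<Longrightarrow> expansion2 (eval2 F) F"
  by (simp add: expansion2_def)

lemma expansion2_cong:
  assumes "expansion2 f F" "\<forall>\<^sub>F z in nhds 0. f z = g z"
  shows "expansion2 g F"
  using assms unfolding expansion2_def by (auto elim: eventually_elim2)

lemma expansion2_tendsto_0:
  assumes "expansion2 f F" "coeff2 F 0 0 = 0"
  shows "(f \<longlongrightarrow> 0) (nhds 0)"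
proof (rule tendstoI)
  fix e :: real assume e: "e > 0"
  from assms(1) obtain \<rho> where \<rho>: "\<rho> > 0" "abs_conv2 \<rho> F" by (rule expansion2E)
  define M where "M = majorant2 \<rho> F"
  have M: "M \<ge> 0" unfolding M_def using \<rho> by (intro majorant2_nonneg) auto
  define r where "r = min \<rho> (e * \<rho> / (2 * (M + 1)))"
  have r: "r > 0" "r \<le> \<rho>" using e \<rho> M by (auto simp: r_def)
  have "r * M \<le> e * \<rho> / (2 * (M + 1)) * M" using M by (intro mult_right_mono) (auto simp: r_def)
  also have "\<dots> < e * \<rho>" using e \<rho> M by (simp add: field_simps add_nonneg_pos)
  finally have rM: "r / \<rho> * M < e" using \<rho> by (simp add: field_simps)
  have "\<forall>\<^sub>F z in nhds 0. f z = eval2 F z" using assms(1) by (simp add: expansion2_def)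
  with eventually_polydisc[OF r(1)] show "\<forall>\<^sub>F z in nhds 0. dist (f z) 0 < e"
  proof eventually_elim
    case (elim z)
    have "norm (eval2 F z) \<le> majorant2 r F"
      by (rule norm_eval2_le) (use elim r \<rho> abs_conv2_mono[OF \<rho>(2)] in auto)
    also have "\<dots> \<le> r / \<rho> * M" unfolding M_def
      by (rule majorant2_shrink) (use \<rho> r assms in auto)
    finally show ?case using rM elim by simp
  qed
qed

lemma power_series_zero_imp_coeff_zero:
  fixes c :: "nat \<Rightarrow> complex"
  assumes "\<epsilon> > 0" and "\<And>x. norm x < \<epsilon> \<Longrightarrow> ((\<lambda>n. c n * x ^ n) has_sum 0) UNIV"
  shows "c n = 0"
proof -
  have "\<forall>\<^sub>F x in nhds 0. (\<lambda>n. fps_nth (Abs_fps c) n * x ^ n) sums 0"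
  proof (rule eventually_mono)
    show "\<forall>\<^sub>F x in nhds (0::complex). x \<in> ball 0 \<epsilon>"
      using assms(1) by (intro eventually_nhds_in_open) auto
  qed (auto intro!: has_sum_imp_sums assms(2))
  hence "(\<lambda>_. 0) has_fps_expansion Abs_fps c"
    by (rule has_fps_expansionI)
  hence "Abs_fps c = 0"
    using has_fps_expansion_0 by (intro eval_fps_eqD) (auto simp: has_fps_expansion_def)
  thus ?thesis by (simp add: fps_eq_iff)
qed

text \<open>The identity theorem in one variable, applied to the outer variable \<open>y\<close> for each fixed small \<open>x\<close>
  and then to each of the resulting series in \<open>x\<close>.\<close>

lemma eval2_zero_imp_zero:
  assumes "convergent2 F" "\<forall>\<^sub>F z in nhds 0. eval2 F z = 0"
  shows "F = 0"
proof (rule coeff2_eqI)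
  fix i j
  from assms(1) obtain \<rho> where \<rho>: "\<rho> > 0" "abs_conv2 \<rho> F" by (auto simp: convergent2_iff)
  from assms(2) obtain e where e: "e > 0" "\<And>z. norm z < e \<Longrightarrow> eval2 F z = 0"
    unfolding eventually_nhds_metric by (auto simp: dist_norm)
  define \<epsilon> where "\<epsilon> = min \<rho> (e / 2)"
  have \<epsilon>: "\<epsilon> > 0" using \<rho> e by (simp add: \<epsilon>_def)
  have zero: "((\<lambda>(i, j). coeff2 F i j * x ^ i * y ^ j) has_sum 0) UNIV" if "norm x < \<epsilon>" "norm y < \<epsilon>" for x y
  proof -
    have "norm (x, y) \<le> norm x + norm y" by (rule norm_Pair_le)
    hence "eval2 F (x, y) = 0" using that by (intro e) (auto simp: \<epsilon>_def)
    thus ?thesis using has_sum_eval2[OF \<rho>(2), of "(x, y)"] that by (auto simp: \<epsilon>_def)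
  qed
  have inner: "((\<lambda>i. coeff2 F i j * x ^ i) has_sum 0) UNIV" if x: "norm x < \<epsilon>" for x j
  proof -
    have sm: "(\<lambda>i. coeff2 F i j * x ^ i) summable_on UNIV" for j
    proof -
      have "(\<lambda>(i, j). coeff2 F i j * x ^ i * (\<epsilon>/2) ^ j) abs_summable_on UNIV \<times> UNIV"
        using abs_summable_eval2[OF \<rho>(2), of "(x, of_real (\<epsilon>/2))"] x \<epsilon> by (auto simp: \<epsilon>_def)
      hence "(\<lambda>(i, j). coeff2 F i j * x ^ i * (\<epsilon>/2) ^ j) summable_on UNIV \<times> UNIV"
        by (rule abs_summable_summable)
      hence "(\<lambda>(j, i). coeff2 F i j * x ^ i * (\<epsilon>/2) ^ j) summable_on UNIV \<times> UNIV"
        by (subst (asm) summable_on_swap) simp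
      hence "(\<lambda>i. coeff2 F i j * x ^ i * (\<epsilon>/2) ^ j) summable_on UNIV"
        by (rule summable_on_SigmaD1) auto
      hence "(\<lambda>i. coeff2 F i j * x ^ i * (\<epsilon>/2) ^ j * inverse ((\<epsilon>/2) ^ j)) summable_on UNIV"
        by (rule summable_on_cmult_left)
      thus ?thesis using \<epsilon> by (simp add: mult.assoc)
    qed
    have "(\<Sum>\<^sub>\<infinity>i. coeff2 F i j * x ^ i) = 0" for j
    proof (rule power_series_zero_imp_coeff_zero[OF \<epsilon>])
      fix y :: complex assume y: "norm y < \<epsilon>"
      have "((\<lambda>(j, i). coeff2 F i j * x ^ i * y ^ j) has_sum 0) (UNIV \<times> UNIV)"
        using zero[OF x y] by (subst (asm) UNIV_Times_UNIV[symmetric], subst (asm) has_sum_swap) simp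
      thus "((\<lambda>j. (\<Sum>\<^sub>\<infinity>i. coeff2 F i j * x ^ i) * y ^ j) has_sum 0) UNIV"
        by (rule has_sum_SigmaD) (auto intro!: has_sum_cmult_left has_sum_infsum sm)
    qed
    thus ?thesis using has_sum_infsum[OF sm[of j]] by simp
  qed
  show "coeff2 F i j = coeff2 0 i j"
    using power_series_zero_imp_coeff_zero[OF \<epsilon>, of "\<lambda>i. coeff2 F i j" i] inner
    by (simp add: coeff2_0)
qed

lemma expansion2_unique:
  assumes "expansion2 f F" "expansion2 f G"
  shows "F = G"
proof -
  have "expansion2 (\<lambda>z. f z + (- 1) * f z) (F + const2 (- 1) * G)"
    by (intro expansion2_add expansion2_mult expansion2_const assms)
  hence "F + const2 (- 1) * G = 0"
    by (intro eval2_zero_imp_zero) (auto simp: expansion2_def)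
  moreover have "const2 (- 1) * G = - G"
    by (simp add: const2_def fps_const_neg[symmetric] del: fps_const_neg)
  ultimately show ?thesis by simp
qed

text \<open>The coefficients of the composite are sums over all monomials of \<open>F\<close>; they converge
  absolutely because the majorants of \<open>A\<close> and \<open>B\<close> are small on small polydiscs.\<close>

lemma expansion2_compose:
  assumes f: "expansion2 f F" and a: "expansion2 a A" and b: "expansion2 b B"
    and A0: "coeff2 A 0 0 = 0" and B0: "coeff2 B 0 0 = 0"
  shows "\<exists>H. expansion2 (\<lambda>z. f (a z, b z)) H"
proof -
  from f obtain R where R: "R > 0" "abs_conv2 R F" by (rule expansion2E)
  have "convergent2 A" "convergent2 B" using a b by (auto simp: expansion2_def)
  then obtain \<rho> where \<rho>: "\<rho> > 0" "abs_conv2 \<rho> A" "abs_conv2 \<rho> B" by (rule abs_conv2_common)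
  define M where "M = majorant2 \<rho> A + majorant2 \<rho> B + 1"
  have M: "M > 0" "majorant2 \<rho> A \<le> M" "majorant2 \<rho> B \<le> M"
    using majorant2_nonneg[of \<rho> A] majorant2_nonneg[of \<rho> B] \<rho> by (auto simp: M_def)
  define r where "r = min \<rho> (R * \<rho> / M)"
  have r: "r > 0" "r \<le> \<rho>" using R \<rho> M by (auto simp: r_def)
  have rM: "r / \<rho> * M \<le> R"
  proof -
    have "r * M \<le> R * \<rho> / M * M" using M by (intro mult_right_mono) (auto simp: r_def)
    thus ?thesis using \<rho> M by (simp add: field_simps)
  qed
  have le: "majorant2 r X \<le> R" if "abs_conv2 \<rho> X" "coeff2 X 0 0 = 0" "majorant2 \<rho> X \<le> M" for X
  proof -
    have "majorant2 r X \<le> r / \<rho> * majorant2 \<rho> X"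
      by (rule majorant2_shrink) (use that \<rho> r in auto)
    also have "\<dots> \<le> r / \<rho> * M" using that r \<rho> by (intro mult_left_mono) auto
    finally show ?thesis using rM by simp
  qed
  have AR: "abs_conv2 r A" "majorant2 r A \<le> R" and BR: "abs_conv2 r B" "majorant2 r B \<le> R"
    using \<rho> r A0 B0 M le abs_conv2_mono by auto
  define G where "G = (\<lambda>(i, j). A ^ i * B ^ j)"
  have G: "abs_conv2 r (G p)" "majorant2 r (G p) \<le> R ^ (fst p + snd p)" for p
  proof -
    obtain i j where p: "p = (i, j)" by (cases p)
    have 1: "abs_conv2 r (A ^ i)" "majorant2 r (A ^ i) \<le> R ^ i"
      "abs_conv2 r (B ^ j)" "majorant2 r (B ^ j) \<le> R ^ j"
      using abs_conv2_power[OF AR(1), of i] abs_conv2_power[OF BR(1), of j] r AR BR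
        power_mono[OF AR(2), of i] power_mono[OF BR(2), of j]
        majorant2_nonneg[of r A] majorant2_nonneg[of r B] by auto
    show "abs_conv2 r (G p)" using abs_conv2_mult[OF 1(1,3)] r by (simp add: G_def p)
    have "majorant2 r (G p) \<le> majorant2 r (A ^ i) * majorant2 r (B ^ j)"
      using abs_conv2_mult[OF 1(1,3)] r by (simp add: G_def p)
    also have "\<dots> \<le> R ^ i * R ^ j"
      using 1 R r by (intro mult_mono majorant2_nonneg) auto
    finally show "majorant2 r (G p) \<le> R ^ (fst p + snd p)" by (simp add: p power_add)
  qed
  define c where "c = (\<lambda>p. coeff2 F (fst p) (snd p))"
  define T where "T = (\<lambda>(p, s). c p * coeff2 (G p) (fst s) (snd s))"
  have sumT: "(\<lambda>(p, s). T (p, s) * of_real (r ^ (fst s + snd s))) abs_summable_on UNIV \<times> UNIV"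
    unfolding Infinite_Sum.abs_summable_on_Sigma_iff
  proof (intro conjI ballI)
    fix p
    have "(\<lambda>s. norm (c p) * (case s of (i, j) \<Rightarrow> norm (coeff2 (G p) i j) * r ^ (i + j))) summable_on UNIV"
      using G(1)[of p] by (intro summable_on_cmult_right) (simp add: abs_conv2_def)
    thus "(\<lambda>y. case (p, y) of (p, s) \<Rightarrow> T (p, s) * of_real (r ^ (fst s + snd s))) abs_summable_on UNIV"
      using r by (simp add: T_def norm_mult norm_power case_prod_unfold mult.assoc)
  next
    have eq: "(\<Sum>\<^sub>\<infinity>y. norm (case (p, y) of (p, s) \<Rightarrow> T (p, s) * of_real (r ^ (fst s + snd s)))) =
        norm (c p) * majorant2 r (G p)" for p
      using r by (simp add: T_def norm_mult norm_power case_prod_unfold mult.assoc majorant2_def infsum_cmult_right')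
    have "(\<lambda>p. norm (c p) * majorant2 r (G p)) summable_on UNIV"
    proof (rule summable_on_comparison_test[OF R(2)[unfolded abs_conv2_def]])
      fix p :: "nat \<times> nat"
      show "norm (c p) * majorant2 r (G p) \<le> (case p of (i, j) \<Rightarrow> norm (coeff2 F i j) * R ^ (i + j))"
        using G(2)[of p] by (simp add: c_def case_prod_unfold mult_left_mono)
      show "0 \<le> norm (c p) * majorant2 r (G p)"
        using r by (simp add: majorant2_nonneg)
    qed
    thus "(\<lambda>x. \<Sum>\<^sub>\<infinity>y. norm (case (x, y) of (p, s) \<Rightarrow> T (p, s) * of_real (r ^ (fst s + snd s)))) abs_summable_on UNIV"
      unfolding eq using r by (simp add: majorant2_nonneg)
  qed
  define H where "H = Abs_fps (\<lambda>j. Abs_fps (\<lambda>i. \<Sum>\<^sub>\<infinity>p. T (p, (i, j))))"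
  have coeffH: "coeff2 H i j = (\<Sum>\<^sub>\<infinity>p. T (p, (i, j)))" for i j
    unfolding H_def by (rule coeff2_Abs)
  have sumT': "(\<lambda>(s, p). T (p, s) * of_real (r ^ (fst s + snd s))) abs_summable_on UNIV \<times> UNIV"
    using sumT by (subst (asm) summable_on_swap) (simp add: case_prod_unfold)
  have Hr: "abs_conv2 r H"
  proof -
    have "(\<lambda>s. \<Sum>\<^sub>\<infinity>p. norm (T (p, s) * of_real (r ^ (fst s + snd s)))) abs_summable_on UNIV"
      using sumT' unfolding Infinite_Sum.abs_summable_on_Sigma_iff by simp
    hence "(\<lambda>s. \<Sum>\<^sub>\<infinity>p. norm (T (p, s) * of_real (r ^ (fst s + snd s)))) summable_on UNIV"
      by (rule abs_summable_summable)
    thus ?thesis unfolding abs_conv2_def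
    proof (rule summable_on_comparison_test)
      fix s :: "nat \<times> nat"
      obtain i j where s: "s = (i, j)" by (cases s)
      have "(\<lambda>p. T (p, s) * of_real (r ^ (fst s + snd s))) abs_summable_on UNIV"
        using sumT' unfolding Infinite_Sum.abs_summable_on_Sigma_iff by (auto simp: s)
      hence "norm (\<Sum>\<^sub>\<infinity>p. T (p, s) * of_real (r ^ (fst s + snd s))) \<le>
          (\<Sum>\<^sub>\<infinity>p. norm (T (p, s) * of_real (r ^ (fst s + snd s))))"
        by (rule norm_infsum_bound)
      also have "norm (\<Sum>\<^sub>\<infinity>p. T (p, s) * of_real (r ^ (fst s + snd s))) = norm (coeff2 H i j) * r ^ (i + j)"
        using r by (simp add: infsum_cmult_left' s coeffH norm_mult norm_power)
      finally show "(case s of (i, j) \<Rightarrow> norm (coeff2 H i j) * r ^ (i + j)) \<le>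
          (\<Sum>\<^sub>\<infinity>p. norm (T (p, s) * of_real (r ^ (fst s + snd s))))"
        by (simp add: s)
    qed (use r in auto)
  qed
  have evH: "eval2 H z = eval2 F (eval2 A z, eval2 B z)" if z: "norm (fst z) \<le> r" "norm (snd z) \<le> r" for z
  proof -
    define mz where "mz = (\<lambda>s. fst z ^ fst s * snd z ^ snd s)"
    have mz: "norm (mz s) \<le> r ^ (fst s + snd s)" for s
      unfolding mz_def norm_mult norm_power power_add using z r
      by (intro mult_mono power_mono) auto
    have abs1: "(\<lambda>(p, s). T (p, s) * mz s) abs_summable_on UNIV \<times> UNIV"
      by (rule Infinite_Sum.abs_summable_on_comparison_test[OF sumT])
         (use mz r in \<open>auto simp: norm_mult norm_power intro!: mult_left_mono\<close>)
    hence sm1: "(\<lambda>(p, s). T (p, s) * mz s) summable_on UNIV \<times> UNIV" by (rule abs_summable_summable)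
    have abs2: "(\<lambda>(s, p). T (p, s) * mz s) abs_summable_on UNIV \<times> UNIV"
      using abs1 by (subst (asm) summable_on_swap) (simp add: case_prod_unfold)
    have "eval2 H z = (\<Sum>\<^sub>\<infinity>s. \<Sum>\<^sub>\<infinity>p. T (p, s) * mz s)"
      unfolding eval2_def by (simp add: coeffH mz_def case_prod_unfold infsum_cmult_left' mult.assoc)
    also have "\<dots> = (\<Sum>\<^sub>\<infinity>p. \<Sum>\<^sub>\<infinity>s. T (p, s) * mz s)"
      by (rule infsum_swap_banach[symmetric]) (rule sm1)
    also have "(\<lambda>p. \<Sum>\<^sub>\<infinity>s. T (p, s) * mz s) = (\<lambda>p. c p * eval2 (G p) z)"
      by (simp add: T_def mz_def eval2_def case_prod_unfold mult.assoc infsum_cmult_right')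
    also have "\<dots> = (\<lambda>(i, j). coeff2 F i j * eval2 A z ^ i * eval2 B z ^ j)"
    proof
      fix p :: "nat \<times> nat"
      obtain i j where p: "p = (i, j)" by (cases p)
      have "eval2 (G p) z = eval2 (A ^ i) z * eval2 (B ^ j) z"
        unfolding G_def p prod.case
        by (rule eval2_mult) (use z abs_conv2_power AR BR r in auto)
      thus "c p * eval2 (G p) z = (case p of (i, j) \<Rightarrow> coeff2 F i j * eval2 A z ^ i * eval2 B z ^ j)"
        by (simp add: p c_def eval2_power[OF AR(1) z] eval2_power[OF BR(1) z])
    qed
    finally show ?thesis by (simp add: eval2_def[of F])
  qed
  have "\<forall>\<^sub>F z in nhds 0. f z = eval2 F z" "\<forall>\<^sub>F z in nhds 0. a z = eval2 A z" "\<forall>\<^sub>F z in nhds 0. b z = eval2 B z"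
    using f a b by (auto simp: expansion2_def)
  moreover have "((\<lambda>z. (a z, b z)) \<longlongrightarrow> (0, 0)) (nhds 0)"
    by (intro tendsto_Pair expansion2_tendsto_0[OF a A0] expansion2_tendsto_0[OF b B0])
  hence "filterlim (\<lambda>z. (a z, b z)) (nhds 0) (nhds 0)" by (simp add: zero_prod_def)
  ultimately have "\<forall>\<^sub>F z in nhds 0. f (a z, b z) = eval2 F (a z, b z)"
    by (auto simp: filterlim_iff)
  with eventually_polydisc[OF r(1)] \<open>\<forall>\<^sub>F z in nhds 0. a z = eval2 A z\<close> \<open>\<forall>\<^sub>F z in nhds 0. b z = eval2 B z\<close>
  have "\<forall>\<^sub>F z in nhds 0. f (a z, b z) = eval2 H z"
    by eventually_elim (simp add: evH)
  moreover have "convergent2 H" using Hr r by (auto simp: convergent2_iff)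
  ultimately show ?thesis by (auto simp: expansion2_def)
qed

subsection \<open>Series in one variable among series in two variables\<close>

definition convergent1 :: "complex fps \<Rightarrow> bool" where
  "convergent1 A \<longleftrightarrow> fps_conv_radius A > 0"

lemma convergent1_iff: "convergent1 A \<longleftrightarrow> (\<exists>\<rho>>0. (\<lambda>n. norm (fps_nth A n) * \<rho> ^ n) summable_on UNIV)"
proof
  assume "convergent1 A"
  then obtain \<rho> where \<rho>: "ereal \<rho> > 0" "ereal \<rho> < fps_conv_radius A"
    using ereal_dense2[of 0 "fps_conv_radius A"] by (auto simp: convergent1_def zero_ereal_def)
  hence "summable (\<lambda>n. norm (fps_nth A n * of_real \<rho> ^ n))"
    by (intro norm_summable_fps) (auto simp: zero_ereal_def)
  hence "(\<lambda>n. norm (fps_nth A n) * \<rho> ^ n) summable_on UNIV"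
    using \<rho> by (subst summable_on_UNIV_nonneg_real_iff) (auto simp: norm_mult norm_power zero_ereal_def)
  with \<rho> show "\<exists>\<rho>>0. (\<lambda>n. norm (fps_nth A n) * \<rho> ^ n) summable_on UNIV"
    by (auto simp: zero_ereal_def)
next
  assume "\<exists>\<rho>>0. (\<lambda>n. norm (fps_nth A n) * \<rho> ^ n) summable_on UNIV"
  then obtain \<rho> where \<rho>: "\<rho> > 0" "(\<lambda>n. norm (fps_nth A n) * \<rho> ^ n) summable_on UNIV" by blast
  hence "summable (\<lambda>n. norm (fps_nth A n * of_real \<rho> ^ n))"
    by (subst (asm) summable_on_UNIV_nonneg_real_iff) (auto simp: norm_mult norm_power)
  hence "summable (\<lambda>n. fps_nth A n * of_real \<rho> ^ n)" by (rule summable_norm_cancel)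
  hence "fps_conv_radius A \<ge> norm (of_real \<rho> :: complex)"
    unfolding fps_conv_radius_def by (rule conv_radius_geI)
  with \<rho> show "convergent1 A" unfolding convergent1_def
    by (metis abs_of_pos ereal_less(2) norm_of_real order_less_le_trans)
qed

lemma convergent1_const [simp, intro]: "convergent1 (fps_const c)"
  and convergent1_0 [simp, intro]: "convergent1 0"
  and convergent1_1 [simp, intro]: "convergent1 1"
  and convergent1_X [simp, intro]: "convergent1 (fps_X ^ n)"
  and convergent1_shift [simp]: "convergent1 (fps_shift n A) \<longleftrightarrow> convergent1 A"
  and convergent1_uminus [simp]: "convergent1 (- A) \<longleftrightarrow> convergent1 A"
  by (simp_all add: convergent1_def)

lemma convergent1_add [intro]: "convergent1 A \<Longrightarrow> convergent1 B \<Longrightarrow> convergent1 (A + B)"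
  unfolding convergent1_def using fps_conv_radius_add[of A B]
  by (metis min_def order_less_le_trans)

lemma convergent1_diff [intro]: "convergent1 A \<Longrightarrow> convergent1 B \<Longrightarrow> convergent1 (A - B)"
  unfolding convergent1_def using fps_conv_radius_diff[of A B]
  by (metis min_def order_less_le_trans)

lemma convergent1_mult [intro]: "convergent1 A \<Longrightarrow> convergent1 B \<Longrightarrow> convergent1 (A * B)"
  unfolding convergent1_def using fps_conv_radius_mult[of A B]
  by (metis min_def order_less_le_trans)

lemma convergent1_power [intro]: "convergent1 A \<Longrightarrow> convergent1 (A ^ n)"
  unfolding convergent1_def using fps_conv_radius_power[of A n] by (metis order_less_le_trans)

lemma convergent1_sum [intro]: "(\<And>i. i \<in> I \<Longrightarrow> convergent1 (f i)) \<Longrightarrow> convergent1 (\<Sum>i\<in>I. f i)"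
  by (induction I rule: infinite_finite_induct) auto

lemma convergent1_prod [intro]: "(\<And>i. i \<in> I \<Longrightarrow> convergent1 (f i)) \<Longrightarrow> convergent1 (\<Prod>i\<in>I. f i)"
  by (induction I rule: infinite_finite_induct) auto

lemma convergent1_inverse [intro]:
  "convergent1 A \<Longrightarrow> fps_nth A 0 \<noteq> 0 \<Longrightarrow> convergent1 (inverse A)"
  unfolding convergent1_def by (rule fps_conv_radius_inverse_pos)

text \<open>Up to a power of the variable, \<open>B\<close> has a convergent inverse.\<close>

lemma convergent1_cofactor:
  assumes "convergent1 (B * C)" "convergent1 B" "B \<noteq> 0"
  shows "convergent1 C"
proof -
  define n where "n = subdegree B"
  define E where "E = fps_shift n B"
  have B: "B = E * fps_X ^ n" and E: "fps_nth E 0 \<noteq> 0" "convergent1 E"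
    using assms by (simp_all add: E_def n_def flip: subdegree_decompose)
  have "B * C = (E * C) * fps_X ^ n" by (simp add: B mult_ac)
  hence "E * C = fps_shift n (B * C)"
    by (simp only: fps_shift_times_fps_X_power')
  hence "convergent1 (E * C)" using assms by simp
  hence "convergent1 (inverse E * (E * C))" using E by blast
  also have "inverse E * (E * C) = C"
    using E inverse_mult_eq_1[of E] by (simp add: mult.assoc[symmetric])
  finally show ?thesis .
qed

lemma convergent1_quotient:
  assumes "convergent1 y" "\<And>n. n < subdegree G + e \<Longrightarrow> fps_nth y n = 0" "G \<noteq> 0" "convergent1 G"
  shows "\<exists>x. convergent1 x \<and> y = G * x \<and> (\<forall>n<e. fps_nth x n = 0)"
proof (cases "y = 0")
  case True thus ?thesis by (intro exI[of _ 0]) auto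
next
  case False
  hence sd: "subdegree G + e \<le> subdegree y" using assms by (intro subdegree_geI) auto
  hence "G dvd y" using assms False by (simp add: fps_dvd_iff)
  then obtain x where x: "y = G * x" ..
  hence "convergent1 x" using assms convergent1_cofactor[of G x] by auto
  moreover have "fps_nth x n = 0" if "n < e" for n
    using sd x that False by (intro nth_less_subdegree_zero) (auto simp: subdegree_mult)
  ultimately show ?thesis using x by blast
qed

lemma convergent2_fps_const:
  assumes "convergent1 A"
  shows "convergent2 (fps_const A)"
proof -
  from assms obtain \<rho> where \<rho>: "\<rho> > 0" "(\<lambda>n. norm (fps_nth A n) * \<rho> ^ n) summable_on UNIV"
    by (auto simp: convergent1_iff)
  have "(\<lambda>n. norm (fps_nth A n) * \<rho> ^ n) = (\<lambda>(i, j). norm (coeff2 (fps_const A) i j) * \<rho> ^ (i + j)) \<circ> (\<lambda>n. (n, 0))"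
    by (auto simp: coeff2_def)
  with \<rho>(2) have "(\<lambda>(i, j). norm (coeff2 (fps_const A) i j) * \<rho> ^ (i + j)) summable_on (range (\<lambda>n. (n, 0)))"
    by (subst summable_on_reindex) (auto simp: inj_on_def)
  also have "?this \<longleftrightarrow> abs_conv2 \<rho> (fps_const A)" unfolding abs_conv2_def
    by (rule summable_on_cong_neutral) (auto simp: coeff2_def split: if_splits)
  finally show ?thesis using \<rho> by (auto simp: convergent2_iff)
qed

lemma convergent1_fps_nth:
  assumes "convergent2 F"
  shows "convergent1 (fps_nth F j)"
proof -
  from assms obtain \<rho> where \<rho>: "\<rho> > 0" "(\<lambda>(i, j). norm (coeff2 F i j) * \<rho> ^ (i + j)) summable_on UNIV"
    by (auto simp: convergent2_iff abs_conv2_def)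
  have "(\<lambda>(j, i). norm (coeff2 F i j) * \<rho> ^ (i + j)) summable_on UNIV \<times> UNIV"
    using \<rho>(2) by (subst summable_on_swap) simp
  hence "(\<lambda>i. norm (coeff2 F i j) * \<rho> ^ (i + j)) summable_on UNIV"
    by (rule summable_on_SigmaD1) auto
  hence "(\<lambda>i. norm (coeff2 F i j) * \<rho> ^ (i + j) * inverse (\<rho> ^ j)) summable_on UNIV"
    by (rule summable_on_cmult_left)
  thus ?thesis using \<rho>(1) unfolding convergent1_iff
    by (intro exI[of _ \<rho>]) (simp add: coeff2_def power_add mult.assoc)
qed

lemma expansion2_slice:
  assumes "expansion2 h H"
  shows "(\<lambda>u. h (u, 0)) has_fps_expansion fps_nth H 0"
proof (rule has_fps_expansionI)
  from assms obtain \<rho> where \<rho>: "\<rho> > 0" "abs_conv2 \<rho> H" by (rule expansion2E)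
  have lim: "filterlim (\<lambda>u::complex. (u, 0::complex)) (nhds 0) (nhds 0)"
    unfolding zero_prod_def by (intro tendsto_Pair tendsto_const filterlim_ident)
  have "\<forall>\<^sub>F u in nhds (0::complex). norm u \<le> \<rho> \<and> h (u, 0) = eval2 H (u, 0)"
    using assms eventually_polydisc[OF \<rho>(1)] lim
    unfolding expansion2_def filterlim_iff eventually_conj_iff by fastforce
  thus "\<forall>\<^sub>F u in nhds 0. (\<lambda>n. fps_nth (fps_nth H 0) n * u ^ n) sums h (u, 0)"
  proof eventually_elim
    case (elim u)
    have "((\<lambda>(i, j). coeff2 H i j * fst (u, 0::complex) ^ i * snd (u, 0) ^ j) has_sum eval2 H (u, 0)) UNIV"
      using has_sum_eval2[OF \<rho>(2), of "(u, 0)"] elim \<rho> by simp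
    also have "?this \<longleftrightarrow> ((\<lambda>(i, j). coeff2 H i j * u ^ i * 0 ^ j) has_sum eval2 H (u, 0)) (range (\<lambda>n. (n, 0)))"
      by (rule has_sum_cong_neutral) (auto split: if_splits)
    also have "\<dots> \<longleftrightarrow> ((\<lambda>(i, j). coeff2 H i j * u ^ i * 0 ^ j) \<circ> (\<lambda>n. (n, 0)) has_sum eval2 H (u, 0)) UNIV"
      by (rule has_sum_reindex) (auto simp: inj_on_def)
    finally have "((\<lambda>n. fps_nth (fps_nth H 0) n * u ^ n) has_sum h (u, 0)) UNIV"
      using elim by (simp add: o_def coeff2_def)
    thus ?case by (rule has_sum_imp_sums)
  qed
qed

lemma has_fps_expansion_unique:
  assumes "f has_fps_expansion A" "f has_fps_expansion (B :: complex fps)"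
  shows "A = B"
proof (rule eval_fps_eqD)
  show "fps_conv_radius A > 0" "fps_conv_radius B > 0"
    using assms by (auto simp: has_fps_expansion_def)
  from assms have "\<forall>\<^sub>F z in nhds 0. eval_fps A z = f z" "\<forall>\<^sub>F z in nhds 0. eval_fps B z = f z"
    by (auto simp: has_fps_expansion_def)
  thus "\<forall>\<^sub>F z in nhds 0. eval_fps A z = eval_fps B z" by eventually_elim simp
qed

lemma expansion2_fst_comp:
  assumes "a has_fps_expansion A"
  shows "expansion2 (\<lambda>z. a (fst z)) (fps_const A)"
proof -
  have c: "convergent2 (fps_const A)"
    using assms by (intro convergent2_fps_const) (simp add: has_fps_expansion_def convergent1_def)
  then obtain \<rho> where \<rho>: "\<rho> > 0" "abs_conv2 \<rho> (fps_const A)" by (auto simp: convergent2_iff)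
  have indep: "eval2 (fps_const A) z = eval2 (fps_const A) (fst z, 0)" for z
    unfolding eval2_def by (rule infsum_cong) (auto simp: coeff2_def power_0_left)
  have "(\<lambda>u. eval2 (fps_const A) (u, 0)) has_fps_expansion A"
    using expansion2_slice[OF expansion2_eval2[OF c]] by simp
  hence "\<forall>\<^sub>F u in nhds 0. eval_fps A u = eval2 (fps_const A) (u, 0)"
    by (simp add: has_fps_expansion_def)
  moreover have "\<forall>\<^sub>F u in nhds 0. eval_fps A u = a u" using assms by (simp add: has_fps_expansion_def)
  ultimately have ev: "\<forall>\<^sub>F u in nhds 0. a u = eval2 (fps_const A) (u, 0)"
    by eventually_elim simp
  have lim: "filterlim fst (nhds 0) (nhds (0::C2))"
    using tendsto_fst[OF filterlim_ident, of "0::C2"] by simp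
  have "\<forall>\<^sub>F z in nhds (0::C2). a (fst z) = eval2 (fps_const A) (fst z, 0)"
    using eventually_compose_filterlim[OF ev lim] .
  with c show ?thesis unfolding expansion2_def by (simp add: indep[symmetric])
qed

lemma expansion2_fst: "expansion2 fst (fps_const fps_X)"
  using expansion2_fst_comp[OF has_fps_expansion_fps_X] .

lemma expansion2_snd: "expansion2 snd fps_X"
proof -
  have c: "coeff2 fps_X i j = (if i = 0 \<and> j = 1 then 1 else 0)" for i j
    by (simp add: coeff2_def)
  have "(\<lambda>(i, j). norm (coeff2 fps_X i j) * 1 ^ (i + j)) summable_on {(0,1)}" by simp
  also have "?this \<longleftrightarrow> abs_conv2 1 fps_X" unfolding abs_conv2_def
    by (rule summable_on_cong_neutral) (auto simp: c split: if_splits)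
  finally have "convergent2 fps_X" by (auto simp: convergent2_iff intro: exI[of _ 1])
  moreover have "eval2 fps_X z = snd z" for z
  proof -
    have "eval2 fps_X z = (\<Sum>\<^sub>\<infinity>(i, j)\<in>{(0,1)}. coeff2 fps_X i j * fst z ^ i * snd z ^ j)"
      unfolding eval2_def by (rule infsum_cong_neutral) (auto simp: c split: if_splits)
    thus ?thesis by (simp add: c)
  qed
  ultimately show ?thesis by (simp add: expansion2_def)
qed

lemma expansion2_minus:
  assumes "expansion2 f F" "expansion2 g G"
  shows "expansion2 (\<lambda>z. f z - g z) (F - G)"
proof -
  have "expansion2 (\<lambda>z. f z + (- 1) * g z) (F + const2 (- 1) * G)"
    by (intro expansion2_add expansion2_mult expansion2_const assms)
  moreover have "const2 (- 1) * G = - G"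
    by (simp add: const2_def fps_const_neg[symmetric] del: fps_const_neg)
  ultimately show ?thesis by simp
qed

lemma convergent2_diff: "convergent2 F \<Longrightarrow> convergent2 G \<Longrightarrow> convergent2 (F - G)"
  using convergent2_add[of F "- G"] by (simp add: convergent2_uminus)

lemma convergent2_0 [simp]: "convergent2 0" and convergent2_1 [simp]: "convergent2 1"
  using convergent2_const2[of 0] convergent2_const2[of 1] by (simp_all add: const2_0 const2_1)

lemma convergent2_X [simp]: "convergent2 fps_X"
  using expansion2_snd by (simp add: expansion2_def)

subsection \<open>Linear and antilinear substitutions\<close>

lemma clinear_map_coords:
  assumes "clinear_map L"
  shows "L z = cscale (fst z) (L (1, 0)) + cscale (snd z) (L (0, 1))"
proof -
  interpret Vector_Spaces.linear cscale cscale L by fact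
  have "z = cscale (fst z) (1, 0) + cscale (snd z) (0, 1)"
    by (simp add: cscale_def)
  hence "L z = L (cscale (fst z) (1, 0) + cscale (snd z) (0, 1))" by simp
  thus ?thesis by (simp only: add scale)
qed

lemma expansion2_linear_form:
  "\<exists>A. expansion2 (\<lambda>z. fst z * a + snd z * b) A \<and> coeff2 A 0 0 = 0"
proof (intro exI conjI)
  show "expansion2 (\<lambda>z. fst z * a + snd z * b) (fps_const fps_X * const2 a + fps_X * const2 b)"
    by (intro expansion2_add expansion2_mult expansion2_const expansion2_fst expansion2_snd)
  show "coeff2 (fps_const fps_X * const2 a + fps_X * const2 b) 0 0 = 0"
    by (simp add: coeff2_def const2_def)
qed

lemma expansion2_clinear:
  assumes "clinear_map L" "expansion2 f F"
  shows "\<exists>H. expansion2 (\<lambda>z. f (L z)) H"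
proof -
  obtain A where A: "expansion2 (\<lambda>z. fst z * fst (L (1, 0)) + snd z * fst (L (0, 1))) A" "coeff2 A 0 0 = 0"
    using expansion2_linear_form by blast
  obtain B where B: "expansion2 (\<lambda>z. fst z * snd (L (1, 0)) + snd z * snd (L (0, 1))) B" "coeff2 B 0 0 = 0"
    using expansion2_linear_form by blast
  have "L z = (fst z * fst (L (1, 0)) + snd z * fst (L (0, 1)), fst z * snd (L (1, 0)) + snd z * snd (L (0, 1)))" for z
    using clinear_map_coords[OF assms(1), of z] by (simp add: cscale_def)
  hence *: "(\<lambda>z. f (L z)) = (\<lambda>z. f (fst z * fst (L (1, 0)) + snd z * fst (L (0, 1)), fst z * snd (L (1, 0)) + snd z * snd (L (0, 1))))"
    by (intro ext) (rule arg_cong[where f = f])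
  show ?thesis
    unfolding * by (rule expansion2_compose[OF assms(2) A(1) B(1) A(2) B(2)])
qed

definition conj2 :: "C2 \<Rightarrow> C2" where
  "conj2 z = (cnj (fst z), cnj (snd z))"

lemma conj2_conj2 [simp]: "conj2 (conj2 z) = z"
  by (simp add: conj2_def)

lemma filterlim_conj2: "filterlim conj2 (nhds 0) (nhds 0)"
proof -
  have "((\<lambda>z. (cnj (fst z), cnj (snd z))) \<longlongrightarrow> (cnj (fst (0::C2)), cnj (snd (0::C2)))) (nhds 0)"
    by (intro tendsto_Pair tendsto_cnj tendsto_fst[OF filterlim_ident] tendsto_snd[OF filterlim_ident])
  thus ?thesis by (simp add: conj2_def[abs_def] zero_prod_def)
qed

lemma expansion2_cnj:
  assumes "expansion2 f F"
  shows "\<exists>H. expansion2 (\<lambda>z. cnj (f (conj2 z))) H"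
proof -
  define H where "H = Abs_fps (\<lambda>j. Abs_fps (\<lambda>i. cnj (coeff2 F i j)))"
  have c: "coeff2 H i j = cnj (coeff2 F i j)" for i j
    unfolding H_def by (rule coeff2_Abs)
  have ev: "eval2 H z = cnj (eval2 F (conj2 z))" for z
    unfolding eval2_def infsum_cnj[symmetric]
    by (rule infsum_cong) (auto simp: c conj2_def)
  have "convergent2 H" using assms by (simp add: expansion2_def convergent2_def c)
  moreover have "\<forall>\<^sub>F z in nhds 0. f (conj2 z) = eval2 F (conj2 z)"
    using assms filterlim_conj2 by (auto simp: expansion2_def filterlim_iff)
  ultimately show ?thesis
    by (intro exI[of _ H]) (auto simp: expansion2_def ev)
qed

subsection \<open>Pullback along a parametrized arc\<close>

definition analytic_arc :: "(complex \<Rightarrow> C2) \<Rightarrow> bool" where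
  "analytic_arc \<gamma> \<longleftrightarrow> (\<exists>A B. (\<lambda>u. fst (\<gamma> u)) has_fps_expansion A \<and> fps_nth A 0 = 0 \<and>
     (\<lambda>u. snd (\<gamma> u)) has_fps_expansion B \<and> fps_nth B 0 = 0)"

text \<open>For an analytic arc \<open>\<gamma>\<close> the expansion at \<open>0\<close> of \<open>F \<circ> \<gamma>\<close> exists and is unique, see
  \<open>pullback_expansion\<close>.\<close>

definition pullback :: "(complex \<Rightarrow> C2) \<Rightarrow> complex fps fps \<Rightarrow> complex fps" where
  "pullback \<gamma> F = (SOME P. (\<lambda>u. eval2 F (\<gamma> u)) has_fps_expansion P)"

lemma has_fps_expansion_compose2:
  assumes "analytic_arc \<gamma>" "expansion2 f F"
  shows "\<exists>P. (\<lambda>u. f (\<gamma> u)) has_fps_expansion P"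
proof -
  from assms(1) obtain A B where A: "(\<lambda>u. fst (\<gamma> u)) has_fps_expansion A" "fps_nth A 0 = 0"
    and B: "(\<lambda>u. snd (\<gamma> u)) has_fps_expansion B" "fps_nth B 0 = 0"
    unfolding analytic_arc_def by blast
  have "\<exists>H. expansion2 (\<lambda>z. f (fst (\<gamma> (fst z)), snd (\<gamma> (fst z)))) H"
    by (rule expansion2_compose[OF assms(2) expansion2_fst_comp[OF A(1)] expansion2_fst_comp[OF B(1)]])
       (simp_all add: coeff2_def A B)
  then obtain H where "expansion2 (\<lambda>z. f (\<gamma> (fst z))) H" by auto
  from expansion2_slice[OF this] show ?thesis by auto
qed

lemma analytic_arc_tendsto: "analytic_arc \<gamma> \<Longrightarrow> filterlim \<gamma> (nhds 0) (nhds 0)"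
proof -
  assume "analytic_arc \<gamma>"
  then obtain A B where A: "(\<lambda>u. fst (\<gamma> u)) has_fps_expansion A" "fps_nth A 0 = 0"
    and B: "(\<lambda>u. snd (\<gamma> u)) has_fps_expansion B" "fps_nth B 0 = 0"
    unfolding analytic_arc_def by blast
  have *: "(a \<longlongrightarrow> 0) (nhds 0)" if "a has_fps_expansion C" "fps_nth C 0 = 0" for a :: "complex \<Rightarrow> complex" and C
  proof -
    have "a 0 = 0"
      using that by (auto simp: has_fps_expansion_def eval_fps_at_0 dest: eventually_nhds_x_imp_x)
    moreover have "isCont a 0" using has_fps_expansion_imp_continuous[OF that(1), of UNIV] by simp
    ultimately show ?thesis using tendsto_at_iff_tendsto_nhds[of a 0] by (simp add: isCont_def)
  qed
  have "((\<lambda>u. (fst (\<gamma> u), snd (\<gamma> u))) \<longlongrightarrow> (0, 0)) (nhds 0)"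
    by (intro tendsto_Pair *[OF A] *[OF B])
  thus ?thesis by (simp add: zero_prod_def)
qed

lemma pullback_expansion:
  assumes "analytic_arc \<gamma>" "expansion2 f F"
  shows "(\<lambda>u. f (\<gamma> u)) has_fps_expansion pullback \<gamma> F"
proof -
  have "convergent2 F" using assms by (simp add: expansion2_def)
  hence "\<exists>P. (\<lambda>u. eval2 F (\<gamma> u)) has_fps_expansion P"
    by (rule has_fps_expansion_compose2[OF assms(1) expansion2_eval2])
  hence "(\<lambda>u. eval2 F (\<gamma> u)) has_fps_expansion pullback \<gamma> F"
    unfolding pullback_def by (rule someI_ex)
  moreover have "\<forall>\<^sub>F u in nhds 0. f (\<gamma> u) = eval2 F (\<gamma> u)"
    using assms(2) analytic_arc_tendsto[OF assms(1)] by (auto simp: expansion2_def filterlim_iff)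
  ultimately show ?thesis
    unfolding has_fps_expansion_def by (auto elim: eventually_elim2)
qed

lemma pullback_eqI:
  assumes "analytic_arc \<gamma>" "expansion2 f F" "(\<lambda>u. f (\<gamma> u)) has_fps_expansion P"
  shows "pullback \<gamma> F = P"
  using has_fps_expansion_unique[OF pullback_expansion[OF assms(1,2)] assms(3)] .

context
  fixes \<gamma> assumes arc: "analytic_arc \<gamma>"
begin

lemma pullback_eval2: "convergent2 F \<Longrightarrow> (\<lambda>u. eval2 F (\<gamma> u)) has_fps_expansion pullback \<gamma> F"
  by (rule pullback_expansion[OF arc expansion2_eval2])

lemma convergent1_pullback: "convergent2 F \<Longrightarrow> convergent1 (pullback \<gamma> F)"
  using pullback_eval2[of F]
  by (simp add: has_fps_expansion_def convergent1_def)

lemma pullback_add: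
  "convergent2 F \<Longrightarrow> convergent2 G \<Longrightarrow> pullback \<gamma> (F + G) = pullback \<gamma> F + pullback \<gamma> G"
  by (rule pullback_eqI[OF arc expansion2_add[OF expansion2_eval2 expansion2_eval2]])
     (auto intro!: has_fps_expansion_add pullback_eval2)

lemma pullback_diff:
  "convergent2 F \<Longrightarrow> convergent2 G \<Longrightarrow> pullback \<gamma> (F - G) = pullback \<gamma> F - pullback \<gamma> G"
  by (rule pullback_eqI[OF arc expansion2_minus[OF expansion2_eval2 expansion2_eval2]])
     (auto intro!: has_fps_expansion_diff pullback_eval2)

lemma pullback_mult:
  "convergent2 F \<Longrightarrow> convergent2 G \<Longrightarrow> pullback \<gamma> (F * G) = pullback \<gamma> F * pullback \<gamma> G"
  by (rule pullback_eqI[OF arc expansion2_mult[OF expansion2_eval2 expansion2_eval2]])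
     (auto intro!: has_fps_expansion_mult pullback_eval2)

lemma pullback_const2: "pullback \<gamma> (const2 c) = fps_const c"
  by (rule pullback_eqI[OF arc expansion2_const]) auto

end

subsection \<open>The local ring\<close>

lemma local_ring_simps [simp]:
  "carrier local_ring = {F. convergent2 F}" "x \<otimes>\<^bsub>local_ring\<^esub> y = x * y"
  "x \<oplus>\<^bsub>local_ring\<^esub> y = x + y" "\<one>\<^bsub>local_ring\<^esub> = 1" "\<zero>\<^bsub>local_ring\<^esub> = 0"
  by (simp_all add: local_ring_def)

lemma domain_local_ring: "domain local_ring"
proof -
  have "cring local_ring"
  proof (rule cringI)
    show "abelian_group local_ring"
    proof (rule abelian_groupI)
      fix x assume "x \<in> carrier local_ring"
      thus "\<exists>y\<in>carrier local_ring. y \<oplus>\<^bsub>local_ring\<^esub> x = \<zero>\<^bsub>local_ring\<^esub>"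
        by (intro bexI[of _ "- x"]) (auto simp: convergent2_uminus)
    qed (auto simp: convergent2_add)
    show "comm_monoid local_ring"
      by (rule comm_monoidI) (auto simp: convergent2_mult mult_ac)
  qed (auto simp: ring_distribs)
  thus ?thesis
    by (intro domain.intro domain_axioms.intro) auto
qed

interpretation local_ring: domain local_ring
  by (rule domain_local_ring)

lemma local_ring_a_inv: "convergent2 F \<Longrightarrow> \<ominus>\<^bsub>local_ring\<^esub> F = - F"
  by (rule local_ring.minus_equality) (auto simp: convergent2_uminus)

lemma PIdl_local_ring: "PIdl\<^bsub>local_ring\<^esub> f = {a * f | a. convergent2 a}"
  by (auto simp: cgenideal_def)

(* coeff and monom refer to the type poly *)
hide_const (open) up_ring.coeff up_ring.monom module.smult

section \<open>The ring of a parametrized branch\<close>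

text \<open>The series \<open>A(z u)\<close>.\<close>

definition twist :: "complex \<Rightarrow> complex fps \<Rightarrow> complex fps" where
  "twist z A = Abs_fps (\<lambda>n. z ^ n * fps_nth A n)"

lemma twist_nth [simp]: "fps_nth (twist z A) n = z ^ n * fps_nth A n"
  by (simp add: twist_def)

lemma twist_simps [simp]:
  "twist z (A + B) = twist z A + twist z B" "twist z (A - B) = twist z A - twist z B"
  "twist z (- A) = - twist z A" "twist z 0 = 0" "twist z 1 = 1"
  "twist z (fps_const c) = fps_const c" "twist 1 A = A" "twist z (twist w A) = twist (z * w) A"
  by (auto simp: fps_eq_iff algebra_simps power_mult_distrib)

lemma twist_mult [simp]: "twist z (A * B) = twist z A * twist z B"
proof (rule fps_ext)
  fix n
  have "fps_nth (twist z (A * B)) n = (\<Sum>i=0..n. z ^ n * (fps_nth A i * fps_nth B (n - i)))"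
    by (simp add: fps_mult_nth sum_distrib_left)
  also have "\<dots> = (\<Sum>i=0..n. z ^ i * fps_nth A i * (z ^ (n - i) * fps_nth B (n - i)))"
  proof (rule sum.cong[OF refl])
    fix i assume "i \<in> {0..n}"
    hence "z ^ n = z ^ i * z ^ (n - i)" by (simp flip: power_add)
    thus "z ^ n * (fps_nth A i * fps_nth B (n - i)) = z ^ i * fps_nth A i * (z ^ (n - i) * fps_nth B (n - i))"
      by simp
  qed
  finally show "fps_nth (twist z (A * B)) n = fps_nth (twist z A * twist z B) n"
    by (simp add: fps_mult_nth)
qed

lemma twist_sum: "twist z (\<Sum>i\<in>I. f i) = (\<Sum>i\<in>I. twist z (f i))"
  by (induction I rule: infinite_finite_induct) auto

lemma twist_prod: "twist z (\<Prod>i\<in>I. f i) = (\<Prod>i\<in>I. twist z (f i))"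
  by (induction I rule: infinite_finite_induct) auto

lemma twist_power: "twist z (A ^ n) = twist z A ^ n"
  by (induction n) auto

lemma twist_X_power: "twist z (fps_X ^ n) = fps_const (z ^ n) * fps_X ^ n"
  by (auto simp: fps_eq_iff)

lemma convergent1_twist: "norm z = 1 \<Longrightarrow> convergent1 A \<Longrightarrow> convergent1 (twist z A)"
  by (simp add: convergent1_iff norm_mult norm_power)

lemma eval_fps_twist: "eval_fps (twist z A) u = eval_fps A (z * u)"
  by (simp add: eval_fps_def power_mult_distrib mult_ac)

lemma coeff_linear_times:
  "coeff ([:- a, 1:] * p) i = (case i of 0 \<Rightarrow> 0 | Suc j \<Rightarrow> coeff p j) - a * coeff p i"
  for p :: "'a::comm_ring_1 poly"
  by (cases i) auto

lemma coeff_prod_twist: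
  "coeff (\<Prod>l\<in>S. [:- twist z (f l), 1:]) i = twist z (coeff (\<Prod>l\<in>S. [:- f l, 1:]) i)"
proof (induction S arbitrary: i rule: infinite_finite_induct)
  case (insert l S)
  have "coeff (\<Prod>l\<in>insert l S. [:- twist z (f l), 1:]) i =
      coeff ([:- twist z (f l), 1:] * (\<Prod>l\<in>S. [:- twist z (f l), 1:])) i"
    using insert by simp
  also have "\<dots> = twist z (coeff ([:- f l, 1:] * (\<Prod>l\<in>S. [:- f l, 1:])) i)"
    unfolding coeff_linear_times by (simp add: insert.IH split: nat.split)
  finally show ?case using insert by simp
qed auto

lemma convergent1_coeff_prod:
  assumes "\<And>l. l \<in> S \<Longrightarrow> convergent1 (f l)"
  shows "convergent1 (coeff (\<Prod>l\<in>S. [:- f l, 1:]) i)"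
  using assms
proof (induction S arbitrary: i rule: infinite_finite_induct)
  case (insert l S)
  have "convergent1 (coeff ([:- f l, 1:] * (\<Prod>l\<in>S. [:- f l, 1:])) i)"
    unfolding coeff_linear_times using insert by (auto split: nat.split)
  thus ?case using insert by simp
qed auto

abbreviation (input) fscale :: "complex \<Rightarrow> complex fps \<Rightarrow> complex fps" where
  "fscale c A \<equiv> fps_const c * A"

lemma vector_space_fscale: "vector_space fscale"
  by unfold_locales
     (simp_all add: algebra_simps mult.assoc[symmetric] fps_const_add[symmetric] del: fps_const_add)

lemma fps_nth_prod_eq_0:
  fixes A B :: "complex fps"
  assumes "\<And>i. i < k \<Longrightarrow> fps_nth A i = 0" "n < k"
  shows "fps_nth (A * B) n = 0"
  unfolding fps_mult_nth by (rule sum.neutral) (use assms in auto)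

lemma codim_fps_truncation:
  "codim fscale {A. convergent1 A} {A. convergent1 A \<and> (\<forall>n<c. fps_nth A n = 0)} c"
  unfolding codim_def qbasis_def
proof (intro exI[of _ "\<lambda>i. fps_X ^ i"] conjI allI ballI impI)
  have nth: "fps_nth (\<Sum>i<c. fps_const (a i) * fps_X ^ i) n = (if n < c then a n else 0)" for n a
  proof -
    have "fps_nth (\<Sum>i<c. fps_const (a i) * fps_X ^ i) n = (\<Sum>i<c. if i = n then a i else 0)"
      unfolding fps_sum_nth by (rule sum.cong) auto
    thus ?thesis by simp
  qed
  show "\<exists>a. x - (\<Sum>i<c. fps_const (a i) * fps_X ^ i) \<in> {A. convergent1 A \<and> (\<forall>n<c. fps_nth A n = 0)}"
    if "x \<in> {A. convergent1 A}" for x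
    by (rule exI[of _ "fps_nth x"]) (use that in \<open>auto simp: nth\<close>)
  show "a i = 0" if "(\<Sum>i<c. fps_const (a i) * fps_X ^ i) \<in> {A. convergent1 A \<and> (\<forall>n<c. fps_nth A n = 0)}" "i < c" for a i
    using that nth[of a i] by simp
qed auto

lemma cis_root_power_eq_1:
  assumes "m > 0"
  shows "cis (2 * pi / real m) ^ n = 1 \<longleftrightarrow> m dvd n"
proof -
  have "cis (2 * pi / real m) ^ n = cis (real n * (2 * pi / real m))" by (rule Complex.DeMoivre)
  also have "\<dots> = exp (\<i> * of_real (real n * (2 * pi / real m)))" by (rule cis_conv_exp)
  also have "\<i> * of_real (real n * (2 * pi / real m)) = 2 * of_real pi * \<i> * of_nat n / of_nat m"
    by simp
  finally show ?thesis using complex_root_unity_eq_1[of m n] assms by simp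
qed

text \<open>The arc \<open>u \<mapsto> (u^m, \<phi>(u))\<close> is tangent to the first axis, and it is injective near \<open>0\<close> exactly if
  the conjugates \<open>\<phi>(\<omega>^k u)\<close> for \<open>k < m\<close> are distinct.\<close>

locale puiseux =
  fixes m :: nat and \<phi> :: "complex fps" and \<omega> :: complex
  assumes m: "m > 0" and \<omega>: "\<omega> = cis (2 * pi / real m)"
    and conv: "convergent1 \<phi>" and ord: "\<And>n. n \<le> m \<Longrightarrow> fps_nth \<phi> n = 0"
    and distinct: "\<And>k. 0 < k \<Longrightarrow> k < m \<Longrightarrow> twist (\<omega> ^ k) \<phi> \<noteq> \<phi>"
begin

lemma norm_\<omega> [simp]: "norm \<omega> = 1" and \<omega>_neq_0 [simp]: "\<omega> \<noteq> 0"
  by (auto simp: \<omega>)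

lemma \<omega>_power_eq_1: "\<omega> ^ n = 1 \<longleftrightarrow> m dvd n"
  unfolding \<omega> by (rule cis_root_power_eq_1[OF m])

lemma \<omega>_power_m [simp]: "\<omega> ^ m = 1"
  by (simp add: \<omega>_power_eq_1)

lemma \<omega>_power_mod: "\<omega> ^ (n mod m) = \<omega> ^ n"
proof -
  have "\<omega> ^ n = \<omega> ^ (m * (n div m) + n mod m)" by simp
  also have "\<dots> = \<omega> ^ (n mod m)" unfolding power_add power_mult by simp
  finally show ?thesis ..
qed

text \<open>The convergent series in \<open>u^m\<close>.\<close>

definition base :: "complex fps set" where
  "base = {A. convergent1 A \<and> twist \<omega> A = A}"

lemma base_iff: "A \<in> base \<longleftrightarrow> convergent1 A \<and> (\<forall>n. \<not> m dvd n \<longrightarrow> fps_nth A n = 0)"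
proof -
  have "twist \<omega> A = A \<longleftrightarrow> (\<forall>n. \<omega> ^ n * fps_nth A n = fps_nth A n)"
    by (simp add: fps_eq_iff)
  also have "\<dots> \<longleftrightarrow> (\<forall>n. \<not> m dvd n \<longrightarrow> fps_nth A n = 0)"
    by (intro all_cong1) (use \<omega>_power_eq_1 in auto)
  finally show ?thesis by (simp add: base_def)
qed

lemma base_convergent: "A \<in> base \<Longrightarrow> convergent1 A"
  by (simp add: base_def)

lemma base_intros [intro]:
  "0 \<in> base" "1 \<in> base" "fps_const c \<in> base" "A \<in> base \<Longrightarrow> - A \<in> base"
  "A \<in> base \<Longrightarrow> B \<in> base \<Longrightarrow> A + B \<in> base" "A \<in> base \<Longrightarrow> B \<in> base \<Longrightarrow> A - B \<in> base"
  "A \<in> base \<Longrightarrow> B \<in> base \<Longrightarrow> A * B \<in> base"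
  by (auto simp: base_def)

lemma base_X [intro]: "m dvd n \<Longrightarrow> fps_X ^ n \<in> base"
  by (auto simp: base_def twist_X_power \<omega>_power_eq_1)

lemma base_sum [intro]: "(\<And>i. i \<in> I \<Longrightarrow> f i \<in> base) \<Longrightarrow> (\<Sum>i\<in>I. f i) \<in> base"
  by (induction I rule: infinite_finite_induct) auto

lemma twist_base: "A \<in> base \<Longrightarrow> twist (\<omega> ^ k) A = A"
proof (induction k)
  case (Suc k)
  have "twist (\<omega> ^ Suc k) A = twist \<omega> (twist (\<omega> ^ k) A)" by simp
  also have "\<dots> = A" using Suc by (simp add: base_def)
  finally show ?case .
qed simp

definition cj :: "nat \<Rightarrow> complex fps" where
  "cj k = twist (\<omega> ^ k) \<phi>"

lemma cj_0: "cj 0 = \<phi>" by (simp add: cj_def)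

lemma twist_cj: "twist (\<omega> ^ k) (cj l) = cj (l + k)"
  by (simp add: cj_def power_add mult.commute)

lemma cj_mod: "cj (k mod m) = cj k"
  by (simp add: cj_def \<omega>_power_mod)

lemma convergent1_cj: "convergent1 (cj k)"
  unfolding cj_def by (rule convergent1_twist) (simp_all add: norm_power conv)

lemma inj_cj: "inj_on cj {..<m}"
proof (rule linorder_inj_onI)
  fix i j assume "i < j" and ij: "i \<in> {..<m}" "j \<in> {..<m}"
  show "cj i \<noteq> cj j"
  proof
    assume "cj i = cj j"
    hence "twist (\<omega> ^ (m - i)) (cj i) = twist (\<omega> ^ (m - i)) (cj j)" by simp
    hence "cj (i + (m - i)) = cj (j + (m - i))" by (simp only: twist_cj)
    moreover have "i + (m - i) = m" "j + (m - i) = m + (j - i)" using ij \<open>i < j\<close> by auto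
    ultimately have "cj m = cj (m + (j - i))" by (simp only:)
    hence "\<phi> = cj (j - i)" using cj_mod[of m] cj_mod[of "m + (j - i)"] cj_mod[of "j - i"]
      by (simp add: cj_0)
    moreover have "j - i < m" using ij by auto
    ultimately show False using distinct[of "j - i"] \<open>i < j\<close> by (auto simp: cj_def)
  qed
qed auto

lemma cj_neq: "0 < l \<Longrightarrow> l < m \<Longrightarrow> \<phi> \<noteq> cj l"
  using distinct[of l] by (auto simp: cj_def)

lemma bij_rotate: "bij_betw (\<lambda>l. (l + k) mod m) {..<m} {..<m}"
proof -
  have "inj_on (\<lambda>l. (l + k) mod m) {..<m}"
  proof (rule linorder_inj_onI)
    fix i j assume ij: "i < j" "i \<in> {..<m}" "j \<in> {..<m}"
    show "(i + k) mod m \<noteq> (j + k) mod m"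
    proof
      assume "(i + k) mod m = (j + k) mod m"
      hence "m dvd (j + k) - (i + k)" using ij by (subst mod_eq_dvd_iff_nat[symmetric]) auto
      moreover have "j - i < m" using ij by auto
      ultimately show False using ij nat_dvd_not_less[of "j - i" m] by simp
    qed
  qed auto
  moreover have "(\<lambda>l. (l + k) mod m) ` {..<m} \<subseteq> {..<m}" using m by auto
  ultimately show ?thesis unfolding bij_betw_def by (simp add: endo_inj_surj)
qed

lemma bij_rotate_remove:
  assumes "k < m"
  shows "bij_betw (\<lambda>l. (l + k) mod m) ({..<m} - {0}) ({..<m} - {k})"
proof -
  have "(\<lambda>l. (l + k) mod m) ` ({..<m} - {0}) = (\<lambda>l. (l + k) mod m) ` {..<m} - (\<lambda>l. (l + k) mod m) ` {0}"
    using bij_rotate[of k] m by (intro inj_on_image_set_diff[of _ "{..<m}"]) (auto simp: bij_betw_def)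
  thus ?thesis using bij_rotate[of k] assms
    by (auto simp: bij_betw_def intro: inj_on_subset)
qed

definition cofactor :: "nat \<Rightarrow> complex fps poly" where
  "cofactor k = (\<Prod>l\<in>{..<m} - {k}. [:- cj l, 1:])"

text \<open>The minimal polynomial of \<open>\<phi>\<close> over the series in \<open>u^m\<close>. The cofactors are its quotients by the
  linear factors.\<close>

definition minpoly :: "complex fps poly" where
  "minpoly = (\<Prod>l<m. [:- cj l, 1:])"

lemma coeff_cofactor: "k < m \<Longrightarrow> coeff (cofactor k) i = twist (\<omega> ^ k) (coeff (cofactor 0) i)"
proof -
  assume k: "k < m"
  have "cofactor k = (\<Prod>l\<in>{..<m} - {0}. [:- cj ((l + k) mod m), 1:])"
    unfolding cofactor_def by (rule prod.reindex_bij_betw[OF bij_rotate_remove[OF k], symmetric])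
  also have "\<dots> = (\<Prod>l\<in>{..<m} - {0}. [:- twist (\<omega> ^ k) (cj l), 1:])"
    by (simp add: cj_mod twist_cj)
  finally show ?thesis unfolding cofactor_def[of 0] by (simp only: coeff_prod_twist)
qed

lemma coeff_minpoly: "coeff minpoly i \<in> base"
proof -
  have "minpoly = (\<Prod>l<m. [:- cj ((l + 1) mod m), 1:])"
    unfolding minpoly_def by (rule prod.reindex_bij_betw[OF bij_rotate, symmetric])
  also have "\<dots> = (\<Prod>l<m. [:- twist (\<omega> ^ 1) (cj l), 1:])"
    by (simp only: cj_mod twist_cj)
  finally have "coeff minpoly i = coeff (\<Prod>l<m. [:- twist (\<omega> ^ 1) (cj l), 1:]) i" by simp
  also have "\<dots> = twist \<omega> (coeff minpoly i)"
    by (simp only: coeff_prod_twist minpoly_def power_one_right)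
  finally have "twist \<omega> (coeff minpoly i) = coeff minpoly i" ..
  moreover have "convergent1 (coeff minpoly i)"
    unfolding minpoly_def by (rule convergent1_coeff_prod) (rule convergent1_cj)
  ultimately show ?thesis by (simp add: base_def)
qed

lemma minpoly_split: "minpoly = [:- \<phi>, 1:] * cofactor 0"
  unfolding minpoly_def cofactor_def using m by (subst prod.remove[of _ 0]) (auto simp: cj_0)

lemma degree_minpoly: "degree minpoly = m" and lead_minpoly: "coeff minpoly m = 1"
proof -
  show *: "degree minpoly = m"
    unfolding minpoly_def by (subst degree_prod_eq_sum_degree) auto
  have "lead_coeff minpoly = 1" unfolding minpoly_def lead_coeff_prod by simp
  thus "coeff minpoly m = 1" by (simp add: *)
qed

lemma degree_cofactor: "k < m \<Longrightarrow> degree (cofactor k) = m - 1"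
  and lead_cofactor: "k < m \<Longrightarrow> coeff (cofactor k) (m - 1) = 1"
proof -
  assume k: "k < m"
  show *: "degree (cofactor k) = m - 1"
    unfolding cofactor_def using k by (subst degree_prod_eq_sum_degree) auto
  have "lead_coeff (cofactor k) = 1" unfolding cofactor_def lead_coeff_prod by simp
  thus "coeff (cofactor k) (m - 1) = 1" by (simp add: *)
qed

lemma poly_minpoly: "poly minpoly \<phi> = 0"
  by (simp add: minpoly_split)

text \<open>The restrictions to the branch of the convergent series in two variables, as
  \<open>range_pullback_arc0\<close> shows.\<close>

definition branch_ring :: "complex fps set" where
  "branch_ring = {\<Sum>i<m. c i * \<phi> ^ i | c. \<forall>i. c i \<in> base}"

lemma branch_ringI: "(\<And>i. i < m \<Longrightarrow> c i \<in> base) \<Longrightarrow> (\<Sum>i<m. c i * \<phi> ^ i) \<in> branch_ring"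
  unfolding branch_ring_def
  by (rule CollectI, rule exI[of _ "\<lambda>i. if i < m then c i else 0"]) auto

lemma branch_ringE:
  assumes "A \<in> branch_ring"
  obtains c where "A = (\<Sum>i<m. c i * \<phi> ^ i)" "\<And>i. c i \<in> base"
  using assms unfolding branch_ring_def by blast

lemma branch_ring_convergent: "A \<in> branch_ring \<Longrightarrow> convergent1 A"
  by (elim branch_ringE) (auto intro!: convergent1_sum convergent1_mult[OF base_convergent convergent1_power[OF conv]])

lemma branch_ring_base_mult: "a \<in> base \<Longrightarrow> B \<in> branch_ring \<Longrightarrow> a * B \<in> branch_ring"
proof (elim branch_ringE)
  fix c assume a: "a \<in> base" and B: "B = (\<Sum>i<m. c i * \<phi> ^ i)" and c: "\<And>i. c i \<in> base"
  have "a * B = (\<Sum>i<m. (a * c i) * \<phi> ^ i)" by (simp add: B sum_distrib_left mult.assoc)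
  thus "a * B \<in> branch_ring" using a c branch_ringI[of "\<lambda>i. a * c i"] by auto
qed

lemma branch_ring_add: "A \<in> branch_ring \<Longrightarrow> B \<in> branch_ring \<Longrightarrow> A + B \<in> branch_ring"
proof (elim branch_ringE)
  fix c e assume A: "A = (\<Sum>i<m. c i * \<phi> ^ i)" and c: "\<And>i. c i \<in> base"
    and B: "B = (\<Sum>i<m. e i * \<phi> ^ i)" and e: "\<And>i. e i \<in> base"
  have "A + B = (\<Sum>i<m. (c i + e i) * \<phi> ^ i)" by (simp add: A B sum.distrib ring_distribs)
  thus "A + B \<in> branch_ring" using c e branch_ringI[of "\<lambda>i. c i + e i"] by auto
qed

lemma branch_ring_0: "0 \<in> branch_ring"
  using branch_ringI[of "\<lambda>_. 0"] by auto

lemma branch_ring_sum: "(\<And>i. i \<in> I \<Longrightarrow> f i \<in> branch_ring) \<Longrightarrow> (\<Sum>i\<in>I. f i) \<in> branch_ring"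
  by (induction I rule: infinite_finite_induct) (auto intro: branch_ring_add branch_ring_0)

text \<open>Higher powers reduce to lower ones by the monic equation \<open>minpoly\<close>.\<close>

lemma branch_ring_power: "\<phi> ^ n \<in> branch_ring"
proof (induction n rule: less_induct)
  case (less n)
  show ?case
  proof (cases "n < m")
    case True
    have "(\<Sum>i<m. (if i = n then 1 else 0) * \<phi> ^ i) \<in> branch_ring"
      by (rule branch_ringI) auto
    also have "(\<Sum>i<m. (if i = n then 1 else 0) * \<phi> ^ i) = (\<Sum>i<m. if i = n then \<phi> ^ i else 0)"
      by (rule sum.cong) auto
    also have "\<dots> = \<phi> ^ n" using True by simp
    finally show ?thesis .
  next
    case False
    have "0 = (\<Sum>i\<le>m. coeff minpoly i * \<phi> ^ i)"
      using poly_minpoly by (simp add: poly_altdef degree_minpoly)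
    also have "\<dots> = (\<Sum>i<m. coeff minpoly i * \<phi> ^ i) + \<phi> ^ m"
      by (simp add: lessThan_Suc_atMost[symmetric] lead_minpoly)
    finally have "\<phi> ^ m = - (\<Sum>i<m. coeff minpoly i * \<phi> ^ i)" by (simp add: eq_neg_iff_add_eq_0 add.commute)
    hence "\<phi> ^ (n - m) * \<phi> ^ m = (\<Sum>i<m. (- coeff minpoly i) * \<phi> ^ (n - m + i))"
      by (simp add: sum_distrib_left sum_negf power_add mult_ac)
    moreover have "\<phi> ^ (n - m) * \<phi> ^ m = \<phi> ^ n" using False by (simp flip: power_add)
    ultimately have "\<phi> ^ n = (\<Sum>i<m. (- coeff minpoly i) * \<phi> ^ (n - m + i))" by simp
    also have "(\<Sum>i<m. (- coeff minpoly i) * \<phi> ^ (n - m + i)) \<in> branch_ring"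
    proof (rule branch_ring_sum)
      fix i assume "i \<in> {..<m}"
      with False show "(- coeff minpoly i) * \<phi> ^ (n - m + i) \<in> branch_ring"
        by (intro branch_ring_base_mult less base_intros(4) coeff_minpoly) auto
    qed
    finally show ?thesis .
  qed
qed

lemma branch_ring_mult:
  assumes "A \<in> branch_ring" "B \<in> branch_ring"
  shows "A * B \<in> branch_ring"
proof -
  from assms(1) obtain c where A: "A = (\<Sum>i<m. c i * \<phi> ^ i)" and c: "\<And>i. c i \<in> base"
    unfolding branch_ring_def by blast
  from assms(2) obtain e where B: "B = (\<Sum>i<m. e i * \<phi> ^ i)" and e: "\<And>i. e i \<in> base"
    unfolding branch_ring_def by blast
  have "A * B = (\<Sum>i<m. \<Sum>j<m. (c i * e j) * \<phi> ^ (i + j))"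
    unfolding A B sum_product by (simp add: power_add mult_ac)
  also have "\<dots> \<in> branch_ring"
    by (intro branch_ring_sum branch_ring_base_mult branch_ring_power base_intros c e)
  finally show ?thesis .
qed

lemma branch_ring_base: "a \<in> base \<Longrightarrow> a \<in> branch_ring"
  using branch_ring_base_mult[of a 1] branch_ring_power[of 0] by simp

lemma branch_ring_poly:
  assumes "\<And>i. coeff r i \<in> base"
  shows "poly r \<phi> \<in> branch_ring"
  unfolding poly_altdef by (intro branch_ring_sum branch_ring_base_mult branch_ring_power assms)

text \<open>Synthetic division of \<open>minpoly\<close> by \<open>X - \<phi>\<close> computes these coefficients from the leading one
  downwards.\<close>

lemma coeff_cofactor_in_ring: "coeff (cofactor 0) i \<in> branch_ring"
proof -
  have "coeff (cofactor 0) (m - j) \<in> branch_ring" for j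
  proof (induction j)
    case 0
    have "coeff (cofactor 0) m = 0" using degree_cofactor[of 0] m by (intro coeff_eq_0) auto
    thus ?case by (simp add: branch_ring_0)
  next
    case (Suc j)
    show ?case
    proof (cases "j < m")
      case True
      hence *: "m - j = Suc (m - Suc j)" by simp
      have "coeff minpoly (m - j) = coeff (cofactor 0) (m - Suc j) - \<phi> * coeff (cofactor 0) (m - j)"
        unfolding minpoly_split coeff_linear_times by (simp add: *)
      hence "coeff (cofactor 0) (m - Suc j) = coeff minpoly (m - j) + \<phi> * coeff (cofactor 0) (m - j)"
        by simp
      also have "\<dots> \<in> branch_ring"
        using branch_ring_add[OF branch_ring_base[OF coeff_minpoly] branch_ring_mult[OF branch_ring_power[of 1] Suc]]
        by simp
      finally show ?thesis .
    qed (use Suc in simp)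
  qed
  from this[of "m - i"] show ?thesis
  proof (cases "i \<le> m")
    case False
    hence "coeff (cofactor 0) i = 0" using degree_cofactor[of 0] m by (intro coeff_eq_0) auto
    thus ?thesis by (simp add: branch_ring_0)
  qed simp
qed

text \<open>The derivative of \<open>minpoly\<close> at \<open>\<phi>\<close>, factored as a unit \<open>dunit\<close> times the power \<open>dord\<close> of the
  variable.\<close>

definition different :: "complex fps" where
  "different = (\<Prod>l\<in>{..<m} - {0}. \<phi> - cj l)"

definition dord :: nat where "dord = subdegree different"

definition dunit :: "complex fps" where "dunit = fps_shift dord different"

lemma different_neq_0: "different \<noteq> 0"
  using cj_neq by (auto simp: different_def)

lemma convergent1_different: "convergent1 different"
  unfolding different_def by (intro convergent1_prod convergent1_diff conv convergent1_cj)

lemma different_decomp: "different = dunit * fps_X ^ dord"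
  unfolding dunit_def dord_def by (rule subdegree_decompose)

lemma dunit_0 [simp]: "fps_nth dunit 0 \<noteq> 0"
  using different_neq_0 by (simp add: dunit_def dord_def)

lemma convergent1_dunit: "convergent1 dunit" "convergent1 (inverse dunit)"
  using convergent1_different by (auto simp: dunit_def intro!: convergent1_inverse)
    (use dunit_0 in \<open>simp add: dunit_def\<close>)

lemma dunit_inverse: "inverse dunit * dunit = 1"
  by (rule inverse_mult_eq_1) simp

lemma dord_eq_sum: "dord = (\<Sum>l\<in>{..<m} - {0}. subdegree (\<phi> - cj l))"
  unfolding dord_def different_def by (rule subdegree_prod) (use cj_neq in auto)

lemma dord_ge: "m \<le> dord + 1"
proof -
  have "1 \<le> subdegree (\<phi> - cj l)" if "l \<in> {..<m} - {0}" for l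
  proof (rule subdegree_geI)
    show "\<phi> - cj l \<noteq> 0" using that cj_neq[of l] by auto
    show "fps_nth (\<phi> - cj l) i = 0" if "i < 1" for i using that ord[of 0] by (simp add: cj_def)
  qed
  hence "(\<Sum>l\<in>{..<m} - {0}. 1) \<le> dord" unfolding dord_eq_sum by (rule sum_mono)
  thus ?thesis using m by simp
qed

text \<open>The Lagrange interpolation polynomial of the conjugates of \<open>b\<close>, with the denominators
  \<open>different\<close> replaced by their unit parts; its coefficients are traces.\<close>

definition lagrange :: "complex fps \<Rightarrow> complex fps poly" where
  "lagrange b = (\<Sum>k<m. smult (fps_const (inverse (\<omega> ^ (k * dord))) * twist (\<omega> ^ k) (b * inverse dunit)) (cofactor k))"

lemma degree_lagrange: "degree (lagrange b) < m"
proof -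
  have "degree (lagrange b) \<le> m - 1" unfolding lagrange_def
    by (intro degree_sum_le) (auto intro!: order_trans[OF degree_smult_le] simp: degree_cofactor)
  thus ?thesis using m by simp
qed

lemma poly_cofactor_self: "j < m \<Longrightarrow> poly (cofactor j) (cj j) = twist (\<omega> ^ j) different"
proof -
  assume j: "j < m"
  have "poly (cofactor j) (cj j) = (\<Prod>l\<in>{..<m} - {j}. cj j - cj l)"
    by (simp add: cofactor_def poly_prod)
  also have "\<dots> = (\<Prod>l\<in>{..<m} - {0}. cj j - cj ((l + j) mod m))"
    by (rule prod.reindex_bij_betw[OF bij_rotate_remove[OF j], symmetric])
  also have "\<dots> = twist (\<omega> ^ j) different"
    by (simp add: different_def twist_prod twist_cj cj_mod) (simp add: cj_def)
  finally show ?thesis .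
qed

lemma poly_lagrange:
  assumes j: "j < m"
  shows "poly (lagrange b) (cj j) = fps_X ^ dord * twist (\<omega> ^ j) b"
proof -
  have other: "poly (cofactor k) (cj j) = 0" if "k \<noteq> j" for k
    using j that by (auto simp: cofactor_def poly_prod intro!: prod_zero bexI[of _ j])
  have "poly (lagrange b) (cj j) = (\<Sum>k<m. if k = j then
     fps_const (inverse (\<omega> ^ (k * dord))) * twist (\<omega> ^ k) (b * inverse dunit) * poly (cofactor k) (cj j) else 0)"
    unfolding lagrange_def poly_sum by (rule sum.cong) (auto simp: other)
  also have "\<dots> = fps_const (inverse (\<omega> ^ (j * dord))) * twist (\<omega> ^ j) (b * inverse dunit) * twist (\<omega> ^ j) different"
    using j by (simp add: poly_cofactor_self)
  also have "twist (\<omega> ^ j) different = twist (\<omega> ^ j) dunit * (fps_const (\<omega> ^ (j * dord)) * fps_X ^ dord)"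
    by (simp add: different_decomp twist_X_power power_mult)
  also have "fps_const (inverse (\<omega> ^ (j * dord))) * twist (\<omega> ^ j) (b * inverse dunit) *
     (twist (\<omega> ^ j) dunit * (fps_const (\<omega> ^ (j * dord)) * fps_X ^ dord)) =
     (fps_const (inverse (\<omega> ^ (j * dord))) * fps_const (\<omega> ^ (j * dord))) * fps_X ^ dord *
      twist (\<omega> ^ j) (b * (inverse dunit * dunit))"
    by (simp only: twist_mult mult_ac)
  also have "\<dots> = fps_X ^ dord * twist (\<omega> ^ j) b"
    unfolding fps_const_mult dunit_inverse by simp
  finally show ?thesis .
qed

text \<open>Summation over the conjugates is a trace: it multiplies by \<open>m\<close> the terms whose exponent is
  congruent to \<open>dord\<close> modulo \<open>m\<close> and kills the others.\<close>

lemma coeff_lagrange: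
  "fps_nth (coeff (lagrange b) i) n =
     (if \<omega> ^ n = \<omega> ^ dord then of_nat m * fps_nth (b * inverse dunit * coeff (cofactor 0) i) n else 0)"
proof -
  define z where "z = \<omega> ^ n / \<omega> ^ dord"
  define C where "C = b * inverse dunit * coeff (cofactor 0) i"
  have "coeff (lagrange b) i = (\<Sum>k<m. fps_const (inverse (\<omega> ^ (k * dord))) * twist (\<omega> ^ k) C)"
    unfolding lagrange_def coeff_sum C_def
  proof (rule sum.cong[OF refl])
    fix k assume "k \<in> {..<m}"
    thus "coeff (smult (fps_const (inverse (\<omega> ^ (k * dord))) * twist (\<omega> ^ k) (b * inverse dunit)) (cofactor k)) i =
        fps_const (inverse (\<omega> ^ (k * dord))) * twist (\<omega> ^ k) (b * inverse dunit * coeff (cofactor 0) i)"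
      using coeff_cofactor[of k i] by (simp only: coeff_smult twist_mult mult.assoc lessThan_iff)
  qed
  hence "fps_nth (coeff (lagrange b) i) n = (\<Sum>k<m. inverse (\<omega> ^ (k * dord)) * ((\<omega> ^ k) ^ n * fps_nth C n))"
    by (simp add: fps_sum_nth)
  also have "\<dots> = (\<Sum>k<m. z ^ k * fps_nth C n)"
    by (rule sum.cong)
       (simp_all add: z_def power_divide power_mult[symmetric] mult.commute[of dord] mult.commute[of n] field_simps)
  also have "\<dots> = (\<Sum>k<m. z ^ k) * fps_nth C n" by (simp add: sum_distrib_right)
  also have "(\<Sum>k<m. z ^ k) = (if \<omega> ^ n = \<omega> ^ dord then of_nat m else 0)"
  proof (cases "z = 1")
    case True thus ?thesis by (simp add: z_def)
  next
    case False
    have "z ^ m = (\<omega> ^ m) ^ n / (\<omega> ^ m) ^ dord"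
      by (simp only: z_def power_divide power_mult[symmetric] mult.commute)
    hence "z ^ m = 1" by simp
    with False show ?thesis by (auto simp: sum_gp_strict z_def)
  qed
  finally show ?thesis by (simp add: C_def)
qed

lemma \<omega>_power_eq_iff: "n \<le> k \<Longrightarrow> \<omega> ^ n = \<omega> ^ k \<longleftrightarrow> m dvd k - n"
proof -
  assume "n \<le> k"
  hence "\<omega> ^ k = \<omega> ^ n * \<omega> ^ (k - n)" by (simp flip: power_add)
  thus ?thesis by (simp flip: \<omega>_power_eq_1)
qed

text \<open>The residue at \<open>0\<close> of \<open>a b u^(m-1) du / different\<close>, a form of the trace pairing over the series in
  \<open>u^m\<close>.\<close>

definition pairing :: "complex fps \<Rightarrow> complex fps \<Rightarrow> complex" where
  "pairing a b = fps_nth (a * b * (fps_X ^ m * inverse dunit)) dord"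

lemma polys_eq_of_agree:
  fixes p q :: "complex fps poly"
  assumes "degree p < m" "degree q < m" "\<And>j. j < m \<Longrightarrow> poly p (cj j) = poly q (cj j)"
  shows "p = q"
proof (rule ccontr)
  assume "p \<noteq> q"
  hence ne: "p - q \<noteq> 0" by simp
  have "cj ` {..<m} \<subseteq> {x. poly (p - q) x = 0}" using assms by auto
  hence "card (cj ` {..<m}) \<le> card {x. poly (p - q) x = 0}"
    by (intro card_mono poly_roots_finite ne)
  also have "\<dots> \<le> degree (p - q)" by (rule card_poly_roots_bound[OF ne])
  also have "\<dots> < m" using assms degree_diff_less[of p m q] by simp
  finally show False by (simp add: card_image inj_cj)
qed

text \<open>Interpolation at the conjugates recovers from \<open>h\<close> its own polynomial expression in \<open>\<phi>\<close>. Its top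
  coefficient is, up to the factor \<open>m\<close>, the trace of \<open>h / different\<close>, which therefore has no pole. This is
  Euler's formula for the traces of the powers of \<open>\<phi>\<close> divided by \<open>different\<close>.\<close>

lemma trace_pole_free:
  assumes "h \<in> branch_ring"
  shows "fps_nth (h * (fps_X ^ m * inverse dunit)) dord = 0"
proof (cases "dord < m")
  case True
  have *: "h * (fps_X ^ m * inverse dunit) = fps_X ^ m * (h * inverse dunit)" by (simp add: mult_ac)
  show ?thesis unfolding * using True by (simp add: fps_X_power_mult_nth)
next
  case False
  from assms obtain c where h: "h = (\<Sum>i<m. c i * \<phi> ^ i)" and c: "\<And>i. c i \<in> base"
    unfolding branch_ring_def by blast
  define r where "r = (\<Sum>i<m. monom (c i) i)"
  have dr: "degree r < m"
  proof -
    have "degree r \<le> m - 1" unfolding r_def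
      by (intro degree_sum_le) (auto intro: order_trans[OF degree_monom_le])
    thus ?thesis using m by simp
  qed
  have "lagrange h = smult (fps_X ^ dord) r"
  proof (rule polys_eq_of_agree)
    show "degree (lagrange h) < m" by (rule degree_lagrange)
    show "degree (smult (fps_X ^ dord) r) < m" using dr degree_smult_le[of _ r] by (rule order_le_less_trans[rotated])
    fix j assume j: "j < m"
    have "twist (\<omega> ^ j) h = (\<Sum>i<m. c i * cj j ^ i)"
      unfolding h twist_sum by (simp add: twist_base[OF c] twist_power cj_def)
    also have "\<dots> = poly r (cj j)" by (simp add: r_def poly_sum poly_monom)
    finally show "poly (lagrange h) (cj j) = poly (smult (fps_X ^ dord) r) (cj j)"
      using j by (simp add: poly_lagrange)
  qed
  hence "coeff (lagrange h) (m - 1) = fps_X ^ dord * coeff r (m - 1)" by simp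
  hence "fps_nth (coeff (lagrange h) (m - 1)) (dord - m) = 0"
    using m False by (simp add: fps_X_power_mult_nth)
  moreover have "\<omega> ^ (dord - m) = \<omega> ^ dord" using False by (subst \<omega>_power_eq_iff) auto
  ultimately have "fps_nth (h * inverse dunit) (dord - m) = 0"
    using m lead_cofactor[of 0] by (simp add: coeff_lagrange)
  moreover have *: "h * (fps_X ^ m * inverse dunit) = fps_X ^ m * (h * inverse dunit)" by (simp add: mult_ac)
  ultimately show ?thesis unfolding * using False by (simp add: fps_X_power_mult_nth)
qed

text \<open>The coefficients of the Lagrange polynomial of \<open>b\<close> are traces of \<open>b\<close> times coefficients of the
  cofactor, which lie in the ring. Orthogonality makes them divisible by \<open>u\<close> to the power \<open>dord\<close>, and
  after this division the value of the polynomial at \<open>\<phi>\<close> expresses \<open>b\<close> as an element of the ring.\<close>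

lemma in_branch_ring_of_orthogonal:
  assumes b: "convergent1 b" and orth: "\<And>a. a \<in> branch_ring \<Longrightarrow> pairing b a = 0"
  shows "b \<in> branch_ring"
proof -
  define e where "e = coeff (cofactor 0)"
  have zero: "fps_nth (coeff (lagrange b) i) n = 0" if "n < dord" for i n
  proof (cases "\<omega> ^ n = \<omega> ^ dord")
    case True
    hence "m dvd dord - n" using that by (subst (asm) \<omega>_power_eq_iff) auto
    then obtain j where j: "dord - n = m * j" ..
    have "j \<noteq> 0"
    proof
      assume "j = 0"
      with j that show False by simp
    qed
    hence X: "fps_X ^ (m * (j - 1)) * fps_X ^ m = (fps_X ^ (m * j) :: complex fps)"
      by (cases j) (simp_all add: power_add[symmetric])
    have "fps_X ^ (m * (j - 1)) * e i \<in> branch_ring"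
      unfolding e_def by (intro branch_ring_base_mult coeff_cofactor_in_ring base_X) simp
    from orth[OF this] have "fps_nth (b * (fps_X ^ (m * (j - 1)) * e i) * (fps_X ^ m * inverse dunit)) dord = 0"
      by (simp only: pairing_def)
    moreover have "b * (fps_X ^ (m * (j - 1)) * e i) * (fps_X ^ m * inverse dunit) =
        (fps_X ^ (m * (j - 1)) * fps_X ^ m) * (b * inverse dunit * e i)" by (simp only: mult_ac)
    ultimately have "fps_nth (fps_X ^ (m * j) * (b * inverse dunit * e i)) dord = 0"
      by (simp only: X)
    moreover have "\<not> dord < m * j" "dord - m * j = n" using j that by linarith+
    ultimately have "fps_nth (b * inverse dunit * e i) n = 0"
      by (simp only: fps_X_power_mult_nth if_False)
    thus ?thesis by (simp add: coeff_lagrange e_def)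
  qed (simp add: coeff_lagrange)
  define c where "c = (\<lambda>i. fps_shift dord (coeff (lagrange b) i))"
  have eq: "coeff (lagrange b) i = fps_X ^ dord * c i" for i
    by (rule fps_ext) (use zero in \<open>auto simp: c_def fps_X_power_mult_nth\<close>)
  have cof: "convergent1 (coeff (cofactor k) i)" for k i
    unfolding cofactor_def by (rule convergent1_coeff_prod) (rule convergent1_cj)
  have "convergent1 (coeff (lagrange b) i)" for i
    unfolding lagrange_def coeff_sum coeff_smult
    by (intro convergent1_sum convergent1_mult convergent1_const convergent1_twist b convergent1_dunit cof)
       (simp add: norm_power)
  hence c: "c i \<in> base" for i
    unfolding base_def by (auto simp: c_def fps_eq_iff coeff_lagrange power_add)
  have "fps_X ^ dord * b = poly (lagrange b) \<phi>"
    using poly_lagrange[of 0 b] m by (simp add: cj_0)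
  also have "\<dots> = (\<Sum>i\<le>degree (lagrange b). coeff (lagrange b) i * \<phi> ^ i)"
    by (rule poly_altdef)
  also have "\<dots> = (\<Sum>i<m. coeff (lagrange b) i * \<phi> ^ i)"
    using degree_lagrange[of b] by (intro sum.mono_neutral_left) (auto simp: coeff_eq_0)
  also have "\<dots> = fps_X ^ dord * (\<Sum>i<m. c i * \<phi> ^ i)"
    by (simp add: eq sum_distrib_left mult.assoc)
  finally have "b = (\<Sum>i<m. c i * \<phi> ^ i)" by simp
  thus ?thesis using branch_ringI[of c] c by simp
qed

lemma pairing_eq_0_of_order:
  assumes "\<And>n. n < dord + 1 - m \<Longrightarrow> fps_nth x n = 0"
  shows "pairing x y = 0"
proof -
  have "fps_nth (fps_X ^ m * x) i = 0" if "i < dord + 1" for i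
    using assms[of "i - m"] that by (auto simp: fps_X_power_mult_nth)
  hence "fps_nth ((fps_X ^ m * x) * (y * inverse dunit)) dord = 0"
    by (rule fps_nth_prod_eq_0) auto
  thus ?thesis by (simp add: pairing_def mult_ac)
qed

lemma conductor:
  assumes "convergent1 x" "\<And>n. n < dord + 1 - m \<Longrightarrow> fps_nth x n = 0"
  shows "x \<in> branch_ring"
  by (rule in_branch_ring_of_orthogonal[OF assms(1)]) (rule pairing_eq_0_of_order, rule assms(2))

text \<open>The ring is its own orthogonal with respect to \<open>pairing\<close>, whose radical is the space of the
  series of order at least \<open>dord + 1 - m\<close>.\<close>

theorem codim_branch_ring:
  "\<exists>\<delta>. codim fscale {A. convergent1 A} branch_ring \<delta> \<and> 2 * \<delta> + m = dord + 1"
proof -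
  interpret vector_space fscale by (rule vector_space_fscale)
  define V where "V = {A. convergent1 A}"
  define U where "U = {A. convergent1 A \<and> (\<forall>n<dord+1-m. fps_nth A n = 0)}"
  have V: "subspace V" unfolding V_def by (intro subspaceI) auto
  have W: "subspace branch_ring"
    by (intro subspaceI) (auto intro: branch_ring_0 branch_ring_add branch_ring_base_mult)
  have U: "subspace U" unfolding U_def by (intro subspaceI) auto
  have UW: "U \<subseteq> branch_ring" using conductor by (auto simp: U_def)
  have WV: "branch_ring \<subseteq> V" using branch_ring_convergent by (auto simp: V_def)
  have "codim fscale V U (dord+1-m)" unfolding V_def U_def by (rule codim_fps_truncation)
  from codim_intermediate[OF W UW WV U this] obtain \<delta> \<epsilon> where
    1: "codim fscale V branch_ring \<delta>" "codim fscale branch_ring U \<epsilon>" "\<delta> + \<epsilon> = dord+1-m" by blast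
  have "\<delta> = \<epsilon>"
  proof (rule codim_self_orthogonal[OF V W WV UW, of pairing])
    show "pairing (x + y) z = pairing x z + pairing y z" for x y z
      by (simp add: pairing_def ring_distribs)
    show "pairing (fps_const c * x) z = c * pairing x z" for c x z
      by (simp add: pairing_def mult.assoc)
    show "pairing x y = pairing y x" for x y by (simp add: pairing_def mult_ac)
    show "x \<in> branch_ring \<longleftrightarrow> (\<forall>y\<in>branch_ring. pairing x y = 0)" if "x \<in> V" for x
      using that in_branch_ring_of_orthogonal[of x] branch_ring_mult trace_pole_free
      by (auto simp: V_def pairing_def)
    show "x \<in> U \<longleftrightarrow> (\<forall>y\<in>V. pairing x y = 0)" if x: "x \<in> V" for x
    proof
      assume "x \<in> U" thus "\<forall>y\<in>V. pairing x y = 0" using pairing_eq_0_of_order by (auto simp: U_def)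
    next
      assume *: "\<forall>y\<in>V. pairing x y = 0"
      have z: "fps_nth (x * inverse dunit) n = 0" if n: "n < dord + 1 - m" for n
      proof -
        have "fps_X ^ (dord - m - n) \<in> V" by (simp add: V_def)
        with * have "pairing x (fps_X ^ (dord - m - n)) = 0" by blast
        moreover have X: "fps_X ^ (dord - m - n) * fps_X ^ m = (fps_X ^ (dord - n) :: complex fps)"
          using n by (simp add: power_add[symmetric])
        have "x * fps_X ^ (dord - m - n) * (fps_X ^ m * inverse dunit) =
           (fps_X ^ (dord - m - n) * fps_X ^ m) * (x * inverse dunit)"
          by (simp only: mult_ac)
        ultimately have "fps_nth (fps_X ^ (dord - n) * (x * inverse dunit)) dord = 0"
          by (simp only: pairing_def X)
        moreover have "\<not> dord < dord - n" "dord - (dord - n) = n" using n by linarith+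
        ultimately show ?thesis by (simp only: fps_X_power_mult_nth if_False)
      qed
      have "fps_nth (x * inverse dunit * dunit) n = 0" if "n < dord + 1 - m" for n
        by (rule fps_nth_prod_eq_0[OF z that])
      thus "x \<in> U" using x by (simp add: U_def V_def mult.assoc dunit_inverse)
    qed
    show "codim fscale V branch_ring \<delta>" "codim fscale branch_ring U \<epsilon>" by fact+
  qed
  with 1 dord_ge show ?thesis by (auto simp: V_def)
qed

end

section \<open>The equation of a parametrized branch\<close>

definition graph_arc :: "complex fps \<Rightarrow> complex \<Rightarrow> C2" where
  "graph_arc \<psi> u = (u, eval_fps \<psi> u)"

lemma analytic_arc_graph:
  assumes "convergent1 \<psi>" "fps_nth \<psi> 0 = 0"
  shows "analytic_arc (graph_arc \<psi>)"
  unfolding analytic_arc_def graph_arc_def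
  by (rule exI[of _ fps_X], rule exI[of _ \<psi>])
     (use assms in \<open>auto intro: eval_fps_has_fps_expansion has_fps_expansion_fps_X simp: convergent1_def\<close>)

lemma eval_fps_expansion: "convergent1 A \<Longrightarrow> eval_fps A has_fps_expansion A"
  by (simp add: convergent1_def eval_fps_has_fps_expansion)

lemma convergent2_fps_of_poly:
  "(\<And>i. convergent1 (coeff p i)) \<Longrightarrow> convergent2 (fps_of_poly p)"
proof (induction p)
  case (pCons a p)
  have "convergent1 a" using pCons.prems[of 0] by simp
  moreover have "convergent1 (coeff p i)" for i using pCons.prems[of "Suc i"] by simp
  ultimately show ?case using pCons.IH
    by (auto simp: fps_of_poly_pCons intro!: convergent2_add convergent2_mult convergent2_fps_const)
qed auto

context
  fixes \<psi> :: "complex fps"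
  assumes \<psi>: "convergent1 \<psi>" "fps_nth \<psi> 0 = 0"
begin

lemma pullback_graph_const:
  assumes "convergent1 c"
  shows "pullback (graph_arc \<psi>) (fps_const c) = c"
  by (rule pullback_eqI[OF analytic_arc_graph[OF \<psi>] expansion2_fst_comp[OF eval_fps_expansion[OF assms]]])
     (simp add: graph_arc_def eval_fps_expansion[OF assms])

lemma pullback_graph_X: "pullback (graph_arc \<psi>) fps_X = \<psi>"
  by (rule pullback_eqI[OF analytic_arc_graph[OF \<psi>] expansion2_snd])
     (simp add: graph_arc_def eval_fps_expansion[OF \<psi>(1)])

lemma pullback_graph_poly:
  "(\<And>i. convergent1 (coeff p i)) \<Longrightarrow> pullback (graph_arc \<psi>) (fps_of_poly p) = poly p \<psi>"
proof (induction p)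
  case 0
  show ?case using pullback_graph_const[of 0] by simp
next
  case (pCons a p)
  note arc = analytic_arc_graph[OF \<psi>]
  have a: "convergent1 a" using pCons.prems[of 0] by simp
  have p: "convergent1 (coeff p i)" for i using pCons.prems[of "Suc i"] by simp
  note c = convergent2_fps_of_poly[OF p]
  have eq: "fps_of_poly (pCons a p) = fps_const a + fps_X * fps_of_poly p"
    by (simp add: fps_of_poly_pCons mult.commute)
  show ?case unfolding eq
    by (simp add: pullback_add[OF arc] pullback_mult[OF arc] convergent2_mult convergent2_fps_const a c
        pullback_graph_const pullback_graph_X pCons.IH[OF p])
qed

end

lemma convergent2_shift:
  assumes "convergent2 F"
  shows "convergent2 (fps_shift 1 F)"
proof -
  from assms obtain \<rho> where \<rho>: "\<rho> > 0" "(\<lambda>(i, j). norm (coeff2 F i j) * \<rho> ^ (i + j)) summable_on UNIV"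
    by (auto simp: convergent2_iff abs_conv2_def)
  have "(\<lambda>(i, j). norm (coeff2 F i j) * \<rho> ^ (i + j)) summable_on range (\<lambda>(i, j). (i, Suc j))"
    by (rule summable_on_subset_banach[OF \<rho>(2)]) auto
  hence "(\<lambda>(i, j). norm (coeff2 F i j) * \<rho> ^ (i + j)) \<circ> (\<lambda>(i, j). (i, Suc j)) summable_on UNIV"
    by (subst (asm) summable_on_reindex) (auto simp: inj_on_def)
  hence "(\<lambda>p. inverse \<rho> * ((\<lambda>(i, j). norm (coeff2 F i j) * \<rho> ^ (i + j)) \<circ> (\<lambda>(i, j). (i, Suc j))) p) summable_on UNIV"
    by (rule summable_on_cmult_right)
  moreover have "(\<lambda>p. inverse \<rho> * ((\<lambda>(i, j). norm (coeff2 F i j) * \<rho> ^ (i + j)) \<circ> (\<lambda>(i, j). (i, Suc j))) p) =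
      (\<lambda>(i, j). norm (coeff2 (fps_shift 1 F) i j) * \<rho> ^ (i + j))"
    using \<rho>(1) by (auto simp: fun_eq_iff coeff2_def field_simps)
  ultimately show ?thesis using \<rho>(1) by (auto simp: convergent2_def)
qed

lemma convergent2_shift_n: "convergent2 F \<Longrightarrow> convergent2 (fps_shift n F)"
proof (induction n)
  case (Suc n)
  have "fps_shift (Suc n) F = fps_shift 1 (fps_shift n F)" by (simp add: fps_eq_iff)
  thus ?case using convergent2_shift[of "fps_shift n F"] Suc by simp
qed simp

text \<open>In the coordinates \<open>(x, y - \<psi> x)\<close> this is division by the second coordinate.\<close>

lemma division_by_graph:
  assumes H: "convergent2 H" and \<psi>: "convergent1 \<psi>" "fps_nth \<psi> 0 = 0"
  shows "\<exists>c H'. convergent1 c \<and> convergent2 H' \<and> H = fps_const c + (fps_X - fps_const \<psi>) * H'"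
proof -
  note ps = expansion2_fst_comp[OF eval_fps_expansion[OF \<psi>(1)]]
  have z: "coeff2 (fps_const fps_X) 0 0 = 0" "coeff2 (fps_X + fps_const \<psi>) 0 0 = 0" "coeff2 (fps_X - fps_const \<psi>) 0 0 = 0"
    using \<psi> by (simp_all add: coeff2_def)
  from expansion2_compose[OF expansion2_eval2[OF H] expansion2_fst
      expansion2_add[OF expansion2_snd ps] z(1,2)]
  obtain G where G: "expansion2 (\<lambda>z. eval2 H (fst z, snd z + eval_fps \<psi> (fst z))) G" by blast
  hence cG: "convergent2 G" by (simp add: expansion2_def)
  define c where "c = fps_nth G 0"
  define K where "K = fps_shift 1 G"
  have c: "convergent1 c" using convergent1_fps_nth[OF cG] by (simp add: c_def)
  have K: "convergent2 K" unfolding K_def by (rule convergent2_shift[OF cG])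
  have GK: "G = fps_const c + fps_X * K"
  proof (rule fps_ext)
    fix n show "fps_nth G n = fps_nth (fps_const c + fps_X * K) n"
      by (cases n) (simp_all add: c_def K_def)
  qed
  from expansion2_compose[OF expansion2_eval2[OF K] expansion2_fst
      expansion2_minus[OF expansion2_snd ps] z(1,3)]
  obtain H' where H': "expansion2 (\<lambda>z. eval2 K (fst z, snd z - eval_fps \<psi> (fst z))) H'" by blast
  have "expansion2 (\<lambda>z. eval_fps c (fst z) + snd z * eval2 K z) G"
    unfolding GK by (intro expansion2_add expansion2_mult expansion2_snd
        expansion2_eval2[OF K] expansion2_fst_comp[OF eval_fps_expansion[OF c]])
  with G have e: "\<forall>\<^sub>F z in nhds 0. eval2 H (fst z, snd z + eval_fps \<psi> (fst z)) =
      eval_fps c (fst z) + snd z * eval2 K z"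
    unfolding expansion2_def by (auto elim: eventually_elim2)
  have lim: "filterlim (\<lambda>z. (fst z, snd z - eval_fps \<psi> (fst z))) (nhds (0::C2)) (nhds (0::C2))"
    using tendsto_Pair[OF expansion2_tendsto_0[OF expansion2_fst z(1)]
        expansion2_tendsto_0[OF expansion2_minus[OF expansion2_snd ps] z(3)]]
    by (simp add: zero_prod_def)
  have ev: "\<forall>\<^sub>F z in nhds (0::C2). eval_fps c (fst z) + (snd z - eval_fps \<psi> (fst z)) *
      eval2 K (fst z, snd z - eval_fps \<psi> (fst z)) = eval2 H z"
    using eventually_compose_filterlim[OF e lim] by (rule eventually_mono) simp
  have "expansion2 (\<lambda>z. eval_fps c (fst z) + (snd z - eval_fps \<psi> (fst z)) *
      eval2 K (fst z, snd z - eval_fps \<psi> (fst z))) (fps_const c + (fps_X - fps_const \<psi>) * H')"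
    by (intro expansion2_add expansion2_mult expansion2_minus expansion2_snd ps H'
        expansion2_fst_comp[OF eval_fps_expansion[OF c]])
  from expansion2_unique[OF expansion2_eval2[OF H] expansion2_cong[OF this ev]] c H'
  show ?thesis by (auto simp: expansion2_def)
qed

definition twist2 :: "complex \<Rightarrow> complex fps fps \<Rightarrow> complex fps fps" where
  "twist2 z F = Abs_fps (\<lambda>j. twist z (fps_nth F j))"

lemma twist2_nth [simp]: "fps_nth (twist2 z F) j = twist z (fps_nth F j)"
  by (simp add: twist2_def)

lemma twist2_add: "twist2 z (F + G) = twist2 z F + twist2 z G"
  by (simp add: fps_eq_iff ring_distribs)

lemma twist2_mult: "twist2 z (F * G) = twist2 z F * twist2 z G"
  by (rule fps_ext) (simp add: fps_mult_nth twist_sum)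

lemma twist2_fps_of_poly:
  assumes "\<And>i. coeff q i = twist z (coeff p i)"
  shows "twist2 z (fps_of_poly p) = fps_of_poly q"
  by (rule fps_ext) (simp add: assms)

lemma convergent2_twist2: "norm z = 1 \<Longrightarrow> convergent2 F \<Longrightarrow> convergent2 (twist2 z F)"
  by (simp add: convergent2_def coeff2_def norm_mult norm_power)

context puiseux
begin

lemma cj_nth_0: "fps_nth (cj k) 0 = 0"
  using ord[of 0] by (simp add: cj_def)

subsection \<open>Substituting an \<open>m\<close>-th power for the first variable\<close>

text \<open>The series \<open>F(x^m, y)\<close>.\<close>

definition inflate :: "complex fps fps \<Rightarrow> complex fps fps" where
  "inflate F = Abs_fps (\<lambda>j. Abs_fps (\<lambda>i. if m dvd i then coeff2 F (i div m) j else 0))"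

lemma coeff2_inflate: "coeff2 (inflate F) i j = (if m dvd i then coeff2 F (i div m) j else 0)"
  unfolding inflate_def by (rule coeff2_Abs)

lemma inj_inflate_index: "inj (\<lambda>(i, j). (m * i, j :: nat))"
  using m by (auto simp: inj_on_def)

lemma eval2_inflate: "eval2 (inflate F) z = eval2 F (fst z ^ m, snd z)"
proof -
  have "eval2 (inflate F) z =
      (\<Sum>\<^sub>\<infinity>(i, j)\<in>range (\<lambda>(i, j). (m * i, j)). coeff2 (inflate F) i j * fst z ^ i * snd z ^ j)"
    unfolding eval2_def
    by (rule infsum_cong_neutral) (auto simp: coeff2_inflate image_iff elim!: dvdE split: if_splits)
  also have "\<dots> = (\<Sum>\<^sub>\<infinity>(i, j). coeff2 F i j * (fst z ^ m) ^ i * snd z ^ j)"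
    using m by (subst infsum_reindex[OF inj_inflate_index])
      (auto simp: o_def case_prod_unfold coeff2_inflate power_mult)
  finally show ?thesis by (simp add: eval2_def)
qed

lemma convergent2_inflate:
  assumes "convergent2 F"
  shows "convergent2 (inflate F)"
proof -
  from assms obtain \<rho> where \<rho>: "\<rho> > 0" "abs_conv2 \<rho> F"
    by (auto simp: convergent2_iff)
  define r where "r = min \<rho> 1"
  have r: "r > 0" "r \<le> 1" "abs_conv2 r F" using \<rho> by (auto simp: r_def intro: abs_conv2_mono)
  have "(\<lambda>(i, j). norm (coeff2 F i j) * r ^ (m * i + j)) summable_on UNIV"
  proof (rule summable_on_comparison_test[OF r(3)[unfolded abs_conv2_def]])
    fix p :: "nat \<times> nat"
    obtain i j where p: "p = (i, j)" by (cases p)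
    have "r ^ (m * i + j) \<le> r ^ (i + j)"
      using r m by (intro power_decreasing) auto
    thus "(case p of (i, j) \<Rightarrow> norm (coeff2 F i j) * r ^ (m * i + j)) \<le>
       (case p of (i, j) \<Rightarrow> norm (coeff2 F i j) * r ^ (i + j))"
      by (auto simp: p intro: mult_left_mono)
  qed (use r in auto)
  moreover have "(\<lambda>(i, j). norm (coeff2 F i j) * r ^ (m * i + j)) =
     (\<lambda>(i, j). norm (coeff2 (inflate F) i j) * r ^ (i + j)) \<circ> (\<lambda>(i, j). (m * i, j))"
    using m by (auto simp: coeff2_inflate)
  ultimately have "(\<lambda>(i, j). norm (coeff2 (inflate F) i j) * r ^ (i + j)) summable_on range (\<lambda>(i, j). (m * i, j))"
    by (subst summable_on_reindex[OF inj_inflate_index]) simp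
  also have "?this \<longleftrightarrow> abs_conv2 r (inflate F)" unfolding abs_conv2_def
    by (rule summable_on_cong_neutral) (auto simp: coeff2_inflate image_iff elim!: dvdE split: if_splits)
  finally show ?thesis using r by (auto simp: convergent2_iff)
qed

lemma inflate_base: "convergent2 F \<Longrightarrow> fps_nth (inflate F) j \<in> base"
  using convergent1_fps_nth[OF convergent2_inflate, of F j]
  by (auto simp: base_iff inflate_def)

lemma inflate_surj:
  assumes K: "convergent2 K" and base: "\<And>j. fps_nth K j \<in> base"
  shows "\<exists>A. convergent2 A \<and> inflate A = K"
proof (intro exI conjI)
  define A where "A = Abs_fps (\<lambda>j. Abs_fps (\<lambda>i. coeff2 K (m * i) j))"
  have cA: "coeff2 A i j = coeff2 K (m * i) j" for i j unfolding A_def by (rule coeff2_Abs)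
  show "inflate A = K"
  proof (rule coeff2_eqI)
    fix i j
    have "\<not> m dvd i \<Longrightarrow> coeff2 K i j = 0"
      using base[of j] by (simp add: base_iff coeff2_def)
    thus "coeff2 (inflate A) i j = coeff2 K i j"
      by (auto simp: coeff2_inflate cA)
  qed
  from K obtain \<rho> where \<rho>: "\<rho> > 0" "abs_conv2 \<rho> K"
    by (auto simp: convergent2_iff)
  define r where "r = min \<rho> 1"
  have r: "r > 0" "r \<le> 1" "abs_conv2 r K" using \<rho> by (auto simp: r_def intro: abs_conv2_mono)
  have "(\<lambda>(i, j). norm (coeff2 K i j) * r ^ (i + j)) summable_on range (\<lambda>(i, j). (m * i, j))"
    by (rule summable_on_subset_banach[OF r(3)[unfolded abs_conv2_def]]) auto
  hence "(\<lambda>(i, j). norm (coeff2 K (m * i) j) * r ^ (m * i + j)) summable_on UNIV"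
    by (subst (asm) summable_on_reindex[OF inj_inflate_index]) (simp add: o_def case_prod_unfold)
  hence "abs_conv2 (r ^ m) A" unfolding abs_conv2_def
  proof (rule summable_on_comparison_test)
    fix p :: "nat \<times> nat"
    obtain i j where p: "p = (i, j)" by (cases p)
    have "(r ^ m) ^ (i + j) = r ^ (m * i + m * j)" by (simp add: power_mult[symmetric] ring_distribs)
    also have "\<dots> \<le> r ^ (m * i + j)"
      using r m by (intro power_decreasing) auto
    finally show "(case p of (i, j) \<Rightarrow> norm (coeff2 A i j) * (r ^ m) ^ (i + j)) \<le>
        (case p of (i, j) \<Rightarrow> norm (coeff2 K (m * i) j) * r ^ (m * i + j))"
      by (auto simp: p cA intro: mult_left_mono)
  qed (use r in auto)
  thus "convergent2 A" using r(1) by (auto simp: convergent2_iff intro!: exI[of _ "r ^ m"])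
qed

lemma inflate_inj: "inflate F = inflate G \<Longrightarrow> F = G"
proof (rule coeff2_eqI)
  fix i j assume "inflate F = inflate G"
  hence "coeff2 (inflate F) (m * i) j = coeff2 (inflate G) (m * i) j" by simp
  thus "coeff2 F i j = coeff2 G i j" using m by (simp add: coeff2_inflate)
qed

lemma inflate_mult:
  assumes "convergent2 F" "convergent2 G"
  shows "inflate (F * G) = inflate F * inflate G"
proof (rule expansion2_unique)
  show "expansion2 (eval2 (inflate (F * G))) (inflate (F * G))"
    by (intro expansion2_eval2 convergent2_inflate convergent2_mult assms)
  have "\<forall>\<^sub>F z in nhds 0. eval2 F z * eval2 G z = eval2 (F * G) z"
    using expansion2_mult[OF expansion2_eval2[OF assms(1)] expansion2_eval2[OF assms(2)]]
    by (simp add: expansion2_def)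
  moreover have "((\<lambda>z. (fst z ^ m, snd z)) \<longlongrightarrow> (fst (0::C2) ^ m, snd (0::C2))) (nhds 0)"
    by (intro tendsto_Pair tendsto_power tendsto_fst[OF filterlim_ident] tendsto_snd[OF filterlim_ident])
  hence "filterlim (\<lambda>z. (fst z ^ m, snd z)) (nhds 0) (nhds (0::C2))"
    using m by (simp add: zero_prod_def power_0_left)
  ultimately have "\<forall>\<^sub>F z in nhds (0::C2). eval2 F (fst z ^ m, snd z) * eval2 G (fst z ^ m, snd z) = eval2 (F * G) (fst z ^ m, snd z)"
    by (rule eventually_compose_filterlim)
  hence "\<forall>\<^sub>F z in nhds 0. eval2 (inflate F) z * eval2 (inflate G) z = eval2 (inflate (F * G)) z"
    by (simp add: eval2_inflate)
  thus "expansion2 (eval2 (inflate (F * G))) (inflate F * inflate G)"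
    by (rule expansion2_cong[OF expansion2_mult[OF expansion2_eval2[OF convergent2_inflate[OF assms(1)]]
          expansion2_eval2[OF convergent2_inflate[OF assms(2)]]]])
qed

subsection \<open>Weierstrass division by the product of the conjugates\<close>

text \<open>Successive divisions by the factors \<open>y - cj k\<close>.\<close>

lemma division_by_conjugates:
  assumes "convergent2 H"
  shows "\<exists>r H'. (\<forall>i. convergent1 (coeff r i)) \<and> (\<forall>i\<ge>n. coeff r i = 0) \<and> convergent2 H' \<and>
    H = fps_of_poly r + fps_of_poly (\<Prod>k<n. [:- cj k, 1:]) * H'"
proof (induction n)
  case 0
  show ?case by (rule exI[of _ 0], rule exI[of _ H]) (use assms in auto)
next
  case (Suc n)
  then obtain r H' where r: "\<And>i. convergent1 (coeff r i)" "\<And>i. i \<ge> n \<Longrightarrow> coeff r i = 0"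
    and H': "convergent2 H'" and eq: "H = fps_of_poly r + fps_of_poly (\<Prod>k<n. [:- cj k, 1:]) * H'" by blast
  obtain c H'' where c: "convergent1 c" and H'': "convergent2 H''"
    and eq': "H' = fps_const c + (fps_X - fps_const (cj n)) * H''"
    using division_by_graph[OF H' convergent1_cj cj_nth_0] by blast
  let ?P = "\<Prod>k<n. [:- cj k, 1:]"
  have dP: "degree ?P = n" by (subst degree_prod_eq_sum_degree) auto
  have lin: "fps_of_poly [:- cj n, 1:] = fps_X - fps_const (cj n)"
    by (simp add: fps_of_poly_pCons)
  have "H = fps_of_poly (r + smult c ?P) + fps_of_poly (\<Prod>k<Suc n. [:- cj k, 1:]) * H''"
    unfolding eq eq' prod.lessThan_Suc fps_of_poly_add fps_of_poly_smult fps_of_poly_mult lin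
    by (simp only: algebra_simps)
  moreover have "convergent1 (coeff (r + smult c ?P) i)" for i
    using r(1) c convergent1_coeff_prod[of "{..<n}" cj i] convergent1_cj by auto
  moreover have "coeff (r + smult c ?P) i = 0" if "i \<ge> Suc n" for i
    using that r(2)[of i] dP by (simp add: coeff_eq_0)
  ultimately show ?case using H'' by blast
qed

text \<open>The remainder vanishes at the \<open>m\<close> conjugates, more than its degree allows.\<close>

lemma division_unique:
  assumes r: "\<And>i. convergent1 (coeff r i)" "degree r < m" and H: "convergent2 H"
    and eq: "fps_of_poly r = fps_of_poly minpoly * H"
  shows "r = 0" "H = 0"
proof -
  have cm: "convergent1 (coeff minpoly i)" for i using coeff_minpoly base_convergent by blast
  have "poly r (cj j) = poly 0 (cj j)" if j: "j < m" for j
  proof -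
    note cjj = convergent1_cj[of j] cj_nth_0[of j]
    note arc = analytic_arc_graph[OF cjj]
    have "poly r (cj j) = pullback (graph_arc (cj j)) (fps_of_poly minpoly * H)"
      using pullback_graph_poly[OF cjj r(1)] eq by simp
    also have "\<dots> = poly minpoly (cj j) * pullback (graph_arc (cj j)) H"
      by (simp add: pullback_mult[OF arc convergent2_fps_of_poly[OF cm] H] pullback_graph_poly[OF cjj cm])
    also have "poly minpoly (cj j) = 0"
      unfolding minpoly_def poly_prod using j by (intro prod_zero) auto
    finally show ?thesis by simp
  qed
  thus "r = 0" using r(2) m by (intro polys_eq_of_agree) auto
  hence "fps_of_poly minpoly * H = 0" using eq by simp
  moreover have "minpoly \<noteq> 0" using lead_minpoly by auto
  hence "fps_of_poly minpoly \<noteq> 0" by simp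
  ultimately show "H = 0" by simp
qed

text \<open>The substitution of \<open>\<omega> x\<close> for \<open>x\<close> fixes the dividend and the divisor, so by uniqueness it fixes
  quotient and remainder, which are therefore series in \<open>x^m\<close>.\<close>

lemma weierstrass_division:
  assumes H: "convergent2 H" and base: "\<And>j. fps_nth H j \<in> base"
  shows "\<exists>r A. (\<forall>i. coeff r i \<in> base) \<and> degree r < m \<and> convergent2 A \<and>
    H = fps_of_poly r + fps_of_poly minpoly * inflate A"
proof -
  from division_by_conjugates[OF H, of m] obtain r H' where r: "\<And>i. convergent1 (coeff r i)" "\<And>i. i \<ge> m \<Longrightarrow> coeff r i = 0"
    and H': "convergent2 H'" and eq: "H = fps_of_poly r + fps_of_poly minpoly * H'"
    unfolding minpoly_def by blast
  have dr: "degree r < m" using r(2) m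
    by (metis degree_0 leading_coeff_0_iff not_le)
  define s where "s = Abs_poly (\<lambda>i. twist \<omega> (coeff r i))"
  have s: "coeff s i = twist \<omega> (coeff r i)" for i
  proof -
    have "coeff (Abs_poly (\<lambda>i. twist \<omega> (coeff r i))) = (\<lambda>i. twist \<omega> (coeff r i))"
      by (rule coeff_Abs_poly[of m]) (simp add: r(2))
    thus ?thesis by (simp add: s_def)
  qed
  have "twist2 \<omega> H = H" by (rule fps_ext) (use base in \<open>simp add: base_def\<close>)
  moreover have "twist2 \<omega> (fps_of_poly minpoly) = fps_of_poly minpoly"
    by (rule twist2_fps_of_poly) (use coeff_minpoly in \<open>simp add: base_def\<close>)
  ultimately have eq2: "H = fps_of_poly s + fps_of_poly minpoly * twist2 \<omega> H'"
    using arg_cong[OF eq, of "twist2 \<omega>"] by (simp add: twist2_add twist2_mult twist2_fps_of_poly[OF s])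
  have ds: "degree s < m" using m by (intro degree_lessI) (auto simp: s r(2))
  have *: "fps_of_poly (r - s) = fps_of_poly minpoly * (twist2 \<omega> H' - H')"
    using eq eq2 by (simp add: fps_of_poly_diff algebra_simps)
  have "convergent1 (coeff (r - s) i)" for i by (auto simp: s r intro!: convergent1_diff convergent1_twist)
  from division_unique[OF this _ _ *] have "r = s" "twist2 \<omega> H' = H'"
    using degree_diff_less[OF dr ds] by (auto simp: convergent2_diff convergent2_twist2 H')
  have "coeff r i \<in> base" for i
  proof -
    have "twist \<omega> (coeff r i) = coeff r i"
      using s[of i] unfolding \<open>r = s\<close>[symmetric] by (rule sym)
    with r(1)[of i] show ?thesis unfolding base_def by blast
  qed
  moreover have "fps_nth H' j \<in> base" for j
  proof -
    have "twist \<omega> (fps_nth H' j) = fps_nth H' j"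
      using arg_cong[OF \<open>twist2 \<omega> H' = H'\<close>, of "\<lambda>F. fps_nth F j"] by (simp only: twist2_nth)
    with convergent1_fps_nth[OF H', of j] show ?thesis unfolding base_def by blast
  qed
  then obtain A where "convergent2 A" "inflate A = H'" using inflate_surj[OF H'] by blast
  ultimately show ?thesis using dr eq by blast
qed

definition arc0 :: "complex \<Rightarrow> C2" where
  "arc0 u = (u ^ m, eval_fps \<phi> u)"

lemma pullback_arc0: "pullback arc0 F = pullback (graph_arc \<phi>) (inflate F)"
  unfolding pullback_def by (simp add: eval2_inflate arc0_def graph_arc_def)

lemma poly_twist_root:
  assumes "\<And>i. coeff r i \<in> base" "poly r \<phi> = 0"
  shows "poly r (cj k) = 0"
proof -
  have "0 = twist (\<omega> ^ k) (poly r \<phi>)" using assms(2) by simp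
  also have "\<dots> = poly r (cj k)"
    unfolding poly_altdef twist_sum by (simp add: twist_power twist_base[OF assms(1)] cj_def)
  finally show ?thesis ..
qed

lemma phi_0: "fps_nth \<phi> 0 = 0"
  using ord[of 0] by simp

lemma pullback_arc0_division:
  assumes r: "\<And>i. coeff r i \<in> base" and A: "convergent2 A"
    and eq: "inflate F = fps_of_poly r + fps_of_poly minpoly * inflate A"
  shows "pullback arc0 F = poly r \<phi>"
proof -
  note arc = analytic_arc_graph[OF conv phi_0]
  have cm: "convergent1 (coeff minpoly i)" "convergent1 (coeff r i)" for i
    using coeff_minpoly r base_convergent by blast+
  have "pullback arc0 F = poly r \<phi> + poly minpoly \<phi> * pullback (graph_arc \<phi>) (inflate A)"
    unfolding pullback_arc0 eq
    by (simp add: pullback_add[OF arc] pullback_mult[OF arc] convergent2_mult convergent2_fps_of_poly[OF cm(1)]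
         convergent2_fps_of_poly[OF cm(2)] convergent2_inflate[OF A] pullback_graph_poly[OF conv phi_0 cm(1)]
         pullback_graph_poly[OF conv phi_0 cm(2)])
  thus ?thesis by (simp add: poly_minpoly)
qed

lemma range_pullback_arc0: "pullback arc0 ` {F. convergent2 F} = branch_ring"
proof (intro equalityI subsetI)
  fix P assume "P \<in> pullback arc0 ` {F. convergent2 F}"
  then obtain F where F: "convergent2 F" "P = pullback arc0 F" by blast
  from weierstrass_division[OF convergent2_inflate[OF F(1)] inflate_base[OF F(1)]]
  obtain r A where "\<And>i. coeff r i \<in> base" "convergent2 A"
    "inflate F = fps_of_poly r + fps_of_poly minpoly * inflate A" by blast
  from pullback_arc0_division[OF this] branch_ring_poly[OF this(1)] F
  show "P \<in> branch_ring" by simp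
next
  fix P assume "P \<in> branch_ring"
  then obtain c where P: "P = (\<Sum>i<m. c i * \<phi> ^ i)" and c: "\<And>i. c i \<in> base"
    unfolding branch_ring_def by blast
  define r where "r = (\<Sum>i<m. monom (c i) i)"
  have r: "coeff r i \<in> base" for i
    unfolding r_def coeff_sum using c by (intro base_sum) (auto simp: coeff_monom)
  have "convergent2 (fps_of_poly r)" by (rule convergent2_fps_of_poly) (use r base_convergent in blast)
  from inflate_surj[OF this] r obtain F where F: "convergent2 F" "inflate F = fps_of_poly r" by auto
  have "inflate 0 = 0" by (rule coeff2_eqI) (simp add: coeff2_inflate coeff2_0)
  with F have "inflate F = fps_of_poly r + fps_of_poly minpoly * inflate 0" by simp
  from pullback_arc0_division[OF r _ this] have "pullback arc0 F = P"
    by (simp add: r_def P poly_sum poly_monom)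
  with F show "P \<in> pullback arc0 ` {F. convergent2 F}" by blast
qed

text \<open>The local equation of the branch in adapted coordinates: the coefficients of \<open>minpoly\<close> are series in
  \<open>u^m\<close>, which becomes the first coordinate.\<close>

definition equation :: "complex fps fps" where
  "equation = (SOME F. convergent2 F \<and> inflate F = fps_of_poly minpoly)"

lemma equation: "convergent2 equation" "inflate equation = fps_of_poly minpoly"
proof -
  have "convergent2 (fps_of_poly minpoly)"
    by (rule convergent2_fps_of_poly) (use coeff_minpoly base_convergent in blast)
  from inflate_surj[OF this] coeff_minpoly have "\<exists>F. convergent2 F \<and> inflate F = fps_of_poly minpoly" by auto
  from someI_ex[OF this] show "convergent2 equation" "inflate equation = fps_of_poly minpoly"
    unfolding equation_def by auto
qed

lemma equation_0: "coeff2 equation 0 0 = 0"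
proof -
  have "coeff2 equation 0 0 = coeff2 (inflate equation) 0 0" by (simp add: coeff2_inflate)
  also have "\<dots> = fps_nth (poly minpoly 0) 0"
    by (simp add: equation coeff2_def poly_0_coeff_0)
  also have "\<dots> = fps_nth (- \<phi> * poly (cofactor 0) 0) 0" by (simp add: minpoly_split)
  also have "\<dots> = 0" by (simp add: phi_0)
  finally show ?thesis .
qed

lemma pullback_arc0_eq_0_imp:
  assumes F: "convergent2 F" and zero: "pullback arc0 F = 0"
  shows "\<exists>A. convergent2 A \<and> F = equation * A"
proof -
  from weierstrass_division[OF convergent2_inflate[OF F(1)] inflate_base[OF F(1)]]
  obtain r A where r: "\<And>i. coeff r i \<in> base" "degree r < m" and A: "convergent2 A"
    and eq: "inflate F = fps_of_poly r + fps_of_poly minpoly * inflate A" by blast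
  from pullback_arc0_division[OF r(1) A eq] zero have "poly r \<phi> = 0" by simp
  hence "r = 0" using poly_twist_root[OF r(1)] r(2) m by (intro polys_eq_of_agree) auto
  hence "inflate F = inflate (equation * A)"
    by (simp add: eq inflate_mult equation A)
  with A show ?thesis using inflate_inj by blast
qed

end

subsection \<open>The kernel of the pullback along a branch\<close>

lemma eval2_at_0: "eval2 F 0 = coeff2 F 0 0"
proof -
  have "eval2 F 0 = (\<Sum>\<^sub>\<infinity>(i, j)\<in>{(0, 0)}. coeff2 F i j * fst (0::C2) ^ i * snd (0::C2) ^ j)"
    unfolding eval2_def by (rule infsum_cong_neutral) (auto simp: power_0_left split: if_splits)
  thus ?thesis by simp
qed

lemma expansion2_at_0: "expansion2 f F \<Longrightarrow> f 0 = coeff2 F 0 0"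
  unfolding expansion2_def using eventually_nhds_x_imp_x[of "\<lambda>z. f z = eval2 F z" 0]
  by (simp add: eval2_at_0)

lemma clinear_map_inv:
  assumes "clinear_map L" "bij L"
  shows "clinear_map (inv_into UNIV L)"
proof -
  interpret Vector_Spaces.linear cscale cscale L by fact
  show ?thesis
  proof unfold_locales
    show "inv_into UNIV L (a + b) = inv_into UNIV L a + inv_into UNIV L b" for a b
      using assms(2) by (intro inv_f_eq bij_is_inj) (auto simp: add bij_is_surj surj_f_inv_f)
    show "inv_into UNIV L (cscale r b) = cscale r (inv_into UNIV L b)" for r b
      using assms(2) by (intro inv_f_eq bij_is_inj) (auto simp: scale bij_is_surj surj_f_inv_f)
  qed
qed

lemma clinear_map_tendsto: "clinear_map L \<Longrightarrow> filterlim L (nhds 0) (nhds 0)"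
proof -
  assume L: "clinear_map L"
  have *: "L z = (fst z * fst (L (1, 0)) + snd z * fst (L (0, 1)), fst z * snd (L (1, 0)) + snd z * snd (L (0, 1)))" for z
    using clinear_map_coords[OF L, of z] by (simp add: cscale_def)
  have "((\<lambda>z. (fst z * fst (L (1, 0)) + snd z * fst (L (0, 1)), fst z * snd (L (1, 0)) + snd z * snd (L (0, 1))))
     \<longlongrightarrow> (fst (0::C2) * fst (L (1, 0)) + snd (0::C2) * fst (L (0, 1)), fst (0::C2) * snd (L (1, 0)) + snd (0::C2) * snd (L (0, 1)))) (nhds 0)"
    by (intro tendsto_Pair tendsto_add tendsto_mult tendsto_const tendsto_fst[OF filterlim_ident] tendsto_snd[OF filterlim_ident])
  thus ?thesis by (simp add: *[symmetric] zero_prod_def)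
qed

context puiseux
begin

context
  fixes L :: "C2 \<Rightarrow> C2" and \<gamma> :: "complex \<Rightarrow> C2"
  assumes L: "clinear_map L" "bij L" and \<gamma>: "\<And>u. \<gamma> u = L (arc0 u)"
begin

lemma analytic_arc0: "analytic_arc arc0"
  unfolding analytic_arc_def arc0_def
  by (rule exI[of _ "fps_X ^ m"], rule exI[of _ \<phi>])
     (use m phi_0 conv in \<open>auto intro: has_fps_expansion_fps_X_power eval_fps_expansion\<close>)

lemma analytic_arc_linear: "analytic_arc \<gamma>"
proof -
  obtain A B where A: "(\<lambda>u. fst (arc0 u)) has_fps_expansion A" "fps_nth A 0 = 0"
    and B: "(\<lambda>u. snd (arc0 u)) has_fps_expansion B" "fps_nth B 0 = 0"
    using analytic_arc0 unfolding analytic_arc_def by blast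
  have eq: "\<gamma> u = (fst (arc0 u) * fst (L (1, 0)) + snd (arc0 u) * fst (L (0, 1)),
      fst (arc0 u) * snd (L (1, 0)) + snd (arc0 u) * snd (L (0, 1)))" for u
    using clinear_map_coords[OF L(1), of "arc0 u"] by (simp add: cscale_def \<gamma>)
  show ?thesis
    unfolding analytic_arc_def eq fst_conv snd_conv
    by (rule exI[of _ "A * fps_const (fst (L (1, 0))) + B * fps_const (fst (L (0, 1)))"],
        rule exI[of _ "A * fps_const (snd (L (1, 0))) + B * fps_const (snd (L (0, 1)))"])
       (use A B in \<open>auto intro!: has_fps_expansion_add has_fps_expansion_mult\<close>)
qed

lemma pullback_linear:
  assumes "expansion2 (\<lambda>z. eval2 F (L z)) G" "convergent2 F"
  shows "pullback \<gamma> F = pullback arc0 G"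
  using pullback_expansion[OF analytic_arc0 assms(1)]
  by (intro pullback_eqI[OF analytic_arc_linear expansion2_eval2[OF assms(2)]]) (simp add: \<gamma>)

lemma range_pullback: "pullback \<gamma> ` {F. convergent2 F} = branch_ring"
proof (intro equalityI subsetI)
  fix P assume "P \<in> pullback \<gamma> ` {F. convergent2 F}"
  then obtain F where F: "convergent2 F" "P = pullback \<gamma> F" by blast
  obtain G where G: "expansion2 (\<lambda>z. eval2 F (L z)) G"
    using expansion2_clinear[OF L(1) expansion2_eval2[OF F(1)]] by blast
  have "P = pullback arc0 G" using pullback_linear[OF G F(1)] F by simp
  thus "P \<in> branch_ring" using range_pullback_arc0 G by (auto simp: expansion2_def)
next
  fix P assume "P \<in> branch_ring"
  then obtain G where G: "convergent2 G" "P = pullback arc0 G" using range_pullback_arc0 by auto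
  obtain F where F: "expansion2 (\<lambda>z. eval2 G (inv_into UNIV L z)) F"
    using expansion2_clinear[OF clinear_map_inv[OF L] expansion2_eval2[OF G(1)]] by blast
  have "pullback \<gamma> F = P"
    by (rule pullback_eqI[OF analytic_arc_linear F])
       (use pullback_eval2[OF analytic_arc0 G(1)] G L in \<open>simp add: \<gamma> bij_is_inj\<close>)
  with F show "P \<in> pullback \<gamma> ` {F. convergent2 F}" by (auto simp: expansion2_def)
qed

text \<open>The kernel consists of the multiples of the equation \<open>E\<close> that belongs to the parametrization. As \<open>f\<close>
  is irreducible and divisible by \<open>E\<close>, it is associated with \<open>E\<close>.\<close>

lemma kernel_pullback:
  assumes f: "branch f" "pullback \<gamma> f = 0" and h: "convergent2 h" "pullback \<gamma> h = 0"
  shows "\<exists>a. convergent2 a \<and> h = a * f"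
proof -
  have cf: "convergent2 f" using f by (simp add: branch_def)
  obtain E where E: "expansion2 (\<lambda>z. eval2 equation (inv_into UNIV L z)) E"
    using expansion2_clinear[OF clinear_map_inv[OF L] expansion2_eval2[OF equation(1)]] by blast
  hence cE: "convergent2 E" by (simp add: expansion2_def)
  have multiple: "\<exists>a. convergent2 a \<and> F = E * a" if F: "convergent2 F" "pullback \<gamma> F = 0" for F
  proof -
    obtain G where G: "expansion2 (\<lambda>z. eval2 F (L z)) G"
      using expansion2_clinear[OF L(1) expansion2_eval2[OF F(1)]] by blast
    have "pullback arc0 G = 0" using pullback_linear[OF G F(1)] F by simp
    then obtain A where A: "convergent2 A" "G = equation * A"
      using pullback_arc0_eq_0_imp[of G] G by (auto simp: expansion2_def)
    obtain a where a: "expansion2 (\<lambda>z. eval2 A (inv_into UNIV L z)) a"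
      using expansion2_clinear[OF clinear_map_inv[OF L] expansion2_eval2[OF A(1)]] by blast
    have "expansion2 (\<lambda>z. eval2 equation z * eval2 A z) G"
      unfolding A(2) by (intro expansion2_mult expansion2_eval2 equation A)
    with G have "\<forall>\<^sub>F z in nhds 0. eval2 equation z * eval2 A z = eval2 F (L z)"
      unfolding expansion2_def by (auto elim: eventually_elim2)
    from eventually_compose_filterlim[OF this clinear_map_tendsto[OF clinear_map_inv[OF L]]]
    have ev: "\<forall>\<^sub>F z in nhds 0. eval2 equation (inv_into UNIV L z) * eval2 A (inv_into UNIV L z) = eval2 F z"
      using L(2) by (simp add: bij_is_surj surj_f_inv_f)
    have "F = E * a"
      by (rule expansion2_unique[OF expansion2_eval2[OF F(1)]
            expansion2_cong[OF expansion2_mult[OF E a] ev]])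
    with a show ?thesis by (auto simp: expansion2_def)
  qed
  from multiple[OF cf f(2)] obtain b where b: "convergent2 b" "f = E * b" by blast
  have "inv_into UNIV L 0 = 0"
  proof -
    interpret Vector_Spaces.linear cscale cscale "inv_into UNIV L" by (rule clinear_map_inv[OF L])
    show ?thesis by (rule zero)
  qed
  hence "coeff2 E 0 0 = 0"
    using expansion2_at_0[OF E] by (simp add: eval2_at_0 equation_0)
  hence "coeff2 (E * c) 0 0 \<noteq> coeff2 1 0 0" for c
    unfolding coeff2_mult by (simp add: coeff2_def[of 1])
  hence "E * c \<noteq> 1" for c by metis
  hence "E \<notin> Units local_ring"
    by (auto simp: Units_def)
  moreover have "irreducible local_ring f" using f(1) by (simp add: branch_def ring_irreducible_def)
  moreover have "E divides\<^bsub>local_ring\<^esub> f" using b by (auto simp: factor_def)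
  ultimately have "f divides\<^bsub>local_ring\<^esub> E"
    using cE unfolding irreducible_def properfactor_def by auto
  then obtain c where c: "convergent2 c" "E = f * c" by (auto simp: factor_def)
  from multiple[OF h] obtain a where "convergent2 a" "h = E * a" by blast
  thus ?thesis using c by (intro exI[of _ "c * a"]) (auto simp: convergent2_mult mult_ac)
qed

end

end

section \<open>The normalization of a curve with parametrized branches\<close>

definition eval_cpoly :: "complex poly \<Rightarrow> complex fps \<Rightarrow> complex fps" where
  "eval_cpoly p w = poly (map_poly fps_const p) w"

lemma eval_cpoly_pCons: "eval_cpoly (pCons a p) w = fps_const a + w * eval_cpoly p w"
  by (simp add: eval_cpoly_def map_poly_pCons)

lemma eval_cpoly_0: "eval_cpoly 0 w = 0"
  by (simp add: eval_cpoly_def)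

lemma eval_cpoly_1: "eval_cpoly 1 w = 1"
  by (simp add: eval_cpoly_def)

lemma eval_cpoly_add: "eval_cpoly (p + q) w = eval_cpoly p w + eval_cpoly q w"
proof (induction p arbitrary: q)
  case (pCons a p)
  obtain b r where "q = pCons b r" by (cases q) simp
  thus ?case
    by (simp add: eval_cpoly_pCons pCons.IH algebra_simps fps_const_add[symmetric] del: fps_const_add)
qed (simp add: eval_cpoly_0)

lemma eval_cpoly_smult: "eval_cpoly (Polynomial.smult a p) w = fps_const a * eval_cpoly p w"
  by (induction p)
     (simp_all add: eval_cpoly_0 eval_cpoly_pCons algebra_simps fps_const_mult[symmetric] del: fps_const_mult)

lemma eval_cpoly_mult: "eval_cpoly (p * q) w = eval_cpoly p w * eval_cpoly q w"
  by (induction p)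
     (simp_all add: eval_cpoly_0 eval_cpoly_pCons eval_cpoly_add eval_cpoly_smult algebra_simps)

lemma eval_cpoly_power: "eval_cpoly (p ^ n) w = eval_cpoly p w ^ n"
  by (induction n) (simp_all add: eval_cpoly_1 eval_cpoly_mult)

lemma eval_cpoly_prod: "eval_cpoly (\<Prod>i\<in>I. f i) w = (\<Prod>i\<in>I. eval_cpoly (f i) w)"
  by (induction I rule: infinite_finite_induct) (simp_all add: eval_cpoly_1 eval_cpoly_mult)

lemma eval_cpoly_altdef: "eval_cpoly p w = (\<Sum>i\<le>degree p. fps_const (coeff p i) * w ^ i)"
proof -
  have "degree (map_poly fps_const p) = degree p"
    by (rule degree_map_poly) auto
  thus ?thesis by (simp add: eval_cpoly_def poly_altdef coeff_map_poly)
qed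

text \<open>A Laurent series integral over the power series has no pole: the leading term of its
  highest power could not cancel.\<close>

lemma integral_fls_regular:
  fixes x :: "complex fls"
  assumes "x ^ n + (\<Sum>i<n. fps_to_fls (c i) * x ^ i) = 0"
  shows "fls_subdegree x \<ge> 0"
proof (rule ccontr)
  assume neg: "\<not> fls_subdegree x \<ge> 0"
  hence x: "x \<noteq> 0" by auto
  define s where "s = fls_subdegree x"
  have "fls_nth (fps_to_fls (c i) * x ^ i) (int n * s) = 0" if "i < n" for i
  proof (cases "c i = 0")
    case False
    have "int n * s < int i * s" using that neg by (simp add: s_def)
    also have "\<dots> \<le> fls_subdegree (fps_to_fls (c i) * x ^ i)"
      using False x by (simp add: fls_subdegree_pow s_def fls_subdegree_fls_to_fps)
    finally show ?thesis by (rule fls_eq0_below_subdegree)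
  qed simp
  hence "fls_nth (x ^ n) (int n * s) = 0"
    using arg_cong[OF assms, of "\<lambda>y. fls_nth y (int n * s)"] by (simp add: fls_nth_sum)
  moreover have "int n * s = fls_subdegree (x ^ n)" by (simp add: fls_subdegree_pow s_def)
  ultimately have "fls_nth (x ^ n) (fls_subdegree (x ^ n)) = 0" by simp
  thus False using x by (simp only: nth_fls_subdegree_zero_iff) simp
qed

definition vscale :: "complex \<Rightarrow> complex fps ^ 'n \<Rightarrow> complex fps ^ 'n" where
  "vscale c w = (\<chi> k. fps_const c * w $ k)"

lemma vscale_nth [simp]: "vscale c w $ k = fps_const c * w $ k"
  by (simp add: vscale_def)

lemma vector_space_vscale: "vector_space (vscale :: complex \<Rightarrow> complex fps ^ 'n \<Rightarrow> _)"
  by unfold_locales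
     (simp_all add: vec_eq_iff algebra_simps mult.assoc[symmetric] fps_const_add[symmetric] del: fps_const_add)

definition regular :: "(complex fps ^ 'n) set" where
  "regular = {w. \<forall>k. convergent1 (w $ k)}"

lemma subspace_regular: "module.subspace vscale (regular :: (complex fps ^ 'n) set)"
proof -
  interpret vector_space "vscale :: complex \<Rightarrow> complex fps ^ 'n \<Rightarrow> _" by (rule vector_space_vscale)
  show ?thesis by (intro subspaceI) (auto simp: regular_def)
qed

text \<open>The functions on a curve with branches indexed by \<open>'n\<close>, embedded by pulling back to the
  normalizations of the branches.\<close>

locale curve_model =
  fixes R :: "('a, 'b) ring_scheme" (structure) and \<iota> :: "'a \<Rightarrow> complex fps ^ 'n::finite"
    and cst :: "complex \<Rightarrow> 'a" and d :: nat
  assumes cring: "cring R"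
    and \<iota>_convergent: "\<And>a. a \<in> carrier R \<Longrightarrow> \<iota> a \<in> regular"
    and \<iota>_add: "\<And>a b. a \<in> carrier R \<Longrightarrow> b \<in> carrier R \<Longrightarrow> \<iota> (a \<oplus> b) = \<iota> a + \<iota> b"
    and \<iota>_mult: "\<And>a b k. a \<in> carrier R \<Longrightarrow> b \<in> carrier R \<Longrightarrow> \<iota> (a \<otimes> b) $ k = \<iota> a $ k * \<iota> b $ k"
    and \<iota>_one: "\<And>k. \<iota> \<one> $ k = 1"
    and \<iota>_inj: "\<And>a. a \<in> carrier R \<Longrightarrow> \<iota> a = 0 \<Longrightarrow> a = \<zero>"
    and conductor: "\<And>w. w \<in> regular \<Longrightarrow> (\<And>k n. n < d \<Longrightarrow> fps_nth (w $ k) n = 0) \<Longrightarrow> w \<in> \<iota> ` carrier R"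
    and cst: "\<And>c. cst c \<in> carrier R" "\<And>c k. \<iota> (cst c) $ k = fps_const c"
begin

sublocale R: cring R by (rule cring)

lemma \<iota>_zero: "\<iota> \<zero> = 0"
  using \<iota>_add[of "\<zero>" "\<zero>"] by simp

lemma \<iota>_neg: "a \<in> carrier R \<Longrightarrow> \<iota> (\<ominus> a) = - \<iota> a"
  using \<iota>_add[of a "\<ominus> a"] by (simp add: R.r_neg \<iota>_zero minus_unique)

lemma inj_\<iota>: "inj_on \<iota> (carrier R)"
proof (rule inj_onI)
  fix a b assume ab: "a \<in> carrier R" "b \<in> carrier R" "\<iota> a = \<iota> b"
  hence "\<iota> (a \<oplus> \<ominus> b) = 0" by (simp add: \<iota>_add \<iota>_neg)
  hence "a \<oplus> \<ominus> b = \<zero>" using ab by (intro \<iota>_inj) auto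
  thus "a = b" using ab by (metis R.a_inv_closed R.minus_equality R.minus_minus)
qed

text \<open>An element that vanishes on a branch is killed by a function that is supported on this branch, and
  such functions lie in the conductor.\<close>

lemma nonzerodivisors_iff:
  "b \<in> nonzerodivisors R \<longleftrightarrow> b \<in> carrier R \<and> (\<forall>k. \<iota> b $ k \<noteq> 0)"
proof (intro iffI conjI allI notI)
  assume b: "b \<in> nonzerodivisors R"
  thus bR: "b \<in> carrier R" by (simp add: nonzerodivisors_def)
  fix k assume k: "\<iota> b $ k = 0"
  define w :: "complex fps ^ 'n" where "w = (\<chi> j. if j = k then fps_X ^ d else 0)"
  have "w \<in> regular" "\<And>j n. n < d \<Longrightarrow> fps_nth (w $ j) n = 0"
    by (auto simp: regular_def w_def)
  from conductor[OF this] obtain a where a: "a \<in> carrier R" "\<iota> a = w" by auto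
  have "\<iota> (a \<otimes> b) = 0" using a bR k by (simp add: vec_eq_iff \<iota>_mult w_def)
  hence "a \<otimes> b = \<zero>" using a bR by (intro \<iota>_inj) auto
  hence "a = \<zero>" using b a by (auto simp: nonzerodivisors_def)
  hence "w $ k = 0" using a \<iota>_zero by simp
  thus False by (simp add: w_def)
next
  assume b: "b \<in> carrier R \<and> (\<forall>k. \<iota> b $ k \<noteq> 0)"
  show "b \<in> nonzerodivisors R"
    unfolding nonzerodivisors_def
  proof (intro CollectI conjI ballI impI)
    fix a assume a: "a \<in> carrier R" "a \<otimes> b = \<zero>"
    have "\<iota> a $ k * \<iota> b $ k = 0" for k using a b \<iota>_mult[of a b k] \<iota>_zero by simp
    hence "\<iota> a = 0" using b by (auto simp: vec_eq_iff)
    thus "a = \<zero>" using a by (intro \<iota>_inj) auto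
  qed (use b in auto)
qed

definition quot :: "'a \<times> 'a \<Rightarrow> 'n \<Rightarrow> complex fls" where
  "quot p k = fps_to_fls (\<iota> (fst p) $ k) / fps_to_fls (\<iota> (snd p) $ k)"

abbreviation fracs :: "('a \<times> 'a) set" where
  "fracs \<equiv> carrier R \<times> nonzerodivisors R"

lemma fraction_rel_iff: "(p, p') \<in> fraction_rel R \<longleftrightarrow> p \<in> fracs \<and> p' \<in> fracs \<and> quot p = quot p'"
proof -
  obtain a b c e where p: "p = (a, b)" "p' = (c, e)" by (cases p, cases p')
  have "a \<otimes> e = c \<otimes> b \<longleftrightarrow> quot p = quot p'" if *: "p \<in> fracs" "p' \<in> fracs"
  proof -
    have mem: "a \<in> carrier R" "c \<in> carrier R" "b \<in> carrier R" "e \<in> carrier R"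
      and nz: "\<iota> b $ k \<noteq> 0" "\<iota> e $ k \<noteq> 0" for k
      using * by (auto simp: p nonzerodivisors_iff)
    have "a \<otimes> e = c \<otimes> b \<longleftrightarrow> \<iota> (a \<otimes> e) = \<iota> (c \<otimes> b)"
      using inj_on_eq_iff[OF inj_\<iota>] mem by (metis R.m_closed)
    also have "\<dots> \<longleftrightarrow> (\<forall>k. \<iota> a $ k * \<iota> e $ k = \<iota> c $ k * \<iota> b $ k)"
      using mem by (simp add: vec_eq_iff \<iota>_mult)
    also have "\<dots> \<longleftrightarrow> (\<forall>k. fps_to_fls (\<iota> a $ k) * fps_to_fls (\<iota> e $ k) = fps_to_fls (\<iota> c $ k) * fps_to_fls (\<iota> b $ k))"
      by (simp add: fls_times_fps_to_fls[symmetric])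
    also have "\<dots> \<longleftrightarrow> quot p = quot p'"
      using nz by (simp add: quot_def p fun_eq_iff frac_eq_eq)
    finally show ?thesis .
  qed
  thus ?thesis unfolding fraction_rel_def by (auto simp: p)
qed

lemma fraction_altdef: "p \<in> fracs \<Longrightarrow> fraction R (fst p) (snd p) = {p' \<in> fracs. quot p' = quot p}"
  unfolding fraction_def Image_def by (auto simp: fraction_rel_iff)

abbreviation K where "K \<equiv> total_fractions R"

text \<open>The class of the fraction \<open>p\<close> in the total ring of fractions.\<close>

definition ratio :: "'a \<times> 'a \<Rightarrow> ('a \<times> 'a) set" where
  "ratio p = {p' \<in> fracs. quot p' = quot p}"

lemma fraction_ratio: "a \<in> carrier R \<Longrightarrow> b \<in> nonzerodivisors R \<Longrightarrow> fraction R a b = ratio (a, b)"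
  using fraction_altdef[of "(a, b)"] by (simp add: ratio_def)

lemma carrier_K: "carrier K = ratio ` fracs"
proof -
  have "carrier K = (\<lambda>p. fraction R (fst p) (snd p)) ` fracs"
    by (auto simp: total_fractions_def quotient_def fraction_def)
  also have "\<dots> = ratio ` fracs" by (rule image_cong) (auto simp: fraction_ratio)
  finally show ?thesis .
qed

definition \<Theta> :: "('a \<times> 'a) set \<Rightarrow> 'n \<Rightarrow> complex fls" where
  "\<Theta> X = quot (SOME p. p \<in> X)"

lemma \<Theta>_eq: "X \<in> carrier K \<Longrightarrow> p \<in> X \<Longrightarrow> \<Theta> X = quot p"
proof -
  assume X: "X \<in> carrier K" "p \<in> X"
  have "(SOME p. p \<in> X) \<in> X" using X(2) by (rule someI)
  thus ?thesis using X unfolding \<Theta>_def carrier_K ratio_def by auto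
qed

lemma ratio_self: "p \<in> fracs \<Longrightarrow> p \<in> ratio p"
  by (simp add: ratio_def)

lemma \<Theta>_ratio: "p \<in> fracs \<Longrightarrow> \<Theta> (ratio p) = quot p"
  by (rule \<Theta>_eq) (auto simp: carrier_K ratio_self)

lemma K_cases:
  assumes "X \<in> carrier K"
  obtains p where "p \<in> fracs" "X = ratio p" "\<Theta> X = quot p"
  using assms \<Theta>_ratio by (auto simp: carrier_K)

lemma inj_\<Theta>: "inj_on \<Theta> (carrier K)"
  by (rule inj_onI) (auto elim!: K_cases simp: ratio_def)

lemma nzd_mult: "b \<in> nonzerodivisors R \<Longrightarrow> e \<in> nonzerodivisors R \<Longrightarrow> b \<otimes> e \<in> nonzerodivisors R"
  by (auto simp: nonzerodivisors_iff \<iota>_mult)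

lemma nzd_one: "\<one> \<in> nonzerodivisors R"
  by (auto simp: nonzerodivisors_iff \<iota>_one)

lemma quot_mult:
  assumes "(a, b) \<in> fracs" "(c, e) \<in> fracs"
  shows "quot (a \<otimes> c, b \<otimes> e) k = quot (a, b) k * quot (c, e) k"
proof -
  have "b \<in> carrier R" "e \<in> carrier R" using assms by (auto simp: nonzerodivisors_iff)
  thus ?thesis using assms by (simp add: quot_def \<iota>_mult fls_times_fps_to_fls)
qed

lemma quot_add:
  assumes "(a, b) \<in> fracs" "(c, e) \<in> fracs"
  shows "quot (a \<otimes> e \<oplus> c \<otimes> b, b \<otimes> e) k = quot (a, b) k + quot (c, e) k"
proof -
  have "b \<in> carrier R" "e \<in> carrier R" "\<iota> b $ k \<noteq> 0" "\<iota> e $ k \<noteq> 0" using assms by (auto simp: nonzerodivisors_iff)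
  thus ?thesis using assms by (simp add: quot_def \<iota>_mult \<iota>_add fls_times_fps_to_fls add_frac_eq)
qed

lemma fraction_operation:
  assumes X: "X \<in> carrier K" and Y: "Y \<in> carrier K"
    and op: "\<And>p q. p \<in> fracs \<Longrightarrow> q \<in> fracs \<Longrightarrow> num p q \<in> carrier R \<and>
      quot (num p q, snd p \<otimes> snd q) = op (quot p) (quot q)"
  shows "(\<Union>p\<in>X. \<Union>q\<in>Y. fraction R (num p q) (snd p \<otimes> snd q)) \<in> carrier K \<and>
    \<Theta> (\<Union>p\<in>X. \<Union>q\<in>Y. fraction R (num p q) (snd p \<otimes> snd q)) = op (\<Theta> X) (\<Theta> Y)"
proof -
  obtain p where p: "p \<in> fracs" "X = ratio p" "\<Theta> X = quot p" using X by (rule K_cases)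
  obtain q where q: "q \<in> fracs" "Y = ratio q" "\<Theta> Y = quot q" using Y by (rule K_cases)
  have const: "fraction R (num p' q') (snd p' \<otimes> snd q') = ratio (num p q, snd p \<otimes> snd q)"
    if "p' \<in> X" "q' \<in> Y" for p' q'
  proof -
    have *: "p' \<in> fracs" "q' \<in> fracs" "quot p' = quot p" "quot q' = quot q"
      using that p q by (auto simp: ratio_def)
    hence "fraction R (num p' q') (snd p' \<otimes> snd q') = ratio (num p' q', snd p' \<otimes> snd q')"
      using op by (intro fraction_ratio nzd_mult) auto
    thus ?thesis using * op p(1) q(1) by (simp add: ratio_def)
  qed
  have "p \<in> X" "q \<in> Y" using p q ratio_self by auto
  hence "(\<Union>p\<in>X. \<Union>q\<in>Y. fraction R (num p q) (snd p \<otimes> snd q)) = ratio (num p q, snd p \<otimes> snd q)"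
    using const by blast
  moreover have "(num p q, snd p \<otimes> snd q) \<in> fracs" using p(1) q(1) op nzd_mult by (auto simp: mem_Times_iff)
  ultimately show ?thesis using op p q by (auto simp: carrier_K \<Theta>_ratio)
qed

lemma K_mult:
  assumes "X \<in> carrier K" "Y \<in> carrier K"
  shows "X \<otimes>\<^bsub>K\<^esub> Y \<in> carrier K" "\<Theta> (X \<otimes>\<^bsub>K\<^esub> Y) k = \<Theta> X k * \<Theta> Y k"
proof -
  have eq: "X \<otimes>\<^bsub>K\<^esub> Y = (\<Union>p\<in>X. \<Union>q\<in>Y. fraction R (fst p \<otimes> fst q) (snd p \<otimes> snd q))"
    by (simp only: total_fractions_def case_prod_unfold monoid.simps)
  have "X \<otimes>\<^bsub>K\<^esub> Y \<in> carrier K \<and> \<Theta> (X \<otimes>\<^bsub>K\<^esub> Y) = (\<lambda>k. \<Theta> X k * \<Theta> Y k)"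
    unfolding eq
    by (rule fraction_operation[OF assms, of "\<lambda>p q. fst p \<otimes> fst q" "\<lambda>x y k. x k * y k"])
       (auto simp: quot_mult fun_eq_iff)
  thus "X \<otimes>\<^bsub>K\<^esub> Y \<in> carrier K" "\<Theta> (X \<otimes>\<^bsub>K\<^esub> Y) k = \<Theta> X k * \<Theta> Y k" by simp_all
qed

lemma K_add:
  assumes "X \<in> carrier K" "Y \<in> carrier K"
  shows "X \<oplus>\<^bsub>K\<^esub> Y \<in> carrier K" "\<Theta> (X \<oplus>\<^bsub>K\<^esub> Y) k = \<Theta> X k + \<Theta> Y k"
proof -
  have eq: "X \<oplus>\<^bsub>K\<^esub> Y = (\<Union>p\<in>X. \<Union>q\<in>Y. fraction R (fst p \<otimes> snd q \<oplus> fst q \<otimes> snd p) (snd p \<otimes> snd q))"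
    by (simp only: total_fractions_def case_prod_unfold ring.simps)
  have "X \<oplus>\<^bsub>K\<^esub> Y \<in> carrier K \<and> \<Theta> (X \<oplus>\<^bsub>K\<^esub> Y) = (\<lambda>k. \<Theta> X k + \<Theta> Y k)"
    unfolding eq
    by (rule fraction_operation[OF assms, of "\<lambda>p q. fst p \<otimes> snd q \<oplus> fst q \<otimes> snd p" "\<lambda>x y k. x k + y k"])
       (auto simp: quot_add fun_eq_iff nonzerodivisors_iff)
  thus "X \<oplus>\<^bsub>K\<^esub> Y \<in> carrier K" "\<Theta> (X \<oplus>\<^bsub>K\<^esub> Y) k = \<Theta> X k + \<Theta> Y k" by simp_all
qed

lemma embed:
  assumes "a \<in> carrier R"
  shows "fraction_embed R a \<in> carrier K" "\<Theta> (fraction_embed R a) k = fps_to_fls (\<iota> a $ k)"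
proof -
  have *: "(a, \<one>) \<in> fracs" using assms nzd_one by auto
  have "fraction_embed R a = ratio (a, \<one>)"
    unfolding fraction_embed_def using assms nzd_one by (rule fraction_ratio)
  thus "fraction_embed R a \<in> carrier K" "\<Theta> (fraction_embed R a) k = fps_to_fls (\<iota> a $ k)"
    using * by (auto simp: carrier_K \<Theta>_ratio quot_def \<iota>_one)
qed

lemma K_zero_one:
  "\<zero>\<^bsub>K\<^esub> \<in> carrier K" "\<Theta> \<zero>\<^bsub>K\<^esub> k = 0" "\<one>\<^bsub>K\<^esub> \<in> carrier K" "\<Theta> \<one>\<^bsub>K\<^esub> k = 1"
  using embed[of "\<zero>"] embed[of "\<one>"]
  by (auto simp: total_fractions_def fraction_embed_def \<iota>_zero \<iota>_one)

lemma \<Theta>_eqI: "X \<in> carrier K \<Longrightarrow> Y \<in> carrier K \<Longrightarrow> (\<And>k. \<Theta> X k = \<Theta> Y k) \<Longrightarrow> X = Y"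
  using inj_onD[OF inj_\<Theta>] by blast

lemma cring_K: "cring K"
proof (rule cringI)
  show "abelian_group K"
  proof (rule abelian_groupI)
    fix X assume X: "X \<in> carrier K"
    then obtain p where p: "p \<in> fracs" "X = ratio p" by (rule K_cases)
    have m1: "(\<ominus> fst p, snd p) \<in> fracs" using p by auto
    show "\<exists>Y\<in>carrier K. Y \<oplus>\<^bsub>K\<^esub> X = \<zero>\<^bsub>K\<^esub>"
    proof (rule bexI[of _ "ratio (\<ominus> fst p, snd p)"])
      show mem: "ratio (\<ominus> fst p, snd p) \<in> carrier K" using m1 by (auto simp: carrier_K)
      show "ratio (\<ominus> fst p, snd p) \<oplus>\<^bsub>K\<^esub> X = \<zero>\<^bsub>K\<^esub>"
      proof (intro \<Theta>_eqI K_add mem X K_zero_one)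
        fix k
        have "fst p \<in> carrier R" using p(1) by auto
        hence "\<Theta> (ratio (\<ominus> fst p, snd p)) k + \<Theta> X k = 0"
          unfolding p(2) \<Theta>_ratio[OF m1] \<Theta>_ratio[OF p(1)] by (simp add: quot_def \<iota>_neg)
        thus "\<Theta> (ratio (\<ominus> fst p, snd p) \<oplus>\<^bsub>K\<^esub> X) k = \<Theta> \<zero>\<^bsub>K\<^esub> k"
          by (simp add: K_add(2)[OF mem X] K_zero_one)
      qed
    qed
  qed ((rule K_add(1) K_zero_one(1); assumption) |
      (rule \<Theta>_eqI; simp add: K_add K_zero_one add_ac))+
  show "comm_monoid K"
    by (rule comm_monoidI)
       ((rule K_mult(1) K_zero_one(3); assumption) | (rule \<Theta>_eqI; simp add: K_mult K_zero_one mult_ac))+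
qed (rule \<Theta>_eqI; simp add: K_add K_mult ring_distribs)

sublocale K: cring K by (rule cring_K)

lemma \<Theta>_pow: "X \<in> carrier K \<Longrightarrow> \<Theta> (X [^]\<^bsub>K\<^esub> (n::nat)) k = \<Theta> X k ^ n"
  by (induction n) (auto simp: K_mult K_zero_one)

lemma \<Theta>_neg: "X \<in> carrier K \<Longrightarrow> \<Theta> (\<ominus>\<^bsub>K\<^esub> X) k = - \<Theta> X k"
  using K_add(2)[of X "\<ominus>\<^bsub>K\<^esub> X" k] by (simp add: K.r_neg K_zero_one minus_unique)

lemma \<Theta>_finsum:
  "finite I \<Longrightarrow> (\<And>i. i \<in> I \<Longrightarrow> f i \<in> carrier K) \<Longrightarrow> \<Theta> (\<Oplus>\<^bsub>K\<^esub>i\<in>I. f i) k = (\<Sum>i\<in>I. \<Theta> (f i) k)"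
proof (induction I rule: finite_induct)
  case (insert i I)
  have "(\<Oplus>\<^bsub>K\<^esub>i\<in>insert i I. f i) = f i \<oplus>\<^bsub>K\<^esub> (\<Oplus>\<^bsub>K\<^esub>i\<in>I. f i)"
    using insert by (intro K.finsum_insert) auto
  thus ?case using insert by (simp add: K_add)
qed (simp add: K_zero_one)

lemma \<Theta>_equation:
  assumes "X \<in> carrier K" "\<And>i. i < n \<Longrightarrow> c i \<in> carrier K"
  shows "X [^]\<^bsub>K\<^esub> n \<oplus>\<^bsub>K\<^esub> (\<Oplus>\<^bsub>K\<^esub>i\<in>{..<n}. c i \<otimes>\<^bsub>K\<^esub> X [^]\<^bsub>K\<^esub> i) \<in> carrier K" (is ?closed)
    "\<Theta> (X [^]\<^bsub>K\<^esub> n \<oplus>\<^bsub>K\<^esub> (\<Oplus>\<^bsub>K\<^esub>i\<in>{..<n}. c i \<otimes>\<^bsub>K\<^esub> X [^]\<^bsub>K\<^esub> i)) k =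
       \<Theta> X k ^ n + (\<Sum>i<n. \<Theta> (c i) k * \<Theta> X k ^ i)" (is ?value)
proof -
  have *: "(\<Oplus>\<^bsub>K\<^esub>i\<in>{..<n}. c i \<otimes>\<^bsub>K\<^esub> X [^]\<^bsub>K\<^esub> i) \<in> carrier K"
    using assms by (intro K.finsum_closed) auto
  thus ?closed using assms by auto
  have "\<Theta> (\<Oplus>\<^bsub>K\<^esub>i\<in>{..<n}. c i \<otimes>\<^bsub>K\<^esub> X [^]\<^bsub>K\<^esub> i) k = (\<Sum>i<n. \<Theta> (c i \<otimes>\<^bsub>K\<^esub> X [^]\<^bsub>K\<^esub> i) k)"
    using assms by (intro \<Theta>_finsum) auto
  also have "\<dots> = (\<Sum>i<n. \<Theta> (c i) k * \<Theta> X k ^ i)"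
    using assms by (intro sum.cong) (auto simp: K_mult \<Theta>_pow)
  finally show ?value using * assms by (simp add: K_add \<Theta>_pow)
qed

text \<open>For \<open>w\<close> regular, the product of the differences of \<open>w\<close> and its values at the points over the
  origin vanishes at all these points, so a power of it lies in the conductor.\<close>

lemma regular_integral:
  assumes X: "X \<in> carrier K" and w: "w \<in> regular" "\<And>k. \<Theta> X k = fps_to_fls (w $ k)"
  shows "X \<in> normalization R"
proof -
  \<comment> \<open>the roots of \<open>p0\<close> are the values of \<open>w\<close> over the origin, so \<open>p0\<close> takes \<open>w\<close> to series without constant term\<close>
  define p0 where "p0 = (\<Prod>j\<in>(UNIV :: 'n set). [:- fps_nth (w $ j) 0, 1:])"
  define p where "p = p0 ^ Suc d"
  define n where "n = degree p"
  have dp0: "degree p0 = CARD('n)" unfolding p0_def by (subst degree_prod_eq_sum_degree) auto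
  have "lead_coeff p0 = 1" unfolding p0_def lead_coeff_prod by simp
  hence lp: "coeff p n = 1" unfolding n_def p_def lead_coeff_power by simp
  have "p0 \<noteq> 0" using dp0 by (metis degree_0 less_irrefl zero_less_card_finite)
  hence n: "n > 0" unfolding n_def p_def using dp0 by (simp add: degree_power_eq del: power_Suc)
  define r where "r = (\<chi> k. eval_cpoly p (w $ k))"
  have r_regular: "r \<in> regular" using w(1) unfolding r_def regular_def eval_cpoly_altdef by auto
  have r_order: "fps_nth (r $ k) i = 0" if "i < d" for i k
  proof -
    have "fps_nth (eval_cpoly p0 (w $ k)) 0 = 0"
      unfolding p0_def eval_cpoly_prod
      by (subst prod.remove[of _ k]) (auto simp: eval_cpoly_pCons eval_cpoly_0)
    hence "eval_cpoly p0 (w $ k) = fps_X * fps_shift 1 (eval_cpoly p0 (w $ k))"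
      by (intro fps_ext) (auto simp: fps_X_mult_nth)
    hence "r $ k = (fps_X * fps_shift 1 (eval_cpoly p0 (w $ k))) ^ Suc d"
      unfolding r_def p_def by (simp add: eval_cpoly_power del: power_Suc)
    also have "\<dots> = fps_X ^ Suc d * fps_shift 1 (eval_cpoly p0 (w $ k)) ^ Suc d"
      by (rule power_mult_distrib)
    finally show ?thesis using that by (simp only: fps_X_power_mult_nth) simp
  qed
  from conductor[OF r_regular r_order] obtain a where a: "a \<in> carrier R" "\<iota> a = r" by auto
  \<comment> \<open>the equation \<open>p(w) - r = 0\<close>, whose constant term lies in the ring because \<open>r\<close> lies in the conductor\<close>
  define c where "c = (\<lambda>i. fraction_embed R (if i = 0 then cst (coeff p 0) \<oplus> \<ominus> a else cst (coeff p i)))"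
  have c: "c i \<in> fraction_embed R ` carrier R" "c i \<in> carrier K"
    "\<Theta> (c i) k = fps_to_fls (fps_const (coeff p i) - (if i = 0 then r $ k else 0))" for i k
    unfolding c_def using a cst by (auto simp: embed \<iota>_add \<iota>_neg)
  have "\<Theta> X k ^ n + (\<Sum>i<n. \<Theta> (c i) k * \<Theta> X k ^ i) = 0" for k
  proof -
    have "(\<Sum>i<n. \<Theta> (c i) k * \<Theta> X k ^ i) =
        fps_to_fls (\<Sum>i<n. (fps_const (coeff p i) - (if i = 0 then r $ k else 0)) * (w $ k) ^ i)"
      by (simp only: c w fps_to_fls_power[symmetric] fls_times_fps_to_fls[symmetric])
         (induction n, simp_all)
    also have "(\<Sum>i<n. (fps_const (coeff p i) - (if i = 0 then r $ k else 0)) * (w $ k) ^ i) =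
        (\<Sum>i<n. fps_const (coeff p i) * (w $ k) ^ i) - (\<Sum>i<n. if i = 0 then r $ k else 0)"
      unfolding sum_subtractf[symmetric] by (intro sum.cong) (auto simp: algebra_simps)
    also have "(\<Sum>i<n. if i = 0 then r $ k else 0) = r $ k" using n by simp
    also have "r $ k = (\<Sum>i<n. fps_const (coeff p i) * (w $ k) ^ i) + (w $ k) ^ n"
      by (simp add: r_def eval_cpoly_altdef n_def[symmetric] lessThan_Suc_atMost[symmetric] lp)
    finally show ?thesis by (simp add: w fps_to_fls_power)
  qed
  hence "X [^]\<^bsub>K\<^esub> n \<oplus>\<^bsub>K\<^esub> (\<Oplus>\<^bsub>K\<^esub>i\<in>{..<n}. c i \<otimes>\<^bsub>K\<^esub> X [^]\<^bsub>K\<^esub> i) = \<zero>\<^bsub>K\<^esub>"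
    using X c by (intro \<Theta>_eqI \<Theta>_equation K_zero_one) (auto simp: \<Theta>_equation K_zero_one)
  thus ?thesis unfolding normalization_def integral_closure_def using X c by blast
qed

text \<open>An integral fraction has expansions without poles by \<open>integral_fls_regular\<close>, and they converge
  as quotients of convergent series. The converse is \<open>regular_integral\<close>.\<close>

lemma normalization_iff:
  "X \<in> normalization R \<longleftrightarrow> X \<in> carrier K \<and> (\<exists>w\<in>regular. \<forall>k. \<Theta> X k = fps_to_fls (w $ k))"
proof (intro iffI conjI)
  assume "X \<in> normalization R"
  then obtain n :: nat and c where X: "X \<in> carrier K" and c: "\<forall>i<n. c i \<in> fraction_embed R ` carrier R"
    and eq: "X [^]\<^bsub>K\<^esub> n \<oplus>\<^bsub>K\<^esub> (\<Oplus>\<^bsub>K\<^esub>i\<in>{..<n}. c i \<otimes>\<^bsub>K\<^esub> X [^]\<^bsub>K\<^esub> i) = \<zero>\<^bsub>K\<^esub>"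
    unfolding normalization_def integral_closure_def by (elim CollectE conjE exE)
  show "X \<in> carrier K" by fact
  from X obtain p where p: "p \<in> fracs" "\<Theta> X = quot p" by (rule K_cases)
  have cK: "c i \<in> carrier K" if "i < n" for i using c that embed by auto
  have cc: "\<exists>b. \<Theta> (c i) k = fps_to_fls b" if "i < n" for i k using c that embed by auto
  define w where "w = (\<chi> k. fls_regpart (\<Theta> X k))"
  have wk: "\<Theta> X k = fps_to_fls (w $ k)" for k
  proof -
    from cc have "\<forall>i. \<exists>b. i < n \<longrightarrow> \<Theta> (c i) k = fps_to_fls b" by blast
    then obtain b where b: "\<And>i. i < n \<Longrightarrow> \<Theta> (c i) k = fps_to_fls (b i)"
      using choice[of "\<lambda>i b. i < n \<longrightarrow> \<Theta> (c i) k = fps_to_fls b"] by auto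
    have "\<Theta> X k ^ n + (\<Sum>i<n. fps_to_fls (b i) * \<Theta> X k ^ i) = 0"
    proof -
      have "\<Theta> X k ^ n + (\<Sum>i<n. \<Theta> (c i) k * \<Theta> X k ^ i) =
          \<Theta> (X [^]\<^bsub>K\<^esub> n \<oplus>\<^bsub>K\<^esub> (\<Oplus>\<^bsub>K\<^esub>i\<in>{..<n}. c i \<otimes>\<^bsub>K\<^esub> X [^]\<^bsub>K\<^esub> i)) k"
        by (rule \<Theta>_equation(2)[OF X cK, symmetric])
      thus ?thesis by (simp add: eq K_zero_one b)
    qed
    hence "fls_subdegree (\<Theta> X k) \<ge> 0" by (rule integral_fls_regular)
    thus ?thesis by (simp add: w_def)
  qed
  have "convergent1 (w $ k)" for k
  proof -
    have p': "fst p \<in> carrier R" "snd p \<in> carrier R" "\<iota> (snd p) $ k \<noteq> 0"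
      using p by (auto simp: nonzerodivisors_iff)
    have "fps_to_fls (w $ k) = fps_to_fls (\<iota> (fst p) $ k) / fps_to_fls (\<iota> (snd p) $ k)"
      using wk[of k] p by (simp add: quot_def)
    hence "fps_to_fls (\<iota> (snd p) $ k * w $ k) = fps_to_fls (\<iota> (fst p) $ k)"
      using p' by (simp add: fls_times_fps_to_fls)
    hence "\<iota> (snd p) $ k * w $ k = \<iota> (fst p) $ k" by (simp only: fps_to_fls_eq_iff)
    thus ?thesis using convergent1_cofactor[of "\<iota> (snd p) $ k" "w $ k"] p' \<iota>_convergent
      by (auto simp: regular_def)
  qed
  thus "\<exists>w\<in>regular. \<forall>k. \<Theta> X k = fps_to_fls (w $ k)" using wk by (auto simp: regular_def)
next
  assume "X \<in> carrier K \<and> (\<exists>w\<in>regular. \<forall>k. \<Theta> X k = fps_to_fls (w $ k))"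
  thus "X \<in> normalization R" using regular_integral by blast
qed

text \<open>The expansions identify the normalization with all regular functions, since each is a quotient of
  two elements of the conductor.\<close>

theorem delta_eq:
  assumes "codim vscale regular (\<iota> ` carrier R) \<delta>"
  shows "quotient_dim K (\<lambda>c. fraction_embed R (cst c)) (normalization R)
    (fraction_embed R ` carrier R) = enat \<delta>"
proof -
  interpret vs: vector_space "vscale :: complex \<Rightarrow> complex fps ^ 'n \<Rightarrow> _" by (rule vector_space_vscale)
  define T where "T = (\<lambda>X. \<chi> k. fls_regpart (\<Theta> X k))"
  have T: "T X \<in> regular" "\<Theta> X k = fps_to_fls (T X $ k)" if "X \<in> normalization R" for X k
    using that unfolding normalization_iff T_def by auto
  have T_eq: "T X = w" if "X \<in> carrier K" "\<And>k. \<Theta> X k = fps_to_fls (w $ k)" for X w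
    using that by (simp add: T_def vec_eq_iff)
  have VK: "X \<in> carrier K" if "X \<in> normalization R" for X using that normalization_iff by blast
  have VI: "X \<in> normalization R" if "X \<in> carrier K" "w \<in> regular" "\<And>k. \<Theta> X k = fps_to_fls (w $ k)" for X w
    using that normalization_iff by blast
  note sub = subspace_regular[where 'n = 'n]
  have onto: "T ` normalization R = regular"
  proof (intro equalityI subsetI)
    fix w :: "complex fps ^ 'n" assume w: "w \<in> regular"
    \<comment> \<open>\<open>w = y / x\<close>, with \<open>x\<close> and \<open>y\<close> in the conductor\<close>
    define x :: "complex fps ^ 'n" where "x = (\<chi> k. fps_X ^ d)"
    define y where "y = (\<chi> k. fps_X ^ d * w $ k)"
    have "x \<in> \<iota> ` carrier R" by (rule conductor) (auto simp: x_def regular_def)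
    moreover have "y \<in> \<iota> ` carrier R"
      by (rule conductor) (use w in \<open>auto simp: y_def regular_def fps_X_power_mult_nth\<close>)
    ultimately obtain a b where ab: "a \<in> carrier R" "b \<in> carrier R" "\<iota> a = y" "\<iota> b = x" by auto
    hence mem: "(a, b) \<in> fracs" by (auto simp: nonzerodivisors_iff x_def)
    have "\<Theta> (ratio (a, b)) k = fps_to_fls (w $ k)" for k
      using ab by (simp add: \<Theta>_ratio[OF mem] quot_def x_def y_def fls_times_fps_to_fls)
    moreover have "ratio (a, b) \<in> carrier K" using mem by (auto simp: carrier_K)
    ultimately show "w \<in> T ` normalization R" using VI w T_eq by (metis image_eqI)
  qed (use T in auto)
  show ?thesis
  proof (rule quotient_dim_eq[where \<Theta> = T and scale = vscale and W' = "\<iota> ` carrier R"])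
    show "ring K" by (rule K.ring_axioms)
    show "normalization R \<subseteq> carrier K" using VK by blast
    show "fraction_embed R (cst c) \<in> carrier K" for c using embed cst by blast
    show "\<zero>\<^bsub>K\<^esub> \<in> normalization R"
      by (rule VI[of _ 0]) (auto simp: K_zero_one regular_def)
    show add: "X \<oplus>\<^bsub>K\<^esub> Y \<in> normalization R" if "X \<in> normalization R" "Y \<in> normalization R" for X Y
      by (rule VI[of _ "T X + T Y"])
         (use that T VK vs.subspace_add[OF sub] in \<open>auto simp: K_add\<close>)
    show "\<ominus>\<^bsub>K\<^esub> X \<in> normalization R" if "X \<in> normalization R" for X
      by (rule VI[of _ "- T X"])
         (use that T VK vs.subspace_neg[OF sub] in \<open>auto simp: \<Theta>_neg\<close>)
    show scal: "fraction_embed R (cst c) \<otimes>\<^bsub>K\<^esub> X \<in> normalization R" if "X \<in> normalization R" for c X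
      by (rule VI[of _ "vscale c (T X)"])
         (use that T VK embed cst vs.subspace_scale[OF sub] in \<open>auto simp: K_mult fls_times_fps_to_fls\<close>)
    show "T (X \<oplus>\<^bsub>K\<^esub> Y) = T X + T Y" if "X \<in> normalization R" "Y \<in> normalization R" for X Y
      by (rule T_eq) (use that T VK in \<open>auto simp: K_add\<close>)
    show "T (fraction_embed R (cst c) \<otimes>\<^bsub>K\<^esub> X) = vscale c (T X)" if "X \<in> normalization R" for c X
      by (rule T_eq) (use that T VK embed cst in \<open>auto simp: K_mult fls_times_fps_to_fls\<close>)
    show "inj_on T (normalization R)"
    proof (rule inj_onI)
      fix X Y assume XY: "X \<in> normalization R" "Y \<in> normalization R" "T X = T Y"
      show "X = Y" by (rule \<Theta>_eqI) (use XY T VK in auto)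
    qed
    show "X \<in> fraction_embed R ` carrier R \<longleftrightarrow> T X \<in> \<iota> ` carrier R" if X: "X \<in> normalization R" for X
    proof
      assume "X \<in> fraction_embed R ` carrier R"
      then obtain a where a: "a \<in> carrier R" "X = fraction_embed R a" by blast
      have "T X = \<iota> a" by (rule T_eq) (use a embed in auto)
      thus "T X \<in> \<iota> ` carrier R" using a by blast
    next
      assume "T X \<in> \<iota> ` carrier R"
      then obtain a where a: "a \<in> carrier R" "T X = \<iota> a" by blast
      have "X = fraction_embed R a" by (rule \<Theta>_eqI) (use a X T VK embed in auto)
      thus "X \<in> fraction_embed R ` carrier R" using a by blast
    qed
    show "vector_space (vscale :: complex \<Rightarrow> complex fps ^ 'n \<Rightarrow> _)" by (rule vector_space_vscale)
    show "vs.subspace (\<iota> ` carrier R)"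
    proof (rule vs.subspaceI)
      show "0 \<in> \<iota> ` carrier R" using \<iota>_zero by (metis R.zero_closed image_eqI)
      show "x + y \<in> \<iota> ` carrier R" if "x \<in> \<iota> ` carrier R" "y \<in> \<iota> ` carrier R" for x y
        using that by (auto simp: \<iota>_add[symmetric])
      show "vscale c x \<in> \<iota> ` carrier R" if "x \<in> \<iota> ` carrier R" for c x
      proof -
        from that obtain a where a: "a \<in> carrier R" "x = \<iota> a" by blast
        hence "vscale c x = \<iota> (cst c \<otimes> a)" using cst by (simp add: vec_eq_iff \<iota>_mult)
        thus ?thesis using a cst by blast
      qed
    qed
    show "codim vscale (T ` normalization R) (\<iota> ` carrier R) \<delta>" using assms onto by simp
  qed
qed

end

section \<open>Delta invariants and intersection multiplicities from parametrizations\<close>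

lemma Idl_local_ring:
  assumes "convergent2 f" "convergent2 g"
  shows "Idl\<^bsub>local_ring\<^esub> {f, g} = {a * f + b * g | a b. convergent2 a \<and> convergent2 b}" (is "_ = ?I")
proof
  have I: "ideal ?I local_ring"
  proof (rule idealI[OF local_ring.ring_axioms])
    show "subgroup ?I (add_monoid local_ring)"
    proof (rule local_ring.add.subgroupI)
      show "?I \<subseteq> carrier local_ring" using assms by (auto intro!: convergent2_add convergent2_mult)
      have "0 * f + 0 * g \<in> ?I" by (rule CollectI) (use convergent2_0 in blast)
      thus "?I \<noteq> {}" by blast
    next
      fix x assume "x \<in> ?I"
      then obtain a b where ab: "x = a * f + b * g" "convergent2 a" "convergent2 b" by blast
      have "convergent2 x" using ab assms by (simp add: convergent2_add convergent2_mult)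
      hence "\<ominus>\<^bsub>local_ring\<^esub> x = (- a) * f + (- b) * g" using ab by (simp add: local_ring_a_inv)
      thus "\<ominus>\<^bsub>local_ring\<^esub> x \<in> ?I" using ab convergent2_uminus by blast
    next
      fix x y assume "x \<in> ?I" "y \<in> ?I"
      then obtain a b a' b' where "x = a * f + b * g" "convergent2 a" "convergent2 b"
        "y = a' * f + b' * g" "convergent2 a'" "convergent2 b'" by blast
      moreover from this have "x + y = (a + a') * f + (b + b') * g" by (simp add: algebra_simps)
      ultimately show "x \<oplus>\<^bsub>local_ring\<^esub> y \<in> ?I" using convergent2_add by auto
    qed
  next
    fix x y assume "x \<in> ?I" and y: "y \<in> carrier local_ring"
    then obtain a b where ab: "x = a * f + b * g" "convergent2 a" "convergent2 b" by blast
    have "y * x = (y * a) * f + (y * b) * g" by (simp add: ab algebra_simps)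
    thus "y \<otimes>\<^bsub>local_ring\<^esub> x \<in> ?I" using ab y convergent2_mult by auto
    thus "x \<otimes>\<^bsub>local_ring\<^esub> y \<in> ?I" by (simp add: mult.commute)
  qed
  have "f = 1 * f + 0 * g" "g = 0 * f + 1 * g" by simp_all
  hence "{f, g} \<subseteq> ?I" using convergent2_0 convergent2_1 by blast
  thus "Idl\<^bsub>local_ring\<^esub> {f, g} \<subseteq> ?I" by (rule local_ring.genideal_minimal[OF I])
  have J: "ideal (Idl\<^bsub>local_ring\<^esub> {f, g}) local_ring" using assms by (intro local_ring.genideal_ideal) auto
  interpret J: ideal "Idl\<^bsub>local_ring\<^esub> {f, g}" local_ring by (rule J)
  have "{f, g} \<subseteq> Idl\<^bsub>local_ring\<^esub> {f, g}" using assms by (intro local_ring.genideal_self) auto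
  hence fg: "f \<in> Idl\<^bsub>local_ring\<^esub> {f, g}" "g \<in> Idl\<^bsub>local_ring\<^esub> {f, g}" by auto
  show "?I \<subseteq> Idl\<^bsub>local_ring\<^esub> {f, g}"
  proof clarify
    fix a b assume ab: "convergent2 a" "convergent2 b"
    have "a \<otimes>\<^bsub>local_ring\<^esub> f \<oplus>\<^bsub>local_ring\<^esub> b \<otimes>\<^bsub>local_ring\<^esub> g \<in> Idl\<^bsub>local_ring\<^esub> {f, g}"
      using ab fg by (intro J.a_closed J.I_l_closed) auto
    thus "a * f + b * g \<in> Idl\<^bsub>local_ring\<^esub> {f, g}" by simp
  qed
qed

text \<open>The curve ring of \<open>h\<close> is modelled by the pullbacks along the branches, which are well defined
  and injective on classes modulo \<open>h\<close>.\<close>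

lemma delta_invariant_eq:
  fixes \<gamma> :: "'n::finite \<Rightarrow> complex \<Rightarrow> C2"
  assumes h: "convergent2 h" and arc: "\<And>k. analytic_arc (\<gamma> k)"
    and ker: "\<And>F. convergent2 F \<Longrightarrow> (\<forall>k. pullback (\<gamma> k) F = 0) \<longleftrightarrow> (\<exists>a. convergent2 a \<and> F = a * h)"
    and cond: "\<And>w. w \<in> regular \<Longrightarrow> (\<And>k n. n < d \<Longrightarrow> fps_nth (w $ k) n = 0) \<Longrightarrow>
      \<exists>F. convergent2 F \<and> (\<forall>k. pullback (\<gamma> k) F = w $ k)"
    and cod: "codim vscale regular {\<chi> k. pullback (\<gamma> k) F | F. convergent2 F} \<delta>"
  shows "delta_invariant h = enat \<delta>"
proof -
  define I where "I = PIdl\<^bsub>local_ring\<^esub> h"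
  have I_eq: "I = {a * h | a. convergent2 a}" unfolding I_def by (rule PIdl_local_ring)
  interpret I: ideal I local_ring unfolding I_def using h by (intro local_ring.cgenideal_ideal) auto
  define coset where "coset = (\<lambda>F. I +>\<^bsub>local_ring\<^esub> F)"
  have coset_eq: "coset F = {x + F | x. x \<in> I}" for F
    unfolding coset_def a_r_coset_def' by auto
  define \<iota> :: "complex fps fps set \<Rightarrow> complex fps ^ 'n" where
    "\<iota> = (\<lambda>C. \<chi> k. pullback (\<gamma> k) (SOME F. F \<in> C))"
  have \<iota>_coset: "\<iota> (coset F) = (\<chi> k. pullback (\<gamma> k) F)" if F: "convergent2 F" for F
  proof -
    have "0 + F \<in> coset F" unfolding coset_eq I_eq using convergent2_0 by (intro CollectI exI[of _ 0]) auto
    hence "(SOME F'. F' \<in> coset F) \<in> coset F" by (rule someI)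
    then obtain a where a: "convergent2 a" "(SOME F'. F' \<in> coset F) = a * h + F" by (auto simp: coset_eq I_eq)
    have ah: "convergent2 (a * h)" using a h by (intro convergent2_mult)
    hence "pullback (\<gamma> k) (a * h) = 0" for k using ker a by blast
    thus ?thesis unfolding \<iota>_def a(2) by (simp add: pullback_add[OF arc ah F])
  qed
  let ?R = "curve_ring h"
  have R: "?R = local_ring Quot I" by (simp add: curve_ring_def I_def)
  have carrier: "carrier ?R = coset ` {F. convergent2 F}"
    by (auto simp: R FactRing_def A_RCOSETS_def' coset_def)
  have add: "coset F \<oplus>\<^bsub>?R\<^esub> coset G = coset (F + G)" if "convergent2 F" "convergent2 G" for F G
    using I.a_rcos_sum[of F G] that by (simp add: R FactRing_def coset_def)
  have mult: "coset F \<otimes>\<^bsub>?R\<^esub> coset G = coset (F * G)" if "convergent2 F" "convergent2 G" for F G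
    using I.rcoset_mult_add[of F G] that by (simp add: R FactRing_def coset_def)
  have one: "\<one>\<^bsub>?R\<^esub> = coset 1" by (simp add: R FactRing_def coset_def)
  have zero: "\<zero>\<^bsub>?R\<^esub> = I" by (simp add: R FactRing_def)
  have "curve_model ?R \<iota> (\<lambda>c. coset (const2 c)) d"
  proof (rule curve_model.intro)
    show "cring ?R" unfolding R by (rule I.quotient_is_cring) (rule local_ring.is_cring)
    show "\<iota> C \<in> regular" if "C \<in> carrier ?R" for C
      using that convergent1_pullback[OF arc] by (auto simp: carrier \<iota>_coset regular_def)
    show "\<iota> (C \<oplus>\<^bsub>?R\<^esub> D) = \<iota> C + \<iota> D" if "C \<in> carrier ?R" "D \<in> carrier ?R" for C D
      using that by (auto simp: carrier add \<iota>_coset convergent2_add vec_eq_iff pullback_add[OF arc])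
    show "\<iota> (C \<otimes>\<^bsub>?R\<^esub> D) $ k = \<iota> C $ k * \<iota> D $ k" if "C \<in> carrier ?R" "D \<in> carrier ?R" for C D k
      using that by (auto simp: carrier mult \<iota>_coset convergent2_mult pullback_mult[OF arc])
    show "\<iota> \<one>\<^bsub>?R\<^esub> $ k = 1" for k
      using pullback_const2[OF arc, of k 1] by (simp add: one \<iota>_coset const2_1)
    show "C = \<zero>\<^bsub>?R\<^esub>" if "C \<in> carrier ?R" "\<iota> C = 0" for C
    proof -
      from that obtain F where F: "convergent2 F" "C = coset F" by (auto simp: carrier)
      hence "\<forall>k. pullback (\<gamma> k) F = 0" using that by (simp add: \<iota>_coset vec_eq_iff)
      hence "F \<in> I" using ker F by (auto simp: I_eq)
      thus ?thesis unfolding zero F(2) coset_def by (rule I.a_rcos_const)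
    qed
    show "w \<in> \<iota> ` carrier ?R" if w: "w \<in> regular" "\<And>k n. n < d \<Longrightarrow> fps_nth (w $ k) n = 0" for w :: "complex fps ^ 'n"
    proof -
      from cond[OF w] obtain F where F: "convergent2 F" "\<And>k. pullback (\<gamma> k) F = w $ k" by blast
      hence "\<iota> (coset F) = w" by (simp add: \<iota>_coset vec_eq_iff)
      thus ?thesis using F by (auto simp: carrier)
    qed
    show "coset (const2 c) \<in> carrier ?R" for c by (auto simp: carrier)
    show "\<iota> (coset (const2 c)) $ k = fps_const c" for c k
      by (simp add: \<iota>_coset pullback_const2[OF arc])
  qed
  then interpret model: curve_model ?R \<iota> "\<lambda>c. coset (const2 c)" d .
  have "\<iota> ` carrier ?R = {\<chi> k. pullback (\<gamma> k) F | F. convergent2 F}"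
    unfolding carrier image_image using \<iota>_coset by (force simp: image_iff)
  hence "codim vscale regular (\<iota> ` carrier ?R) \<delta>" using cod by simp
  from model.delta_eq[OF this] show ?thesis
    unfolding delta_invariant_def coset_def I_def .
qed

text \<open>A local equation \<open>f\<close> with a parametrization \<open>\<gamma>\<close> that generates the kernel of the pullback along
  \<open>\<gamma>\<close>; \<open>\<delta>\<close> is the codimension of the pullbacks, and every convergent series of order at least \<open>d\<close> is a pullback.\<close>

locale branch_arc =
  fixes f :: "complex fps fps" and \<gamma> :: "complex \<Rightarrow> C2" and \<delta> d :: nat
  assumes f: "convergent2 f" "f \<noteq> 0" and arc: "analytic_arc \<gamma>"
    and pullback_self: "pullback \<gamma> f = 0"
    and kernel: "\<And>h. convergent2 h \<Longrightarrow> pullback \<gamma> h = 0 \<Longrightarrow> \<exists>a. convergent2 a \<and> h = a * f"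
    and conductor: "\<And>x. convergent1 x \<Longrightarrow> (\<And>n. n < d \<Longrightarrow> fps_nth x n = 0) \<Longrightarrow> x \<in> pullback \<gamma> ` {F. convergent2 F}"
    and codim: "codim fscale {x. convergent1 x} (pullback \<gamma> ` {F. convergent2 F}) \<delta>"
begin

abbreviation image_ring where "image_ring \<equiv> pullback \<gamma> ` {F. convergent2 F}"

lemma pullback_multiple: "convergent2 a \<Longrightarrow> pullback \<gamma> (a * f) = 0"
  by (simp add: pullback_mult[OF arc] f pullback_self)

lemma subspace_image_ring: "module.subspace fscale image_ring"
proof -
  interpret vector_space fscale by (rule vector_space_fscale)
  show ?thesis
  proof (rule subspaceI)
    show "0 \<in> image_ring" using pullback_const2[OF arc, of 0] by (force simp: const2_0)
    show "x + y \<in> image_ring" if "x \<in> image_ring" "y \<in> image_ring" for x y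
      using that by (auto simp: pullback_add[OF arc, symmetric] intro: convergent2_add)
    show "fps_const c * x \<in> image_ring" if "x \<in> image_ring" for c x
    proof -
      from that obtain F where F: "convergent2 F" "x = pullback \<gamma> F" by blast
      hence "fps_const c * x = pullback \<gamma> (const2 c * F)"
        by (simp add: pullback_const2[OF arc] pullback_mult[OF arc])
      thus ?thesis using F convergent2_mult[OF convergent2_const2] by blast
    qed
  qed
qed

lemma image_ring_convergent: "image_ring \<subseteq> {x. convergent1 x}"
  using convergent1_pullback[OF arc] by auto

lemma delta_invariant: "delta_invariant f = enat \<delta>"
proof (rule delta_invariant_eq[where \<gamma> = "\<lambda>_::unit. \<gamma>" and d = d])
  show "(\<forall>k. pullback \<gamma> F = 0) \<longleftrightarrow> (\<exists>a. convergent2 a \<and> F = a * f)" if "convergent2 F" for F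
    using kernel[OF that] pullback_multiple by auto
  show "\<exists>F. convergent2 F \<and> (\<forall>k. pullback \<gamma> F = w $ k)"
    if "w \<in> regular" "\<And>k n. n < d \<Longrightarrow> fps_nth (w $ k) n = 0" for w :: "complex fps ^ unit"
  proof -
    have "w $ () \<in> image_ring" using that by (intro conductor) (auto simp: regular_def)
    thus ?thesis by force
  qed
  interpret vs: vector_space "vscale :: complex \<Rightarrow> complex fps ^ unit \<Rightarrow> _" by (rule vector_space_vscale)
  show "codim vscale (regular :: (complex fps ^ unit) set) {\<chi> k. pullback \<gamma> F | F. convergent2 F} \<delta>"
  proof (rule codim_vimage[OF vector_space_vscale subspace_regular, where h = "\<lambda>w. w $ ()" and sb = fscale
        and V' = "{x. convergent1 x}" and W' = image_ring])
    show "(\<lambda>w. w $ ()) ` (regular :: (complex fps ^ unit) set) = {x. convergent1 x}"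
    proof (intro equalityI subsetI)
      fix x assume "x \<in> {x. convergent1 x}"
      thus "x \<in> (\<lambda>w. w $ ()) ` (regular :: (complex fps ^ unit) set)"
        by (intro image_eqI[of _ _ "\<chi> _. x"]) (auto simp: regular_def)
    qed (auto simp: regular_def)
    show "w \<in> {\<chi> k. pullback \<gamma> F | F. convergent2 F} \<longleftrightarrow> w $ () \<in> image_ring" for w :: "complex fps ^ unit"
      by (auto simp: vec_eq_iff image_iff)
    show "{\<chi> k. pullback \<gamma> F | F. convergent2 F} \<subseteq> (regular :: (complex fps ^ unit) set)"
      using convergent1_pullback[OF arc] by (auto simp: regular_def)
  qed (auto intro: codim)
qed (use f arc in auto)

text \<open>Multiplication by \<open>G\<close> identifies the quotient of the normalization by the functions with that
  of their multiples, and the multiples of \<open>G\<close> in the normalization have as codimension the order of \<open>G\<close>.\<close>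

lemma codim_multiples:
  assumes G: "G \<in> image_ring" "G \<noteq> 0"
  shows "codim fscale image_ring ((*) G ` image_ring) (subdegree G)"
proof -
  interpret vector_space fscale by (rule vector_space_fscale)
  define V where "V = {x. convergent1 x}"
  have Gc: "convergent1 G" using G image_ring_convergent by auto
  have GV: "(*) G ` V = {A. convergent1 A \<and> (\<forall>n<subdegree G. fps_nth A n = 0)}"
  proof (intro equalityI subsetI)
    fix A assume "A \<in> (*) G ` V"
    then obtain x where x: "convergent1 x" "A = G * x" by (auto simp: V_def)
    have "fps_nth A n = 0" if "n < subdegree G" for n
      unfolding x(2) by (rule fps_nth_prod_eq_0[of "subdegree G"]) (use that nth_less_subdegree_zero in auto)
    thus "A \<in> {A. convergent1 A \<and> (\<forall>n<subdegree G. fps_nth A n = 0)}" using x Gc by auto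
  next
    fix A assume "A \<in> {A. convergent1 A \<and> (\<forall>n<subdegree G. fps_nth A n = 0)}"
    thus "A \<in> (*) G ` V" using convergent1_quotient[of A G 0] G Gc by (auto simp: V_def)
  qed
  have 1: "codim fscale V ((*) G ` V) (subdegree G)"
    unfolding GV unfolding V_def by (rule codim_fps_truncation)
  have sGV: "subspace ((*) G ` V)" unfolding GV by (intro subspaceI) auto
  have GRV: "(*) G ` image_ring \<subseteq> (*) G ` V" using image_ring_convergent by (auto simp: V_def)
  have 2: "codim fscale ((*) G ` V) ((*) G ` image_ring) \<delta>"
    by (rule codim_vimage[OF vector_space_fscale sGV, where h = "\<lambda>y. y div G" and sb = fscale and V' = V
          and W' = image_ring])
       (use G codim GRV in \<open>auto simp: V_def image_image distrib_left[symmetric] mult.left_commute[of _ G]\<close>)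
  have sGR: "subspace ((*) G ` image_ring)"
  proof (rule subspaceI)
    show "0 \<in> (*) G ` image_ring" using subspace_0[OF subspace_image_ring] by force
    show "x + y \<in> (*) G ` image_ring" if "x \<in> (*) G ` image_ring" "y \<in> (*) G ` image_ring" for x y
    proof -
      from that obtain a b where "a \<in> image_ring" "b \<in> image_ring" "x = G * a" "y = G * b" by blast
      thus ?thesis using subspace_add[OF subspace_image_ring, of a b]
        by (intro image_eqI[of _ _ "a + b"]) (auto simp: algebra_simps)
    qed
    show "fps_const c * x \<in> (*) G ` image_ring" if "x \<in> (*) G ` image_ring" for c x
    proof -
      from that obtain a where "a \<in> image_ring" "x = G * a" by blast
      thus ?thesis using subspace_scale[OF subspace_image_ring, of a c]
        by (intro image_eqI[of _ _ "fps_const c * a"]) (auto simp: algebra_simps)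
    qed
  qed
  have GVV: "(*) G ` V \<subseteq> V" using Gc by (auto simp: V_def)
  have GRR: "(*) G ` image_ring \<subseteq> image_ring"
    using G by (auto simp: pullback_mult[OF arc, symmetric] intro: convergent2_mult)
  have "codim fscale V ((*) G ` image_ring) (subdegree G + \<delta>)"
    by (rule codim_trans[OF sGV GVV GRV 1 2])
  from codim_intermediate[OF subspace_image_ring GRR _ sGR this] obtain k l where
    kl: "codim fscale V image_ring k" "codim fscale image_ring ((*) G ` image_ring) l" "k + l = subdegree G + \<delta>"
    using image_ring_convergent by (auto simp: V_def)
  have "k = \<delta>" using codim_unique[OF subspace_image_ring kl(1)] codim by (auto simp: V_def)
  with kl show ?thesis by simp
qed

end

locale two_branches = A: branch_arc f \<gamma> \<delta> d + B: branch_arc g \<gamma>' \<delta>' d'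
  for f \<gamma> \<delta> d g \<gamma>' \<delta>' d' +
  assumes transverse: "pullback \<gamma> g \<noteq> 0"
begin

lemma in_ideal_iff:
  assumes h: "convergent2 h"
  shows "(\<exists>a b. convergent2 a \<and> convergent2 b \<and> h = a * f + b * g) \<longleftrightarrow>
    pullback \<gamma> h \<in> (*) (pullback \<gamma> g) ` A.image_ring"
proof
  assume "\<exists>a b. convergent2 a \<and> convergent2 b \<and> h = a * f + b * g"
  then obtain a b where ab: "convergent2 a" "convergent2 b" "h = a * f + b * g" by blast
  have "pullback \<gamma> h = pullback \<gamma> g * pullback \<gamma> b"
    using ab A.f B.f by (simp add: pullback_add[OF A.arc] convergent2_mult A.pullback_self pullback_mult[OF A.arc])
  thus "pullback \<gamma> h \<in> (*) (pullback \<gamma> g) ` A.image_ring" using ab by auto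
next
  assume "pullback \<gamma> h \<in> (*) (pullback \<gamma> g) ` A.image_ring"
  then obtain b where b: "convergent2 b" "pullback \<gamma> h = pullback \<gamma> g * pullback \<gamma> b" by auto
  have "pullback \<gamma> (h - b * g) = 0"
    using b h B.f by (simp add: pullback_diff[OF A.arc] convergent2_mult pullback_mult[OF A.arc])
  then obtain a where "convergent2 a" "h - b * g = a * f"
    using A.kernel[of "h - b * g"] b h B.f by (auto intro: convergent2_diff convergent2_mult)
  thus "\<exists>a b. convergent2 a \<and> convergent2 b \<and> h = a * f + b * g"
    using b by (intro exI[of _ a] exI[of _ b]) (auto simp: algebra_simps)
qed

lemma g_in: "pullback \<gamma> g \<in> A.image_ring"
  using B.f by auto

text \<open>The quotient by \<open>f\<close> is the ring of pullbacks along \<open>\<gamma>\<close>, and that by \<open>f\<close> and \<open>g\<close> is its quotient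
  by the multiples of the pullback of \<open>g\<close>.\<close>

theorem intersection_mult: "intersection_mult f g = enat (subdegree (pullback \<gamma> g))"
  unfolding intersection_mult_def
proof (rule quotient_dim_eq[where \<Theta> = "\<lambda>x. x" and scale = "\<lambda>c x. const2 c * x"
      and W' = "Idl\<^bsub>local_ring\<^esub> {f, g}"])
  let ?I = "Idl\<^bsub>local_ring\<^esub> {f, g}"
  show "ring local_ring" by (rule local_ring.ring_axioms)
  show vs: "vector_space (\<lambda>c x. const2 c * x)"
    by unfold_locales
      (simp_all add: algebra_simps const2_def fps_const_add[symmetric] fps_const_mult[symmetric] const2_1[unfolded const2_def]
        del: fps_const_add fps_const_mult)
  interpret vs: vector_space "\<lambda>c x. const2 c * x" by (rule vs)
  have memI: "x \<in> ?I \<longleftrightarrow> convergent2 x \<and> pullback \<gamma> x \<in> (*) (pullback \<gamma> g) ` A.image_ring" for x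
    unfolding Idl_local_ring[OF A.f(1) B.f(1)] using in_ideal_iff[of x] A.f B.f
    by (auto intro: convergent2_add convergent2_mult)
  interpret J: ideal "?I" local_ring
    using A.f B.f by (intro local_ring.genideal_ideal) auto
  show "vs.subspace (?I)"
  proof (rule vs.subspaceI)
    show "0 \<in> ?I" using J.zero_closed by simp
    show "x + y \<in> ?I" if "x \<in> ?I" "y \<in> ?I" for x y
      using J.a_closed[OF that] by simp
    show "const2 c * x \<in> ?I" if "x \<in> ?I" for c x
      using J.I_l_closed[OF that, of "const2 c"] by simp
  qed
  have V: "vs.subspace {F. convergent2 F}"
    by (intro vs.subspaceI) (auto intro: convergent2_add convergent2_mult)
  have "codim (\<lambda>c x. const2 c * x) {F. convergent2 F} (?I) (subdegree (pullback \<gamma> g))"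
    by (rule codim_vimage[OF vs V, where h = "pullback \<gamma>" and sb = fscale and V' = A.image_ring
          and W' = "(*) (pullback \<gamma> g) ` A.image_ring"])
       (use A.codim_multiples[OF g_in transverse] in
         \<open>auto simp: memI pullback_add[OF A.arc] pullback_mult[OF A.arc] pullback_const2[OF A.arc]\<close>)
  thus "codim (\<lambda>c x. const2 c * x) ((\<lambda>x. x) ` carrier local_ring) (?I) (subdegree (pullback \<gamma> g))"
    by simp
qed (auto simp: convergent2_add convergent2_mult convergent2_uminus local_ring_a_inv)

lemma transverse': "pullback \<gamma>' f \<noteq> 0"
proof
  assume "pullback \<gamma>' f = 0"
  then obtain a where a: "convergent2 a" "f = a * g" using B.kernel A.f by blast
  have "pullback \<gamma> a * pullback \<gamma> g = 0"
    using A.pullback_self a B.f by (simp add: pullback_mult[OF A.arc])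
  hence "pullback \<gamma> a = 0" using transverse by simp
  then obtain b where b: "convergent2 b" "a = b * f" using A.kernel a by blast
  have "f * (b * g) = (b * f) * g" by (simp only: mult_ac)
  also have "\<dots> = f" using a(2) b(2) by simp
  finally have "f * (b * g) = f * 1" by (simp only: mult_1_right)
  hence "b * g = 1" using mult_left_cancel[OF A.f(2)] by blast
  hence "pullback \<gamma>' 1 = 0" using B.pullback_multiple[OF b(1)] by simp
  moreover have "pullback \<gamma>' 1 = 1" using pullback_const2[OF B.arc, of 1] by (simp add: const2_1)
  ultimately show False by simp
qed

definition arcs :: "bool \<Rightarrow> complex \<Rightarrow> C2" where
  "arcs k = (if k then \<gamma> else \<gamma>')"

text \<open>The functions on the union, inside \<open>separate\<close>, the pairs of functions on the two branches.\<close>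

definition joint :: "(complex fps ^ bool) set" where
  "joint = {\<chi> k. pullback (arcs k) F | F. convergent2 F}"

definition separate :: "(complex fps ^ bool) set" where
  "separate = {w. w $ True \<in> A.image_ring \<and> w $ False \<in> B.image_ring}"

lemma codim_separate: "codim vscale (regular :: (complex fps ^ bool) set) separate (\<delta> + \<delta>')"
proof -
  interpret vs: vector_space "vscale :: complex \<Rightarrow> complex fps ^ bool \<Rightarrow> _" by (rule vector_space_vscale)
  interpret fs: vector_space fscale by (rule vector_space_fscale)
  define M where "M = {w :: complex fps ^ bool. w \<in> regular \<and> w $ True \<in> A.image_ring}"
  have M: "vs.subspace M" unfolding M_def
    using fs.subspace_0[OF A.subspace_image_ring] fs.subspace_add[OF A.subspace_image_ring]
      fs.subspace_scale[OF A.subspace_image_ring] vs.subspace_0[OF subspace_regular]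
      vs.subspace_add[OF subspace_regular] vs.subspace_scale[OF subspace_regular]
    by (intro vs.subspaceI) auto
  have reg: "w \<in> regular \<longleftrightarrow> convergent1 (w $ True) \<and> convergent1 (w $ False)" for w :: "complex fps ^ bool"
    unfolding regular_def by (simp add: all_bool_eq)
  have sepM: "separate \<subseteq> M"
    using A.image_ring_convergent B.image_ring_convergent
    by (auto simp: separate_def M_def reg)
  have onto: "\<exists>w::complex fps ^ bool. w $ True = x \<and> w $ False = y" for x y
    by (rule exI[of _ "\<chi> k. if k then x else y"]) simp
  have 1: "codim vscale (regular :: (complex fps ^ bool) set) M \<delta>"
  proof (rule codim_vimage[OF vector_space_vscale subspace_regular, where h = "\<lambda>w. w $ True" and sb = fscale
        and V' = "{x. convergent1 x}" and W' = A.image_ring])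
    show "(\<lambda>w. w $ True) ` (regular :: (complex fps ^ bool) set) = {x. convergent1 x}"
    proof (intro equalityI subsetI)
      fix x assume "x \<in> {x. convergent1 x}"
      moreover obtain w :: "complex fps ^ bool" where "w $ True = x" "w $ False = 0" using onto by blast
      ultimately show "x \<in> (\<lambda>w. w $ True) ` (regular :: (complex fps ^ bool) set)"
        by (intro image_eqI[of _ _ w]) (auto simp: reg)
    qed (auto simp: reg)
  qed (use A.codim in \<open>auto simp: M_def\<close>)
  have 2: "codim vscale M separate \<delta>'"
  proof (rule codim_vimage[OF vector_space_vscale M, where h = "\<lambda>w. w $ False" and sb = fscale
        and V' = "{x. convergent1 x}" and W' = B.image_ring])
    show "(\<lambda>w. w $ False) ` M = {x. convergent1 x}"
    proof (intro equalityI subsetI)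
      fix x assume x: "x \<in> {x. convergent1 x}"
      obtain w :: "complex fps ^ bool" where w: "w $ True = 0" "w $ False = x" using onto by blast
      have "w \<in> M" using x w fs.subspace_0[OF A.subspace_image_ring] by (simp add: M_def reg)
      thus "x \<in> (\<lambda>w. w $ False) ` M" using w by blast
    qed (auto simp: reg M_def)
  qed (use B.codim sepM in \<open>auto simp: M_def separate_def\<close>)
  show ?thesis
    by (rule vs.codim_trans[OF M _ sepM 1 2]) (auto simp: M_def)
qed

text \<open>A pair of functions on the branches comes from one function if their difference lies in the ideal of
  \<open>f\<close> and \<open>g\<close>, that is, if it is a multiple of the pullback of \<open>g\<close> along \<open>\<gamma>\<close>.\<close>

lemma codim_joint: "codim vscale separate joint (subdegree (pullback \<gamma> g))"
proof -
  interpret fs: vector_space fscale by (rule vector_space_fscale)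
  define G where "G = pullback \<gamma> g"
  from A.codim_multiples[OF g_in transverse] obtain b where
    b: "qbasis fscale A.image_ring ((*) G ` A.image_ring) (subdegree G) b"
    by (auto simp: codim_def G_def)
  define v :: "nat \<Rightarrow> complex fps ^ bool" where "v = (\<lambda>i. \<chi> k. if k then b i else 0)"
  have sum: "(\<Sum>i<n. vscale (c i) (v i)) $ True = (\<Sum>i<n. fps_const (c i) * b i)"
    "(\<Sum>i<n. vscale (c i) (v i)) $ False = 0" for n c
    by (simp_all add: sum_component v_def)
  have joint_iff: "w \<in> joint \<longleftrightarrow> (\<exists>F. convergent2 F \<and> w $ True = pullback \<gamma> F \<and> w $ False = pullback \<gamma>' F)"
    for w
  proof -
    have "w = (\<chi> k. pullback (arcs k) F) \<longleftrightarrow> w $ True = pullback \<gamma> F \<and> w $ False = pullback \<gamma>' F" for F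
      unfolding vec_eq_iff by (simp add: arcs_def all_bool_eq)
    thus ?thesis unfolding joint_def by blast
  qed
  have "qbasis vscale separate joint (subdegree G) v"
    unfolding qbasis_def
  proof (intro conjI allI ballI impI)
    fix i assume "i < subdegree G"
    hence "b i \<in> A.image_ring" by (rule qbasis_memD[OF b])
    thus "v i \<in> separate" using fs.subspace_0[OF B.subspace_image_ring]
      unfolding separate_def v_def by simp
  next
    fix w assume "w \<in> separate"
    then obtain F1 F2 where F: "convergent2 F1" "w $ True = pullback \<gamma> F1" "convergent2 F2" "w $ False = pullback \<gamma>' F2"
      by (auto simp: separate_def)
    have "pullback \<gamma> (F1 - F2) \<in> A.image_ring" using F by (auto intro: convergent2_diff)
    then obtain c where "pullback \<gamma> (F1 - F2) - (\<Sum>i<subdegree G. fps_const (c i) * b i) \<in> (*) G ` A.image_ring"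
      using b unfolding qbasis_def by blast
    then obtain a where a: "convergent2 a"
      "pullback \<gamma> (F1 - F2) - (\<Sum>i<subdegree G. fps_const (c i) * b i) = G * pullback \<gamma> a" by auto
    have "w - (\<Sum>i<subdegree G. vscale (c i) (v i)) \<in> joint"
      unfolding joint_iff
    proof (intro exI conjI)
      show c: "convergent2 (F2 + a * g)" using F a B.f by (intro convergent2_add convergent2_mult)
      show "(w - (\<Sum>i<subdegree G. vscale (c i) (v i))) $ True = pullback \<gamma> (F2 + a * g)"
        unfolding vector_minus_component sum using a F B.f
        by (simp add: pullback_add[OF A.arc] pullback_mult[OF A.arc] convergent2_mult G_def
             pullback_diff[OF A.arc] algebra_simps)
      show "(w - (\<Sum>i<subdegree G. vscale (c i) (v i))) $ False = pullback \<gamma>' (F2 + a * g)"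
        unfolding vector_minus_component sum using a F B.f by (simp add: pullback_add[OF B.arc] convergent2_mult B.pullback_multiple)
    qed
    thus "\<exists>c. w - (\<Sum>i<subdegree G. vscale (c i) (v i)) \<in> joint" by (rule exI[of _ c])
  next
    fix c i assume s: "(\<Sum>i<subdegree G. vscale (c i) (v i)) \<in> joint" and i: "i < subdegree G"
    from s[unfolded joint_iff sum] obtain F where F: "convergent2 F"
      "(\<Sum>i<subdegree G. fps_const (c i) * b i) = pullback \<gamma> F" "0 = pullback \<gamma>' F" by blast
    then obtain a where a: "convergent2 a" "F = a * g" using B.kernel[OF F(1) F(3)[symmetric]] by blast
    have "pullback \<gamma> F = G * pullback \<gamma> a"
      unfolding a(2) using a B.f by (simp add: pullback_mult[OF A.arc] G_def)
    hence "(\<Sum>i<subdegree G. fps_const (c i) * b i) \<in> (*) G ` A.image_ring" using F a by auto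
    from qbasis_indepD[OF b this i] show "c i = 0" .
  qed
  thus ?thesis by (auto simp: codim_def G_def)
qed

text \<open>The codimensions add up along the chain \<open>joint \<subseteq> separate \<subseteq> regular\<close>.\<close>

theorem delta_union: "delta_invariant (f * g) = enat (\<delta> + \<delta>' + subdegree (pullback \<gamma> g))"
proof (rule delta_invariant_eq[where \<gamma> = arcs
      and d = "max (subdegree (pullback \<gamma> g) + d) (subdegree (pullback \<gamma>' f) + d')"])
  show "convergent2 (f * g)" using A.f B.f by (intro convergent2_mult)
  show arc: "analytic_arc (arcs k)" for k by (simp add: arcs_def A.arc B.arc)
  show "(\<forall>k. pullback (arcs k) F = 0) \<longleftrightarrow> (\<exists>a. convergent2 a \<and> F = a * (f * g))" if F: "convergent2 F" for F
  proof
    assume "\<forall>k. pullback (arcs k) F = 0"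
    hence 0: "pullback \<gamma> F = 0" "pullback \<gamma>' F = 0" unfolding arcs_def by (metis (full_types))+
    then obtain a where a: "convergent2 a" "F = a * f" using A.kernel F by blast
    have "pullback \<gamma>' a * pullback \<gamma>' f = 0" using 0 a A.f by (simp add: pullback_mult[OF B.arc])
    hence "pullback \<gamma>' a = 0" using transverse' by simp
    then obtain b where "convergent2 b" "a = b * g" using B.kernel a by blast
    thus "\<exists>a. convergent2 a \<and> F = a * (f * g)" using a by (intro exI[of _ b]) (auto simp: mult_ac)
  next
    assume "\<exists>a. convergent2 a \<and> F = a * (f * g)"
    then obtain a where a: "convergent2 a" "F = a * (f * g)" by blast
    have "F = (a * g) * f" "F = (a * f) * g" using a by (simp_all add: mult_ac)
    hence "pullback \<gamma> F = 0" "pullback \<gamma>' F = 0"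
      using A.pullback_multiple[OF convergent2_mult[OF a(1) B.f(1)]]
        B.pullback_multiple[OF convergent2_mult[OF a(1) A.f(1)]] by metis+
    thus "\<forall>k. pullback (arcs k) F = 0" by (simp add: arcs_def)
  qed
  show "\<exists>F. convergent2 F \<and> (\<forall>k. pullback (arcs k) F = w $ k)"
    if w: "w \<in> regular" "\<And>k n. n < max (subdegree (pullback \<gamma> g) + d) (subdegree (pullback \<gamma>' f) + d') \<Longrightarrow> fps_nth (w $ k) n = 0"
    for w :: "complex fps ^ bool"
  proof -
    have c1: "convergent1 (w $ k)" for k using w by (auto simp: regular_def)
    obtain x where x: "convergent1 x" "w $ True = pullback \<gamma> g * x" "\<And>n. n < d \<Longrightarrow> fps_nth x n = 0"
      using convergent1_quotient[OF c1[of True], of "pullback \<gamma> g" d] w transverse convergent1_pullback[OF A.arc B.f(1)] by auto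
    obtain y where y: "convergent1 y" "w $ False = pullback \<gamma>' f * y" "\<And>n. n < d' \<Longrightarrow> fps_nth y n = 0"
      using convergent1_quotient[OF c1[of False], of "pullback \<gamma>' f" d'] w transverse' convergent1_pullback[OF B.arc A.f(1)] by auto
    obtain X where X: "convergent2 X" "x = pullback \<gamma> X" using A.conductor[OF x(1,3)] by auto
    obtain Y where Y: "convergent2 Y" "y = pullback \<gamma>' Y" using B.conductor[OF y(1,3)] by auto
    have "pullback \<gamma> (X * g + Y * f) = w $ True" "pullback \<gamma>' (X * g + Y * f) = w $ False"
      using X Y x y A.f B.f
      by (simp_all add: pullback_add[OF A.arc] pullback_add[OF B.arc] convergent2_mult A.pullback_multiple
           B.pullback_multiple) (simp_all add: pullback_mult[OF A.arc] pullback_mult[OF B.arc])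
    hence "\<forall>k. pullback (arcs k) (X * g + Y * f) = w $ k"
      unfolding arcs_def by (metis (full_types))
    moreover have "convergent2 (X * g + Y * f)" using X Y A.f B.f by (intro convergent2_add convergent2_mult)
    ultimately show ?thesis by blast
  qed
  interpret vs: vector_space "vscale :: complex \<Rightarrow> complex fps ^ bool \<Rightarrow> _" by (rule vector_space_vscale)
  interpret fs: vector_space fscale by (rule vector_space_fscale)
  have sep: "vs.subspace separate" unfolding separate_def
    using fs.subspace_0[OF A.subspace_image_ring] fs.subspace_add[OF A.subspace_image_ring]
      fs.subspace_scale[OF A.subspace_image_ring] fs.subspace_0[OF B.subspace_image_ring]
      fs.subspace_add[OF B.subspace_image_ring] fs.subspace_scale[OF B.subspace_image_ring]
    by (intro vs.subspaceI CollectI conjI) auto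
  have "separate \<subseteq> regular"
  proof
    fix w assume "w \<in> separate"
    hence "convergent1 (w $ True)" "convergent1 (w $ False)"
      using A.image_ring_convergent B.image_ring_convergent by (auto simp: separate_def)
    thus "w \<in> regular" by (simp add: regular_def all_bool_eq)
  qed
  moreover have "joint \<subseteq> separate" by (auto simp: joint_def separate_def arcs_def)
  ultimately show "codim vscale regular {\<chi> k. pullback (arcs k) F | F. convergent2 F} (\<delta> + \<delta>' + subdegree (pullback \<gamma> g))"
    using vs.codim_trans[OF sep _ _ codim_separate codim_joint] unfolding joint_def by simp
qed

end

section \<open>Homogeneous parts\<close>

definition hom_part :: "nat \<Rightarrow> complex fps fps \<Rightarrow> C2 \<Rightarrow> complex" where
  "hom_part d F z = (\<Sum>i\<le>d. coeff2 F i (d - i) * fst z ^ i * snd z ^ (d - i))"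

lemma initial_form_eq: "initial_form F z = hom_part (mult2 F) F z"
  by (simp add: initial_form_def hom_part_def)

lemma clinear_mapI:
  assumes "\<And>a b. L (a + b) = L a + L b" "\<And>c z. L (cscale c z) = cscale c (L z)"
  shows "clinear_map L"
proof unfold_locales
  show "L (a + b) = L a + L b" "L (cscale c z) = cscale c (L z)" for a b c z by (rule assms)+
qed (auto simp: cscale_def algebra_simps prod_eq_iff)

lemma cscale_tendsto: "filterlim (\<lambda>t. cscale t z) (nhds 0) (nhds 0)"
proof -
  have "((\<lambda>t. (t * fst z, t * snd z)) \<longlongrightarrow> (0 * fst z, 0 * snd z)) (nhds 0)"
    by (intro tendsto_Pair tendsto_mult filterlim_ident tendsto_const)
  thus ?thesis by (simp add: cscale_def[abs_def] zero_prod_def)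
qed

text \<open>The homogeneous parts are the Taylor coefficients along the lines through the origin.\<close>

lemma has_fps_expansion_line:
  assumes "expansion2 h F"
  shows "(\<lambda>t. h (cscale t z)) has_fps_expansion Abs_fps (\<lambda>d. hom_part d F z)"
proof (rule has_fps_expansionI)
  from assms obtain \<rho> where \<rho>: "\<rho> > 0" "abs_conv2 \<rho> F" by (rule expansion2E)
  have "\<forall>\<^sub>F w in nhds 0. h w = eval2 F w" using assms by (simp add: expansion2_def)
  from eventually_conj[OF eventually_compose_filterlim[OF this cscale_tendsto[of z]]
      eventually_compose_filterlim[OF eventually_polydisc[OF \<rho>(1)] cscale_tendsto[of z]]]
  show "\<forall>\<^sub>F t in nhds 0. (\<lambda>n. fps_nth (Abs_fps (\<lambda>d. hom_part d F z)) n * t ^ n) sums h (cscale t z)"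
  proof eventually_elim
    case (elim t)
    define c where "c = (\<lambda>(i, j). coeff2 F i j * (t * fst z) ^ i * (t * snd z) ^ j)"
    have "(c has_sum h (cscale t z)) UNIV"
      using has_sum_eval2[OF \<rho>(2), of "cscale t z"] elim by (simp add: c_def cscale_def)
    moreover have "bij_betw (\<lambda>(d, i). (i, d - i)) (SIGMA d:UNIV. {..d}) (UNIV :: (nat \<times> nat) set)"
      by (rule bij_betwI[where g = "\<lambda>(i, j). (i + j, i)"]) auto
    ultimately have "((\<lambda>x. c ((\<lambda>(d, i). (i, d - i)) x)) has_sum h (cscale t z)) (SIGMA d:UNIV. {..d})"
      by (subst has_sum_reindex_bij_betw) auto
    hence "((\<lambda>d. \<Sum>i\<le>d. c (i, d - i)) has_sum h (cscale t z)) UNIV"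
      by (rule has_sum_SigmaD) (auto intro!: has_sum_finiteI)
    moreover have "(\<Sum>i\<le>d. c (i, d - i)) = hom_part d F z * t ^ d" for d
      unfolding hom_part_def sum_distrib_right
    proof (rule sum.cong[OF refl])
      fix i assume "i \<in> {..d}"
      hence "t ^ d = t ^ i * t ^ (d - i)" by (simp flip: power_add)
      thus "c (i, d - i) = coeff2 F i (d - i) * fst z ^ i * snd z ^ (d - i) * t ^ d"
        by (simp add: c_def power_mult_distrib)
    qed
    ultimately have "((\<lambda>d. hom_part d F z * t ^ d) has_sum h (cscale t z)) UNIV" by simp
    thus ?case using has_sum_imp_sums by simp
  qed
qed

lemma hom_part_eq_0_iff: "(\<forall>z. hom_part d F z = 0) \<longleftrightarrow> (\<forall>i\<le>d. coeff2 F i (d - i) = 0)"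
proof
  assume *: "\<forall>z. hom_part d F z = 0"
  have "(\<Sum>i\<le>d. coeff2 F i (d - i) * x ^ i) = 0" for x
    using *[rule_format, of "(x, 1)"] by (simp add: hom_part_def)
  thus "\<forall>i\<le>d. coeff2 F i (d - i) = 0" using polyfun_eq_0[of "\<lambda>i. coeff2 F i (d - i)" d] by blast
qed (simp add: hom_part_def)

lemma mult2_altdef: "mult2 F = (LEAST d. \<exists>z. hom_part d F z \<noteq> 0)"
proof -
  have "(\<exists>i j. i + j = d \<and> coeff2 F i j \<noteq> 0) \<longleftrightarrow> (\<exists>z. hom_part d F z \<noteq> 0)" for d
  proof -
    have "(\<exists>i j. i + j = d \<and> coeff2 F i j \<noteq> 0) \<longleftrightarrow> \<not> (\<forall>i\<le>d. coeff2 F i (d - i) = 0)"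
      by (metis add_diff_cancel_left' le_add1 le_add_diff_inverse)
    thus ?thesis using hom_part_eq_0_iff[of d F] by blast
  qed
  thus ?thesis by (simp add: mult2_def)
qed

lemma hom_part_below: "d < mult2 F \<Longrightarrow> hom_part d F z = 0"
  unfolding mult2_altdef using not_less_Least by blast

lemma hom_part_mult2:
  assumes "F \<noteq> 0"
  shows "\<exists>z. hom_part (mult2 F) F z \<noteq> 0"
proof -
  obtain i j where "coeff2 F i j \<noteq> 0" using assms coeff2_eqI[of F 0] by (auto simp: coeff2_0)
  hence "\<not> (\<forall>k\<le>i+j. coeff2 F k (i + j - k) = 0)" by (metis add_diff_cancel_left' le_add1)
  hence "\<exists>d z. hom_part d F z \<noteq> 0" using hom_part_eq_0_iff[of "i + j" F] by blast
  thus ?thesis unfolding mult2_altdef by (rule LeastI_ex)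
qed

lemma fps_cnj_nth [simp]: "fps_nth (fps_cnj A) n = cnj (fps_nth A n)"
  by (simp add: fps_cnj_def)

lemma has_fps_expansion_cnj:
  assumes "h has_fps_expansion F"
  shows "(\<lambda>t. cnj (h (cnj t))) has_fps_expansion fps_cnj F"
proof (rule has_fps_expansionI)
  have lim: "filterlim cnj (nhds 0) (nhds (0::complex))"
    using tendsto_cnj[OF filterlim_ident, of "0::complex"] by simp
  have "fps_conv_radius F > 0" "\<forall>\<^sub>F z in nhds 0. eval_fps F z = h z"
    using assms by (auto simp: has_fps_expansion_def)
  moreover from this(1) have "\<forall>\<^sub>F z in nhds 0. z \<in> eball 0 (fps_conv_radius F)"
    by (intro eventually_nhds_in_open) (auto simp: zero_ereal_def)
  ultimately have "\<forall>\<^sub>F z in nhds 0. z \<in> eball 0 (fps_conv_radius F) \<and> eval_fps F z = h z"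
    by (intro eventually_conj)
  from eventually_compose_filterlim[OF this lim]
  show "\<forall>\<^sub>F t in nhds 0. (\<lambda>n. fps_nth (fps_cnj F) n * t ^ n) sums cnj (h (cnj t))"
  proof eventually_elim
    case (elim t)
    hence "(\<lambda>n. fps_nth F n * cnj t ^ n) sums h (cnj t)"
      using sums_eval_fps[of "cnj t" F] by simp
    hence "(\<lambda>n. cnj (fps_nth F n * cnj t ^ n)) sums cnj (h (cnj t))" by (simp only: sums_cnj)
    thus ?case by (simp add: fps_cnj_def)
  qed
qed

section \<open>Conjugate branches in adapted coordinates\<close>

context puiseux
begin

text \<open>Among the monomials \<open>p\<^sup>i q\<^sup>j\<close> with \<open>i + j \<ge> m\<close>, of orders at least \<open>m i + (m + 1) j\<close> along the
  branch, only \<open>p\<^sup>m\<close> has order \<open>m\<^sup>2\<close>.\<close>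

lemma subdegree_pullback_arc0:
  assumes H: "convergent2 H" and low: "\<And>i j. i + j < m \<Longrightarrow> coeff2 H i j = 0" and lead: "coeff2 H m 0 \<noteq> 0"
  shows "subdegree (pullback arc0 H) = m * m" "pullback arc0 H \<noteq> 0"
proof -
  note arc = analytic_arc_graph[OF conv phi_0]
  define I where "I = inflate H"
  have cI: "convergent2 I" unfolding I_def by (rule convergent2_inflate[OF H])
  define r where "r = (\<Sum>j<m. monom (fps_nth I j) j)"
  have r: "coeff r j = (if j < m then fps_nth I j else 0)" for j
    unfolding r_def coeff_sum coeff_monom by (simp add: if_distrib sum.delta cong: if_cong)
  have cr: "convergent1 (coeff r j)" for j using convergent1_fps_nth[OF cI] by (simp add: r)
  define S where "S = fps_shift m I"
  have cS: "convergent2 S" unfolding S_def by (rule convergent2_shift_n[OF cI])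
  have cX: "convergent2 (fps_X ^ n)" for n
    by (induction n) (auto intro: convergent2_mult)
  have split: "I = fps_of_poly r + fps_X ^ m * S"
    by (rule fps_ext) (auto simp: r S_def fps_X_power_mult_nth)
  have pX: "pullback (graph_arc \<phi>) (fps_X ^ n) = \<phi> ^ n" for n
  proof (induction n)
    case 0 show ?case using pullback_const2[OF arc, of 1] by (simp add: const2_1)
  next
    case (Suc n) thus ?case by (simp add: pullback_mult[OF arc] cX pullback_graph_X[OF conv phi_0])
  qed
  have "pullback arc0 H = poly r \<phi> + \<phi> ^ m * pullback (graph_arc \<phi>) S"
    unfolding pullback_arc0 I_def[symmetric] split
    by (simp add: pullback_add[OF arc] pullback_mult[OF arc] convergent2_mult convergent2_fps_of_poly[OF cr] cX cS
        pullback_graph_poly[OF conv phi_0 cr] pX)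
  also have "poly r \<phi> = (\<Sum>j<m. fps_nth I j * \<phi> ^ j)"
    by (simp add: r_def poly_sum poly_monom)
  finally have eq: "pullback arc0 H = (\<Sum>j<m. fps_nth I j * \<phi> ^ j) + \<phi> ^ m * pullback (graph_arc \<phi>) S" .
  have phi: "fps_nth (\<phi> ^ j * B) n = 0" if "n < (m + 1) * j" for j n B
  proof -
    have "\<phi> = fps_X ^ (m + 1) * fps_shift (m + 1) \<phi>"
      by (rule fps_ext) (use ord in \<open>auto simp: fps_X_power_mult_nth simp del: power_Suc\<close>)
    hence "\<phi> ^ j * B = (fps_X ^ (m + 1) * fps_shift (m + 1) \<phi>) ^ j * B" by simp
    also have "\<dots> = fps_X ^ ((m + 1) * j) * (fps_shift (m + 1) \<phi> ^ j * B)"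
      by (simp only: power_mult_distrib power_mult mult.assoc)
    finally show ?thesis using that by (simp only: fps_X_power_mult_nth if_True)
  qed
  have last: "fps_nth (\<phi> ^ m * pullback (graph_arc \<phi>) S) n = 0" if "n \<le> m * m" for n
    by (rule phi) (use that m in simp)
  have Inth: "fps_nth (fps_nth I j) n = (if m dvd n then coeff2 H (n div m) j else 0)" for n j
    using coeff2_inflate[of H n j] by (simp add: I_def coeff2_def)
  have Ilow: "fps_nth (fps_nth I j) n = 0" if "n < m * (m - j)" "j < m" for n j
  proof (cases "m dvd n")
    case True
    then obtain k where k: "n = m * k" ..
    hence "k < m - j" using that by simp
    thus ?thesis using m low[of k j] by (simp add: Inth k)
  qed (simp add: Inth)
  have summand: "fps_nth (fps_nth I j * \<phi> ^ j) n = (if j = 0 then fps_nth (fps_nth I 0) n else 0)"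
    if n: "n \<le> m * m" and j: "j < m" for j n
  proof (cases "j = 0")
    case False
    define B where "B = fps_shift (m * (m - j)) (fps_nth I j)"
    have B: "fps_nth I j = fps_X ^ (m * (m - j)) * B"
      by (rule fps_ext) (use Ilow j in \<open>auto simp: fps_X_power_mult_nth B_def\<close>)
    have "fps_nth (fps_nth I j * \<phi> ^ j) n = fps_nth (fps_X ^ (m * (m - j)) * (\<phi> ^ j * B)) n"
      unfolding B by (simp only: mult_ac)
    also have "\<dots> = 0"
    proof (cases "n < m * (m - j)")
      case False
      have "m * m = m * (m - j) + m * j" using j by (simp add: algebra_simps diff_mult_distrib2)
      hence "n - m * (m - j) < (m + 1) * j" using n False \<open>j \<noteq> 0\<close> by simp
      thus ?thesis using phi by (simp only: fps_X_power_mult_nth) simp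
    qed (simp add: fps_X_power_mult_nth)
    finally show ?thesis using False by simp
  qed simp
  have nth: "fps_nth (pullback arc0 H) n = fps_nth (fps_nth I 0) n" if "n \<le> m * m" for n
  proof -
    have "(\<Sum>j<m. fps_nth (fps_nth I j * \<phi> ^ j) n) = (\<Sum>j<m. if j = 0 then fps_nth (fps_nth I 0) n else 0)"
      by (rule sum.cong) (use summand that in auto)
    also have "\<dots> = fps_nth (fps_nth I 0) n" using m by simp
    finally show ?thesis using last[OF that] by (simp add: eq fps_sum_nth)
  qed
  have lead': "fps_nth (pullback arc0 H) (m * m) \<noteq> 0" using nth[of "m * m"] lead m by (simp add: Inth)
  have low': "fps_nth (pullback arc0 H) n = 0" if "n < m * m" for n
    using nth[of n] Ilow[of n 0] that m by simp
  from lead' low' show "subdegree (pullback arc0 H) = m * m" by (rule subdegreeI)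
  from lead' show "pullback arc0 H \<noteq> 0" by auto
qed

end

locale conjugate_branches =
  fixes \<sigma> :: "C2 \<Rightarrow> C2" and f g :: "complex fps fps" and q :: "C2 \<Rightarrow> complex"
    and \<phi> :: "complex fps" and m :: nat
  assumes \<sigma>: "real_structure \<sigma>" and f: "branch f" and g: "conjugate_equation \<sigma> f g"
    and tangents: "tangent_cone f \<noteq> tangent_cone g" and m_def: "m = mult2 f"
    and q: "clinear_form q" "{z. q z = 0} = tangent_cone f"
    and \<phi>: "fps_conv_radius \<phi> > 0" "\<forall>n\<le>m. fps_nth \<phi> n = 0"
    and prim: "primitive_parametrization f (gamma_Q \<sigma> q m \<phi>)"
begin

lemma \<sigma>_props:
  shows \<sigma>_\<sigma>: "\<sigma> (\<sigma> z) = z" and \<sigma>_add: "\<sigma> (z + w) = \<sigma> z + \<sigma> w"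
    and \<sigma>_scale: "\<sigma> (cscale c z) = cscale (cnj c) (\<sigma> z)"
proof -
  from \<sigma> obtain \<kappa> where \<kappa>: "clinear_map \<kappa>" "bij \<kappa>" and \<kappa>\<sigma>: "\<And>z. \<kappa> (\<sigma> z) = conj2 (\<kappa> z)"
    by (auto simp: real_structure_def conj2_def)
  interpret Vector_Spaces.linear cscale cscale \<kappa> by (rule \<kappa>)
  have inj: "z = w" if "\<kappa> z = \<kappa> w" for z w using that bij_is_inj[OF \<kappa>(2)] by (simp add: inj_eq)
  show "\<sigma> (\<sigma> z) = z" by (rule inj) (simp add: \<kappa>\<sigma>)
  show "\<sigma> (z + w) = \<sigma> z + \<sigma> w" by (rule inj) (simp add: \<kappa>\<sigma> add conj2_def)
  show "\<sigma> (cscale c z) = cscale (cnj c) (\<sigma> z)" by (rule inj) (simp only: \<kappa>\<sigma> scale, simp add: conj2_def cscale_def)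
qed

lemma \<sigma>_0: "\<sigma> 0 = 0"
  using \<sigma>_add[of 0 0] by simp

lemma clinear_\<sigma>_conj2: "clinear_map (\<lambda>z. \<sigma> (conj2 z))"
proof (rule clinear_mapI)
  have "conj2 (a + b) = conj2 a + conj2 b" for a b by (simp add: conj2_def)
  thus "\<sigma> (conj2 (a + b)) = \<sigma> (conj2 a) + \<sigma> (conj2 b)" for a b by (simp add: \<sigma>_add)
  have "conj2 (cscale c z) = cscale (cnj c) (conj2 z)" for c z by (simp add: conj2_def cscale_def)
  thus "\<sigma> (conj2 (cscale c z)) = cscale c (\<sigma> (conj2 z))" for c z by (simp add: \<sigma>_scale)
qed

lemma \<sigma>_tendsto: "filterlim \<sigma> (nhds 0) (nhds 0)"
  using filterlim_compose[OF clinear_map_tendsto[OF clinear_\<sigma>_conj2] filterlim_conj2] by simp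

lemma expansion2_conjugate:
  assumes "expansion2 h H"
  shows "\<exists>H'. expansion2 (\<lambda>z. cnj (h (\<sigma> z))) H'"
proof -
  obtain G where G: "expansion2 (\<lambda>z. h (\<sigma> (conj2 z))) G"
    using expansion2_clinear[OF clinear_\<sigma>_conj2 assms] by blast
  from expansion2_cnj[OF G] show ?thesis by simp
qed

lemma g_expansion: "expansion2 (\<lambda>z. cnj (eval2 f (\<sigma> z))) g"
  using g by (auto simp: conjugate_equation_def expansion2_def elim: eventually_mono)

lemma cg: "convergent2 g"
  using g_expansion by (simp add: expansion2_def)

lemma cf: "convergent2 f"
  using f by (simp add: branch_def)

lemma f_neq_0: "f \<noteq> 0"
  using f by (simp add: branch_def ring_irreducible_def)

lemma hom_part_g: "hom_part d g z = cnj (hom_part d f (\<sigma> z))"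
proof -
  have "(\<lambda>t. eval2 f (cscale t (\<sigma> z))) has_fps_expansion Abs_fps (\<lambda>d. hom_part d f (\<sigma> z))"
    by (rule has_fps_expansion_line[OF expansion2_eval2[OF cf]])
  hence "(\<lambda>t. cnj (eval2 f (cscale (cnj t) (\<sigma> z)))) has_fps_expansion fps_cnj (Abs_fps (\<lambda>d. hom_part d f (\<sigma> z)))"
    by (rule has_fps_expansion_cnj)
  moreover have "(\<lambda>t. cnj (eval2 f (\<sigma> (cscale t z)))) has_fps_expansion Abs_fps (\<lambda>d. hom_part d g z)"
    by (rule has_fps_expansion_line[OF g_expansion])
  ultimately have "Abs_fps (\<lambda>d. hom_part d g z) = fps_cnj (Abs_fps (\<lambda>d. hom_part d f (\<sigma> z)))"
    by (intro has_fps_expansion_unique[of "\<lambda>t. cnj (eval2 f (\<sigma> (cscale t z)))"]) (simp_all add: \<sigma>_scale)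
  from arg_cong[OF this, of "\<lambda>F. fps_nth F d"] show ?thesis by (simp add: fps_cnj_def)
qed


lemma mult2_g: "mult2 g = m"
proof -
  have "(\<exists>z. hom_part d g z \<noteq> 0) \<longleftrightarrow> (\<exists>z. hom_part d f z \<noteq> 0)" for d
    unfolding hom_part_g by (metis \<sigma>_\<sigma> complex_cnj_zero_iff)
  thus ?thesis by (simp add: m_def mult2_altdef)
qed

definition p :: "C2 \<Rightarrow> complex" where
  "p z = cnj (q (\<sigma> z))"

definition coords :: "C2 \<Rightarrow> C2" where
  "coords z = (p z, q z)"

lemma adapted_coords_eq: "adapted_coords \<sigma> q = coords"
  by (simp add: fun_eq_iff adapted_coords_def coords_def p_def)

lemma tangent_cone_g: "tangent_cone g = {z. p z = 0}"
proof -
  have "initial_form g z = cnj (initial_form f (\<sigma> z))" for z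
    by (simp add: initial_form_eq mult2_g hom_part_g m_def)
  hence "z \<in> tangent_cone g \<longleftrightarrow> \<sigma> z \<in> tangent_cone f" for z
    by (simp add: tangent_cone_def)
  thus ?thesis using q(2) by (auto simp: p_def)
qed

lemma q_neq_0: "\<exists>z. q z \<noteq> 0"
proof -
  obtain z where "initial_form f z \<noteq> 0"
    using hom_part_mult2[OF f_neq_0] by (auto simp: initial_form_eq)
  hence "z \<notin> tangent_cone f" by (simp add: tangent_cone_def)
  thus ?thesis using q(2) by blast
qed

lemma clinear_coords: "clinear_map coords"
proof (rule clinear_mapI)
  interpret Vector_Spaces.linear cscale "(*)" q by (rule q)
  show "coords (a + b) = coords a + coords b" for a b
    by (simp add: coords_def p_def \<sigma>_add add)
  show "coords (cscale c z) = cscale c (coords z)" for c z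
    by (simp add: coords_def p_def \<sigma>_scale scale) (simp add: cscale_def)
qed

text \<open>The kernels of \<open>p\<close> and \<open>q\<close> are the tangent cones of \<open>g\<close> and \<open>f\<close>, which are distinct lines.\<close>

lemma bij_coords: "bij coords"
proof -
  define p1 p2 q1 q2 where "p1 = p (1, 0)" and "p2 = p (0, 1)" and "q1 = q (1, 0)" and "q2 = q (0, 1)"
  have c: "coords z = (fst z * p1 + snd z * p2, fst z * q1 + snd z * q2)" for z
    using clinear_map_coords[OF clinear_coords, of z]
    by (simp add: coords_def cscale_def p1_def p2_def q1_def q2_def)
  hence pz: "p z = fst z * p1 + snd z * p2" and qz: "q z = fst z * q1 + snd z * q2" for z
    by (simp_all add: coords_def)
  define D where "D = p1 * q2 - p2 * q1"
  have "D \<noteq> 0"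
  proof
    assume D: "D = 0"
    have 1: "q1 * p z = p1 * q z" "q2 * p z = p2 * q z" for z
    proof -
      have "q1 * p z - p1 * q z = - (snd z * D)" "q2 * p z - p2 * q z = fst z * D"
        by (simp_all add: pz qz D_def algebra_simps)
      thus "q1 * p z = p1 * q z" "q2 * p z = p2 * q z" using D by simp_all
    qed
    have "q1 \<noteq> 0 \<or> q2 \<noteq> 0" using q_neq_0 by (auto simp: qz)
    moreover have "p1 \<noteq> 0 \<or> p2 \<noteq> 0"
    proof -
      from q_neq_0 obtain z where "q z \<noteq> 0" ..
      hence "p (\<sigma> z) \<noteq> 0" by (simp add: p_def \<sigma>_\<sigma>)
      thus ?thesis by (auto simp: pz)
    qed
    ultimately have "p z = 0 \<longleftrightarrow> q z = 0" for z using 1[of z] by auto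
    thus False using tangents q(2) tangent_cone_g by simp
  qed
  define N where "N = (\<lambda>w :: C2. ((fst w * q2 - snd w * p2) / D, (snd w * p1 - fst w * q1) / D))"
  have "N (coords z) = z" for z
  proof -
    have "(fst z * p1 + snd z * p2) * q2 - (fst z * q1 + snd z * q2) * p2 = fst z * D"
      "(fst z * q1 + snd z * q2) * p1 - (fst z * p1 + snd z * p2) * q1 = snd z * D"
      by (simp_all add: D_def algebra_simps)
    thus ?thesis using \<open>D \<noteq> 0\<close> by (simp add: N_def c)
  qed
  moreover have "coords (N w) = w" for w
  proof -
    have "(fst w * q2 - snd w * p2) * p1 + (snd w * p1 - fst w * q1) * p2 = fst w * D"
      "(fst w * q2 - snd w * p2) * q1 + (snd w * p1 - fst w * q1) * q2 = snd w * D"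
      by (simp_all add: D_def algebra_simps)
    thus ?thesis using \<open>D \<noteq> 0\<close> by (simp add: N_def c add_divide_distrib[symmetric])
  qed
  ultimately show ?thesis by (intro o_bij[of N]) (auto simp: fun_eq_iff)
qed

definition M :: "C2 \<Rightarrow> C2" where
  "M = inv_into UNIV coords"

lemma coords_M [simp]: "coords (M w) = w"
  unfolding M_def using bij_coords by (simp add: bij_is_surj surj_f_inv_f)

lemma M_coords [simp]: "M (coords z) = z"
  unfolding M_def using bij_coords by (simp add: bij_is_inj)

lemma clinear_M: "clinear_map M"
  unfolding M_def by (rule clinear_map_inv[OF clinear_coords bij_coords])

lemma bij_M: "bij M"
  unfolding M_def by (rule bij_imp_bij_inv[OF bij_coords])

lemma \<sigma>_M: "\<sigma> (M (a, b)) = M (cnj b, cnj a)"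
proof -
  have "p (M (a, b)) = a" "q (M (a, b)) = b" using coords_M[of "(a, b)"] by (simp_all add: coords_def)
  hence "coords (\<sigma> (M (a, b))) = (cnj b, cnj a)"
    by (simp add: coords_def p_def \<sigma>_\<sigma>) (metis complex_cnj_cnj)
  hence "M (coords (\<sigma> (M (a, b)))) = M (cnj b, cnj a)" by simp
  thus ?thesis by simp
qed

abbreviation \<gamma> where "\<gamma> \<equiv> gamma_Q \<sigma> q m \<phi>"
abbreviation \<gamma>bar where "\<gamma>bar \<equiv> gamma_Qbar \<sigma> q m \<phi>"

lemma \<gamma>_eq: "\<gamma> u = M (u ^ m, eval_fps \<phi> u)"
  by (simp add: gamma_Q_def adapted_coords_eq M_def)

lemma \<gamma>bar_eq: "\<gamma>bar u = M (eval_fps (fps_cnj \<phi>) u, u ^ m)"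
  by (simp add: gamma_Qbar_def adapted_coords_eq M_def)

lemma prim_unfolded:
  "\<exists>\<epsilon>>0. inj_on \<gamma> (ball 0 \<epsilon>) \<and> (\<forall>u. norm u < \<epsilon> \<longrightarrow> eval2 f (\<gamma> u) = 0) \<and> \<gamma> 0 = 0"
proof -
  from prim obtain \<epsilon> U where *: "\<gamma> 0 = 0" "\<epsilon> > 0" "inj_on \<gamma> (ball 0 \<epsilon>)" "\<gamma> ` ball 0 \<epsilon> = {z \<in> U. eval2 f z = 0}"
    unfolding primitive_parametrization_def by blast
  have "eval2 f (\<gamma> u) = 0" if "norm u < \<epsilon>" for u
  proof -
    have "\<gamma> u \<in> \<gamma> ` ball 0 \<epsilon>" using that by auto
    thus ?thesis unfolding *(4) by simp
  qed
  with * show ?thesis by blast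
qed

lemma m_pos: "m > 0"
proof (rule ccontr)
  assume "\<not> m > 0"
  hence 0: "mult2 f = 0" by (simp add: m_def)
  obtain \<epsilon> where "\<epsilon> > 0" "\<And>u. norm u < \<epsilon> \<Longrightarrow> eval2 f (\<gamma> u) = 0" "\<gamma> 0 = 0" using prim_unfolded by blast
  from this(2)[of 0] this have "coeff2 f 0 0 = 0" by (simp add: eval2_at_0)
  thus False using hom_part_mult2[OF f_neq_0] by (simp add: 0 hom_part_def)
qed

definition \<omega> :: complex where "\<omega> = cis (2 * pi / real m)"

lemma \<omega>_power: "\<omega> ^ n = 1 \<longleftrightarrow> m dvd n"
  unfolding \<omega>_def by (rule cis_root_power_eq_1[OF m_pos])

text \<open>The parameters \<open>u\<close> and \<open>\<omega>^k u\<close> would have the same image.\<close>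

lemma twist_neq:
  assumes "0 < k" "k < m"
  shows "twist (\<omega> ^ k) \<phi> \<noteq> \<phi>"
proof
  assume *: "twist (\<omega> ^ k) \<phi> = \<phi>"
  obtain \<epsilon> where \<epsilon>: "\<epsilon> > 0" "inj_on \<gamma> (ball 0 \<epsilon>)" using prim_unfolded by blast
  define u :: complex where "u = of_real (\<epsilon> / 2)"
  have "(\<omega> ^ k * u) ^ m = (\<omega> ^ m) ^ k * u ^ m"
    by (simp add: power_mult_distrib power_mult[symmetric] mult.commute)
  hence 1: "(\<omega> ^ k * u) ^ m = u ^ m" using \<omega>_power[of m] by simp
  have 2: "eval_fps \<phi> (\<omega> ^ k * u) = eval_fps \<phi> u"
    using eval_fps_twist[of "\<omega> ^ k" \<phi> u] * by simp
  have "\<gamma> (\<omega> ^ k * u) = \<gamma> u" unfolding \<gamma>_eq 1 2 ..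
  moreover have "\<omega> ^ k * u \<in> ball 0 \<epsilon>" "u \<in> ball 0 \<epsilon>"
    using \<epsilon>(1) by (simp_all add: u_def norm_mult norm_power \<omega>_def)
  ultimately have "\<omega> ^ k * u = u" using \<epsilon>(2) by (meson inj_onD)
  hence "\<omega> ^ k = 1" using \<epsilon>(1) by (simp add: u_def)
  thus False using assms \<omega>_power[of k] nat_dvd_not_less[of k m] by simp
qed

lemma puiseux_\<phi>: "puiseux m \<phi> \<omega>"
  by unfold_locales (use \<phi> m_pos twist_neq in \<open>auto simp: \<omega>_def convergent1_def\<close>)

lemma cnj_expansion: "(\<lambda>t. cnj (eval_fps \<phi> (cnj t))) has_fps_expansion fps_cnj \<phi>"
  by (rule has_fps_expansion_cnj) (rule eval_fps_has_fps_expansion[OF \<phi>(1)])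

lemma fps_cnj_diff_twist_nth:
  "fps_nth (fps_cnj \<phi> - twist (\<omega> ^ k) (fps_cnj \<phi>)) n = 0 \<longleftrightarrow> fps_nth (\<phi> - twist (\<omega> ^ k) \<phi>) n = 0"
proof -
  have "fps_nth (fps_cnj \<phi> - twist (\<omega> ^ k) (fps_cnj \<phi>)) n = cnj (fps_nth \<phi> n) * (1 - (\<omega> ^ k) ^ n)"
    "fps_nth (\<phi> - twist (\<omega> ^ k) \<phi>) n = fps_nth \<phi> n * (1 - (\<omega> ^ k) ^ n)"
    by (simp_all add: algebra_simps)
  thus ?thesis by simp
qed

lemma puiseux_\<phi>bar: "puiseux m (fps_cnj \<phi>) \<omega>"
proof unfold_locales
  show "convergent1 (fps_cnj \<phi>)" using cnj_expansion by (simp add: has_fps_expansion_def convergent1_def)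
  show "twist (\<omega> ^ k) (fps_cnj \<phi>) \<noteq> fps_cnj \<phi>" if "0 < k" "k < m" for k
  proof
    assume "twist (\<omega> ^ k) (fps_cnj \<phi>) = fps_cnj \<phi>"
    hence "fps_nth (fps_cnj \<phi> - twist (\<omega> ^ k) (fps_cnj \<phi>)) n = 0" for n by simp
    hence "\<phi> - twist (\<omega> ^ k) \<phi> = 0" unfolding fps_cnj_diff_twist_nth by (intro fps_ext) simp
    thus False using twist_neq[OF that] by simp
  qed
qed (use \<phi> m_pos in \<open>auto simp: \<omega>_def\<close>)

sublocale P: puiseux m \<phi> \<omega> by (rule puiseux_\<phi>)
sublocale P': puiseux m "fps_cnj \<phi>" \<omega> by (rule puiseux_\<phi>bar)

lemma dord_conj: "P'.dord = P.dord"
proof -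
  have "subdegree (fps_cnj \<phi> - P'.cj k) = subdegree (\<phi> - P.cj k)" for k
  proof -
    have iff: "fps_cnj \<phi> - P'.cj k = 0 \<longleftrightarrow> \<phi> - P.cj k = 0"
      unfolding fps_eq_iff[of _ 0] P'.cj_def P.cj_def using fps_cnj_diff_twist_nth[of k] by simp
    show ?thesis
    proof (cases "\<phi> - P.cj k = 0")
      case False
      hence "fps_nth (\<phi> - P.cj k) (subdegree (\<phi> - P.cj k)) \<noteq> 0" by (rule nth_subdegree_nonzero)
      thus ?thesis
        using fps_cnj_diff_twist_nth[of k] nth_less_subdegree_zero[of _ "\<phi> - P.cj k"]
        by (intro subdegreeI) (auto simp only: P'.cj_def P.cj_def)
    qed (use iff in simp)
  qed
  thus ?thesis by (simp add: P.dord_eq_sum P'.dord_eq_sum)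
qed

lemma \<gamma>_arc0: "\<gamma> u = M (P.arc0 u)"
  by (simp add: \<gamma>_eq P.arc0_def)

lemma clinear_M_swap: "clinear_map (\<lambda>z. M (snd z, fst z))"
proof (rule clinear_mapI)
  interpret Vector_Spaces.linear cscale cscale M by (rule clinear_M)
  show "M (snd (a + b), fst (a + b)) = M (snd a, fst a) + M (snd b, fst b)" for a b
    by (simp add: add[symmetric])
  show "M (snd (cscale c z), fst (cscale c z)) = cscale c (M (snd z, fst z))" for c z
  proof -
    have "(snd (cscale c z), fst (cscale c z)) = cscale c (snd z, fst z)" by (simp add: cscale_def)
    thus ?thesis by (simp only: scale)
  qed
qed

lemma bij_M_swap: "bij (\<lambda>z. M (snd z, fst z))"
proof -
  have "bij (\<lambda>z :: C2. (snd z, fst z))" by (rule o_bij[of "\<lambda>z. (snd z, fst z)"]) (auto simp: fun_eq_iff)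
  from bij_comp[OF this bij_M] show ?thesis by (simp add: o_def)
qed

lemma \<gamma>bar_arc0: "\<gamma>bar u = M (snd (P'.arc0 u), fst (P'.arc0 u))"
  by (simp add: \<gamma>bar_eq P'.arc0_def)

lemmas arc_\<gamma> = P.analytic_arc_linear[OF clinear_M bij_M \<gamma>_arc0]
lemmas arc_\<gamma>bar = P'.analytic_arc_linear[OF clinear_M_swap bij_M_swap \<gamma>bar_arc0]

lemma pullback_eq_0_iff:
  assumes "analytic_arc \<eta>" "expansion2 h H"
  shows "pullback \<eta> H = 0 \<longleftrightarrow> (\<forall>\<^sub>F u in nhds 0. h (\<eta> u) = 0)"
proof
  assume "pullback \<eta> H = 0"
  thus "\<forall>\<^sub>F u in nhds 0. h (\<eta> u) = 0"
    using pullback_expansion[OF assms] by (auto simp: has_fps_expansion_def elim: eventually_mono)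
next
  assume "\<forall>\<^sub>F u in nhds 0. h (\<eta> u) = 0"
  hence "(\<lambda>u. h (\<eta> u)) has_fps_expansion 0"
    by (auto simp: has_fps_expansion_def elim: eventually_mono)
  thus "pullback \<eta> H = 0" by (rule pullback_eqI[OF assms])
qed

lemma conjugate_arc: "\<forall>\<^sub>F u in nhds 0. \<sigma> (\<gamma> u) = \<gamma>bar (cnj u)"
proof -
  have lim: "filterlim cnj (nhds 0) (nhds (0::complex))"
    using tendsto_cnj[OF filterlim_ident, of "0::complex"] by simp
  have "\<forall>\<^sub>F t in nhds 0. eval_fps (fps_cnj \<phi>) t = cnj (eval_fps \<phi> (cnj t))"
    using cnj_expansion by (simp add: has_fps_expansion_def)
  from eventually_compose_filterlim[OF this lim] show ?thesis
    by (rule eventually_mono) (simp add: \<gamma>_eq \<gamma>bar_eq \<sigma>_M)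
qed

lemma conjugate_arc': "\<forall>\<^sub>F u in nhds 0. \<sigma> (\<gamma>bar u) = \<gamma> (cnj u)"
proof -
  have lim: "filterlim cnj (nhds 0) (nhds (0::complex))"
    using tendsto_cnj[OF filterlim_ident, of "0::complex"] by simp
  from eventually_compose_filterlim[OF conjugate_arc lim] show ?thesis
    by (rule eventually_mono) (metis \<sigma>_\<sigma> complex_cnj_cnj)
qed

lemma pullback_f: "pullback \<gamma> f = 0"
proof -
  obtain \<epsilon> where \<epsilon>: "\<epsilon> > 0" "\<And>u. norm u < \<epsilon> \<Longrightarrow> eval2 f (\<gamma> u) = 0" using prim_unfolded by blast
  have "\<forall>\<^sub>F u in nhds (0::complex). u \<in> ball 0 \<epsilon>" using \<epsilon> by (intro eventually_nhds_in_open) auto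
  hence "\<forall>\<^sub>F u in nhds 0. eval2 f (\<gamma> u) = 0" by (rule eventually_mono) (use \<epsilon> in auto)
  thus ?thesis using pullback_eq_0_iff[OF arc_\<gamma> expansion2_eval2[OF cf]] by blast
qed

lemma pullback_conjugate_eq_0:
  assumes h: "expansion2 h H" and h': "expansion2 (\<lambda>z. cnj (h (\<sigma> z))) H'"
  shows "pullback \<gamma>bar H = 0 \<longleftrightarrow> pullback \<gamma> H' = 0"
proof -
  have lim: "filterlim cnj (nhds 0) (nhds (0::complex))"
    using tendsto_cnj[OF filterlim_ident, of "0::complex"] by simp
  have "(\<forall>\<^sub>F u in nhds 0. h (\<gamma>bar u) = 0) \<longleftrightarrow> (\<forall>\<^sub>F u in nhds 0. cnj (h (\<sigma> (\<gamma> u))) = 0)"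
  proof
    assume "\<forall>\<^sub>F u in nhds 0. h (\<gamma>bar u) = 0"
    from eventually_conj[OF eventually_compose_filterlim[OF this lim] conjugate_arc]
    show "\<forall>\<^sub>F u in nhds 0. cnj (h (\<sigma> (\<gamma> u))) = 0" by (rule eventually_mono) simp
  next
    assume "\<forall>\<^sub>F u in nhds 0. cnj (h (\<sigma> (\<gamma> u))) = 0"
    from eventually_conj[OF eventually_compose_filterlim[OF this lim] conjugate_arc']
    show "\<forall>\<^sub>F u in nhds 0. h (\<gamma>bar u) = 0"
    proof (rule eventually_mono)
      fix u assume *: "cnj (h (\<sigma> (\<gamma> (cnj u)))) = 0 \<and> \<sigma> (\<gamma>bar u) = \<gamma> (cnj u)"
      hence "\<sigma> (\<gamma> (cnj u)) = \<gamma>bar u" by (metis \<sigma>_\<sigma>)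
      with * show "h (\<gamma>bar u) = 0" by simp
    qed
  qed
  thus ?thesis
    unfolding pullback_eq_0_iff[OF arc_\<gamma>bar h] pullback_eq_0_iff[OF arc_\<gamma> h'] .
qed

lemma branch_arc_f:
  assumes "codim fscale {A. convergent1 A} P.branch_ring \<delta>"
  shows "branch_arc f \<gamma> \<delta> (P.dord + 1 - m)"
proof (rule branch_arc.intro)
  note range = P.range_pullback[OF clinear_M bij_M \<gamma>_arc0]
  show "\<exists>a. convergent2 a \<and> h = a * f" if "convergent2 h" "pullback \<gamma> h = 0" for h
    by (rule P.kernel_pullback[OF clinear_M bij_M \<gamma>_arc0 f pullback_f that])
  show "x \<in> pullback \<gamma> ` {F. convergent2 F}"
    if "convergent1 x" "\<And>n. n < P.dord + 1 - m \<Longrightarrow> fps_nth x n = 0" for x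
    unfolding range using that by (rule P.conductor)
  show "codim fscale {x. convergent1 x} (pullback \<gamma> ` {F. convergent2 F}) \<delta>"
    unfolding range by (rule assms)
qed (fact cf f_neq_0 arc_\<gamma> pullback_f)+

text \<open>Conjugation carries the statement for \<open>f\<close> to \<open>g\<close>, except for the image ring, which is that of the
  conjugate series.\<close>

lemma branch_arc_g:
  assumes "codim fscale {A. convergent1 A} P'.branch_ring \<delta>"
  shows "branch_arc g \<gamma>bar \<delta> (P'.dord + 1 - m)"
proof (rule branch_arc.intro)
  note range = P'.range_pullback[OF clinear_M_swap bij_M_swap \<gamma>bar_arc0]
  have conj_g: "expansion2 (\<lambda>z. cnj (cnj (eval2 f (\<sigma> (\<sigma> z))))) f"
    by (simp add: \<sigma>_\<sigma> expansion2_eval2[OF cf])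
  show "pullback \<gamma>bar g = 0"
    using pullback_conjugate_eq_0[OF g_expansion conj_g] pullback_f by blast
  show "g \<noteq> 0"
  proof
    assume "g = 0"
    hence "expansion2 (\<lambda>z. cnj (eval2 f (\<sigma> z))) 0" using g_expansion by simp
    hence "\<forall>\<^sub>F z in nhds 0. cnj (eval2 f (\<sigma> z)) = 0"
      unfolding expansion2_def using eval2_const2[of 0] by (simp add: const2_0)
    from eventually_compose_filterlim[OF this \<sigma>_tendsto] have "\<forall>\<^sub>F z in nhds 0. eval2 f z = 0"
      by (simp add: \<sigma>_\<sigma>)
    thus False using eval2_zero_imp_zero[OF cf] f_neq_0 by blast
  qed
  show "\<exists>a. convergent2 a \<and> h = a * g" if h: "convergent2 h" "pullback \<gamma>bar h = 0" for h
  proof -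
    obtain h' where h': "expansion2 (\<lambda>z. cnj (eval2 h (\<sigma> z))) h'"
      using expansion2_conjugate[OF expansion2_eval2[OF h(1)]] by blast
    have "pullback \<gamma> h' = 0"
      using pullback_conjugate_eq_0[OF expansion2_eval2[OF h(1)] h'] h by blast
    then obtain a where a: "convergent2 a" "h' = a * f"
      using P.kernel_pullback[OF clinear_M bij_M \<gamma>_arc0 f pullback_f, of h'] h'
      by (auto simp: expansion2_def)
    obtain b where b: "expansion2 (\<lambda>z. cnj (eval2 a (\<sigma> z))) b"
      using expansion2_conjugate[OF expansion2_eval2[OF a(1)]] by blast
    have "expansion2 (\<lambda>z. eval2 a z * eval2 f z) h'"
      unfolding a(2) by (intro expansion2_mult expansion2_eval2 a cf)
    with h' have "\<forall>\<^sub>F z in nhds 0. eval2 a z * eval2 f z = cnj (eval2 h (\<sigma> z))"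
      unfolding expansion2_def by (auto elim: eventually_elim2)
    from eventually_compose_filterlim[OF this \<sigma>_tendsto]
    have ev: "\<forall>\<^sub>F z in nhds 0. cnj (eval2 a (\<sigma> z)) * cnj (eval2 f (\<sigma> z)) = eval2 h z"
      by (rule eventually_mono) (metis \<sigma>_\<sigma> complex_cnj_cnj complex_cnj_mult)
    have "h = b * g"
      by (rule expansion2_unique[OF expansion2_eval2[OF h(1)]
            expansion2_cong[OF expansion2_mult[OF b g_expansion] ev]])
    with b show ?thesis by (auto simp: expansion2_def)
  qed
  show "x \<in> pullback \<gamma>bar ` {F. convergent2 F}"
    if "convergent1 x" "\<And>n. n < P'.dord + 1 - m \<Longrightarrow> fps_nth x n = 0" for x
    unfolding range using that by (rule P'.conductor)
  show "codim fscale {x. convergent1 x} (pullback \<gamma>bar ` {F. convergent2 F}) \<delta>"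
    unfolding range by (rule assms)
qed (fact cg arc_\<gamma>bar)+

text \<open>The tangent cone of \<open>g\<close> is \<open>p = 0\<close>, so in adapted coordinates the initial form of \<open>g\<close> does not
  vanish at \<open>(1, 0)\<close>; this is its coefficient of \<open>p^m\<close>.\<close>

lemma pullback_g: "subdegree (pullback \<gamma> g) = m * m" "pullback \<gamma> g \<noteq> 0"
proof -
  obtain G where G: "expansion2 (\<lambda>z. eval2 g (M z)) G"
    using expansion2_clinear[OF clinear_M expansion2_eval2[OF cg]] by blast
  interpret M: Vector_Spaces.linear cscale cscale M by (rule clinear_M)
  have hom: "hom_part d G z = hom_part d g (M z)" for d z
  proof -
    have "(\<lambda>t. eval2 g (cscale t (M z))) has_fps_expansion Abs_fps (\<lambda>d. hom_part d G z)"
      using has_fps_expansion_line[OF G, of z] by (simp add: M.scale)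
    from has_fps_expansion_unique[OF this has_fps_expansion_line[OF expansion2_eval2[OF cg]]]
    show ?thesis by (simp add: fps_eq_iff)
  qed
  have low: "coeff2 G i j = 0" if "i + j < m" for i j
  proof -
    have "\<forall>z. hom_part (i + j) G z = 0" using that hom_part_below[of "i + j" g] by (simp add: hom mult2_g)
    hence "\<forall>k\<le>i+j. coeff2 G k (i + j - k) = 0" by (simp only: hom_part_eq_0_iff)
    from this[rule_format, of i] show ?thesis by simp
  qed
  have "p (M (1, 0)) = 1" using coords_M[of "(1, 0)"] by (simp add: coords_def)
  hence "M (1, 0) \<notin> tangent_cone g" by (simp add: tangent_cone_g)
  hence "hom_part m G (1, 0) \<noteq> 0" by (simp add: hom tangent_cone_def initial_form_eq mult2_g)
  moreover have "hom_part m G (1, 0) = coeff2 G m 0"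
  proof -
    have "hom_part m G (1, 0) = (\<Sum>i\<le>m. if i = m then coeff2 G m 0 else 0)"
      unfolding hom_part_def by (rule sum.cong) (auto simp: power_0_left)
    thus ?thesis by simp
  qed
  ultimately have lead: "coeff2 G m 0 \<noteq> 0" by simp
  have cG: "convergent2 G" using G by (simp add: expansion2_def)
  have "pullback \<gamma> g = pullback P.arc0 G"
    by (rule P.pullback_linear[OF clinear_M bij_M \<gamma>_arc0 G cg])
  thus "subdegree (pullback \<gamma> g) = m * m" "pullback \<gamma> g \<noteq> 0"
    using P.subdegree_pullback_arc0[OF cG low lead] by simp_all
qed

theorem invariants:
  "\<exists>\<delta>. delta_invariant f = enat \<delta> \<and> intersection_mult f g = enat (m * m) \<and>
     delta_invariant (f * g) = enat (2 * \<delta> + m * m) \<and> 2 * \<delta> + m = P.dord + 1"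
proof -
  obtain \<delta> where \<delta>: "codim fscale {A. convergent1 A} P.branch_ring \<delta>" "2 * \<delta> + m = P.dord + 1"
    using P.codim_branch_ring by blast
  obtain \<delta>' where \<delta>': "codim fscale {A. convergent1 A} P'.branch_ring \<delta>'" "2 * \<delta>' + m = P'.dord + 1"
    using P'.codim_branch_ring by blast
  have "\<delta>' = \<delta>" using \<delta>(2) \<delta>'(2) dord_conj by simp
  interpret F: branch_arc f \<gamma> \<delta> "P.dord + 1 - m" by (rule branch_arc_f[OF \<delta>(1)])
  interpret two_branches f \<gamma> \<delta> "P.dord + 1 - m" g \<gamma>bar \<delta>' "P'.dord + 1 - m"
    by (intro two_branches.intro branch_arc_f branch_arc_g \<delta> \<delta>' two_branches_axioms.intro pullback_g)
  show ?thesis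
    using F.delta_invariant intersection_mult delta_union pullback_g(1) \<delta>(2) \<open>\<delta>' = \<delta>\<close>
    by (intro exI[of _ \<delta>]) (simp add: mult_2)
qed

end

section \<open>Zeros of a perturbed wave\<close>

lemma norm_cis_diff_le: "norm (cis a - cis b) \<le> \<bar>a - b\<bar>"
proof -
  have "cis a - cis b = cis b * (cis (a - b) - 1)" by (simp add: algebra_simps cis_mult)
  hence "norm (cis a - cis b) = norm (cis (a - b) - 1)" by (simp add: norm_mult)
  also have "\<dots> = 2 * \<bar>sin ((a - b) / 2)\<bar>"
    using dist_exp_i_1[of "a - b"] by (simp add: cis_conv_exp)
  also have "\<dots> \<le> 2 * \<bar>(a - b) / 2\<bar>" by (intro mult_left_mono abs_sin_x_le_abs_x) auto
  finally show ?thesis by simp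
qed

lemma abs_cos_diff_le: "\<bar>cos a - cos b\<bar> \<le> \<bar>a - b\<bar>" for a b :: real
  using abs_Re_le_cmod[of "cis a - cis b"] norm_cis_diff_le[of a b] by simp

lemma abs_sin_diff_le: "\<bar>sin a - sin b\<bar> \<le> \<bar>a - b\<bar>" for a b :: real
  using abs_Im_le_cmod[of "cis a - cis b"] norm_cis_diff_le[of a b] by simp

lemma abs_cos_ge_half:
  assumes "\<bar>y\<bar> \<le> pi / 3"
  shows "cos y \<ge> 1 / 2"
proof -
  have "cos (pi / 3) \<le> cos \<bar>y\<bar>"
    using assms pi_gt_zero by (intro cos_monotone_0_pi_le) linarith+
  thus ?thesis by (simp add: cos_60)
qed

lemma sin_expanding:
  fixes a b :: real and l :: int
  assumes "\<bar>a - of_int l * pi\<bar> \<le> pi / 3" "\<bar>b - of_int l * pi\<bar> \<le> pi / 3"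
  shows "\<bar>a - b\<bar> / 2 \<le> \<bar>sin a - sin b\<bar>"
proof -
  define a' b' where "a' = a - of_int l * pi" and "b' = b - of_int l * pi"
  have shift: "\<bar>sin a - sin b\<bar> = \<bar>sin a' - sin b'\<bar>"
  proof -
    have "sin a = sin a' * cos (of_int l * pi)" "sin b = sin b' * cos (of_int l * pi)"
      using sin_add[of a' "of_int l * pi"] sin_add[of b' "of_int l * pi"]
      by (simp_all add: a'_def b'_def sin_npi_int mult.commute)
    hence "sin a - sin b = (sin a' - sin b') * cos (of_int l * pi)" by (simp add: left_diff_distrib)
    thus ?thesis by (simp add: abs_mult cos_npi_int mult.commute)
  qed
  have main: "(y - x) / 2 \<le> \<bar>sin y - sin x\<bar>" if "x < y" "\<bar>x\<bar> \<le> pi / 3" "\<bar>y\<bar> \<le> pi / 3" for x y :: real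
  proof -
    have "\<exists>z. x < z \<and> z < y \<and> sin y - sin x = (y - x) * cos z"
      by (rule MVT2[OF that(1)]) (auto intro!: derivative_eq_intros)
    then obtain z where z: "x < z" "z < y" "sin y - sin x = (y - x) * cos z" by blast
    have "cos z \<ge> 1 / 2" using z that by (intro abs_cos_ge_half) linarith
    hence "(y - x) * (1 / 2) \<le> (y - x) * cos z" using that by (intro mult_left_mono) auto
    thus ?thesis using z(3) by simp
  qed
  have "\<bar>a' - b'\<bar> / 2 \<le> \<bar>sin a' - sin b'\<bar>"
  proof (cases a' b' rule: linorder_cases)
    case less
    have "(b' - a') / 2 \<le> \<bar>sin b' - sin a'\<bar>"
      by (rule main[OF less]) (use assms in \<open>simp_all add: a'_def b'_def\<close>)
    thus ?thesis using less by (simp add: abs_minus_commute[of "sin a'"])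
  next
    case greater
    have "(a' - b') / 2 \<le> \<bar>sin a' - sin b'\<bar>"
      by (rule main[OF greater]) (use assms in \<open>simp_all add: a'_def b'_def\<close>)
    thus ?thesis using greater by simp
  qed simp
  thus ?thesis using shift by (simp add: a'_def b'_def)
qed

text \<open>The limit, for vanishing radius, of the rescaled equation of the crossings near one of the values
  \<open>\<pi> j / m\<close> of \<open>t\<close>.\<close>

definition wave :: "real \<Rightarrow> complex \<Rightarrow> nat \<Rightarrow> real \<Rightarrow> real \<Rightarrow> complex" where
  "wave m c M s x = of_real (m * x) - c * cis (real M * s)"

text \<open>The unperturbed zeros are \<open>x = \<plusminus> |c| / m\<close> with \<open>c * cis (M s)\<close> real, two for each period of
  \<open>cis (M s)\<close>; near each of them the map is expanding, more than the perturbation is Lipschitz.\<close>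

locale perturbed_wave =
  fixes G :: "real \<Rightarrow> real \<Rightarrow> complex" and m X \<epsilon> \<kappa> :: real and M :: nat and c :: complex
  assumes m: "m > 0" and M: "M > 0" and c: "c \<noteq> 0"
    and \<kappa>: "\<kappa> = 1 / (2 / (norm c * real M) + 3 / m)"
    and \<epsilon>: "\<epsilon> \<ge> 0" "\<epsilon> \<le> \<kappa> / 2" "\<epsilon> \<le> norm c / 2" and X: "norm c + \<epsilon> < m * X"
    and periodic: "\<And>s x. G (s + 2 * pi) x = G s x"
    and bound: "\<And>s x. \<bar>x\<bar> \<le> X \<Longrightarrow> norm (G s x - wave m c M s x) \<le> \<epsilon>"
    and lipschitz: "\<And>s x s' x'. \<bar>x\<bar> \<le> X \<Longrightarrow> \<bar>x'\<bar> \<le> X \<Longrightarrow>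
      norm ((G s x - wave m c M s x) -
            (G s' x' - wave m c M s' x')) \<le> \<epsilon> * (\<bar>s - s'\<bar> + \<bar>x - x'\<bar>)"
begin

definition err where "err s x = G s x - wave m c M s x"

definition phase :: "real \<Rightarrow> real" where "phase s = real M * s + Arg c"

lemma c_cis: "c * cis (real M * s) = of_real (norm c) * cis (phase s)"
proof -
  have "c = of_real (norm c) * cis (Arg c)" using rcis_cmod_Arg[of c] by (simp add: rcis_def)
  hence "c * cis (real M * s) = of_real (norm c) * cis (Arg c) * cis (real M * s)" by simp
  thus ?thesis by (simp add: phase_def cis_mult mult.assoc add.commute)
qed

lemma Re_G: "Re (G s x) = m * x - norm c * cos (phase s) + Re (err s x)"
  and Im_G: "Im (G s x) = - (norm c * sin (phase s)) + Im (err s x)"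
  by (simp_all add: err_def wave_def c_cis)

lemma err_bound: "\<bar>x\<bar> \<le> X \<Longrightarrow> \<bar>Re (err s x)\<bar> \<le> \<epsilon>" "\<bar>x\<bar> \<le> X \<Longrightarrow> \<bar>Im (err s x)\<bar> \<le> \<epsilon>"
  using bound[of x s] abs_Re_le_cmod[of "err s x"] abs_Im_le_cmod[of "err s x"]
  by (auto simp: err_def)

lemma err_lipschitz:
  assumes "\<bar>x\<bar> \<le> X" "\<bar>x'\<bar> \<le> X"
  shows "\<bar>Re (err s x) - Re (err s' x')\<bar> \<le> \<epsilon> * (\<bar>s - s'\<bar> + \<bar>x - x'\<bar>)"
    "\<bar>Im (err s x) - Im (err s' x')\<bar> \<le> \<epsilon> * (\<bar>s - s'\<bar> + \<bar>x - x'\<bar>)"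
  using lipschitz[OF assms, of s s'] abs_Re_le_cmod[of "err s x - err s' x'"]
    abs_Im_le_cmod[of "err s x - err s' x'"] by (auto simp: err_def)

lemma norm_c: "norm c > 0" using c by simp

lemma \<kappa>_pos: "\<kappa> > 0" using m M norm_c by (simp add: \<kappa> add_pos_pos)

lemma \<kappa>_bounds: "\<kappa> * (2 / (norm c * real M) + 3 / m) = 1"
proof -
  have "2 / (norm c * real M) + 3 / m > 0" using m M norm_c by (simp add: add_pos_pos)
  thus ?thesis by (simp add: \<kappa>)
qed

lemma \<epsilon>_small: "\<epsilon> \<le> m / 2"
proof -
  have "\<kappa> * (3 / m) \<le> \<kappa> * (2 / (norm c * real M) + 3 / m)"
    using \<kappa>_pos norm_c by (intro mult_left_mono) auto
  hence "\<kappa> * 3 \<le> m" using \<kappa>_bounds m by (simp add: field_simps)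
  thus ?thesis using \<epsilon>(2) \<kappa>_pos m by linarith
qed

lemma phase_diff: "\<bar>phase s - phase s'\<bar> = real M * \<bar>s - s'\<bar>"
proof -
  have "phase s - phase s' = real M * (s - s')" by (simp add: phase_def algebra_simps)
  thus ?thesis by (simp add: abs_mult)
qed

lemma expanding:
  assumes l: "\<bar>phase s - of_int l * pi\<bar> \<le> pi / 3" "\<bar>phase s' - of_int l * pi\<bar> \<le> pi / 3"
    and x: "\<bar>x\<bar> \<le> X" "\<bar>x'\<bar> \<le> X"
  shows "\<kappa> / 2 * (\<bar>s - s'\<bar> + \<bar>x - x'\<bar>) \<le> norm (G s x - G s' x')"
proof -
  define ds dx where "ds = \<bar>s - s'\<bar>" and "dx = \<bar>x - x'\<bar>"
  define L where "L = norm (wave m c M s x - wave m c M s' x')"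
  have "norm c * (real M * ds / 2) \<le> norm c * \<bar>sin (phase s) - sin (phase s')\<bar>"
    using sin_expanding[OF l] by (intro mult_left_mono) (auto simp: phase_diff ds_def)
  also have "\<dots> = \<bar>Im (wave m c M s x - wave m c M s' x')\<bar>"
    by (simp add: wave_def c_cis right_diff_distrib[symmetric] abs_mult abs_minus_commute)
  also have "\<dots> \<le> L" unfolding L_def by (rule abs_Im_le_cmod)
  finally have 1: "norm c * real M * ds \<le> 2 * L" by simp
  have "m * dx - norm c * (real M * ds) \<le> m * dx - norm c * \<bar>cos (phase s) - cos (phase s')\<bar>"
    using abs_cos_diff_le[of "phase s" "phase s'"] by (intro diff_left_mono mult_left_mono) (auto simp: phase_diff ds_def)
  also have "\<dots> = \<bar>m * (x - x')\<bar> - \<bar>norm c * (cos (phase s) - cos (phase s'))\<bar>"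
    using m by (simp add: abs_mult dx_def)
  also have "\<dots> \<le> \<bar>m * (x - x') - norm c * (cos (phase s) - cos (phase s'))\<bar>"
    by (rule abs_triangle_ineq2)
  also have "\<dots> = \<bar>Re (wave m c M s x - wave m c M s' x')\<bar>"
    unfolding wave_def c_cis by (simp add: algebra_simps)
  also have "\<dots> \<le> L" unfolding L_def by (rule abs_Re_le_cmod)
  finally have 2: "m * dx \<le> 3 * L" using 1 by simp
  have "ds \<le> 2 / (norm c * real M) * L"
    using 1 norm_c M by (simp add: field_simps)
  moreover have "dx \<le> 3 / m * L" using 2 m by (simp add: field_simps)
  ultimately have "ds + dx \<le> (2 / (norm c * real M) + 3 / m) * L" by (simp add: distrib_right)
  hence "\<kappa> * (ds + dx) \<le> \<kappa> * ((2 / (norm c * real M) + 3 / m) * L)" using \<kappa>_pos by (intro mult_left_mono) auto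
  hence 3: "\<kappa> * (ds + dx) \<le> L" unfolding mult.assoc[symmetric] \<kappa>_bounds by simp
  have "L \<le> norm (G s x - G s' x') + norm (err s x - err s' x')"
  proof -
    have "wave m c M s x - wave m c M s' x' =
       (G s x - G s' x') - (err s x - err s' x')" by (simp add: err_def)
    thus ?thesis unfolding L_def by (metis norm_triangle_ineq4)
  qed
  also have "norm (err s x - err s' x') \<le> \<epsilon> * (ds + dx)"
    unfolding err_def ds_def dx_def by (rule lipschitz[OF x])
  also have "\<dots> \<le> \<kappa> / 2 * (ds + dx)"
    using \<epsilon> by (intro mult_right_mono) (auto simp: ds_def dx_def)
  finally have "\<kappa> * (ds + dx) - \<kappa> / 2 * (ds + dx) \<le> norm (G s x - G s' x')" using 3 by linarith
  thus ?thesis by (simp add: ds_def dx_def field_simps)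
qed

text \<open>At a zero the imaginary part forces \<open>sin (phase s)\<close> to be at most \<open>1/2\<close> in absolute value.\<close>

lemma zero_phase:
  assumes "\<bar>x\<bar> \<le> X" "G s x = 0"
  shows "\<exists>l :: int. \<bar>phase s - of_int l * pi\<bar> < pi / 3"
proof -
  define l where "l = round (phase s / pi)"
  define \<eta> where "\<eta> = phase s - of_int l * pi"
  have "\<bar>of_int l - phase s / pi\<bar> \<le> 1 / 2" unfolding l_def by (rule of_int_round_abs_le)
  hence "\<bar>of_int l - phase s / pi\<bar> * pi \<le> 1 / 2 * pi" by (intro mult_right_mono) auto
  also have "\<bar>of_int l - phase s / pi\<bar> * pi = \<bar>(of_int l - phase s / pi) * pi\<bar>" by (simp add: abs_mult)
  also have "(of_int l - phase s / pi) * pi = - \<eta>" by (simp add: \<eta>_def left_diff_distrib)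
  finally have \<eta>: "\<bar>\<eta>\<bar> \<le> pi / 2" by simp
  have "sin (phase s) = sin \<eta> * cos (of_int l * pi)"
    using sin_add[of \<eta> "of_int l * pi"] by (simp add: \<eta>_def sin_npi_int mult.commute)
  hence "\<bar>sin (phase s)\<bar> = \<bar>sin \<eta>\<bar>" by (simp add: abs_mult cos_npi_int mult.commute)
  moreover have "norm c * \<bar>sin (phase s)\<bar> \<le> norm c / 2"
  proof -
    have "norm c * sin (phase s) = Im (err s x)" using Im_G[of s x] assms by simp
    hence "norm c * \<bar>sin (phase s)\<bar> = \<bar>Im (err s x)\<bar>" by (metis abs_mult abs_norm_cancel)
    thus ?thesis using err_bound(2)[OF assms(1), of s] \<epsilon> by linarith
  qed
  ultimately have half: "\<bar>sin \<eta>\<bar> \<le> 1 / 2" using norm_c by (simp add: field_simps)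
  have "\<bar>\<eta>\<bar> < pi / 3"
  proof (rule ccontr)
    assume "\<not> \<bar>\<eta>\<bar> < pi / 3"
    hence "sin (pi / 3) \<le> sin \<bar>\<eta>\<bar>" using \<eta> by (intro sin_monotone_2pi_le) (use pi_gt_zero in linarith)+
    also have "\<dots> = \<bar>sin \<eta>\<bar>"
    proof -
      have "sin \<bar>\<eta>\<bar> \<ge> 0" using \<eta> pi_gt_zero by (intro sin_ge_zero) linarith+
      thus ?thesis by (cases "\<eta> \<ge> 0") auto
    qed
    finally have "sin (pi / 3) \<le> 1 / 2" using half by linarith
    hence "sqrt 3 \<le> 1" by (simp add: sin_60)
    thus False by simp
  qed
  thus ?thesis by (auto simp: \<eta>_def)
qed

text \<open>For every \<open>s\<close> the real part vanishes for some \<open>x = \<xi> s\<close>, which is Lipschitz in \<open>s\<close>. Along this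
  curve the imaginary part changes sign when the phase crosses a multiple of \<open>\<pi>\<close>.\<close>

lemma zero_exists:
  fixes l :: int
  shows "\<exists>s x. \<bar>phase s - of_int l * pi\<bar> < pi / 3 \<and> \<bar>x\<bar> \<le> X \<and> G s x = 0"
proof -
  have X0: "X > 0" using X m norm_c \<epsilon>(1) by (smt (verit) mult_nonneg_nonpos)
  have ReG_lip: "\<bar>Re (G s x) - Re (G s x')\<bar> \<le> (m + \<epsilon>) * \<bar>x - x'\<bar>" if "\<bar>x\<bar> \<le> X" "\<bar>x'\<bar> \<le> X" for s x x'
  proof -
    have "\<bar>Re (G s x) - Re (G s x')\<bar> = \<bar>m * (x - x') + (Re (err s x) - Re (err s x'))\<bar>"
      by (simp add: Re_G algebra_simps)
    also have "\<dots> \<le> \<bar>m * (x - x')\<bar> + \<bar>Re (err s x) - Re (err s x')\<bar>" by (rule abs_triangle_ineq)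
    also have "\<dots> \<le> m * \<bar>x - x'\<bar> + \<epsilon> * \<bar>x - x'\<bar>"
      using err_lipschitz(1)[OF that, of s s] m by (simp add: abs_mult)
    finally show ?thesis by (simp add: distrib_right)
  qed
  have "\<exists>x\<ge>-X. x \<le> X \<and> Re (G s x) = 0" for s
  proof (rule IVT')
    have "\<bar>norm c * cos (phase s)\<bar> \<le> norm c" by (simp add: abs_mult mult_left_le)
    thus "Re (G s (- X)) \<le> 0" "0 \<le> Re (G s X)"
      unfolding Re_G using X X0 err_bound(1)[of X s] err_bound(1)[of "- X" s] by auto
    have "(m + \<epsilon>)-lipschitz_on {-X..X} (\<lambda>x. Re (G s x))"
      using ReG_lip m \<epsilon> by (intro lipschitz_onI) (auto simp: dist_real_def)
    thus "continuous_on {-X..X} (\<lambda>x. Re (G s x))" by (rule lipschitz_on_continuous_on)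
  qed (use X0 in auto)
  hence "\<forall>s. \<exists>x. \<bar>x\<bar> \<le> X \<and> Re (G s x) = 0" by (metis abs_le_iff minus_le_iff)
  from choice[OF this] obtain \<xi> where \<xi>: "\<And>s. \<bar>\<xi> s\<bar> \<le> X" "\<And>s. Re (G s (\<xi> s)) = 0" by auto
  have \<xi>_lip: "m / 2 * \<bar>\<xi> s - \<xi> s'\<bar> \<le> (norm c * real M + \<epsilon>) * \<bar>s - s'\<bar>" for s s'
  proof -
    have "m * (\<xi> s - \<xi> s') = norm c * (cos (phase s) - cos (phase s')) - (Re (err s (\<xi> s)) - Re (err s' (\<xi> s')))"
      using \<xi>(2)[of s] \<xi>(2)[of s'] by (simp add: Re_G algebra_simps)
    hence "\<bar>m * (\<xi> s - \<xi> s')\<bar> \<le> \<bar>norm c * (cos (phase s) - cos (phase s'))\<bar> + \<bar>Re (err s (\<xi> s)) - Re (err s' (\<xi> s'))\<bar>"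
      using abs_triangle_ineq4 by metis
    also have "\<bar>norm c * (cos (phase s) - cos (phase s'))\<bar> \<le> norm c * (real M * \<bar>s - s'\<bar>)"
      using abs_cos_diff_le[of "phase s" "phase s'"] by (simp add: abs_mult phase_diff mult_left_mono)
    also have "\<bar>Re (err s (\<xi> s)) - Re (err s' (\<xi> s'))\<bar> \<le> \<epsilon> * (\<bar>s - s'\<bar> + \<bar>\<xi> s - \<xi> s'\<bar>)"
      by (rule err_lipschitz(1)[OF \<xi>(1) \<xi>(1)])
    finally have 1: "m * \<bar>\<xi> s - \<xi> s'\<bar> \<le> norm c * (real M * \<bar>s - s'\<bar>) + \<epsilon> * (\<bar>s - s'\<bar> + \<bar>\<xi> s - \<xi> s'\<bar>)"
      using m by (simp add: abs_mult)
    have "\<epsilon> * \<bar>\<xi> s - \<xi> s'\<bar> \<le> m / 2 * \<bar>\<xi> s - \<xi> s'\<bar>" using \<epsilon>_small by (intro mult_right_mono) auto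
    with 1 show ?thesis by (simp add: algebra_simps)
  qed
  define y where "y = (\<lambda>s. Im (G s (\<xi> s)))"
  define K where "K = (norm c * real M + \<epsilon>) * (2 / m)"
  have K0: "K \<ge> 0" using m \<epsilon> by (simp add: K_def)
  have \<xi>_lip': "\<bar>\<xi> s - \<xi> s'\<bar> \<le> K * \<bar>s - s'\<bar>" for s s'
    using \<xi>_lip[of s s'] m by (simp add: K_def field_simps)
  have y_lip: "\<bar>y s - y s'\<bar> \<le> (norm c * real M + \<epsilon> * (1 + K)) * \<bar>s - s'\<bar>" for s s'
  proof -
    have "\<bar>y s - y s'\<bar> = \<bar>(Im (err s (\<xi> s)) - Im (err s' (\<xi> s'))) - norm c * (sin (phase s) - sin (phase s'))\<bar>"
      by (simp add: y_def Im_G algebra_simps)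
    also have "\<dots> \<le> \<bar>Im (err s (\<xi> s)) - Im (err s' (\<xi> s'))\<bar> + \<bar>norm c * (sin (phase s) - sin (phase s'))\<bar>"
      by (rule abs_triangle_ineq4)
    also have "\<bar>Im (err s (\<xi> s)) - Im (err s' (\<xi> s'))\<bar> \<le> \<epsilon> * (\<bar>s - s'\<bar> + \<bar>\<xi> s - \<xi> s'\<bar>)"
      by (rule err_lipschitz(2)[OF \<xi>(1) \<xi>(1)])
    also have "\<epsilon> * (\<bar>s - s'\<bar> + \<bar>\<xi> s - \<xi> s'\<bar>) \<le> \<epsilon> * (\<bar>s - s'\<bar> + K * \<bar>s - s'\<bar>)"
      using \<xi>_lip' \<epsilon> by (intro mult_left_mono add_left_mono) auto
    also have "\<bar>norm c * (sin (phase s) - sin (phase s'))\<bar> \<le> norm c * (real M * \<bar>s - s'\<bar>)"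
      using abs_sin_diff_le[of "phase s" "phase s'"] by (simp add: abs_mult phase_diff mult_left_mono)
    finally show ?thesis by (simp add: algebra_simps)
  qed
  have "(norm c * real M + \<epsilon> * (1 + K))-lipschitz_on A y" for A
    using y_lip K0 \<epsilon> by (intro lipschitz_onI) (auto simp: dist_real_def)
  hence y_cont: "continuous_on A y" for A by (rule lipschitz_on_continuous_on)
  \<comment> \<open>the parameters of phase \<open>l \<pi> - \<pi>/3\<close> and \<open>l \<pi> + \<pi>/3\<close>\<close>
  define a b where "a = (of_int l * pi - pi / 3 - Arg c) / real M" and "b = (of_int l * pi + pi / 3 - Arg c) / real M"
  have pa: "phase a = of_int l * pi - pi / 3" and pb: "phase b = of_int l * pi + pi / 3"
    using M by (simp_all add: phase_def a_def b_def)
  have ab: "a \<le> b" using M by (simp add: a_def b_def divide_right_mono)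
  define \<tau> where "\<tau> = cos (of_int l * pi :: real)"
  have \<tau>: "\<tau> = 1 \<or> \<tau> = - 1" using cos_npi_int[of l] by (auto simp: \<tau>_def mult.commute split: if_splits)
  have sa: "sin (phase a) = - (\<tau> * (sqrt 3 / 2))" and sb: "sin (phase b) = \<tau> * (sqrt 3 / 2)"
    unfolding pa pb sin_diff sin_add by (simp_all add: sin_npi_int \<tau>_def sin_60 mult.commute)
  have big: "\<epsilon> < norm c * (sqrt 3 / 2)"
  proof -
    have "1 / 2 < sqrt 3 / 2" by simp
    hence "norm c * (1 / 2) < norm c * (sqrt 3 / 2)" using norm_c by (intro mult_strict_left_mono) auto
    thus ?thesis using \<epsilon> by simp
  qed
  have ya: "y a = \<tau> * (norm c * (sqrt 3 / 2)) + Im (err a (\<xi> a))"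
    and yb: "y b = - (\<tau> * (norm c * (sqrt 3 / 2))) + Im (err b (\<xi> b))"
    by (simp_all add: y_def Im_G sa sb)
  note e = err_bound(2)[OF \<xi>(1)[of a], of a] err_bound(2)[OF \<xi>(1)[of b], of b]
  have "\<exists>s. a \<le> s \<and> s \<le> b \<and> y s = 0"
  proof (cases "\<tau> = 1")
    case True
    have "y b \<le> 0" "0 \<le> y a" using True e big by (auto simp: ya yb)
    thus ?thesis using IVT2'[of y b 0 a] ab y_cont by blast
  next
    case False
    hence "\<tau> = - 1" using \<tau> by simp
    hence "y a \<le> 0" "0 \<le> y b" using e big by (auto simp: ya yb)
    thus ?thesis using IVT'[of y a 0 b] ab y_cont by blast
  qed
  then obtain s where s: "a \<le> s" "s \<le> b" "y s = 0" by blast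
  have zero: "G s (\<xi> s) = 0" using s(3) \<xi>(2)[of s] by (simp add: y_def complex_eq_iff)
  have "y a \<noteq> 0" "y b \<noteq> 0" using \<tau> e big by (auto simp: ya yb)
  hence "a < s" "s < b" using s by (auto simp: less_le)
  hence "phase a < phase s" "phase s < phase b" using M by (auto simp: phase_def)
  hence "\<bar>phase s - of_int l * pi\<bar> < pi / 3" unfolding pa pb by linarith
  thus ?thesis using zero \<xi>(1) by blast
qed

definition is_zero where
  "is_zero l s x \<longleftrightarrow> \<bar>phase s - of_int l * pi\<bar> < pi / 3 \<and> \<bar>x\<bar> \<le> X \<and> G s x = 0" for l :: int

lemma is_zero_unique:
  assumes "is_zero l s x" "is_zero l s' x'"
  shows "s = s' \<and> x = x'"
proof -
  have "\<kappa> / 2 * (\<bar>s - s'\<bar> + \<bar>x - x'\<bar>) \<le> 0"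
    using expanding[of s l s' x x'] assms by (simp add: is_zero_def)
  hence "\<bar>s - s'\<bar> + \<bar>x - x'\<bar> \<le> 0" using \<kappa>_pos by (simp add: mult_le_0_iff)
  thus ?thesis by linarith
qed

lemma is_zero_same_index:
  assumes "is_zero l s x" "is_zero l' s x'"
  shows "l = l'"
proof -
  have "\<bar>of_int (l - l') * pi\<bar> \<le> \<bar>phase s - of_int l * pi\<bar> + \<bar>phase s - of_int l' * pi\<bar>"
    by (simp add: algebra_simps)
  also have "\<dots> < 1 * pi" using assms pi_gt_zero unfolding is_zero_def by linarith
  finally have "\<bar>of_int (l - l') :: real\<bar> < 1" by (simp add: abs_mult)
  thus ?thesis by linarith
qed

lemma periodic_int: "G (s + 2 * pi * of_int k) x = G s x"
proof -
  have nat: "G (s + 2 * pi * of_nat n) x = G s x" for n s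
  proof (induction n)
    case (Suc n)
    thus ?case using periodic[of "s + 2 * pi * of_nat n" x] by (simp add: algebra_simps)
  qed simp
  show ?thesis
  proof (cases "k \<ge> 0")
    case True thus ?thesis using nat[of s "nat k"] by simp
  next
    case False
    thus ?thesis using nat[of "s + 2 * pi * of_int k" "nat (- k)"] by simp
  qed
qed

lemma is_zero_shift: "is_zero l s x \<Longrightarrow> is_zero (l + 2 * int M * k) (s + 2 * pi * of_int k) x"
proof -
  have "phase (s + 2 * pi * of_int k) - of_int (l + 2 * int M * k) * pi = phase s - of_int l * pi"
    by (simp add: phase_def algebra_simps)
  thus "is_zero l s x \<Longrightarrow> is_zero (l + 2 * int M * k) (s + 2 * pi * of_int k) x"
    unfolding is_zero_def by (simp add: periodic_int)
qed

definition zeros :: "(real \<times> real) set" where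
  "zeros = {(s, x). 0 \<le> s \<and> s < 2 * pi \<and> \<bar>x\<bar> \<le> X \<and> G s x = 0}"

text \<open>There is exactly one zero with phase close to each multiple of \<open>\<pi>\<close>, and \<open>s\<close> runs through one period
  while the phase grows by \<open>2 \<pi> M\<close>.\<close>

theorem card_zeros: "finite zeros" "card zeros = 2 * M"
proof -
  have "\<forall>l. \<exists>p. is_zero l (fst p) (snd p)" using zero_exists by (auto simp: is_zero_def)
  from choice[OF this] obtain Z where Z: "\<And>l. is_zero l (fst (Z l)) (snd (Z l))" by blast
  define I where "I = {l. 0 \<le> fst (Z l) \<and> fst (Z l) < 2 * pi}"
  have shift: "fst (Z (l + 2 * int M * k)) = fst (Z l) + 2 * pi * of_int k" for l k
    using is_zero_unique[OF Z is_zero_shift[OF Z]] by blast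
  have "bij_betw Z I zeros"
  proof (rule bij_betw_imageI)
    show "inj_on Z I"
      using is_zero_same_index Z by (intro inj_onI) metis
    show "Z ` I = zeros"
    proof (intro equalityI subsetI)
      fix p assume "p \<in> Z ` I"
      then obtain l where "l \<in> I" "p = Z l" by blast
      thus "p \<in> zeros" using Z[of l] by (auto simp: zeros_def I_def is_zero_def case_prod_unfold)
    next
      fix p assume p: "p \<in> zeros"
      hence "\<bar>snd p\<bar> \<le> X" "G (fst p) (snd p) = 0" by (auto simp: zeros_def)
      then obtain l where "is_zero l (fst p) (snd p)" using zero_phase unfolding is_zero_def by blast
      from is_zero_unique[OF this Z] have "p = Z l" by (simp add: prod_eq_iff)
      thus "p \<in> Z ` I" using p by (auto simp: I_def zeros_def)
    qed
  qed
  moreover have "bij_betw (\<lambda>l. l mod (2 * int M)) I {0..<2 * int M}"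
  proof (rule bij_betw_imageI)
    show "inj_on (\<lambda>l. l mod (2 * int M)) I"
    proof (rule inj_onI)
      fix l l' assume l: "l \<in> I" "l' \<in> I" "l mod (2 * int M) = l' mod (2 * int M)"
      then obtain k where k: "l = l' + 2 * int M * k" by (metis mod_eqE mult.commute)
      hence "fst (Z l) = fst (Z l') + 2 * pi * of_int k" using shift by simp
      hence "\<bar>2 * pi * of_int k\<bar> < 2 * pi" using l by (auto simp: I_def)
      hence "\<bar>of_int k :: real\<bar> < 1" by (simp add: abs_mult)
      hence "k = 0" by linarith
      thus "l = l'" using k by simp
    qed
    show "(\<lambda>l. l mod (2 * int M)) ` I = {0..<2 * int M}"
    proof (intro equalityI subsetI)
      fix r assume r: "r \<in> {0..<2 * int M}"
      define k where "k = - \<lfloor>fst (Z r) / (2 * pi)\<rfloor>"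
      define l where "l = r + 2 * int M * k"
      have "fst (Z l) = fst (Z r) - 2 * pi * of_int \<lfloor>fst (Z r) / (2 * pi)\<rfloor>"
        unfolding l_def shift by (simp add: k_def)
      moreover have "of_int \<lfloor>fst (Z r) / (2 * pi)\<rfloor> * (2 * pi) \<le> fst (Z r)"
        "fst (Z r) < (of_int \<lfloor>fst (Z r) / (2 * pi)\<rfloor> + 1) * (2 * pi)"
        by (rule floor_divide_lower floor_divide_upper, simp)+
      ultimately have "l \<in> I" by (simp add: I_def algebra_simps)
      moreover have "l mod (2 * int M) = r" using r by (simp add: l_def)
      ultimately show "r \<in> (\<lambda>l. l mod (2 * int M)) ` I" by (metis image_eqI)
    qed (use M in auto)
  qed
  ultimately have "bij_betw (Z \<circ> inv_into I (\<lambda>l. l mod (2 * int M))) {0..<2 * int M} zeros"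
    by (intro bij_betw_trans[OF bij_betw_inv_into])
  thus "finite zeros" "card zeros = 2 * M"
    using bij_betw_finite bij_betw_same_card by force+
qed

text \<open>The first part keeps the zeros away from the boundary, so that the expansion holds on a full
  neighbourhood.\<close>

lemma expanding_at_zero:
  assumes "\<bar>x\<bar> \<le> X" "G s x = 0"
  shows "\<bar>x\<bar> < X" "\<exists>\<eta>>0. \<forall>s' x'. \<bar>s' - s\<bar> < \<eta> \<longrightarrow> \<bar>x'\<bar> \<le> X \<longrightarrow> \<kappa> / 2 * (\<bar>s' - s\<bar> + \<bar>x' - x\<bar>) \<le> norm (G s' x')"
proof -
  have "m * x = norm c * cos (phase s) - Re (err s x)" using Re_G[of s x] assms by simp
  hence "\<bar>m * x\<bar> \<le> \<bar>norm c * cos (phase s)\<bar> + \<bar>Re (err s x)\<bar>" by (metis abs_triangle_ineq4)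
  also have "\<dots> \<le> norm c + \<epsilon>"
    using err_bound(1)[OF assms(1)] by (intro add_mono) (auto simp: abs_mult mult_left_le)
  also have "\<dots> < m * X" by (rule X)
  finally have "m * \<bar>x\<bar> < m * X" using m by (simp add: abs_mult)
  thus "\<bar>x\<bar> < X" using m by simp
  obtain l :: int where l: "\<bar>phase s - of_int l * pi\<bar> < pi / 3" using zero_phase[OF assms] by blast
  define \<eta> where "\<eta> = (pi / 3 - \<bar>phase s - of_int l * pi\<bar>) / real M"
  have \<eta>: "\<eta> > 0" using l M by (simp add: \<eta>_def)
  have "\<kappa> / 2 * (\<bar>s' - s\<bar> + \<bar>x' - x\<bar>) \<le> norm (G s' x')" if "\<bar>s' - s\<bar> < \<eta>" "\<bar>x'\<bar> \<le> X" for s' x'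
  proof -
    have "real M * \<bar>s' - s\<bar> < pi / 3 - \<bar>phase s - of_int l * pi\<bar>"
      using that(1) M by (simp add: \<eta>_def field_simps)
    hence "\<bar>phase s' - of_int l * pi\<bar> \<le> pi / 3"
      using phase_diff[of s' s] by linarith
    from expanding[OF this less_imp_le[OF l] that(2) assms(1)] show ?thesis using assms(2) by simp
  qed
  thus "\<exists>\<eta>>0. \<forall>s' x'. \<bar>s' - s\<bar> < \<eta> \<longrightarrow> \<bar>x'\<bar> \<le> X \<longrightarrow> \<kappa> / 2 * (\<bar>s' - s\<bar> + \<bar>x' - x\<bar>) \<le> norm (G s' x')"
    using \<eta> by blast
qed

end

section \<open>Crossings of the sum curve\<close>

lemma sin_minus_id_lipschitz:
  fixes y y' Y :: real
  assumes "\<bar>y\<bar> \<le> Y" "\<bar>y'\<bar> \<le> Y"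
  shows "\<bar>(sin y - y) - (sin y' - y')\<bar> \<le> Y * \<bar>y - y'\<bar>"
proof -
  have main: "\<bar>(sin b - b) - (sin a - a)\<bar> \<le> Y * (b - a)" if "a < b" "\<bar>a\<bar> \<le> Y" "\<bar>b\<bar> \<le> Y" for a b :: real
  proof -
    have "\<exists>z. a < z \<and> z < b \<and> (sin b - b) - (sin a - a) = (b - a) * (cos z - 1)"
      by (rule MVT2[OF that(1)]) (auto intro!: derivative_eq_intros)
    then obtain z where z: "a < z" "z < b" "(sin b - b) - (sin a - a) = (b - a) * (cos z - 1)" by blast
    have "\<bar>cos z - 1\<bar> \<le> Y" using abs_cos_diff_le[of z 0] z that by simp
    hence "(b - a) * \<bar>cos z - 1\<bar> \<le> (b - a) * Y" using that by (intro mult_left_mono) auto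
    thus ?thesis using that unfolding z(3) by (simp add: abs_mult mult.commute)
  qed
  show ?thesis
  proof (cases y y' rule: linorder_cases)
    case less
    have "\<bar>(sin y - y) - (sin y' - y')\<bar> = \<bar>(sin y' - y') - (sin y - y)\<bar>" by (rule abs_minus_commute)
    thus ?thesis using main[OF less assms] less by simp
  next
    case greater
    thus ?thesis using main[OF greater assms(2,1)] by simp
  qed simp
qed

lemma abs_sin_mult_le: "\<bar>sin (real k * t)\<bar> \<le> real k * \<bar>sin t\<bar>"
proof (induction k)
  case (Suc k)
  have "sin (real (Suc k) * t) = sin (real k * t) * cos t + cos (real k * t) * sin t"
    by (simp add: distrib_right sin_add add.commute)
  hence "\<bar>sin (real (Suc k) * t)\<bar> \<le> \<bar>sin (real k * t) * cos t\<bar> + \<bar>cos (real k * t) * sin t\<bar>"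
    by (metis abs_triangle_ineq)
  also have "\<dots> \<le> \<bar>sin (real k * t)\<bar> + \<bar>sin t\<bar>"
    by (intro add_mono) (auto simp: abs_mult mult_left_le mult_left_le_one_le)
  also have "\<dots> \<le> real k * \<bar>sin t\<bar> + \<bar>sin t\<bar>" using Suc by simp
  finally show ?case by (simp add: distrib_right)
qed simp

lemma abs_sin_ge_half:
  assumes "\<bar>y\<bar> \<le> pi / 2"
  shows "\<bar>y\<bar> / 2 \<le> \<bar>sin y\<bar>"
proof (cases "\<bar>y\<bar> \<le> pi / 3")
  case True
  thus ?thesis using sin_expanding[of y 0 0] by simp
next
  case False
  have "sin (pi / 3) \<le> sin \<bar>y\<bar>"
    using False assms by (intro sin_monotone_2pi_le) (use pi_gt_zero in linarith)+
  moreover have "\<bar>sin y\<bar> = \<bar>sin \<bar>y\<bar>\<bar>" by (simp add: abs_if)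
  moreover have "\<bar>y\<bar> / 2 \<le> sin (pi / 3)"
  proof -
    have "sqrt 3 \<ge> 1.7" by (rule real_le_rsqrt) (simp add: power2_eq_square)
    thus ?thesis using assms pi_less_4 pi_approx by (simp add: sin_60)
  qed
  ultimately show ?thesis by linarith
qed

text \<open>The operator \<open>u d/du\<close>, by which differentiation with respect to the angle acts on functions of
  \<open>u = r cis \<theta>\<close>, up to the factor \<open>i\<close>.\<close>

definition euler :: "complex fps \<Rightarrow> complex fps" where
  "euler A = fps_X * fps_deriv A"

lemma euler_power_nth: "fps_nth ((euler ^^ i) A) k = of_nat k ^ i * fps_nth A k"
proof (induction i)
  case (Suc i)
  have "fps_nth (euler B) k = of_nat k * fps_nth B k" for B
    unfolding euler_def by (cases k) simp_all
  thus ?case by (simp add: Suc)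
qed simp

lemma conv_radius_euler_power: "fps_conv_radius A \<le> fps_conv_radius ((euler ^^ i) A)"
proof (induction i)
  case (Suc i)
  have "fps_conv_radius ((euler ^^ i) A) \<le> fps_conv_radius (fps_deriv ((euler ^^ i) A))"
    by (rule fps_conv_radius_deriv)
  also have "\<dots> \<le> fps_conv_radius (fps_X * fps_deriv ((euler ^^ i) A))"
    using fps_conv_radius_mult[of fps_X "fps_deriv ((euler ^^ i) A)"] by simp
  finally show ?case using Suc unfolding euler_def[symmetric] by simp
qed simp

text \<open>The radius \<open>\<rho>\<close> bounds the radii considered and makes all estimates uniform.\<close>

locale sum_curve = puiseux +
  fixes \<rho> :: real
  assumes \<rho>: "0 < \<rho>" "\<rho> \<le> 1" and \<rho>_conv: "ereal \<rho> < fps_conv_radius \<phi>"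
begin

abbreviation a where "a \<equiv> fps_nth \<phi>"

lemma summ: "summable (\<lambda>k. norm (a k) * real k ^ 2 * \<rho> ^ k)"
proof -
  have "ereal (norm (complex_of_real \<rho>)) < fps_conv_radius ((euler ^^ 2) \<phi>)"
    using less_le_trans[OF \<rho>_conv conv_radius_euler_power] \<rho> by simp
  from norm_summable_fps[OF this] show ?thesis
    using \<rho> unfolding euler_power_nth by (simp add: norm_mult norm_power mult_ac)
qed

definition B where "B = (\<Sum>k. norm (a k) * real k ^ 2 * \<rho> ^ k)"

lemma B_nonneg: "B \<ge> 0" unfolding B_def using \<rho> by (intro suminf_nonneg summ) auto

lemma a_0 [simp]: "a k = 0" if "k \<le> m" using ord that by simp

lemma summable_bounded:
  fixes d :: "nat \<Rightarrow> 'b::banach"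
  assumes "\<And>k. k > m \<Longrightarrow> norm (d k) \<le> C * (norm (a k) * real k ^ 2 * \<rho> ^ k)"
    and "\<And>k. k \<le> m \<Longrightarrow> d k = 0"
  shows "summable d" "norm (suminf d) \<le> C * B"
proof -
  have le: "norm (d k) \<le> C * (norm (a k) * real k ^ 2 * \<rho> ^ k)" for k
    using assms[of k] by (cases "k > m") auto
  have s: "summable (\<lambda>k. C * (norm (a k) * real k ^ 2 * \<rho> ^ k))" by (rule summable_mult[OF summ])
  show "summable d" by (rule summable_comparison_test'[OF s]) (rule le)
  have "norm (suminf d) \<le> (\<Sum>k. norm (d k))"
    by (rule summable_norm) (rule summable_comparison_test'[OF s], simp add: le)
  also have "\<dots> \<le> (\<Sum>k. C * (norm (a k) * real k ^ 2 * \<rho> ^ k))"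
    by (rule suminf_le[OF le _ s]) (rule summable_comparison_test'[OF s], simp add: le)
  also have "\<dots> = C * B" unfolding B_def by (rule suminf_mult[OF summ])
  finally show "norm (suminf d) \<le> C * B" .
qed

text \<open>Up to a nonvanishing factor and conjugation, the difference of the values of the curve at \<open>s + t\<close> and
  \<open>s - t\<close>, see \<open>h_difference\<close>.\<close>

definition F :: "real \<Rightarrow> real \<Rightarrow> real \<Rightarrow> complex" where
  "F r s t = of_real (sin (real m * t)) -
     (\<Sum>k. a k * of_real (r ^ (k - m)) * cis (real (k + m) * s) * of_real (sin (real k * t)))"

lemma pow_le:
  assumes "0 \<le> r" "r \<le> \<rho>" "l \<le> k"
  shows "r ^ (k - l) \<le> \<rho> ^ k / \<rho> ^ l"
proof -
  have "r ^ (k - l) \<le> \<rho> ^ (k - l)" using assms by (intro power_mono) auto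
  also have "\<dots> = \<rho> ^ k / \<rho> ^ l" using assms \<rho> by (simp add: power_diff)
  finally show ?thesis .
qed

lemma pow_Suc_le:
  assumes "0 \<le> r" "r \<le> \<rho>" "l < k"
  shows "r ^ (k - l) \<le> r * (\<rho> ^ k / \<rho> ^ Suc l)"
proof -
  have "r ^ (k - l) = r * r ^ (k - Suc l)" using assms by (metis Suc_diff_Suc power_Suc)
  also have "\<dots> \<le> r * (\<rho> ^ k / \<rho> ^ Suc l)" using assms by (intro mult_left_mono pow_le) auto
  finally show ?thesis .
qed

lemma one_le_sq: "x \<le> x * real k ^ 2" if "x \<ge> 0" "k > m"
proof -
  have "1 \<le> real k ^ 2" using that(2) by (intro one_le_power) auto
  from mult_left_mono[OF this that(1)] show ?thesis by simp
qed

lemma le_sq: "x * real k \<le> x * real k ^ 2" if "x \<ge> 0" for x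
proof (cases k)
  case (Suc l)
  thus ?thesis unfolding power2_eq_square using that by (intro mult_left_mono) auto
qed simp

lemma F_summable:
  assumes "0 \<le> r" "r \<le> \<rho>"
  shows "summable (\<lambda>k. a k * of_real (r ^ (k - m)) * cis (real (k + m) * s) * of_real (sin (real k * t)))"
proof (rule summable_bounded(1))
  fix k assume "k > m"
  have "norm (a k * of_real (r ^ (k - m)) * cis (real (k + m) * s) * of_real (sin (real k * t))) =
     norm (a k) * r ^ (k - m) * \<bar>sin (real k * t)\<bar>"
    using assms by (simp add: norm_mult norm_power)
  also have "\<dots> \<le> norm (a k) * (\<rho> ^ k / \<rho> ^ m) * 1"
    using assms \<rho> \<open>k > m\<close> by (intro mult_mono pow_le) auto
  also have "\<dots> \<le> norm (a k) * (\<rho> ^ k / \<rho> ^ m) * 1 * real k ^ 2"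
    using \<rho> \<open>k > m\<close> by (intro one_le_sq) auto
  finally show "norm (a k * of_real (r ^ (k - m)) * cis (real (k + m) * s) * of_real (sin (real k * t)))
     \<le> 1 / \<rho> ^ m * (norm (a k) * real k ^ 2 * \<rho> ^ k)" by (simp add: mult_ac)
qed auto

lemma F_periodic: "F r (s + 2 * pi) t = F r s t"
proof -
  have "cis (real n * (s + 2 * pi)) = cis (real n * s)" for n :: nat
    by (simp add: distrib_left cis_mult[symmetric] cis_multiple_2pi mult.commute[of "real n" "2 * pi"])
  thus ?thesis by (simp only: F_def)
qed

subsection \<open>Zeros close to a multiple of \<open>\<pi> / m\<close>\<close>

context
  fixes j :: nat
  assumes j: "0 < j" "j < m"
begin

text \<open>The parameters \<open>s - tj\<close> and \<open>s + tj\<close> differ by the factor \<open>\<omega>^j\<close> in \<open>u\<close>. The number \<open>n\<close> is the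
  exponent of the first term of \<open>F\<close> that does not vanish at \<open>tj\<close>, by \<open>below_n\<close> and \<open>sin_n\<close>.\<close>

definition n where "n = subdegree (\<phi> - cj j)"
definition tj where "tj = pi * real j / real m"
definition c :: complex where "c = (-1) ^ j * a n * of_real (sin (real n * tj))"

lemma sin_k_tj: "sin (real k * tj) = 0 \<longleftrightarrow> m dvd j * k"
proof -
  have "sin (real k * tj) = 0 \<longleftrightarrow> (\<exists>i::int. real k * tj = of_int i * pi)" by (rule sin_zero_iff_int2)
  also have "\<dots> \<longleftrightarrow> (\<exists>i::int. real (j * k) = of_int (i * int m))"
  proof (intro ex_cong1)
    fix i :: int
    have "real k * tj = of_int i * pi \<longleftrightarrow> real k * real j * pi = of_int i * real m * pi"
      using m by (simp add: tj_def field_simps)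
    also have "\<dots> \<longleftrightarrow> real (j * k) = of_int (i * int m)" by (simp add: mult_ac)
    finally show "real k * tj = of_int i * pi \<longleftrightarrow> real (j * k) = of_int (i * int m)" .
  qed
  also have "\<dots> \<longleftrightarrow> (\<exists>i::int. int (j * k) = i * int m)"
    by (metis of_int_eq_iff of_int_of_nat_eq)
  also have "\<dots> \<longleftrightarrow> int m dvd int (j * k)" by (auto simp: dvd_def mult.commute)
  finally show ?thesis by (simp only: int_dvd_int_iff)
qed

lemma nth_diff_cj: "fps_nth (\<phi> - cj j) k = (1 - \<omega> ^ (j * k)) * a k"
  by (simp add: cj_def algebra_simps power_mult)

lemma diff_cj_neq_0: "\<phi> - cj j \<noteq> 0"
  using distinct[OF j] by (auto simp: cj_def)

lemma a_n: "a n \<noteq> 0" and sin_n: "sin (real n * tj) \<noteq> 0"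
proof -
  have "fps_nth (\<phi> - cj j) n \<noteq> 0" unfolding n_def by (rule nth_subdegree_nonzero[OF diff_cj_neq_0])
  thus "a n \<noteq> 0" "sin (real n * tj) \<noteq> 0" unfolding nth_diff_cj sin_k_tj by (auto simp: \<omega>_power_eq_1)
qed

lemma below_n: "k < n \<Longrightarrow> a k = 0 \<or> sin (real k * tj) = 0"
  using nth_less_subdegree_zero[of k "\<phi> - cj j"]
  unfolding n_def nth_diff_cj sin_k_tj by (auto simp: \<omega>_power_eq_1)

lemma n_gt_m: "m < n"
  using a_n a_0[of n] by (cases "n \<le> m") auto

lemma c_neq_0: "c \<noteq> 0"
  using a_n sin_n by (simp add: c_def)

definition G :: "real \<Rightarrow> real \<Rightarrow> real \<Rightarrow> complex" where
  "G r s x = (-1) ^ j * F r s (tj + r ^ (n - m) * x) / of_real (r ^ (n - m))"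

text \<open>Amplitude and oscillation of the terms of the rescaled equation \<open>G\<close>; the value of the leading term
  at \<open>x = 0\<close> is subtracted, so that \<open>G_expand\<close> describes the deviation from the wave.\<close>

definition amp :: "real \<Rightarrow> nat \<Rightarrow> complex" where
  "amp r k = a k * of_real (r ^ (k - m)) / of_real (r ^ (n - m))"
definition osc :: "real \<Rightarrow> nat \<Rightarrow> real \<Rightarrow> real" where
  "osc r k x = sin (real k * tj + real k * (r ^ (n - m) * x)) - (if k = n then sin (real n * tj) else 0)"

lemma osc_lipschitz: "r \<ge> 0 \<Longrightarrow> \<bar>osc r k x - osc r k x'\<bar> \<le> real k * r ^ (n - m) * \<bar>x - x'\<bar>"
  using abs_sin_diff_le[of "real k * tj + real k * (r ^ (n - m) * x)" "real k * tj + real k * (r ^ (n - m) * x')"]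
  by (simp add: osc_def right_diff_distrib[symmetric] abs_mult)

text \<open>All terms gain a factor \<open>r\<close>: those with \<open>k > n\<close> from the amplitude, and those with \<open>k \<le> n\<close>
  because their oscillation is of the order of \<open>r ^ (n - m)\<close>.\<close>

lemma amp_le:
  assumes "0 < r" "r \<le> \<rho>" "k > m"
  shows "norm (amp r k) * r ^ (n - m) \<le> r / \<rho> ^ Suc n * (norm (a k) * \<rho> ^ k)"
    "k > n \<Longrightarrow> norm (amp r k) \<le> r / \<rho> ^ Suc n * (norm (a k) * \<rho> ^ k)"
proof -
  have "norm (amp r k) * r ^ (n - m) = norm (a k) * r ^ (k - m)"
    using assms by (simp add: amp_def norm_mult norm_divide norm_power)
  also have "\<dots> \<le> norm (a k) * (r * (\<rho> ^ k / \<rho> ^ Suc m))"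
    using assms by (intro mult_left_mono pow_Suc_le) auto
  also have "\<dots> \<le> norm (a k) * (r * (\<rho> ^ k / \<rho> ^ Suc n))"
    using assms \<rho> n_gt_m by (intro mult_left_mono divide_left_mono power_decreasing mult_pos_pos zero_less_power) auto
  finally show "norm (amp r k) * r ^ (n - m) \<le> r / \<rho> ^ Suc n * (norm (a k) * \<rho> ^ k)" by (simp add: mult_ac)
  assume "k > n"
  have "r ^ (k - m) = r ^ (k - n) * r ^ (n - m)" using \<open>k > n\<close> n_gt_m by (simp flip: power_add)
  hence "norm (amp r k) = norm (a k) * r ^ (k - n)"
    using assms by (simp add: amp_def norm_mult norm_divide norm_power)
  also have "\<dots> \<le> norm (a k) * (r * (\<rho> ^ k / \<rho> ^ Suc n))"
    using assms \<open>k > n\<close> by (intro mult_left_mono pow_Suc_le) auto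
  finally show "norm (amp r k) \<le> r / \<rho> ^ Suc n * (norm (a k) * \<rho> ^ k)" by (simp add: mult_ac)
qed

lemma amp_osc_le:
  assumes "0 < r" "r \<le> \<rho>" "k > m" "\<bar>x\<bar> \<le> X"
  shows "norm (amp r k) * \<bar>osc r k x\<bar> \<le> r / \<rho> ^ Suc n * (norm (a k) * \<rho> ^ k) * real k * (X + 1)"
proof (cases "k > n")
  case True
  have "norm (amp r k) * \<bar>osc r k x\<bar> \<le> r / \<rho> ^ Suc n * (norm (a k) * \<rho> ^ k) * (real k * (X + 1))"
  proof (intro mult_mono amp_le)
    have "\<bar>osc r k x\<bar> \<le> 1" using True by (simp add: osc_def)
    also have "1 \<le> real k * (X + 1)" using mult_mono[of 1 "real k" 1 "X + 1"] assms by simp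
    finally show "\<bar>osc r k x\<bar> \<le> real k * (X + 1)" .
  qed (use assms True \<rho> in auto)
  thus ?thesis by (simp add: mult_ac)
next
  case False
  show ?thesis
  proof (cases "a k = 0")
    case True thus ?thesis by (simp add: amp_def)
  next
    case nz: False
    have "osc r k 0 = 0" using False below_n[of k] nz by (cases "k = n") (auto simp: osc_def)
    hence "\<bar>osc r k x\<bar> \<le> real k * r ^ (n - m) * \<bar>x\<bar>" using osc_lipschitz[of r k x 0] assms by simp
    hence "norm (amp r k) * \<bar>osc r k x\<bar> \<le> norm (amp r k) * (real k * r ^ (n - m) * \<bar>x\<bar>)"
      by (intro mult_left_mono) auto
    also have "\<dots> = (norm (amp r k) * r ^ (n - m)) * (real k * \<bar>x\<bar>)" by simp
    also have "\<dots> \<le> r / \<rho> ^ Suc n * (norm (a k) * \<rho> ^ k) * (real k * (X + 1))"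
      using assms \<rho> by (intro mult_mono amp_le) auto
    finally show ?thesis by (simp add: mult_ac)
  qed
qed

lemma sin_m_tj: "sin (real m * (tj + y)) = (-1) ^ j * sin (real m * y)"
proof -
  have "real m * (tj + y) = real m * y + real j * pi" using m by (simp add: tj_def field_simps)
  thus ?thesis by (simp add: sin_add sin_npi cos_npi mult.commute)
qed

lemma G_expand:
  assumes "0 < r" "r \<le> \<rho>"
  shows "summable (\<lambda>k. amp r k * cis (real (k + m) * s) * of_real (osc r k x))"
    "G r s x - wave (real m) c (n + m) s x =
      of_real ((sin (real m * r ^ (n - m) * x) - real m * r ^ (n - m) * x) / r ^ (n - m)) -
      (-1) ^ j * (\<Sum>k. amp r k * cis (real (k + m) * s) * of_real (osc r k x))"
proof -
  define R where "R = r ^ (n - m)"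
  have R: "R > 0" using assms by (simp add: R_def)
  define t where "t = tj + R * x"
  define f where "f k = a k * of_real (r ^ (k - m)) * cis (real (k + m) * s) * of_real (sin (real k * t)) / of_real R" for k
  define e where "e k = (if k = n then a n * cis (real (n + m) * s) * of_real (sin (real n * tj)) else 0)" for k
  have f: "summable f" unfolding f_def using assms by (intro summable_divide F_summable) auto
  have e: "e sums (a n * cis (real (n + m) * s) * of_real (sin (real n * tj)))" unfolding e_def
    using sums_single[of n "\<lambda>_. a n * cis (real (n + m) * s) * of_real (sin (real n * tj))"] by simp
  have fe: "f k - e k = amp r k * cis (real (k + m) * s) * of_real (osc r k x)" for k
    using R by (cases "k = n") (simp_all add: f_def e_def amp_def osc_def t_def R_def[symmetric] algebra_simps diff_divide_distrib)
  have sums: "(\<lambda>k. amp r k * cis (real (k + m) * s) * of_real (osc r k x)) sums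
     (suminf f - a n * cis (real (n + m) * s) * of_real (sin (real n * tj)))"
    unfolding fe[symmetric] by (intro sums_diff summable_sums f e)
  thus "summable (\<lambda>k. amp r k * cis (real (k + m) * s) * of_real (osc r k x))" by (rule sums_summable)
  have "suminf f = (\<Sum>k. a k * of_real (r ^ (k - m)) * cis (real (k + m) * s) * of_real (sin (real k * t))) / of_real R"
    unfolding f_def by (rule suminf_divide) (use assms in \<open>intro F_summable, auto\<close>)
  hence "F r s t / of_real R = of_real (sin (real m * t) / R) - suminf f"
    by (simp add: F_def diff_divide_distrib)
  moreover have "G r s x = (-1) ^ j * (F r s t / of_real R)"
    by (simp add: G_def t_def R_def)
  moreover have "(-1 :: complex) ^ j * of_real (sin (real m * t) / R) = of_real (sin (real m * R * x) / R)"
    by (simp add: t_def sin_m_tj mult.assoc power_mult_distrib[symmetric] flip: mult.assoc[of "(-1)^j"])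
  ultimately have "G r s x = of_real (sin (real m * R * x) / R) - (-1) ^ j * suminf f"
    by (simp add: right_diff_distrib)
  thus "G r s x - wave (real m) c (n + m) s x =
      of_real ((sin (real m * r ^ (n - m) * x) - real m * r ^ (n - m) * x) / r ^ (n - m)) -
      (-1) ^ j * (\<Sum>k. amp r k * cis (real (k + m) * s) * of_real (osc r k x))"
    unfolding R_def[symmetric] sums_unique[OF sums, symmetric] using R
    by (simp add: wave_def c_def algebra_simps diff_divide_distrib)
qed

text \<open>The first summand of \<open>X\<close> makes room for all zeros near \<open>tj\<close>, see \<open>zero_localization\<close>; the other
  two ensure \<open>norm c < m X\<close> with a margin. The factor \<open>C\<close> bounds the error, and \<open>\<kappa>\<close> is the expansion
  rate of the wave.\<close>

definition X where "X = 4 * B / (real m * \<rho> ^ n) + 2 * norm c / real m + 1"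
definition C where "C = 2 * (X + 1) * B / \<rho> ^ Suc n + real m ^ 2 * X * (X + 1)"
definition \<kappa> where "\<kappa> = 1 / (2 / (norm c * real (n + m)) + 3 / real m)"

lemma X_ge: "X \<ge> 1" using m B_nonneg \<rho> by (simp add: X_def)

lemma C_nonneg: "C \<ge> 0" using X_ge B_nonneg \<rho> by (simp add: C_def)

lemma sin_part:
  assumes "0 < r" "r \<le> 1" "\<bar>x\<bar> \<le> X" "\<bar>x'\<bar> \<le> X"
  defines "R \<equiv> r ^ (n - m)"
  shows "\<bar>(sin (real m * R * x) - real m * R * x) / R - (sin (real m * R * x') - real m * R * x') / R\<bar>
    \<le> r * (real m ^ 2 * X) * \<bar>x - x'\<bar>"
proof -
  have R: "R > 0" "R \<le> r" using assms n_gt_m power_decreasing[of 1 "n - m" r] by (auto simp: R_def)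
  have "\<bar>(sin (real m * R * x) - real m * R * x) - (sin (real m * R * x') - real m * R * x')\<bar>
     \<le> (real m * R * X) * \<bar>real m * R * x - real m * R * x'\<bar>"
    using assms(3,4) R m by (intro sin_minus_id_lipschitz) (auto simp: abs_mult intro!: mult_left_mono)
  also have "\<bar>real m * R * x - real m * R * x'\<bar> = real m * R * \<bar>x - x'\<bar>"
    using R by (simp add: right_diff_distrib[symmetric] abs_mult)
  finally have "\<bar>(sin (real m * R * x) - real m * R * x) - (sin (real m * R * x') - real m * R * x')\<bar> / R
     \<le> (real m * R * X) * (real m * R * \<bar>x - x'\<bar>) / R" using R by (intro divide_right_mono) auto
  also have "\<dots> = R * (real m ^ 2 * X) * \<bar>x - x'\<bar>" using R by (simp add: power2_eq_square)
  also have "\<dots> \<le> r * (real m ^ 2 * X) * \<bar>x - x'\<bar>" using R X_ge by (intro mult_right_mono) auto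
  finally show ?thesis using R by (simp add: diff_divide_distrib[symmetric] abs_divide)
qed

lemma wave_bound:
  assumes "0 < r" "r \<le> \<rho>" "\<bar>x\<bar> \<le> X"
  shows "norm (G r s x - wave (real m) c (n + m) s x) \<le> C * r"
proof -
  let ?d = "\<lambda>k. amp r k * cis (real (k + m) * s) * of_real (osc r k x)"
  define V W where "V = r / \<rho> ^ Suc n * (X + 1) * B" and "W = r * (real m ^ 2 * X) * (X + 1)"
  have "norm (suminf ?d) \<le> V" unfolding V_def
  proof (rule summable_bounded(2))
    fix k assume k: "k > m"
    have "norm (?d k) = norm (amp r k) * \<bar>osc r k x\<bar>" by (simp add: norm_mult)
    also have "\<dots> \<le> r / \<rho> ^ Suc n * (norm (a k) * \<rho> ^ k) * real k * (X + 1)"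
      by (rule amp_osc_le[OF assms(1,2) k assms(3)])
    also have "\<dots> = (r / \<rho> ^ Suc n * (norm (a k) * \<rho> ^ k) * (X + 1)) * real k" by simp
    also have "\<dots> \<le> (r / \<rho> ^ Suc n * (norm (a k) * \<rho> ^ k) * (X + 1)) * real k ^ 2"
      using assms \<rho> X_ge by (intro le_sq) auto
    finally show "norm (?d k) \<le> r / \<rho> ^ Suc n * (X + 1) * (norm (a k) * real k ^ 2 * \<rho> ^ k)"
      by (simp add: mult_ac)
  qed (auto simp: amp_def)
  moreover have "\<bar>(sin (real m * r ^ (n - m) * x) - real m * r ^ (n - m) * x) / r ^ (n - m)\<bar> \<le> r * (real m ^ 2 * X) * \<bar>x\<bar>"
    using sin_part[of r x 0] assms \<rho> X_ge by simp
  moreover have "r * (real m ^ 2 * X) * \<bar>x\<bar> \<le> W"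
    unfolding W_def using assms X_ge by (intro mult_left_mono) auto
  moreover have "norm (G r s x - wave (real m) c (n + m) s x) \<le>
     \<bar>(sin (real m * r ^ (n - m) * x) - real m * r ^ (n - m) * x) / r ^ (n - m)\<bar> + norm (suminf ?d)"
    unfolding G_expand(2)[OF assms(1,2)]
    by (rule order_trans[OF norm_triangle_ineq4])
       (simp only: norm_mult norm_power norm_minus_cancel norm_one power_one mult_1_left norm_of_real order_refl)
  moreover have "C * r = 2 * V + W"
    by (simp add: C_def V_def W_def algebra_simps add_divide_distrib)
  moreover have "V \<ge> 0" unfolding V_def using assms \<rho> X_ge B_nonneg by auto
  ultimately show ?thesis by linarith
qed

lemma wave_lipschitz:
  assumes "0 < r" "r \<le> \<rho>" "\<bar>x\<bar> \<le> X" "\<bar>x'\<bar> \<le> X"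
  shows "norm ((G r s x - wave (real m) c (n + m) s x) -
      (G r s' x' - wave (real m) c (n + m) s' x')) \<le> C * r * (\<bar>s - s'\<bar> + \<bar>x - x'\<bar>)"
proof -
  let ?d = "\<lambda>k. amp r k * cis (real (k + m) * s) * of_real (osc r k x)"
  let ?d' = "\<lambda>k. amp r k * cis (real (k + m) * s') * of_real (osc r k x')"
  let ?sin = "\<lambda>x. (sin (real m * r ^ (n - m) * x) - real m * r ^ (n - m) * x) / r ^ (n - m)"
  define D where "D = \<bar>s - s'\<bar> + \<bar>x - x'\<bar>"
  have "norm (\<Sum>k. ?d k - ?d' k) \<le> r / \<rho> ^ Suc n * (2 * (X + 1)) * D * B"
  proof (rule summable_bounded(2))
    fix k assume k: "k > m"
    define g where "g = r / \<rho> ^ Suc n * (norm (a k) * \<rho> ^ k)"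
    have g: "g \<ge> 0" using assms \<rho> by (simp add: g_def)
    have "?d k - ?d' k = amp r k * of_real (osc r k x) * (cis (real (k + m) * s) - cis (real (k + m) * s')) +
       amp r k * cis (real (k + m) * s') * of_real (osc r k x - osc r k x')"
      by (simp add: algebra_simps)
    hence "norm (?d k - ?d' k) \<le> norm (amp r k) * \<bar>osc r k x\<bar> * norm (cis (real (k + m) * s) - cis (real (k + m) * s')) +
       norm (amp r k) * \<bar>osc r k x - osc r k x'\<bar>"
      using norm_triangle_ineq[of "amp r k * of_real (osc r k x) * (cis (real (k + m) * s) - cis (real (k + m) * s'))"
         "amp r k * cis (real (k + m) * s') * of_real (osc r k x - osc r k x')"]
      by (simp only: norm_mult norm_cis norm_of_real mult_1_right)
    also have "\<dots> \<le> g * real k * (X + 1) * (2 * real k * \<bar>s - s'\<bar>) + norm (amp r k) * (real k * r ^ (n - m) * \<bar>x - x'\<bar>)"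
    proof (rule add_mono[OF mult_mono mult_left_mono])
      have "norm (cis (real (k + m) * s) - cis (real (k + m) * s')) \<le> real (k + m) * \<bar>s - s'\<bar>"
        using norm_cis_diff_le[of "real (k + m) * s" "real (k + m) * s'"]
        by (simp add: right_diff_distrib[symmetric] abs_mult)
      also have "\<dots> \<le> 2 * real k * \<bar>s - s'\<bar>" using k by (intro mult_right_mono) auto
      finally show "norm (cis (real (k + m) * s) - cis (real (k + m) * s')) \<le> 2 * real k * \<bar>s - s'\<bar>" .
      show "norm (amp r k) * \<bar>osc r k x\<bar> \<le> g * real k * (X + 1)"
        unfolding g_def by (rule amp_osc_le[OF assms(1,2) k assms(3)])
      show "\<bar>osc r k x - osc r k x'\<bar> \<le> real k * r ^ (n - m) * \<bar>x - x'\<bar>"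
        using assms by (intro osc_lipschitz) auto
    qed (use g X_ge in auto)
    also have "norm (amp r k) * (real k * r ^ (n - m) * \<bar>x - x'\<bar>) = norm (amp r k) * r ^ (n - m) * (real k * \<bar>x - x'\<bar>)"
      by simp
    also have "\<dots> \<le> g * (real k * \<bar>x - x'\<bar>)"
      unfolding g_def by (intro mult_right_mono amp_le(1) assms k) auto
    also have "g * (real k * \<bar>x - x'\<bar>) = g * \<bar>x - x'\<bar> * real k" by simp
    also have "g * \<bar>x - x'\<bar> * real k \<le> g * \<bar>x - x'\<bar> * real k ^ 2" using g by (intro le_sq) auto
    also have "g * \<bar>x - x'\<bar> * real k ^ 2 \<le> g * \<bar>x - x'\<bar> * real k ^ 2 * (2 * (X + 1))"
    proof -
      have "g * \<bar>x - x'\<bar> * real k ^ 2 * 1 \<le> g * \<bar>x - x'\<bar> * real k ^ 2 * (2 * (X + 1))"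
        using g X_ge by (intro mult_left_mono) auto
      thus ?thesis by simp
    qed
    also have "g * real k * (X + 1) * (2 * real k * \<bar>s - s'\<bar>) + g * \<bar>x - x'\<bar> * real k ^ 2 * (2 * (X + 1)) =
       r / \<rho> ^ Suc n * (2 * (X + 1)) * D * (norm (a k) * real k ^ 2 * \<rho> ^ k)"
      by (simp add: g_def D_def power2_eq_square algebra_simps add_divide_distrib)
    finally show "norm (?d k - ?d' k) \<le> r / \<rho> ^ Suc n * (2 * (X + 1)) * D * (norm (a k) * real k ^ 2 * \<rho> ^ k)"
      by simp
  qed (auto simp: amp_def)
  hence "norm (suminf ?d - suminf ?d') \<le> r / \<rho> ^ Suc n * (2 * (X + 1)) * D * B"
    by (subst suminf_diff[OF G_expand(1)[OF assms(1,2)] G_expand(1)[OF assms(1,2)]])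
  moreover have "\<bar>?sin x - ?sin x'\<bar> \<le> r * (real m ^ 2 * X) * \<bar>x - x'\<bar>"
    using assms \<rho> by (intro sin_part) auto
  moreover have "r * (real m ^ 2 * X) * \<bar>x - x'\<bar> \<le> r * (real m ^ 2 * X) * ((X + 1) * D)"
  proof -
    have "\<bar>x - x'\<bar> \<le> (X + 1) * D" using mult_mono[of 1 "X + 1" "\<bar>x - x'\<bar>" D] X_ge by (simp add: D_def)
    thus ?thesis using assms X_ge by (intro mult_left_mono) auto
  qed
  moreover have "norm ((G r s x - wave (real m) c (n + m) s x) -
      (G r s' x' - wave (real m) c (n + m) s' x')) \<le>
     \<bar>?sin x - ?sin x'\<bar> + norm (suminf ?d - suminf ?d')"
  proof -
    have "(of_real (?sin x) - (-1) ^ j * suminf ?d) - (of_real (?sin x') - (-1) ^ j * suminf ?d') =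
       complex_of_real (?sin x - ?sin x') - (-1) ^ j * (suminf ?d - suminf ?d')"
      by (simp add: algebra_simps diff_divide_distrib)
    thus ?thesis unfolding G_expand(2)[OF assms(1,2)]
      using norm_triangle_ineq4[of "complex_of_real (?sin x - ?sin x')" "(-1) ^ j * (suminf ?d - suminf ?d')"]
      by (simp only: norm_mult norm_power norm_minus_cancel norm_one power_one mult_1_left norm_of_real)
  qed
  moreover have "C * r * D = r / \<rho> ^ Suc n * (2 * (X + 1)) * D * B + r * (real m ^ 2 * X) * ((X + 1) * D)"
    by (simp add: C_def algebra_simps add_divide_distrib)
  ultimately show ?thesis unfolding D_def[symmetric] by linarith
qed

lemma eventually_wave:
  "\<forall>\<^sub>F r in at_right 0. perturbed_wave (G r) (real m) X (C * r) \<kappa> (n + m) c"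
proof -
  have \<kappa>0: "\<kappa> > 0" using m c_neq_0 by (simp add: \<kappa>_def add_pos_pos)
  have "((\<lambda>r. C * r) \<longlongrightarrow> C * 0) (at_right 0)" by (intro tendsto_intros)
  moreover have "C * 0 < min (\<kappa> / 2) (norm c / 2)" using \<kappa>0 c_neq_0 by simp
  ultimately have "\<forall>\<^sub>F r in at_right 0. C * r < min (\<kappa> / 2) (norm c / 2)" by (rule order_tendstoD(2))
  moreover have "\<forall>\<^sub>F r in at_right 0. r \<in> {0<..<\<rho>}" using \<rho> by (intro eventually_at_right_real) auto
  ultimately show ?thesis
  proof eventually_elim
    case (elim r)
    show ?case
    proof unfold_locales
      have "real m * X = 4 * B / \<rho> ^ n + 2 * norm c + real m" using m by (simp add: X_def distrib_left)
      moreover have "4 * B / \<rho> ^ n \<ge> 0" using B_nonneg \<rho> by simp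
      moreover have "C * r < norm c" using elim(1) norm_ge_zero[of c] by linarith
      ultimately show "norm c + C * r < real m * X" using m norm_ge_zero[of c] by linarith
    qed (use elim m c_neq_0 C_nonneg \<kappa>_def wave_bound wave_lipschitz F_periodic in \<open>auto simp: G_def\<close>)
  qed
qed

end

subsection \<open>Localization and number of all zeros\<close>

lemma eventually_small:
  "\<forall>\<^sub>F r in at_right 0. 0 < r \<and> r \<le> \<rho> \<and> r / \<rho> ^ Suc m * B < real m / 4"
proof -
  have "((\<lambda>r. r / \<rho> ^ Suc m * B) \<longlongrightarrow> 0 / \<rho> ^ Suc m * B) (at_right 0)" using \<rho> by (intro tendsto_intros) auto
  hence "\<forall>\<^sub>F r in at_right 0. r / \<rho> ^ Suc m * B < real m / 4" by (rule order_tendstoD(2)) (use m in simp)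
  moreover have "\<forall>\<^sub>F r in at_right 0. r \<in> {0<..<\<rho>}" using \<rho> by (intro eventually_at_right_real) auto
  ultimately show ?thesis by eventually_elim auto
qed

definition F_zeros :: "real \<Rightarrow> (real \<times> real) set" where
  "F_zeros r = {(s, t). 0 \<le> s \<and> s < 2 * pi \<and> 0 < t \<and> t < pi \<and> F r s t = 0}"

lemma abs_sin_shift: "\<bar>sin (of_int l * pi + y)\<bar> = \<bar>sin y\<bar>"
proof -
  have "sin (of_int l * pi + y) = cos (of_int l * pi) * sin y"
    by (simp add: sin_add sin_npi_int mult.commute)
  thus ?thesis by (simp add: abs_mult cos_npi_int mult.commute)
qed

lemma sin_eq_of_zero:
  assumes "F r s t = 0"
  shows "\<bar>sin (real m * t)\<bar> =
    norm (\<Sum>k. a k * of_real (r ^ (k - m)) * cis (real (k + m) * s) * of_real (sin (real k * t)))"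
proof -
  have "complex_of_real (sin (real m * t)) =
     (\<Sum>k. a k * of_real (r ^ (k - m)) * cis (real (k + m) * s) * of_real (sin (real k * t)))"
    using assms unfolding F_def by (rule iffD1[OF right_minus_eq])
  from arg_cong[OF this, of norm] show ?thesis by (simp only: norm_of_real)
qed

text \<open>With \<open>\<tau>\<close> the distance of \<open>t\<close> from the nearest \<open>\<pi> l / m\<close>, the left side of the equation
  is at least \<open>m |\<tau>| / 2\<close>. The sum on the right is at most \<open>m |\<tau>| / 4\<close> plus the values of its terms at
  \<open>\<pi> l / m\<close>. These vanish for \<open>l = 0\<close> and \<open>l = m\<close>, which excludes these cases, and otherwise
  start with the term of index \<open>n j\<close>.\<close>

lemma zero_localization:
  assumes r: "0 < r" "r \<le> \<rho>" "r / \<rho> ^ Suc m * B \<le> real m / 4" and t: "0 < t" "t < pi"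
    and zero: "F r s t = 0"
  shows "\<exists>j\<in>{1..<m}. \<bar>t - tj j\<bar> \<le> X j * r ^ (n j - m)"
proof -
  define l where "l = round (real m * t / pi)"
  define \<tau> where "\<tau> = t - of_int l * pi / real m"
  let ?d = "\<lambda>k. a k * of_real (r ^ (k - m)) * cis (real (k + m) * s) * of_real (sin (real k * t))"
  have norm_d: "norm (?d k) = norm (a k) * r ^ (k - m) * \<bar>sin (real k * t)\<bar>" for k
    using r by (simp add: norm_mult norm_power)
  have "\<bar>of_int l - real m * t / pi\<bar> \<le> 1 / 2" unfolding l_def by (rule of_int_round_abs_le)
  hence l: "\<bar>of_int l - real m * t / pi\<bar> * pi \<le> 1 / 2 * pi" by (intro mult_right_mono) auto
  have mt: "real m * t = of_int l * pi + real m * \<tau>" using m by (simp add: \<tau>_def field_simps)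
  have "\<bar>of_int l - real m * t / pi\<bar> * pi = \<bar>(of_int l - real m * t / pi) * pi\<bar>" by (simp add: abs_mult)
  also have "(of_int l - real m * t / pi) * pi = - (real m * \<tau>)" by (simp add: mt left_diff_distrib)
  finally have "\<bar>real m * \<tau>\<bar> \<le> pi / 2" using l by simp
  from abs_sin_ge_half[OF this] have "real m * \<bar>\<tau>\<bar> / 2 \<le> \<bar>sin (real m * t)\<bar>"
    unfolding mt abs_sin_shift by (simp add: abs_mult)
  hence lower: "real m * \<bar>\<tau>\<bar> / 2 \<le> norm (suminf ?d)" unfolding sin_eq_of_zero[OF zero] .
  have slope: "norm (a k) * r ^ (k - m) * (real k * \<bar>\<tau>\<bar>) \<le> r / \<rho> ^ Suc m * \<bar>\<tau>\<bar> * (norm (a k) * real k ^ 2 * \<rho> ^ k)"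
    if k: "k > m" for k
  proof -
    have "norm (a k) * r ^ (k - m) * (real k * \<bar>\<tau>\<bar>) \<le> norm (a k) * (r * (\<rho> ^ k / \<rho> ^ Suc m)) * (real k * \<bar>\<tau>\<bar>)"
      using r k by (intro mult_right_mono mult_left_mono pow_Suc_le) auto
    also have "\<dots> = (norm (a k) * (r * (\<rho> ^ k / \<rho> ^ Suc m)) * \<bar>\<tau>\<bar>) * real k" by simp
    also have "\<dots> \<le> (norm (a k) * (r * (\<rho> ^ k / \<rho> ^ Suc m)) * \<bar>\<tau>\<bar>) * real k ^ 2"
      using r \<rho> by (intro le_sq) auto
    finally show ?thesis by (simp add: mult_ac)
  qed
  have slope_le: "r / \<rho> ^ Suc m * \<bar>\<tau>\<bar> * B \<le> real m * \<bar>\<tau>\<bar> / 4"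
    using mult_right_mono[OF r(3), of "\<bar>\<tau>\<bar>"] by (simp add: mult_ac)
  have l_range: "0 \<le> l" "l \<le> int m"
  proof -
    have "0 \<le> real m * t / pi" "real m * t / pi \<le> real m" using t by (simp_all add: field_simps mult_right_mono)
    thus "0 \<le> l" "l \<le> int m" unfolding l_def
      using round_mono[of 0 "real m * t / pi"] round_mono[of "real m * t / pi" "real m"] by simp_all
  qed
  have "l \<noteq> 0 \<and> l \<noteq> int m"
  proof (rule ccontr)
    assume "\<not> (l \<noteq> 0 \<and> l \<noteq> int m)"
    hence l: "l = 0 \<or> l = int m" by blast
    hence "\<exists>e::int. t = of_int e * pi + \<tau>"
    proof
      assume "l = 0" thus ?thesis by (intro exI[of _ 0]) (simp add: \<tau>_def)
    next
      assume "l = int m" thus ?thesis using m by (intro exI[of _ 1]) (simp add: \<tau>_def)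
    qed
    then obtain e :: int where "t = of_int e * pi + \<tau>" by blast
    hence "\<bar>sin t\<bar> \<le> \<bar>\<tau>\<bar>" using abs_sin_shift[of e \<tau>] abs_sin_x_le_abs_x[of \<tau>] by simp
    have "norm (suminf ?d) \<le> r / \<rho> ^ Suc m * \<bar>\<tau>\<bar> * B"
    proof (rule summable_bounded(2))
      fix k assume k: "k > m"
      have "\<bar>sin (real k * t)\<bar> \<le> real k * \<bar>\<tau>\<bar>"
        using abs_sin_mult_le[of k t] \<open>\<bar>sin t\<bar> \<le> \<bar>\<tau>\<bar>\<close> mult_left_mono[of "\<bar>sin t\<bar>" "\<bar>\<tau>\<bar>" "real k"] by simp
      hence "norm (?d k) \<le> norm (a k) * r ^ (k - m) * (real k * \<bar>\<tau>\<bar>)"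
        unfolding norm_d using r by (intro mult_left_mono) auto
      also note slope[OF k]
      finally show "norm (?d k) \<le> r / \<rho> ^ Suc m * \<bar>\<tau>\<bar> * (norm (a k) * real k ^ 2 * \<rho> ^ k)" .
    qed auto
    hence "real m * \<bar>\<tau>\<bar> / 2 \<le> real m * \<bar>\<tau>\<bar> / 4" using lower slope_le by linarith
    hence "\<tau> = 0" using m by (simp add: mult_le_0_iff)
    hence "t = of_int l * pi / real m" by (simp add: \<tau>_def)
    thus False using l t m by auto
  qed
  hence "l > 0" "l < int m" using l_range by auto
  then obtain j where j: "0 < j" "j < m" "l = int j" by (metis zero_less_imp_eq_int of_nat_less_iff)
  have \<tau>: "\<tau> = t - tj j" by (simp add: \<tau>_def tj_def[OF j(1,2)] j(3) mult.commute)
  note N = n_gt_m[OF j(1,2)]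
  have "norm (suminf ?d) \<le> (r / \<rho> ^ Suc m * \<bar>\<tau>\<bar> + r ^ (n j - m) / \<rho> ^ n j) * B"
  proof (rule summable_bounded(2))
    fix k assume k: "k > m"
    have kt: "real k * t = real k * tj j + real k * \<tau>" by (simp add: \<tau> right_diff_distrib)
    have "norm (?d k) \<le> norm (a k) * r ^ (k - m) * (real k * \<bar>\<tau>\<bar>) + norm (a k) * r ^ (k - m) * \<bar>sin (real k * tj j)\<bar>"
    proof -
      have "\<bar>sin (real k * t)\<bar> \<le> real k * \<bar>\<tau>\<bar> + \<bar>sin (real k * tj j)\<bar>"
        using abs_sin_diff_le[of "real k * t" "real k * tj j"] by (simp add: kt abs_mult)
      thus ?thesis unfolding norm_d distrib_left[symmetric] using r by (intro mult_left_mono) auto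
    qed
    also have "norm (a k) * r ^ (k - m) * \<bar>sin (real k * tj j)\<bar> \<le>
       r ^ (n j - m) / \<rho> ^ n j * (norm (a k) * real k ^ 2 * \<rho> ^ k)"
    proof (cases "k < n j")
      case True
      hence z: "norm (a k) * r ^ (k - m) * \<bar>sin (real k * tj j)\<bar> = 0" using below_n[OF j(1,2) True] by auto
      show ?thesis unfolding z using r \<rho> by simp
    next
      case False
      have "r ^ (k - m) = r ^ (k - n j) * r ^ (n j - m)" using False N by (simp flip: power_add)
      also have "\<dots> \<le> \<rho> ^ k / \<rho> ^ n j * r ^ (n j - m)"
        using r False by (intro mult_right_mono pow_le) auto
      finally have "norm (a k) * r ^ (k - m) * \<bar>sin (real k * tj j)\<bar> \<le> norm (a k) * (\<rho> ^ k / \<rho> ^ n j * r ^ (n j - m)) * 1"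
        using r \<rho> by (intro mult_mono) auto
      also have "\<dots> \<le> norm (a k) * (\<rho> ^ k / \<rho> ^ n j * r ^ (n j - m)) * 1 * real k ^ 2"
        using k r \<rho> by (intro one_le_sq) auto
      finally show ?thesis by (simp add: mult_ac)
    qed
    also note slope[OF k]
    finally show "norm (?d k) \<le> (r / \<rho> ^ Suc m * \<bar>\<tau>\<bar> + r ^ (n j - m) / \<rho> ^ n j) * (norm (a k) * real k ^ 2 * \<rho> ^ k)"
      by (simp add: distrib_right)
  qed auto
  hence "real m * \<bar>\<tau>\<bar> / 4 \<le> r ^ (n j - m) / \<rho> ^ n j * B"
    using lower slope_le unfolding distrib_right by linarith
  hence "\<bar>\<tau>\<bar> \<le> 4 * B / (real m * \<rho> ^ n j) * r ^ (n j - m)" using m \<rho> by (simp add: field_simps)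
  also have "\<dots> \<le> X j * r ^ (n j - m)" using r m by (intro mult_right_mono) (auto simp: X_def[OF j(1,2)])
  finally show ?thesis using j \<tau> by (intro bexI[of _ j]) auto
qed

text \<open>The zeros near \<open>tj j\<close> are those of a perturbed wave of frequency \<open>n j + m\<close> after rescaling;
  these neighbourhoods are disjoint and, for small radius, contain all zeros.\<close>

lemma card_F_zeros_and_expansion:
  "\<forall>\<^sub>F r in at_right 0. finite (F_zeros r) \<and> card (F_zeros r) = (\<Sum>j\<in>{1..<m}. 2 * (n j + m)) \<and>
     (\<forall>s t. 0 < t \<longrightarrow> t < pi \<longrightarrow> F r s t = 0 \<longrightarrow>
        (\<exists>\<kappa>>0. \<exists>\<eta>>0. \<forall>s' t'. \<bar>s' - s\<bar> < \<eta> \<longrightarrow> \<bar>t' - t\<bar> < \<eta> \<longrightarrow>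
            \<kappa> * (\<bar>s' - s\<bar> + \<bar>t' - t\<bar>) \<le> norm (F r s' t')))"
proof -
  have 3: "\<forall>\<^sub>F r in at_right 0. \<forall>j\<in>{1..<m}. perturbed_wave (G j r) (real m) (X j) (C j * r) (\<kappa> j) (n j + m) (c j)"
    by (intro eventually_ball_finite ballI eventually_wave) auto
  have 4: "\<forall>\<^sub>F r in at_right 0. \<forall>j\<in>{1..<m}. X j * r ^ (n j - m) < pi / (2 * real m)"
  proof (intro eventually_ball_finite ballI)
    fix j assume "j \<in> {1..<m}"
    hence j: "0 < j" "j < m" by auto
    have "((\<lambda>r. X j * r ^ (n j - m)) \<longlongrightarrow> X j * 0 ^ (n j - m)) (at_right 0)" by (intro tendsto_intros)
    moreover have "X j * 0 ^ (n j - m) < pi / (2 * real m)" using m n_gt_m[OF j] by (simp add: power_0_left)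
    ultimately show "\<forall>\<^sub>F r in at_right 0. X j * r ^ (n j - m) < pi / (2 * real m)" by (rule order_tendstoD(2))
  qed auto
  from eventually_small 3 4 show ?thesis
  proof eventually_elim
    case (elim r)
    have r: "0 < r" "r \<le> \<rho>" "r \<le> 1" "r / \<rho> ^ Suc m * B \<le> real m / 4" using elim(1) \<rho> by auto
    define Z where "Z j = {(s, x). 0 \<le> s \<and> s < 2 * pi \<and> \<bar>x\<bar> \<le> X j \<and> G j r s x = 0}" for j
    define sc where "sc j = (\<lambda>(s::real, x). (s, tj j + r ^ (n j - m) * x))" for j
    have Z: "finite (Z j)" "card (Z j) = 2 * (n j + m)" if "j \<in> {1..<m}" for j
    proof -
      interpret W: perturbed_wave "G j r" "real m" "X j" "C j * r" "\<kappa> j" "n j + m" "c j"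
        using elim(2) that by blast
      show "finite (Z j)" "card (Z j) = 2 * (n j + m)" using W.card_zeros unfolding W.zeros_def Z_def by auto
    qed
    have inj: "inj_on (sc j) (Z j)" for j
      using r by (auto simp: inj_on_def sc_def)
    have near: "\<bar>t - tj j\<bar> < pi / (2 * real m)" if "j \<in> {1..<m}" and st: "(s, t) \<in> sc j ` Z j" for j s t
    proof -
      obtain x where x: "t = tj j + r ^ (n j - m) * x" "\<bar>x\<bar> \<le> X j" using st by (auto simp: sc_def Z_def)
      have "\<bar>t - tj j\<bar> = \<bar>x\<bar> * r ^ (n j - m)" using r by (simp add: x(1) abs_mult)
      also have "\<dots> \<le> X j * r ^ (n j - m)" using x(2) r by (intro mult_right_mono) auto
      finally show ?thesis using elim(3) that(1) by force
    qed
    have scale: "\<bar>x\<bar> \<le> X j \<longleftrightarrow> \<bar>t - tj j\<bar> \<le> X j * r ^ (n j - m)" "tj j + r ^ (n j - m) * x = t"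
      if "x = (t - tj j) / r ^ (n j - m)" for j x t
    proof -
      have R: "r ^ (n j - m) > 0" using r by simp
      show "\<bar>x\<bar> \<le> X j \<longleftrightarrow> \<bar>t - tj j\<bar> \<le> X j * r ^ (n j - m)"
        unfolding that abs_divide abs_of_pos[OF R] using R by (rule pos_divide_le_eq)
      show "tj j + r ^ (n j - m) * x = t" using r by (simp add: that)
    qed
    have F_G: "norm (F r s t) = norm (G j r s ((t - tj j) / r ^ (n j - m))) * r ^ (n j - m)" if "j \<in> {1..<m}" for j s t
      using that r by (simp add: G_def norm_mult norm_divide norm_power)
    have union: "F_zeros r = (\<Union>j\<in>{1..<m}. sc j ` Z j)"
    proof (intro equalityI subsetI)
      fix y assume "y \<in> F_zeros r"
      then obtain s t where y: "y = (s, t)" "0 \<le> s" "s < 2 * pi" "0 < t" "t < pi" "F r s t = 0"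
        by (auto simp: F_zeros_def)
      obtain j where j: "j \<in> {1..<m}" "\<bar>t - tj j\<bar> \<le> X j * r ^ (n j - m)"
        using zero_localization[OF r(1,2,4) y(4-6)] by blast
      define x where "x = (t - tj j) / r ^ (n j - m)"
      have "(s, x) \<in> Z j" using y j F_G[OF j(1), of s t] r scale[OF x_def] by (auto simp: Z_def x_def)
      hence "sc j (s, x) \<in> sc j ` Z j" by (rule imageI)
      moreover have "sc j (s, x) = y" by (simp add: sc_def scale(2)[OF x_def] y(1))
      ultimately show "y \<in> (\<Union>j\<in>{1..<m}. sc j ` Z j)" using j by auto
    next
      fix y assume "y \<in> (\<Union>j\<in>{1..<m}. sc j ` Z j)"
      then obtain j where j: "j \<in> {1..<m}" and y': "y \<in> sc j ` Z j" by blast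
      then obtain s t where y: "y = (s, t)" by (cases y)
      obtain x where x: "(s, x) \<in> Z j" "t = tj j + r ^ (n j - m) * x" using y' y by (auto simp: sc_def)
      have x': "(t - tj j) / r ^ (n j - m) = x" using x(2) r by simp
      have "F r s t = 0" using F_G[OF j, of s t] x(1) unfolding x' by (simp add: Z_def)
      moreover have "pi / (2 * real m) < tj j" "tj j + pi / (2 * real m) < pi"
      proof -
        define w where "w = pi / real m"
        have w: "w > 0" "tj j = real j * w" "pi / (2 * real m) = 1 / 2 * w" "pi = real m * w"
          using j m by (simp_all add: w_def tj_def)
        have "1 / 2 * w < real j * w" "(real j + 1 / 2) * w < real m * w"
          using j w(1) by (intro mult_strict_right_mono; simp)+
        thus "pi / (2 * real m) < tj j" "tj j + pi / (2 * real m) < pi"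
          unfolding w(2,3) distrib_right using w(4) by linarith+
      qed
      hence "0 < t" "t < pi" using near[OF j, of s t] y' y by (auto simp: abs_less_iff)
      ultimately show "y \<in> F_zeros r" using x(1) by (simp add: y F_zeros_def Z_def)
    qed
    have disj: "sc i ` Z i \<inter> sc j ` Z j = {}" if "i \<in> {1..<m}" "j \<in> {1..<m}" "i < j" for i j
    proof (rule equals0I)
      fix y assume y: "y \<in> sc i ` Z i \<inter> sc j ` Z j"
      obtain s t where st: "y = (s, t)" by (cases y)
      have "\<bar>t - tj i\<bar> < pi / (2 * real m)" "\<bar>t - tj j\<bar> < pi / (2 * real m)"
        using near[of i s t] near[of j s t] that y st by auto
      hence "\<bar>tj j - tj i\<bar> < pi / (2 * real m) + pi / (2 * real m)" by linarith
      hence "tj j - tj i < pi / real m" by simp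
      moreover have "tj j - tj i = (real j - real i) * (pi / real m)"
        using that by (simp add: tj_def algebra_simps diff_divide_distrib)
      moreover have "1 * (pi / real m) \<le> (real j - real i) * (pi / real m)"
        using that m by (intro mult_right_mono) auto
      ultimately show False by simp
    qed
    have "card (F_zeros r) = (\<Sum>j\<in>{1..<m}. card (sc j ` Z j))"
      unfolding union
    proof (rule card_UN_disjoint)
      show "\<forall>i\<in>{1..<m}. \<forall>j\<in>{1..<m}. i \<noteq> j \<longrightarrow> sc i ` Z i \<inter> sc j ` Z j = {}"
        using disj by (metis neq_iff Int_commute)
    qed (use Z(1) in auto)
    also have "\<dots> = (\<Sum>j\<in>{1..<m}. 2 * (n j + m))"
      by (intro sum.cong refl) (simp only: card_image[OF inj] Z(2))
    finally have card: "card (F_zeros r) = (\<Sum>j\<in>{1..<m}. 2 * (n j + m))" .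
    have fin: "finite (F_zeros r)" unfolding union using Z(1) by blast
    have "\<exists>\<kappa>>0. \<exists>\<eta>>0. \<forall>s' t'. \<bar>s' - s\<bar> < \<eta> \<longrightarrow> \<bar>t' - t\<bar> < \<eta> \<longrightarrow>
            \<kappa> * (\<bar>s' - s\<bar> + \<bar>t' - t\<bar>) \<le> norm (F r s' t')"
      if t: "0 < t" "t < pi" and zero: "F r s t = 0" for s t
    proof -
      obtain j where j: "j \<in> {1..<m}" "\<bar>t - tj j\<bar> \<le> X j * r ^ (n j - m)"
        using zero_localization[OF r(1,2,4) t zero] by blast
      define R where "R = r ^ (n j - m)"
      have R: "0 < R" "R \<le> 1" using r by (simp_all add: R_def power_le_one)
      define x where "x = (t - tj j) / R"
      interpret W: perturbed_wave "G j r" "real m" "X j" "C j * r" "\<kappa> j" "n j + m" "c j"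
        using elim(2) j by blast
      have x: "\<bar>x\<bar> \<le> X j" "G j r s x = 0"
        using scale(1)[OF x_def[unfolded R_def]] F_G[OF j(1), of s t] zero j r(1) by (auto simp: x_def R_def)
      obtain \<eta> where \<eta>: "\<eta> > 0" "\<And>s' x'. \<bar>s' - s\<bar> < \<eta> \<Longrightarrow> \<bar>x'\<bar> \<le> X j \<Longrightarrow>
          \<kappa> j / 2 * (\<bar>s' - s\<bar> + \<bar>x' - x\<bar>) \<le> norm (G j r s' x')"
        using W.expanding_at_zero(2)[OF x] by blast
      have gap: "0 < R * (X j - \<bar>x\<bar>)" using W.expanding_at_zero(1)[OF x] R by simp
      show ?thesis
      proof (intro exI conjI allI impI)
        show "\<kappa> j / 2 * R > 0" using W.\<kappa>_pos R by simp
        show "min \<eta> (R * (X j - \<bar>x\<bar>)) > 0" using \<eta> gap by simp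
        fix s' t' assume s': "\<bar>s' - s\<bar> < min \<eta> (R * (X j - \<bar>x\<bar>))" and t': "\<bar>t' - t\<bar> < min \<eta> (R * (X j - \<bar>x\<bar>))"
        define x' where "x' = (t' - tj j) / R"
        have d: "\<bar>x' - x\<bar> = \<bar>t' - t\<bar> / R"
          using R by (simp add: x'_def x_def diff_divide_distrib[symmetric] abs_divide)
        also have "\<dots> < X j - \<bar>x\<bar>" using t' R by (simp add: field_simps)
        finally have "\<bar>x'\<bar> \<le> X j" by linarith
        hence "\<kappa> j / 2 * (\<bar>s' - s\<bar> + \<bar>t' - t\<bar> / R) \<le> norm (G j r s' x')" using \<eta>(2)[of s' x'] s' d by simp
        hence "\<kappa> j / 2 * (\<bar>s' - s\<bar> + \<bar>t' - t\<bar> / R) * R \<le> norm (F r s' t')"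
          unfolding F_G[OF j(1), of s' t'] x'_def R_def using r by (intro mult_right_mono) auto
        moreover have "\<kappa> j / 2 * R * (\<bar>s' - s\<bar> + \<bar>t' - t\<bar>) \<le> \<kappa> j / 2 * R * (\<bar>s' - s\<bar> + \<bar>t' - t\<bar> / R)"
          using W.\<kappa>_pos R by (intro mult_left_mono add_mono) (auto simp: field_simps mult_left_le_one_le)
        ultimately show "\<kappa> j / 2 * R * (\<bar>s' - s\<bar> + \<bar>t' - t\<bar>) \<le> norm (F r s' t')" by (simp add: mult_ac)
      qed
    qed
    with fin card show ?case by blast
  qed
qed

subsection \<open>From zeros to transversal crossings\<close>

text \<open>The complex coordinate of \<open>\<alpha>\<^sub>r(\<theta>)\<close> in the real plane.\<close>

definition h :: "real \<Rightarrow> real \<Rightarrow> complex" where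
  "h r \<theta> = (of_real r * cis \<theta>) ^ m + cnj (eval_fps \<phi> (of_real r * cis \<theta>))"

text \<open>The derivative of order \<open>i\<close> of \<open>h r\<close>.\<close>

definition h_deriv :: "real \<Rightarrow> nat \<Rightarrow> real \<Rightarrow> complex" where
  "h_deriv r i \<theta> = (\<i> * of_nat m) ^ i * (of_real r * cis \<theta>) ^ m +
     cnj (\<i> ^ i * eval_fps ((euler ^^ i) \<phi>) (of_real r * cis \<theta>))"

lemma h_deriv_0: "h_deriv r 0 = h r"
  by (simp add: h_deriv_def h_def fun_eq_iff)

lemma has_vector_derivative_h_deriv:
  assumes "ereal \<bar>r\<bar> < fps_conv_radius \<phi>"
  shows "(h_deriv r i has_vector_derivative h_deriv r (Suc i) \<theta>) (at \<theta>)"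
proof -
  let ?A = "(euler ^^ i) \<phi>"
  have cis: "((\<lambda>\<theta>. of_real r * cis \<theta>) has_vector_derivative \<i> * (of_real r * cis \<theta>)) (at \<theta>)"
    unfolding has_vector_derivative_def
    by (auto intro!: derivative_eq_intros simp: scaleR_conv_of_real algebra_simps)
  have rad: "ereal (norm (of_real r * cis \<theta>)) < fps_conv_radius ?A"
    using less_le_trans[OF assms conv_radius_euler_power] by (simp add: norm_mult)
  have "((\<lambda>\<theta>. (of_real r * cis \<theta>) ^ m) has_vector_derivative
      (\<i> * (of_real r * cis \<theta>)) * (of_nat m * (of_real r * cis \<theta>) ^ (m - 1))) (at \<theta>)"
    by (rule field_vector_diff_chain_at[OF cis, unfolded o_def]) (auto intro!: derivative_eq_intros)
  also have "(\<i> * (of_real r * cis \<theta>)) * (of_nat m * (of_real r * cis \<theta>) ^ (m - 1)) =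
     \<i> * of_nat m * (of_real r * cis \<theta>) ^ m"
    using m by (cases m) simp_all
  finally have 1: "((\<lambda>\<theta>. (of_real r * cis \<theta>) ^ m) has_vector_derivative \<i> * of_nat m * (of_real r * cis \<theta>) ^ m) (at \<theta>)" .
  have "((\<lambda>\<theta>. eval_fps ?A (of_real r * cis \<theta>)) has_vector_derivative
      (\<i> * (of_real r * cis \<theta>)) * eval_fps (fps_deriv ?A) (of_real r * cis \<theta>)) (at \<theta>)"
    by (rule field_vector_diff_chain_at[OF cis, unfolded o_def]) (rule has_field_derivative_eval_fps[OF rad])
  also have "(\<i> * (of_real r * cis \<theta>)) * eval_fps (fps_deriv ?A) (of_real r * cis \<theta>) =
     \<i> * eval_fps ((euler ^^ Suc i) \<phi>) (of_real r * cis \<theta>)"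
  proof -
    have "eval_fps (fps_X * fps_deriv ?A) (of_real r * cis \<theta>) =
        eval_fps fps_X (of_real r * cis \<theta>) * eval_fps (fps_deriv ?A) (of_real r * cis \<theta>)"
      using less_le_trans[OF rad fps_conv_radius_deriv] by (intro eval_fps_mult) auto
    thus ?thesis by (simp add: euler_def)
  qed
  finally have 2: "((\<lambda>\<theta>. eval_fps ?A (of_real r * cis \<theta>)) has_vector_derivative
      \<i> * eval_fps ((euler ^^ Suc i) \<phi>) (of_real r * cis \<theta>)) (at \<theta>)" .
  have "((\<lambda>\<theta>. (\<i> * of_nat m) ^ i * (of_real r * cis \<theta>) ^ m +
     cnj (\<i> ^ i * eval_fps ?A (of_real r * cis \<theta>))) has_vector_derivative
     (\<i> * of_nat m) ^ i * (\<i> * of_nat m * (of_real r * cis \<theta>) ^ m) +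
     cnj (\<i> ^ i * (\<i> * eval_fps ((euler ^^ Suc i) \<phi>) (of_real r * cis \<theta>)))) (at \<theta>)"
    by (intro has_vector_derivative_add has_vector_derivative_mult_right 1
      bounded_linear.has_vector_derivative[OF bounded_linear_cnj] 2)
  thus ?thesis unfolding h_deriv_def by (simp add: mult_ac)
qed

lemma h_shift: "h r (\<theta> + 2 * pi) = h r \<theta>" and h_shift': "h r (\<theta> - 2 * pi) = h r \<theta>"
proof -
  have "cis (\<theta> + 2 * pi) = cis \<theta>" "cis (\<theta> - 2 * pi) = cis \<theta>"
    by (simp_all add: cis_mult[symmetric] cis_divide[symmetric])
  thus "h r (\<theta> + 2 * pi) = h r \<theta>" "h r (\<theta> - 2 * pi) = h r \<theta>" by (simp_all add: h_def)
qed

lemma eval_fps_\<phi>_summable: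
  assumes "0 \<le> r" "r \<le> \<rho>"
  shows "summable (\<lambda>k. a k * (of_real r * cis \<theta>) ^ k)"
proof (rule summable_fps)
  have "ereal r \<le> ereal \<rho>" using assms by simp
  also note \<rho>_conv
  finally show "ereal (norm (of_real r * cis \<theta>)) < fps_conv_radius \<phi>"
    using assms by (simp add: norm_mult)
qed

lemma cis_diff: "cis (x + y) - cis (x - y) = 2 * \<i> * cis x * of_real (sin y)"
  by (auto simp: complex_eq_iff cos_add sin_add cos_diff sin_diff)

lemma h_difference:
  assumes "0 \<le> r" "r \<le> \<rho>"
  shows "h r (s + t) - h r (s - t) = 2 * \<i> * of_real (r ^ m) * cis (real m * s) * cnj (F r s t)"
proof -
  let ?d = "\<lambda>k. a k * of_real (r ^ (k - m)) * cis (real (k + m) * s) * of_real (sin (real k * t))"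
  have pow: "(of_real r * cis \<theta>) ^ k = of_real (r ^ k) * cis (real k * \<theta>)" for k \<theta>
    by (simp add: power_mult_distrib Complex.DeMoivre)
  have "(of_real r * cis (s + t)) ^ m - (of_real r * cis (s - t)) ^ m =
      of_real (r ^ m) * (cis (real m * s + real m * t) - cis (real m * s - real m * t))"
    unfolding pow by (simp add: algebra_simps)
  hence 1: "(of_real r * cis (s + t)) ^ m - (of_real r * cis (s - t)) ^ m =
      2 * \<i> * of_real (r ^ m) * cis (real m * s) * cnj (of_real (sin (real m * t)))"
    unfolding cis_diff by simp
  have "eval_fps \<phi> (of_real r * cis (s + t)) - eval_fps \<phi> (of_real r * cis (s - t)) =
      (\<Sum>k. a k * (of_real r * cis (s + t)) ^ k - a k * (of_real r * cis (s - t)) ^ k)"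
    unfolding eval_fps_def using assms by (intro suminf_diff eval_fps_\<phi>_summable)
  also have "\<dots> = (\<Sum>k. 2 * \<i> * of_real (r ^ m) * cis (- (real m * s)) * ?d k)"
  proof (rule suminf_cong)
    fix k
    show "a k * (of_real r * cis (s + t)) ^ k - a k * (of_real r * cis (s - t)) ^ k =
       2 * \<i> * of_real (r ^ m) * cis (- (real m * s)) * ?d k"
    proof (cases "k \<le> m")
      case False
      have "a k * (of_real r * cis (s + t)) ^ k - a k * (of_real r * cis (s - t)) ^ k =
         a k * of_real (r ^ k) * (cis (real k * s + real k * t) - cis (real k * s - real k * t))"
        unfolding pow by (simp add: algebra_simps)
      also have "\<dots> = a k * of_real (r ^ k) * (2 * \<i> * cis (real k * s) * of_real (sin (real k * t)))"
        unfolding cis_diff ..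
      also have "r ^ k = r ^ m * r ^ (k - m)" using False by (simp flip: power_add)
      also have "cis (real k * s) = cis (- (real m * s)) * cis (real (k + m) * s)"
        by (simp add: cis_mult algebra_simps)
      finally show ?thesis by (simp add: mult_ac)
    qed simp
  qed
  also have "\<dots> = 2 * \<i> * of_real (r ^ m) * cis (- (real m * s)) * suminf ?d"
    using assms by (intro suminf_mult F_summable)
  finally have "cnj (eval_fps \<phi> (of_real r * cis (s + t))) - cnj (eval_fps \<phi> (of_real r * cis (s - t))) =
      cnj (2 * \<i> * of_real (r ^ m) * cis (- (real m * s)) * suminf ?d)"
    by (metis complex_cnj_diff)
  also have "\<dots> = - (2 * \<i> * of_real (r ^ m) * cis (real m * s) * cnj (suminf ?d))"
    by (simp add: cis_cnj)
  finally have "h r (s + t) - h r (s - t) = 2 * \<i> * of_real (r ^ m) * cis (real m * s) * cnj (of_real (sin (real m * t)))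
     - 2 * \<i> * of_real (r ^ m) * cis (real m * s) * cnj (suminf ?d)"
    using 1 by (simp add: h_def algebra_simps)
  thus ?thesis by (simp add: F_def right_diff_distrib)
qed

lemma F_eq_0_iff: "0 < r \<Longrightarrow> r \<le> \<rho> \<Longrightarrow> F r s t = 0 \<longleftrightarrow> h r (s + t) = h r (s - t)"
  using h_difference[of r s t] by (auto simp: complex_cnj_zero_iff)

text \<open>The derivative of \<open>u^m\<close> has absolute value \<open>m r^m\<close> and dominates the terms of higher order.\<close>

lemma h_deriv_1_neq_0:
  assumes "0 < r" "r \<le> \<rho>" "r / \<rho> ^ Suc m * B < real m / 4"
  shows "h_deriv r 1 \<theta> \<noteq> 0"
proof
  let ?z = "of_real r * cis \<theta>"
  assume "h_deriv r 1 \<theta> = 0"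
  hence "\<i> * of_nat m * ?z ^ m = - cnj (\<i> * eval_fps (euler \<phi>) ?z)" by (simp add: h_deriv_def add_eq_0_iff)
  hence "norm (\<i> * of_nat m * ?z ^ m) = norm (cnj (\<i> * eval_fps (euler \<phi>) ?z))" by (metis norm_minus_cancel)
  hence "real m * r ^ m = norm (eval_fps (euler \<phi>) ?z)" using assms by (simp add: norm_mult norm_power)
  also have "\<dots> \<le> r ^ m * (r / \<rho> ^ Suc m) * B"
    unfolding eval_fps_def
  proof (rule summable_bounded(2))
    fix k assume k: "k > m"
    have "norm (fps_nth (euler \<phi>) k * ?z ^ k) = norm (a k) * r ^ k * real k"
      using euler_power_nth[of 1 \<phi> k] assms by (simp add: norm_mult norm_power)
    also have "r ^ k = r ^ m * r ^ (k - m)" using k by (simp flip: power_add)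
    also have "norm (a k) * (r ^ m * r ^ (k - m)) * real k \<le> norm (a k) * (r ^ m * (r * (\<rho> ^ k / \<rho> ^ Suc m))) * real k"
      using assms k by (intro mult_right_mono mult_left_mono pow_Suc_le) auto
    also have "\<dots> \<le> norm (a k) * (r ^ m * (r * (\<rho> ^ k / \<rho> ^ Suc m))) * real k ^ 2"
      using assms \<rho> by (intro le_sq) auto
    finally show "norm (fps_nth (euler \<phi>) k * ?z ^ k) \<le> r ^ m * (r / \<rho> ^ Suc m) * (norm (a k) * real k ^ 2 * \<rho> ^ k)"
      by (simp add: mult_ac)
  next
    fix k assume "k \<le> m"
    thus "fps_nth (euler \<phi>) k * ?z ^ k = 0" using euler_power_nth[of 1 \<phi> k] by simp
  qed
  also have "\<dots> = r ^ m * (r / \<rho> ^ Suc m * B)" by simp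
  also have "\<dots> < r ^ m * (real m / 4)" using assms by (intro mult_strict_left_mono) auto
  finally show False using assms m by (simp add: mult.commute)
qed

definition crossings :: "real \<Rightarrow> (real \<times> real) set" where
  "crossings r = {(\<theta>, \<theta>'). 0 \<le> \<theta> \<and> \<theta> < \<theta>' \<and> \<theta>' < 2 * pi \<and> h r \<theta> = h r \<theta>'}"

text \<open>Each unordered pair of parameters \<open>s - t\<close>, \<open>s + t\<close> arises from two pairs \<open>(s, t)\<close>, exchanged
  by \<open>(s, t) \<mapsto> (s \<plusminus> \<pi>, \<pi> - t)\<close>, of which just one has both parameters in the fundamental domain.\<close>

lemma card_crossings:
  assumes "0 < r" "r \<le> \<rho>" "finite (F_zeros r)"
  shows "finite (crossings r)" "card (F_zeros r) = 2 * card (crossings r)"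
proof -
  define Z where "Z = {(s, t) \<in> F_zeros r. t \<le> s \<and> s + t < 2 * pi}"
  define I where "I = (\<lambda>(s::real, t). (if s < pi then s + pi else s - pi, pi - t))"
  have memZ: "(s, t) \<in> F_zeros r \<longleftrightarrow> 0 \<le> s \<and> s < 2 * pi \<and> 0 < t \<and> t < pi \<and> h r (s + t) = h r (s - t)" for s t
    by (simp add: F_zeros_def F_eq_0_iff[OF assms(1,2)])
  have ZI: "I z \<in> F_zeros r" if "z \<in> F_zeros r" for z
  proof -
    obtain s t where z: "z = (s, t)" by (cases z)
    have b: "0 \<le> s" "s < 2 * pi" "0 < t" "t < pi" "h r (s + t) = h r (s - t)" using that by (auto simp: z memZ)
    show ?thesis
    proof (cases "s < pi")
      case True
      have "h r ((s + pi) + (pi - t)) = h r ((s + pi) - (pi - t))"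
        using h_shift[of r "s - t"] b(5) by (simp add: algebra_simps)
      thus ?thesis using True b by (simp add: I_def z memZ)
    next
      case False
      have "h r ((s - pi) + (pi - t)) = h r ((s - pi) - (pi - t))"
        using h_shift'[of r "s + t"] b(5) by (simp add: algebra_simps)
      thus ?thesis using False b by (simp add: I_def z memZ)
    qed
  qed
  have Z_sub: "Z \<subseteq> F_zeros r" by (auto simp: Z_def)
  have II: "I (I z) = z" if "z \<in> F_zeros r" for z
    using that by (auto simp: I_def F_zeros_def split: if_splits)
  have swap: "I z \<in> Z \<longleftrightarrow> z \<notin> Z" if "z \<in> F_zeros r" for z
    using that ZI[OF that] by (auto simp: Z_def I_def F_zeros_def split: if_splits)
  have "bij_betw I Z (F_zeros r - Z)"
  proof (rule bij_betw_byWitness[of _ I])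
    show "I ` Z \<subseteq> F_zeros r - Z"
    proof
      fix y assume "y \<in> I ` Z"
      then obtain z where z: "z \<in> Z" "y = I z" by blast
      hence "z \<in> F_zeros r" using Z_sub by blast
      thus "y \<in> F_zeros r - Z" using ZI swap z by simp
    qed
    show "I ` (F_zeros r - Z) \<subseteq> Z" using swap by blast
  qed (use II Z_sub in blast)+
  hence "card (F_zeros r - Z) = card Z" by (simp add: bij_betw_same_card)
  moreover have finZ: "finite Z" using assms(3) Z_sub by (rule finite_subset[rotated])
  moreover have "card (F_zeros r) = card Z + card (F_zeros r - Z)"
    using Z_sub assms(3) finZ card_mono[OF assms(3) Z_sub] by (simp add: card_Diff_subset)
  ultimately have card: "card (F_zeros r) = 2 * card Z" by simp
  have "bij_betw (\<lambda>(\<theta>, \<theta>'). ((\<theta> + \<theta>') / 2, (\<theta>' - \<theta>) / 2)) (crossings r) Z"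
    by (rule bij_betw_byWitness[of _ "\<lambda>(s, t). (s - t, s + t)"])
       (auto simp: crossings_def Z_def memZ add_divide_distrib diff_divide_distrib)
  thus "finite (crossings r)" "card (F_zeros r) = 2 * card (crossings r)"
    using card finZ by (simp_all add: bij_betw_finite bij_betw_same_card)
qed

text \<open>Moving \<open>s + t\<close> with speed \<open>1\<close> and \<open>s - t\<close> with speed \<open>\<mu>\<close>, parallel velocities would make the
  difference of the two values vanish faster than linearly, against the lower bound for \<open>F\<close>.\<close>

lemma expansion_imp_transversal:
  assumes r: "0 < r" "r \<le> \<rho>"
    and exp: "\<kappa>0 > 0" "\<eta> > 0" "\<And>s' t'. \<bar>s' - s\<bar> < \<eta> \<Longrightarrow> \<bar>t' - t\<bar> < \<eta> \<Longrightarrow>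
      \<kappa>0 * (\<bar>s' - s\<bar> + \<bar>t' - t\<bar>) \<le> norm (F r s' t')"
    and zero: "F r s t = 0"
  shows "h_deriv r 1 (s + t) \<noteq> of_real \<mu> * h_deriv r 1 (s - t)"
proof
  assume eq: "h_deriv r 1 (s + t) = of_real \<mu> * h_deriv r 1 (s - t)"
  have "ereal \<bar>r\<bar> \<le> ereal \<rho>" using r by simp
  also note \<rho>_conv
  finally have rad: "ereal \<bar>r\<bar> < fps_conv_radius \<phi>" .
  have hder: "(h r has_vector_derivative h_deriv r 1 \<theta>) (at \<theta>)" for \<theta>
    using has_vector_derivative_h_deriv[OF rad, of 0 \<theta>] by (simp add: h_deriv_0)
  define D where "D = (\<lambda>\<tau>. h r (s + t + \<tau>) - h r (s - t + \<mu> * \<tau>))"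
  have lin: "((\<lambda>\<tau>. c + b * \<tau>) has_real_derivative b) (at 0)" for b c :: real
    by (auto intro!: derivative_eq_intros)
  have "((\<lambda>\<tau>. h r (s + t + 1 * \<tau>)) has_vector_derivative 1 *\<^sub>R h_deriv r 1 (s + t)) (at 0)"
    using vector_diff_chain_at[of "\<lambda>\<tau>. s + t + 1 * \<tau>" 1 0 "h r" "h_deriv r 1 (s + t)"] lin[of "s + t" 1] hder
    by (simp add: o_def has_real_derivative_iff_has_vector_derivative)
  moreover have "((\<lambda>\<tau>. h r (s - t + \<mu> * \<tau>)) has_vector_derivative \<mu> *\<^sub>R h_deriv r 1 (s - t)) (at 0)"
    using vector_diff_chain_at[of "\<lambda>\<tau>. s - t + \<mu> * \<tau>" \<mu> 0 "h r" "h_deriv r 1 (s - t)"] lin[of "s - t" \<mu>] hder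
    by (simp add: o_def has_real_derivative_iff_has_vector_derivative)
  ultimately have "(D has_vector_derivative 1 *\<^sub>R h_deriv r 1 (s + t) - \<mu> *\<^sub>R h_deriv r 1 (s - t)) (at 0)"
    unfolding D_def by (simp add: has_vector_derivative_diff)
  hence D': "(D has_derivative (\<lambda>_. 0)) (at 0)"
    using eq by (simp add: has_vector_derivative_def scaleR_conv_of_real)
  have D0: "D 0 = 0" using zero F_eq_0_iff[OF r, of s t] by (simp add: D_def)
  define K where "K = 2 * r ^ m * \<kappa>0"
  have K: "K > 0" using exp(1) r by (simp add: K_def)
  obtain d where d: "d > 0" "\<And>\<tau>. \<bar>\<tau>\<bar> < d \<Longrightarrow> norm (D \<tau>) \<le> K / 2 * \<bar>\<tau>\<bar>"
    using D'[unfolded has_derivative_at_alt, THEN conjunct2, rule_format, of "K / 2"] K D0 by auto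
  define L where "L = \<bar>1 + \<mu>\<bar> + \<bar>1 - \<mu>\<bar> + 1"
  \<comment> \<open>small enough for both the differential estimate and the lower bound\<close>
  define \<tau> where "\<tau> = min (d / 2) (\<eta> / (2 * L))"
  have L: "L > 0" by (simp add: L_def add_nonneg_pos)
  have \<tau>: "0 < \<tau>" "\<tau> < d" "\<tau> * L < \<eta>"
  proof -
    show "0 < \<tau>" "\<tau> < d" using d(1) exp(2) L by (auto simp: \<tau>_def)
    have "\<tau> * L \<le> \<eta> / (2 * L) * L" using L by (intro mult_right_mono) (auto simp: \<tau>_def)
    also have "\<dots> < \<eta>" using L exp(2) by simp
    finally show "\<tau> * L < \<eta>" .
  qed
  define s' t' where "s' = s + \<tau> * (1 + \<mu>) / 2" and "t' = t + \<tau> * (1 - \<mu>) / 2"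
  have sum: "s' + t' = s + t + \<tau>" "s' - t' = s - t + \<mu> * \<tau>"
    by (simp_all add: s'_def t'_def field_simps)
  have "\<tau> * \<bar>1 + \<mu>\<bar> \<le> \<tau> * L" "\<tau> * \<bar>1 - \<mu>\<bar> \<le> \<tau> * L" using \<tau> by (auto simp: L_def intro!: mult_left_mono)
  moreover have ds: "\<bar>s' - s\<bar> = \<tau> * \<bar>1 + \<mu>\<bar> / 2" "\<bar>t' - t\<bar> = \<tau> * \<bar>1 - \<mu>\<bar> / 2"
    using \<tau> by (simp_all add: s'_def t'_def abs_mult)
  ultimately have "\<kappa>0 * (\<bar>s' - s\<bar> + \<bar>t' - t\<bar>) \<le> norm (F r s' t')"
    using \<tau>(1,3) by (intro exp(3)) linarith+
  moreover have "\<tau> \<le> \<bar>s' - s\<bar> + \<bar>t' - t\<bar>"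
  proof -
    have "\<tau> * 2 \<le> \<tau> * (\<bar>1 + \<mu>\<bar> + \<bar>1 - \<mu>\<bar>)" using \<tau> by (intro mult_left_mono) auto
    thus ?thesis by (simp add: ds distrib_left)
  qed
  ultimately have "\<kappa>0 * \<tau> \<le> norm (F r s' t')"
    using mult_left_mono[of \<tau> "\<bar>s' - s\<bar> + \<bar>t' - t\<bar>" \<kappa>0] exp(1) by linarith
  hence "2 * r ^ m * (\<kappa>0 * \<tau>) \<le> 2 * r ^ m * norm (F r s' t')" using r by (intro mult_left_mono) auto
  also have "\<dots> = norm (D \<tau>)"
    using h_difference[of r s' t'] r unfolding sum by (simp add: D_def norm_mult norm_power)
  finally have "K * \<tau> \<le> norm (D \<tau>)" by (simp add: K_def)
  also have "\<dots> \<le> K / 2 * \<tau>" using d(2)[of \<tau>] \<tau> by simp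
  finally show False using K \<tau>(1) by simp
qed

theorem small_curves:
  "\<forall>\<^sub>F r in at_right 0. (\<forall>\<theta>. h_deriv r 1 \<theta> \<noteq> 0) \<and> finite (crossings r) \<and> card (crossings r) = dord + m * (m - 1) \<and>
     (\<forall>(\<theta>, \<theta>')\<in>crossings r. \<forall>\<mu>::real. h_deriv r 1 \<theta>' \<noteq> of_real \<mu> * h_deriv r 1 \<theta>)"
proof -
  from eventually_small card_F_zeros_and_expansion show ?thesis
  proof eventually_elim
    case (elim r)
    have r: "0 < r" "r \<le> \<rho>" "r / \<rho> ^ Suc m * B < real m / 4" using elim(1) by auto
    have "(\<Sum>j\<in>{1..<m}. n j + m) = dord + m * (m - 1)"
    proof -
      have "{..<m} - {0} = {1..<m}" by auto
      moreover have "(\<Sum>j\<in>{1..<m}. n j) = (\<Sum>j\<in>{1..<m}. subdegree (\<phi> - cj j))"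
        by (intro sum.cong refl) (simp add: n_def)
      ultimately show ?thesis by (simp add: sum.distrib dord_eq_sum)
    qed
    hence card: "card (F_zeros r) = 2 * (dord + m * (m - 1))"
      using elim(2) unfolding sum_distrib_left[symmetric] by simp
    note cr = card_crossings[OF r(1,2) conjunct1[OF elim(2)]]
    have "h_deriv r 1 \<theta>' \<noteq> of_real \<mu> * h_deriv r 1 \<theta>" if "(\<theta>, \<theta>') \<in> crossings r" for \<theta> \<theta>' \<mu>
    proof -
      define s t where "s = (\<theta> + \<theta>') / 2" and "t = (\<theta>' - \<theta>) / 2"
      have st: "s + t = \<theta>'" "s - t = \<theta>" by (simp_all add: s_def t_def field_simps)
      have t: "0 < t" "t < pi" and zero: "F r s t = 0"
        using that F_eq_0_iff[OF r(1,2), of s t] by (auto simp: crossings_def st) (auto simp: t_def)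
      obtain \<kappa>0 \<eta> where "\<kappa>0 > 0" "\<eta> > 0" "\<And>s' t'. \<bar>s' - s\<bar> < \<eta> \<Longrightarrow> \<bar>t' - t\<bar> < \<eta> \<Longrightarrow>
          \<kappa>0 * (\<bar>s' - s\<bar> + \<bar>t' - t\<bar>) \<le> norm (F r s' t')"
        using elim(2) t zero by blast
      from expansion_imp_transversal[OF r(1,2) this zero, of \<mu>] show ?thesis by (simp add: st)
    qed
    thus ?case using h_deriv_1_neq_0[OF r] cr card by auto
  qed
qed

end

section \<open>Real analyticity\<close>

lemma real_analytic_at_bounded_linear:
  assumes "bounded_linear L" "real_analytic_at f x"
  shows "real_analytic_at (\<lambda>y. L (f y)) x"
proof -
  interpret L: bounded_linear L by fact
  from assms(2) obtain \<epsilon> c where \<epsilon>: "\<epsilon> > 0" and c: "\<And>y. y \<in> ball x \<epsilon> \<Longrightarrow>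
      ((\<lambda>(i, j). ((fst y - fst x) ^ i * (snd y - snd x) ^ j) *\<^sub>R c i j) has_sum f y) UNIV"
    unfolding real_analytic_at_def by blast
  have "((\<lambda>(i, j). ((fst y - fst x) ^ i * (snd y - snd x) ^ j) *\<^sub>R L (c i j)) has_sum L (f y)) UNIV"
    if "y \<in> ball x \<epsilon>" for y
    using has_sum_bounded_linear[OF assms(1) c[OF that]]
    by (simp add: case_prod_unfold o_def L.scaleR)
  thus ?thesis unfolding real_analytic_at_def using \<epsilon> by (intro exI[of _ \<epsilon>] conjI exI[of _ "\<lambda>i j. L (c i j)"]) auto
qed

lemma real_analytic_at_add:
  assumes "real_analytic_at f x" "real_analytic_at g x"
  shows "real_analytic_at (\<lambda>y. f y + g y) x"
proof -
  from assms(1) obtain \<epsilon> c where \<epsilon>: "\<epsilon> > 0" and c: "\<And>y. y \<in> ball x \<epsilon> \<Longrightarrow>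
      ((\<lambda>(i, j). ((fst y - fst x) ^ i * (snd y - snd x) ^ j) *\<^sub>R c i j) has_sum f y) UNIV"
    unfolding real_analytic_at_def by blast
  from assms(2) obtain \<epsilon>' c' where \<epsilon>': "\<epsilon>' > 0" and c': "\<And>y. y \<in> ball x \<epsilon>' \<Longrightarrow>
      ((\<lambda>(i, j). ((fst y - fst x) ^ i * (snd y - snd x) ^ j) *\<^sub>R c' i j) has_sum g y) UNIV"
    unfolding real_analytic_at_def by blast
  have "((\<lambda>(i, j). ((fst y - fst x) ^ i * (snd y - snd x) ^ j) *\<^sub>R (c i j + c' i j)) has_sum (f y + g y)) UNIV"
    if "y \<in> ball x (min \<epsilon> \<epsilon>')" for y
    using has_sum_add[OF c c', of y] that by (simp add: case_prod_unfold scaleR_add_right)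
  thus ?thesis unfolding real_analytic_at_def using \<epsilon> \<epsilon>'
    by (intro exI[of _ "min \<epsilon> \<epsilon>'"] conjI exI[of _ "\<lambda>i j. c i j + c' i j"]) auto
qed

lemma expansion2_imp_real_analytic_at:
  assumes "expansion2 (\<lambda>z. h (of_real (fst x) + fst z) (of_real (snd x) + snd z)) H"
  shows "real_analytic_at (\<lambda>y. h (of_real (fst y)) (of_real (snd y))) x"
proof -
  obtain \<rho> where \<rho>: "\<rho> > 0" "abs_conv2 \<rho> H" using assms by (rule expansion2E)
  have "\<forall>\<^sub>F z in nhds 0. h (of_real (fst x) + fst z) (of_real (snd x) + snd z) = eval2 H z"
    using assms by (simp add: expansion2_def)
  then obtain \<epsilon> where \<epsilon>: "\<epsilon> > 0" "\<And>z. norm z < \<epsilon> \<Longrightarrow>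
      h (of_real (fst x) + fst z) (of_real (snd x) + snd z) = eval2 H z"
    unfolding eventually_nhds_metric dist_norm by auto
  have "((\<lambda>(i, j). ((fst y - fst x) ^ i * (snd y - snd x) ^ j) *\<^sub>R coeff2 H i j) has_sum
      h (of_real (fst y)) (of_real (snd y))) UNIV" if y: "y \<in> ball x (min \<rho> \<epsilon>)" for y
  proof -
    define z :: C2 where "z = (of_real (fst y - fst x), of_real (snd y - snd x))"
    have "norm z = norm (y - x)"
      by (simp add: z_def norm_Pair norm_prod_def flip: of_real_diff)
    hence z: "norm z < \<rho>" "norm z < \<epsilon>" using y by (simp_all add: dist_norm norm_minus_commute)
    have "norm (fst z) \<le> \<rho>" "norm (snd z) \<le> \<rho>"
      using z(1) norm_fst_le[of "fst z" "snd z"] norm_snd_le[of "snd z" "fst z"] by simp_all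
    from has_sum_eval2[OF \<rho>(2) this] \<epsilon>(2)[OF z(2), symmetric]
    have "((\<lambda>(i, j). coeff2 H i j * fst z ^ i * snd z ^ j) has_sum h (of_real (fst y)) (of_real (snd y))) UNIV"
      by (simp add: z_def)
    thus ?thesis by (simp add: z_def case_prod_unfold scaleR_conv_of_real mult_ac)
  qed
  thus ?thesis unfolding real_analytic_at_def using \<rho> \<epsilon>
    by (intro exI[of _ "min \<rho> \<epsilon>"] conjI exI[of _ "coeff2 H"]) auto
qed

lemma fps_expansion_eval_fps_shift:
  fixes A :: "complex fps"
  assumes "ereal (norm u) < fps_conv_radius A"
  shows "\<exists>A'. (\<lambda>y. eval_fps A (u + y)) has_fps_expansion A'"
proof -
  obtain d where d: "norm u < d" "ereal d < fps_conv_radius A" using ereal_dense2[OF assms] by auto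
  have "ball u (d - norm u) \<subseteq> eball 0 (fps_conv_radius A)"
  proof
    fix w assume "w \<in> ball u (d - norm u)"
    hence "norm w < d" using norm_triangle_sub[of w u] by (simp add: dist_norm norm_minus_commute)
    thus "w \<in> eball 0 (fps_conv_radius A)" using d(2) less_trans[of "ereal (norm w)" "ereal d"] by simp
  qed
  hence "(eval_fps A \<circ> (+) u) holomorphic_on ball 0 (d - norm u)"
    by (intro holomorphic_on_compose_gen[OF _ holomorphic_on_eval_fps]) (auto intro!: holomorphic_intros simp: dist_norm)
  hence "(eval_fps A \<circ> (+) u) has_fps_expansion fps_expansion (eval_fps A \<circ> (+) u) 0"
    using d by (intro has_fps_expansion_fps_expansion[of "ball 0 (d - norm u)"]) auto
  thus ?thesis by (auto simp: o_def)
qed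

text \<open>The complex extension \<open>(z, w) \<mapsto> A(z exp(i e w))\<close> is a composition of convergent expansions.\<close>

lemma real_analytic_at_polar:
  fixes A :: "complex fps" and e :: real
  assumes "ereal \<bar>fst x\<bar> < fps_conv_radius A"
  shows "real_analytic_at (\<lambda>y. eval_fps A (of_real (fst y) * cis (e * snd y))) x"
proof -
  define u :: complex where "u = of_real (fst x) * cis (e * snd x)"
  define E where "E w = exp (\<i> * of_real e * of_real (snd x)) * exp (\<i> * of_real e * w)" for w
  obtain A' where A': "(\<lambda>y. eval_fps A (u + y)) has_fps_expansion A'"
    using fps_expansion_eval_fps_shift[of u A] assms by (auto simp: u_def norm_mult)
  obtain H1 where H1: "expansion2 (\<lambda>z. E (snd z)) H1"
  proof -
    have "E has_fps_expansion fps_const (exp (\<i> * of_real e * of_real (snd x))) * fps_exp (\<i> * of_real e)"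
      unfolding E_def by (intro fps_expansion_intros)
    from expansion2_compose[OF expansion2_fst_comp[OF this] expansion2_snd expansion2_snd]
    show ?thesis using that by (auto simp: coeff2_def)
  qed
  define a where "a z = (of_real (fst x) + fst z) * E (snd z) + - u" for z :: C2
  define Y where "Y = (const2 (of_real (fst x)) + fps_const fps_X) * H1 + const2 (- u)"
  have Y: "expansion2 a Y" unfolding a_def Y_def
    by (intro expansion2_add expansion2_mult expansion2_const expansion2_fst H1)
  have "\<forall>\<^sub>F z in nhds 0. a z = eval2 Y z" using Y by (simp add: expansion2_def)
  hence "a 0 = coeff2 Y 0 0" using eventually_nhds_x_imp_x by (fastforce simp: eval2_at_0)
  hence Y0: "coeff2 Y 0 0 = 0" by (simp add: a_def E_def u_def cis_conv_exp mult_ac)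
  from expansion2_compose[OF expansion2_fst_comp[OF A'] Y Y Y0 Y0]
  obtain H where "expansion2 (\<lambda>z. eval_fps A (u + a z)) H" by auto
  hence H: "expansion2 (\<lambda>z. eval_fps A ((of_real (fst x) + fst z) * exp (\<i> * of_real e * (of_real (snd x) + snd z)))) H"
    by (simp add: a_def E_def distrib_left exp_add)
  show ?thesis
    using expansion2_imp_real_analytic_at[of "\<lambda>y1 y2. eval_fps A (y1 * exp (\<i> * of_real e * y2))", OF H]
    by (simp add: cis_conv_exp mult_ac)
qed

section \<open>The predivides of a pair of conjugate branches\<close>

lemma clinear_map_bounded_linear: "clinear_map L \<Longrightarrow> bounded_linear L"
proof -
  assume "clinear_map L"
  then interpret Vector_Spaces.linear cscale cscale L .
  have "linear L"
  proof (rule linearI)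
    show "L (r *\<^sub>R z) = r *\<^sub>R L z" for r z
      using scale[of "of_real r" z] by (simp add: cscale_def scaleR_prod_def scaleR_conv_of_real)
  qed (rule add)
  thus ?thesis by (rule linear_conv_bounded_linear[THEN iffD1])
qed

lemma fps_conv_radius_cnj: "fps_conv_radius (fps_cnj A) = fps_conv_radius A"
proof -
  have "conv_radius (\<lambda>n. norm (fps_nth (fps_cnj A) n)) = conv_radius (\<lambda>n. norm (fps_nth A n))"
    by (simp only: fps_cnj_nth complex_mod_cnj)
  thus ?thesis by (simp only: fps_conv_radius_def conv_radius_norm)
qed

lemma eval_fps_cnj:
  assumes "ereal (norm u) < fps_conv_radius A"
  shows "eval_fps (fps_cnj A) (cnj u) = cnj (eval_fps A u)"
proof -
  have "(\<lambda>n. cnj (fps_nth A n * u ^ n)) sums cnj (\<Sum>n. fps_nth A n * u ^ n)"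
    unfolding sums_cnj by (intro summable_sums summable_fps assms)
  thus ?thesis by (simp add: eval_fps_def fps_cnj_def sums_iff)
qed

context conjugate_branches
begin

lemma alpha_real_analytic:
  assumes "ereal \<bar>fst x\<bar> < fps_conv_radius \<phi>"
  shows "real_analytic_at (\<lambda>(r, \<theta>). alpha \<sigma> q m \<phi> r \<theta>) x"
proof -
  interpret M: bounded_linear M by (rule clinear_map_bounded_linear[OF clinear_M])
  have M1: "bounded_linear (\<lambda>z. M (z, 0))" and M2: "bounded_linear (\<lambda>z. M (0, z))"
    by (intro bounded_linear_compose[OF M.bounded_linear_axioms] bounded_linear_Pair
        bounded_linear_ident bounded_linear_zero)+
  have split: "M (y, z) = M (y, 0) + M (0, z)" for y z by (simp add: M.add[symmetric])
  have X: "ereal \<bar>fst x\<bar> < fps_conv_radius (fps_X ^ m :: complex fps)" by simp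
  have \<phi>bar: "ereal \<bar>fst x\<bar> < fps_conv_radius (fps_cnj \<phi>)" using assms by (simp add: fps_conv_radius_cnj)
  have eq: "(\<lambda>(r, \<theta>). alpha \<sigma> q m \<phi> r \<theta>) = (\<lambda>y.
      (M (eval_fps (fps_X ^ m) (of_real (fst y) * cis (1 * snd y)), 0) +
       M (0, eval_fps \<phi> (of_real (fst y) * cis (1 * snd y)))) +
      (M (eval_fps (fps_cnj \<phi>) (of_real (fst y) * cis (- 1 * snd y)), 0) +
       M (0, eval_fps (fps_X ^ m) (of_real (fst y) * cis (- 1 * snd y)))))"
    by (simp add: fun_eq_iff alpha_def \<gamma>_eq \<gamma>bar_eq split[symmetric])
  show ?thesis
    unfolding eq by (intro real_analytic_at_add real_analytic_at_bounded_linear[OF M1] real_analytic_at_bounded_linear[OF M2]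
        real_analytic_at_polar assms X \<phi>bar)
qed

definition real_point :: "complex \<Rightarrow> C2" where
  "real_point z = M (z, cnj z)"

lemma bounded_linear_real_point: "bounded_linear real_point"
  unfolding real_point_def
  by (intro bounded_linear_compose[OF clinear_map_bounded_linear[OF clinear_M]] bounded_linear_Pair
      bounded_linear_ident bounded_linear_cnj)

lemma real_point_inj [simp]: "real_point z = real_point w \<longleftrightarrow> z = w"
  using bij_M by (auto simp: real_point_def bij_def inj_def)

lemma real_point_real: "real_point z \<in> real_plane \<sigma>"
  by (simp add: real_point_def real_plane_def \<sigma>_M)

lemma alpha_eq_real_point:
  assumes "ereal \<bar>r\<bar> < fps_conv_radius \<phi>"
  shows "alpha \<sigma> q m \<phi> r \<theta> = real_point ((of_real r * cis \<theta>) ^ m + cnj (eval_fps \<phi> (of_real r * cis \<theta>)))"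
proof -
  interpret M: bounded_linear M by (rule clinear_map_bounded_linear[OF clinear_M])
  have c: "of_real r * cis (- \<theta>) = cnj (of_real r * cis \<theta>)" by (simp add: cis_cnj)
  have "eval_fps (fps_cnj \<phi>) (cnj (of_real r * cis \<theta>)) = cnj (eval_fps \<phi> (of_real r * cis \<theta>))"
    using assms by (intro eval_fps_cnj) (simp add: norm_mult)
  thus ?thesis
    unfolding alpha_def \<gamma>_eq \<gamma>bar_eq c by (simp add: real_point_def M.add[symmetric] add.commute)
qed

lemma alpha_eventually_small:
  assumes "s > 0"
  shows "\<forall>\<^sub>F r in at_right 0. \<forall>\<theta>. alpha \<sigma> q m \<phi> r \<theta> \<in> ball 0 s"
proof -
  have near: "\<exists>d>0. \<forall>u. norm u < d \<longrightarrow> norm (\<eta> u) < s / 2" if "analytic_arc \<eta>" for \<eta>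
  proof -
    have "\<forall>\<^sub>F u in nhds 0. \<eta> u \<in> ball 0 (s / 2)"
      by (rule eventually_compose_filterlim[OF eventually_nhds_in_open analytic_arc_tendsto[OF that]])
         (use assms in auto)
    thus ?thesis by (auto simp: eventually_nhds_metric dist_norm)
  qed
  obtain d where d: "d > 0" "\<And>u. norm u < d \<Longrightarrow> norm (\<gamma> u) < s / 2" using near[OF arc_\<gamma>] by blast
  obtain d' where d': "d' > 0" "\<And>u. norm u < d' \<Longrightarrow> norm (\<gamma>bar u) < s / 2" using near[OF arc_\<gamma>bar] by blast
  have "\<forall>\<^sub>F r in at_right 0. r \<in> {0<..<min d d'}" using d d' by (intro eventually_at_right_real) auto
  thus ?thesis
  proof eventually_elim
    case (elim r)
    show ?case
    proof
      fix \<theta>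
      have "norm (alpha \<sigma> q m \<phi> r \<theta>) < s / 2 + s / 2"
        unfolding alpha_def
        by (rule norm_add_less[OF d(2) d'(2)]) (use elim in \<open>simp_all add: norm_mult\<close>)
      thus "alpha \<sigma> q m \<phi> r \<theta> \<in> ball 0 s" by simp
    qed
  qed
qed

end

text \<open>An unordered pair of parameters is represented by the ordered pair in increasing order.\<close>

lemma double_pairs_circle:
  assumes "\<And>\<theta>. \<alpha> (0, \<theta>) = A \<theta>"
  defines "U \<equiv> {(\<theta>, \<theta>'). 0 \<le> \<theta> \<and> \<theta> < \<theta>' \<and> \<theta>' < 2 * pi \<and> A \<theta> = A \<theta>'}"
  shows "bij_betw (\<lambda>(\<theta>, \<theta>'). {(0, \<theta>), (0, \<theta>')}) U (double_pairs [Circle] \<alpha>)"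
proof (rule bij_betw_imageI)
  show "inj_on (\<lambda>(\<theta>, \<theta>'). {(0 :: nat, \<theta>), (0, \<theta>')}) U"
  proof (rule inj_onI)
    have lt: "\<theta> < \<theta>'" if "(\<theta>, \<theta>') \<in> U" for \<theta> \<theta>' using that by (simp add: U_def)
    fix x y assume xy: "x \<in> U" "y \<in> U"
      "(case x of (\<theta>, \<theta>') \<Rightarrow> {(0 :: nat, \<theta>), (0, \<theta>')}) = (case y of (\<theta>, \<theta>') \<Rightarrow> {(0, \<theta>), (0, \<theta>')})"
    thus "x = y" using lt[of "fst x" "snd x"] lt[of "fst y" "snd y"]
      by (auto simp: case_prod_unfold doubleton_eq_iff prod_eq_iff)
  qed
  show "(\<lambda>(\<theta>, \<theta>'). {(0, \<theta>), (0, \<theta>')}) ` U = double_pairs [Circle] \<alpha>"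
  proof (intro equalityI subsetI)
    fix P :: "(nat \<times> real) set" assume "P \<in> (\<lambda>(\<theta>, \<theta>'). {(0, \<theta>), (0, \<theta>')}) ` U"
    then obtain \<theta> \<theta>' where P: "P = {(0::nat, \<theta>), (0, \<theta>')}" and "(\<theta>, \<theta>') \<in> U" by auto
    hence "(0, \<theta>) \<in> points [Circle]" "(0, \<theta>') \<in> points [Circle]" "\<theta> \<noteq> \<theta>'" "\<alpha> (0, \<theta>) = \<alpha> (0, \<theta>')"
      by (auto simp: U_def points_def assms(1))
    thus "P \<in> double_pairs [Circle] \<alpha>" unfolding double_pairs_def P by blast
  next
    fix P :: "(nat \<times> real) set" assume "P \<in> double_pairs [Circle] \<alpha>"
    then obtain \<theta> \<theta>' where P: "P = {(0, \<theta>), (0, \<theta>')}" "\<theta> \<noteq> \<theta>'" and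
      U: "0 \<le> \<theta>" "\<theta> < 2 * pi" "0 \<le> \<theta>'" "\<theta>' < 2 * pi" "A \<theta> = A \<theta>'"
      by (auto simp: double_pairs_def points_def assms(1))
    have "(\<theta>, \<theta>') \<in> U \<or> (\<theta>', \<theta>) \<in> U" using P(2) U by (auto simp: U_def)
    moreover have "P = {(0, \<theta>'), (0, \<theta>)}" using P(1) by (simp add: insert_commute)
    ultimately show "P \<in> (\<lambda>(\<theta>, \<theta>'). {(0, \<theta>), (0, \<theta>')}) ` U" using P(1) by force
  qed
qed

context conjugate_branches
begin

lemma alpha_circle_eq: "alpha_circle \<sigma> q m \<phi> r (k, \<theta>) = alpha \<sigma> q m \<phi> r \<theta>"
  by (simp add: alpha_circle_def)

text \<open>The curve stays in the open disk, so all conditions at the boundary are empty.\<close>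

theorem alpha_predivide:
  assumes s: "s > 0"
  shows "\<forall>\<^sub>F r in at_right 0. range (alpha \<sigma> q m \<phi> r) \<subseteq> real_plane \<sigma> \<inter> ball 0 s \<and>
     predivide (real_plane \<sigma>) 0 s [Circle] (alpha_circle \<sigma> q m \<phi> r) \<and>
     finite (double_pairs [Circle] (alpha_circle \<sigma> q m \<phi> r)) \<and>
     dbl [Circle] (alpha_circle \<sigma> q m \<phi> r) = P.dord + m * (m - 1)"
proof -
  obtain \<rho>0 where \<rho>0: "0 < ereal \<rho>0" "ereal \<rho>0 < fps_conv_radius \<phi>" using ereal_dense2[OF \<phi>(1)] by auto
  define \<rho> where "\<rho> = min \<rho>0 1"
  have \<rho>: "ereal \<rho> < fps_conv_radius \<phi>"
    using \<rho>0(2) le_less_trans[of "ereal \<rho>" "ereal \<rho>0"] by (simp add: \<rho>_def)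
  interpret S: sum_curve m \<phi> \<omega> \<rho>
    by unfold_locales (use \<rho>0 \<rho> in \<open>auto simp: \<rho>_def\<close>)
  interpret RP: bounded_linear real_point by (rule bounded_linear_real_point)
  have "\<forall>\<^sub>F r in at_right 0. r \<in> {0<..<\<rho>}" using S.\<rho> by (intro eventually_at_right_real) auto
  from this S.small_curves alpha_eventually_small[OF s] show ?thesis
  proof eventually_elim
    case (elim r)
    let ?\<alpha> = "alpha_circle \<sigma> q m \<phi> r"
    have "ereal \<bar>r\<bar> \<le> ereal \<rho>" using elim(1) by simp
    also note \<rho>
    finally have rad: "ereal \<bar>r\<bar> < fps_conv_radius \<phi>" .
    have \<alpha>: "alpha \<sigma> q m \<phi> r \<theta> = real_point (S.h r \<theta>)" for \<theta>
      unfolding alpha_eq_real_point[OF rad] S.h_def ..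
    have range: "range (alpha \<sigma> q m \<phi> r) \<subseteq> real_plane \<sigma> \<inter> ball 0 s"
      using elim(3) real_point_real by (auto simp: \<alpha>)
    have deriv: "((\<lambda>t. real_point (S.h_deriv r i t)) has_vector_derivative real_point (S.h_deriv r (Suc i) t)) (at t)" for i t
      by (rule RP.has_vector_derivative[OF S.has_vector_derivative_h_deriv[OF rad]])
    have vel: "velocity [Circle] ?\<alpha> (0, t) = real_point (S.h_deriv r 1 t)" for t
      using deriv[of 0 t] unfolding velocity_def
      by (simp add: alpha_circle_eq \<alpha> S.h_deriv_0 vector_derivative_at)
    have crossings: "S.crossings r = {(\<theta>, \<theta>'). 0 \<le> \<theta> \<and> \<theta> < \<theta>' \<and> \<theta>' < 2 * pi \<and> alpha \<sigma> q m \<phi> r \<theta> = alpha \<sigma> q m \<phi> r \<theta>'}"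
      by (simp add: S.crossings_def \<alpha>)
    note bij = double_pairs_circle[of ?\<alpha> "alpha \<sigma> q m \<phi> r", OF alpha_circle_eq, folded crossings]
    have inside: "?\<alpha> x \<in> real_plane \<sigma> \<inter> ball 0 s" for x
      using subsetD[OF range rangeI, of "snd x"] by (simp add: alpha_circle_def)
    have transversal: "span {real_point (S.h_deriv r 1 \<theta>)} \<noteq> span {real_point (S.h_deriv r 1 \<theta>')}"
      if cr: "(\<theta>, \<theta>') \<in> S.crossings r" for \<theta> \<theta>'
    proof
      assume "span {real_point (S.h_deriv r 1 \<theta>)} = span {real_point (S.h_deriv r 1 \<theta>')}"
      moreover have "real_point (S.h_deriv r 1 \<theta>') \<in> span {real_point (S.h_deriv r 1 \<theta>')}" by (simp add: span_base)
      ultimately obtain k where "real_point (S.h_deriv r 1 \<theta>') = k *\<^sub>R real_point (S.h_deriv r 1 \<theta>)"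
        by (auto simp: span_singleton)
      hence "S.h_deriv r 1 \<theta>' = of_real k * S.h_deriv r 1 \<theta>" by (simp flip: RP.scaleR add: scaleR_conv_of_real)
      thus False using elim(2) cr by blast
    qed
    have "predivide (real_plane \<sigma>) 0 s [Circle] ?\<alpha>"
      unfolding predivide_def
    proof (intro conjI ballI impI)
      have "smooth_on_dom UNIV (\<lambda>t. ?\<alpha> (0, t))"
        unfolding smooth_on_dom_def
        by (rule exI[of _ "\<lambda>i t. real_point (S.h_deriv r i t)"]) (use deriv in \<open>auto simp: alpha_circle_eq \<alpha> S.h_deriv_0\<close>)
      moreover have "velocity [Circle] ?\<alpha> (0, t) \<noteq> 0" for t
      proof -
        have "S.h_deriv r 1 t \<noteq> 0" using elim(2) by blast
        hence "real_point (S.h_deriv r 1 t) \<noteq> real_point 0" unfolding real_point_inj .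
        thus ?thesis unfolding vel by (simp add: RP.zero)
      qed
      moreover have "?\<alpha> (0, t + 2 * pi) = ?\<alpha> (0, t)" for t
        by (simp add: alpha_circle_eq \<alpha> S.h_shift)
      ultimately show "smooth_immersion [Circle] ?\<alpha>" by (simp add: smooth_immersion_def)
      show "?\<alpha> ` points [Circle] \<subseteq> real_plane \<sigma> \<inter> cball 0 s"
        using inside ball_subset_cball[of 0 s] by (intro image_subsetI) blast
      have bd: "bd_points [Circle] = {}" by (auto simp: bd_points_def)
      show "{x \<in> points [Circle]. ?\<alpha> x \<in> real_plane \<sigma> \<inter> sphere 0 s} = bd_points [Circle]"
        unfolding bd using inside by fastforce
      show "inj_on ?\<alpha> (bd_points [Circle])" by (simp add: bd)
      show "inner (velocity [Circle] ?\<alpha> x) (?\<alpha> x - 0) \<noteq> 0" if "?\<alpha> x \<in> sphere 0 s" for x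
        using that inside[of x] by simp
      show "span {velocity [Circle] ?\<alpha> x} \<noteq> span {velocity [Circle] ?\<alpha> y}"
        if xy: "x \<in> points [Circle]" "y \<in> points [Circle]" "x \<noteq> y \<and> ?\<alpha> x = ?\<alpha> y" for x y
      proof -
        obtain \<theta> \<theta>' where x: "x = (0, \<theta>)" "y = (0, \<theta>')" and \<theta>: "0 \<le> \<theta>" "\<theta> < 2 * pi" "0 \<le> \<theta>'" "\<theta>' < 2 * pi"
          using xy(1,2) by (auto simp: points_def)
        have "(\<theta>, \<theta>') \<in> S.crossings r \<or> (\<theta>', \<theta>) \<in> S.crossings r"
          using xy(3) \<theta> by (auto simp: x crossings alpha_circle_eq)
        thus ?thesis unfolding x vel using transversal by metis
      qed
    qed
    thus ?case
      using range elim(2) bij_betw_finite[OF bij] bij_betw_same_card[OF bij] by (simp add: dbl_def)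
  qed
qed

end

theorem theorem5p8:
  fixes \<sigma> \<Psi> :: "C2 \<Rightarrow> C2"
    and f g :: "complex fps fps"
    and q :: "C2 \<Rightarrow> complex"
    and \<phi> :: "complex fps"
    and m :: nat
    and R :: real
  assumes "real_structure \<sigma>"
    and "branch f"
    and "conjugate_equation \<sigma> f g"
    and "\<not> same_zero_germ f g"
    and "tangent_cone f \<noteq> tangent_cone g"
    and "m = mult2 f"
    and "clinear_form q"
    and "{z. q z = 0} = tangent_cone f"
    and "fps_conv_radius \<phi> > 0"
    and "\<forall>n\<le>m. fps_nth \<phi> n = 0"
    and "primitive_parametrization f (gamma_Q \<sigma> q m \<phi>)"
    and "clinear_map \<Psi>" and "bij \<Psi>"
    and "milnor_ball \<Psi> R (f * g)"
    and "\<sigma> ` coord_ball \<Psi> R = coord_ball \<Psi> R"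
  shows "(\<forall>x. ereal \<bar>fst x\<bar> < fps_conv_radius \<phi> \<longrightarrow>
            real_analytic_at (\<lambda>(r, \<theta>). alpha \<sigma> q m \<phi> r \<theta>) x) \<and>
         (\<exists>r0>0. ereal r0 \<le> fps_conv_radius \<phi> \<and>
            (\<exists>c\<in>real_plane \<sigma>. \<exists>s>0.
               real_plane \<sigma> \<inter> cball c s \<subseteq> coord_ball \<Psi> R \<inter> real_plane \<sigma> \<and>
               0 \<in> real_plane \<sigma> \<inter> ball c s \<and>
               (\<forall>r. 0 < r \<and> r < r0 \<longrightarrow>
                  range (alpha \<sigma> q m \<phi> r) \<subseteq> real_plane \<sigma> \<inter> ball c s \<and>
                  predivide (real_plane \<sigma>) c s [Circle] (alpha_circle \<sigma> q m \<phi> r) \<and>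
                  finite (double_pairs [Circle] (alpha_circle \<sigma> q m \<phi> r)) \<and>
                  enat (dbl [Circle] (alpha_circle \<sigma> q m \<phi> r)) + 1
                    = 2 * delta_invariant f + intersection_mult f g \<and>
                  2 * delta_invariant f + intersection_mult f g
                    = delta_invariant (f * g))))"
proof -
  interpret conjugate_branches \<sigma> f g q \<phi> m
    by (rule conjugate_branches.intro) (fact assms)+
  obtain \<delta> where \<delta>: "delta_invariant f = enat \<delta>" "intersection_mult f g = enat (m * m)"
    "delta_invariant (f * g) = enat (2 * \<delta> + m * m)" "2 * \<delta> + m = P.dord + 1"
    using invariants by blast
  have R: "R > 0" using assms by (simp add: milnor_ball_def)
  have "\<forall>\<^sub>F z in nhds 0. \<Psi> z \<in> ball 0 R"
    by (rule eventually_compose_filterlim[OF eventually_nhds_in_open clinear_map_tendsto[OF assms(12)]])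
       (use R in auto)
  then obtain s0 where s0: "s0 > 0" "\<And>z. norm z < s0 \<Longrightarrow> norm (\<Psi> z) < R"
    by (auto simp: eventually_nhds_metric dist_norm)
  define s where "s = s0 / 2"
  have s: "s > 0" "cball 0 s \<subseteq> coord_ball \<Psi> R" using s0 by (auto simp: s_def coord_ball_def)
  have 0: "0 \<in> real_plane \<sigma>" by (simp add: real_plane_def \<sigma>_0)
  from alpha_predivide[OF s(1)] obtain b where b: "b > 0" "\<And>r. 0 < r \<Longrightarrow> r < b \<Longrightarrow>
     range (alpha \<sigma> q m \<phi> r) \<subseteq> real_plane \<sigma> \<inter> ball 0 s \<and>
     predivide (real_plane \<sigma>) 0 s [Circle] (alpha_circle \<sigma> q m \<phi> r) \<and>
     finite (double_pairs [Circle] (alpha_circle \<sigma> q m \<phi> r)) \<and>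
     dbl [Circle] (alpha_circle \<sigma> q m \<phi> r) = P.dord + m * (m - 1)"
    unfolding eventually_at_right_field by blast
  obtain \<rho> where \<rho>: "0 < ereal \<rho>" "ereal \<rho> < fps_conv_radius \<phi>" using ereal_dense2[OF \<phi>(1)] by auto
  have count: "enat (dbl [Circle] (alpha_circle \<sigma> q m \<phi> r)) + 1 = 2 * delta_invariant f + intersection_mult f g"
    if "0 < r" "r < b" for r
  proof -
    have "dbl [Circle] (alpha_circle \<sigma> q m \<phi> r) + 1 = 2 * \<delta> + m * m"
      using b(2)[OF that] \<delta>(4) m_pos by (cases m) simp_all
    thus ?thesis unfolding \<delta> by (simp add: one_enat_def numeral_eq_enat)
  qed
  have sum: "2 * delta_invariant f + intersection_mult f g = delta_invariant (f * g)"
    unfolding \<delta> by (simp add: numeral_eq_enat)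
  have analytic: "\<forall>x. ereal \<bar>fst x\<bar> < fps_conv_radius \<phi> \<longrightarrow>
      real_analytic_at (\<lambda>(r, \<theta>). alpha \<sigma> q m \<phi> r \<theta>) x"
    using alpha_real_analytic by blast
  have radius: "ereal (min b \<rho>) \<le> fps_conv_radius \<phi>"
    by (rule order_trans[OF _ less_imp_le[OF \<rho>(2)]]) simp
  have pos: "min b \<rho> > 0" using b(1) \<rho>(1) by simp
  have disk: "real_plane \<sigma> \<inter> cball 0 s \<subseteq> coord_ball \<Psi> R \<inter> real_plane \<sigma>" "0 \<in> real_plane \<sigma> \<inter> ball 0 s"
    using s 0 by auto
  have curves: "range (alpha \<sigma> q m \<phi> r) \<subseteq> real_plane \<sigma> \<inter> ball 0 s \<and>
      predivide (real_plane \<sigma>) 0 s [Circle] (alpha_circle \<sigma> q m \<phi> r) \<and>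
      finite (double_pairs [Circle] (alpha_circle \<sigma> q m \<phi> r)) \<and>
      enat (dbl [Circle] (alpha_circle \<sigma> q m \<phi> r)) + 1 = 2 * delta_invariant f + intersection_mult f g \<and>
      2 * delta_invariant f + intersection_mult f g = delta_invariant (f * g)" if "0 < r \<and> r < min b \<rho>" for r
    using b(2)[of r] count[of r] sum that by (simp only: min_less_iff_conj simp_thms)
  show ?thesis
    by (intro conjI[OF analytic] exI[of _ "min b \<rho>"] conjI[OF pos] conjI[OF radius] bexI[OF _ 0]
        exI[of _ s] conjI[OF s(1)] conjI[OF disk(1)] conjI[OF disk(2)] allI impI curves)
qed

end
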